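(* For every sufficiently small $\epsilon>0$ there exist initial data $u_0\in H^\infty_+(\mathbb{R})$ with $M(u_0)=\int_{\mathbb{R}}|u_0|^2\,dx=2\pi+\epsilon$, a time $T\in(0,\infty]$, and a maximal lifespan solution $u(t)$ of the focusing continuum Calogero--Moser equation $$iu_t+u_{xx}-2iu\,\Pi^+\partial_x(|u|^2)=0,\qquad u(0)=u_0,$$ such that for all $s>0$ one has $u\in C_tH^s_x([0,T)\times\mathbb{R})$ and $$\lim_{t\nearrow T}\|u(t)\|_{H^s}=+\infty.$$ In particular, if $T=\infty$, then $\|u(t)\|_{H^s}\gtrsim t^s$. An analogous statement holds backwards in time.
   Context: Fourier transform convention: $\widehat f(\xi)=\frac{1}{\sqrt{2\pi}}\int e^{-i\xi x}f(x)\,dx$. The Cauchy--Szegő projection is $[\Pi^+f](x)=\frac{1}{\sqrt{2\pi}}\int_0^\infty e^{ix\xi}\widehat f(\xi)\,d\xi$. For $s\ge 0$, $H^s$ is the usual Sobolev space with norm $\|f\|_{H^s}^2=\int(1+|\xi|^2)^s|\widehat f(\xi)|^2d\xi$, and the Hardy--Sobolev space is $H^s_+=\{f\in H^s:\widehat f(\xi)=0\text{ for }\xi<0\}$; $H^\infty_+=\bigcap_s H^s_+$. Solutions of the equation take values in $H^s_+$ at each time. For $H^\infty_+$ initial data there is a unique maximal lifespan solution $u\in C_tH^s_+$ for all $s\ge0$ on a maximal interval of existence. $A\gtrsim B$ means $A\ge CB$ for some constant $C>0$. *)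

theory Defs
  imports "HOL-Analysis.Analysis"
begin

definition fourier_L1 :: "(real \<Rightarrow> complex) \<Rightarrow> real \<Rightarrow> complex" where
  "fourier_L1 f \<xi> = complex_of_real (1 / sqrt (2 * pi)) *
     (LINT x|lborel. exp (- \<i> * complex_of_real \<xi> * complex_of_real x) * f x)"

definition square_integrable :: "(real \<Rightarrow> complex) \<Rightarrow> bool" where
  "square_integrable f \<longleftrightarrow> f \<in> borel_measurable lborel \<and>
     integrable lborel (\<lambda>x. (cmod (f x))\<^sup>2)"

definition test_function :: "(real \<Rightarrow> complex) \<Rightarrow> bool" where
  "test_function \<phi> \<longleftrightarrow> continuous_on UNIV \<phi> \<and> bounded {x. \<phi> x \<noteq> 0}"

text \<open>g is the (Plancherel / distributional) Fourier transform of the L^2 function f: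
  the duality identity  int g phi = int f phihat  holds for all continuous compactly
  supported phi.\<close>
definition is_fourier :: "(real \<Rightarrow> complex) \<Rightarrow> (real \<Rightarrow> complex) \<Rightarrow> bool" where
  "is_fourier f g \<longleftrightarrow> square_integrable f \<and> square_integrable g \<and>
     (\<forall>\<phi>. test_function \<phi> \<longrightarrow>
        (LINT \<xi>|lborel. g \<xi> * \<phi> \<xi>) = (LINT x|lborel. f x * fourier_L1 \<phi> x))"

definition fourier :: "(real \<Rightarrow> complex) \<Rightarrow> real \<Rightarrow> complex" where
  "fourier f = (SOME g. is_fourier f g)"

definition in_Hs :: "real \<Rightarrow> (real \<Rightarrow> complex) \<Rightarrow> bool" where
  "in_Hs s f \<longleftrightarrow> square_integrable f \<and>
     integrable lborel (\<lambda>\<xi>. (1 + \<xi>\<^sup>2) powr s * (cmod (fourier f \<xi>))\<^sup>2)"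

definition Hs_norm :: "real \<Rightarrow> (real \<Rightarrow> complex) \<Rightarrow> real" where
  "Hs_norm s f = sqrt (LINT \<xi>|lborel. (1 + \<xi>\<^sup>2) powr s * (cmod (fourier f \<xi>))\<^sup>2)"

definition in_Hs_plus :: "real \<Rightarrow> (real \<Rightarrow> complex) \<Rightarrow> bool" where
  "in_Hs_plus s f \<longleftrightarrow> in_Hs s f \<and> (AE \<xi> in lborel. \<xi> < 0 \<longrightarrow> fourier f \<xi> = 0)"

definition in_Hinf_plus :: "(real \<Rightarrow> complex) \<Rightarrow> bool" where
  "in_Hinf_plus f \<longleftrightarrow> (\<forall>s\<ge>0. in_Hs_plus s f)"

definition Pi_plus :: "(real \<Rightarrow> complex) \<Rightarrow> real \<Rightarrow> complex" where
  "Pi_plus f x = complex_of_real (1 / sqrt (2 * pi)) *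
     (LINT \<xi>:{0..}|lborel. exp (\<i> * complex_of_real x * complex_of_real \<xi>) * fourier f \<xi>)"

definition CCM_solution :: "(real \<Rightarrow> real \<Rightarrow> complex) \<Rightarrow> real set \<Rightarrow> bool" where
  "CCM_solution u I \<longleftrightarrow>
     (\<forall>t\<in>I. \<forall>s\<ge>0. in_Hs_plus s (u t)) \<and>
     (\<forall>t\<in>I. \<forall>x.
        (\<lambda>\<tau>. u \<tau> x) differentiable (at t within I) \<and>
        (\<forall>y. (\<lambda>z. u t z) differentiable (at y)) \<and>
        (\<lambda>y. vector_derivative (\<lambda>z. u t z) (at y)) differentiable (at x) \<and>
        (\<forall>y. (\<lambda>z. complex_of_real ((cmod (u t z))\<^sup>2)) differentiable (at y)) \<and>
        \<i> * vector_derivative (\<lambda>\<tau>. u \<tau> x) (at t within I)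
        + vector_derivative (\<lambda>y. vector_derivative (\<lambda>z. u t z) (at y)) (at x)
        - 2 * \<i> * u t x *
            Pi_plus (\<lambda>y. vector_derivative (\<lambda>z. complex_of_real ((cmod (u t z))\<^sup>2)) (at y)) x
        = 0)"

definition Hs_continuous :: "real \<Rightarrow> (real \<Rightarrow> real \<Rightarrow> complex) \<Rightarrow> real set \<Rightarrow> bool" where
  "Hs_continuous s u I \<longleftrightarrow> (\<forall>t\<in>I. in_Hs s (u t)) \<and>
     (\<forall>t\<in>I. \<forall>e>0. \<exists>d>0. \<forall>t'\<in>I. \<bar>t' - t\<bar> < d \<longrightarrow>
        Hs_norm s (\<lambda>x. u t' x - u t x) < e)"

definition tends_to_infinity_at_left :: "ereal \<Rightarrow> (real \<Rightarrow> real) \<Rightarrow> bool" where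
  "tends_to_infinity_at_left T f \<longleftrightarrow>
     (case T of ereal T' \<Rightarrow> filterlim f at_top (at_left T')
              | PInfty \<Rightarrow> filterlim f at_top at_top
              | MInfty \<Rightarrow> False)"

end

theory Submission
  imports Defs "HOL-Probability.Probability"
begin

text \<open>
  Take \<open>u\<^sub>0(x) = \<surd>(2\<kappa>) / (1 - i x)\<close> with \<open>2\<pi>\<kappa> = 2\<pi> + \<epsilon>\<close>; its Fourier transform is a multiple of \<open>exp (-\<xi>)\<close> on
  \<open>\<xi> \<ge> 0\<close>. The explicit formula for the equation suggests to define the Fourier transform of \<open>u(t)\<close> at \<open>r \<ge> 0\<close> as a
  multiple of the boundary value \<open>\<gamma>(t, r) = g\<^sub>r(0)\<close>, where \<open>g\<close> solves \<open>\<partial>\<^sub>r g = \<partial>\<^sub>x g - 2it L g\<close>, \<open>g\<^sub>0 = exp (-x)\<close>, on the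
  half-line and \<open>L\<close> is the Lax operator of \<open>u\<^sub>0\<close>. Computing \<open>\<partial>\<^sub>t \<gamma>\<close> gives the equation. Up to a constant,
  \<open>N(t, r) = \<parallel>g\<^sub>r\<parallel>\<^sup>2\<close> is the mass of \<open>u(t)\<close> at frequencies above \<open>r\<close>, provided that it tends to \<open>0\<close> as
  \<open>r \<rightarrow> \<infinity>\<close> (\<open>t\<close> is stable). The limit is either \<open>0\<close> or at least \<open>1/(2\<kappa>)\<close>, hence stability is an open condition,
  and it implies rapid decay of \<open>\<gamma>(t, \<cdot>)\<close>. At the first unstable time a fixed amount of mass escapes to infinite
  frequency and all Sobolev norms blow up. If all times are stable, one uses that \<open>L\<close> has a negative eigenvalue
  because \<open>\<kappa> > 1\<close>; a perturbed eigenfunction shows that a fixed amount of mass sits at frequencies above a multiple of \<open>t\<close>.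
  The datum satisfies \<open>\<gamma>(-t, r) = cnj \<gamma>(t, r)\<close>, so the same function also serves backwards in time.
\<close>

section \<open>Integrals depending on a parameter\<close>

text \<open>What makes this datum tractable is the commutator
  \<open>[d/dx, Lop] f = f - 2 \<kappa> ell f ee\<close>, the identity plus a rank one operator,
  together with \<open>Lop f 0 = 0\<close>. Applying \<open>Lop\<close> to a trajectory, or
  multiplying it by \<open>r\<close>, creates sources that cancel up to a convolution with the basic
  trajectory, and at x = 0 the operator \<open>Lop\<close> drops out. The time derivative of the
  boundary values, their rapid decay and the corrector for the eigenfunction all rest on this. No
  well-posedness theory is used: the solution is written down and its properties are read off the
  half-line trajectories. The obstacle is that boundary values record only what leaves through x =
  0. If part of the norm never arrives there, the autocorrelation of the boundary values is no
  longer \<open>ell\<close> of the trajectory, and it is this identity that turns the formula for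
  the time derivative into the differential equation. Thus the boundary values exist for all times,
  but give a solution only at stable ones. The threshold \<open>1 / (2 \<kappa>)\<close> is the
  positive root of \<open>2 \<kappa> \<rho>\<^sup>2 - \<rho>\<close>.\<close>

lemma has_vector_derivative_iff_difference_quotient:
  fixes f :: "real \<Rightarrow> 'b::real_normed_vector"
  shows "(f has_vector_derivative D) (at x within S) \<longleftrightarrow>
    ((\<lambda>y. (f y - f x) /\<^sub>R (y - x)) \<longlongrightarrow> D) (at x within S)"
proof -
  have "norm ((f y - f x - (y - x) *\<^sub>R D) /\<^sub>R norm (y - x)) = norm ((f y - f x) /\<^sub>R (y - x) - D)"
    if "y \<noteq> x" for y
  proof -
    have "(f y - f x) /\<^sub>R (y - x) - D = (f y - f x - (y - x) *\<^sub>R D) /\<^sub>R (y - x)"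
      using that by (simp add: scaleR_diff_right)
    then show ?thesis by simp
  qed
  then have "((\<lambda>y. (f y - f x - (y - x) *\<^sub>R D) /\<^sub>R norm (y - x)) \<longlongrightarrow> 0) (at x within S)
    \<longleftrightarrow> ((\<lambda>y. (f y - f x) /\<^sub>R (y - x) - D) \<longlongrightarrow> 0) (at x within S)"
    unfolding tendsto_norm_zero_iff[symmetric, of "\<lambda>y. _ y /\<^sub>R _ y"]
      tendsto_norm_zero_iff[symmetric, of "\<lambda>y. _ y - D"]
    by (intro tendsto_cong) (auto simp: eventually_at_filter)
  then show ?thesis
    unfolding has_vector_derivative_def has_derivative_at_within
    by (simp add: bounded_linear_scaleR_left LIM_zero_iff)
qed

text \<open>The mean value inequality on the convex set \<open>S\<close> bounds every difference
  quotient by \<open>b\<close>, so dominated convergence applies along sequences. Working within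
  \<open>S\<close> covers one-sided derivatives at the end of a half-line.\<close>

lemma has_vector_derivative_integral_dominated:
  fixes f :: "real \<Rightarrow> 'a \<Rightarrow> 'b::{banach,second_countable_topology}"
  assumes S: "convex S" "x0 \<in> S"
    and int: "\<And>x. x \<in> S \<Longrightarrow> integrable M (f x)"
    and der: "\<And>x y. x \<in> S \<Longrightarrow> y \<in> space M \<Longrightarrow>
        ((\<lambda>x. f x y) has_vector_derivative f' x y) (at x within S)"
    and bd: "\<And>x y. x \<in> S \<Longrightarrow> y \<in> space M \<Longrightarrow> norm (f' x y) \<le> b y"
    and b: "integrable M b"
    and meas: "f' x0 \<in> borel_measurable M"
  shows "((\<lambda>x. \<integral>y. f x y \<partial>M) has_vector_derivative (\<integral>y. f' x0 y \<partial>M)) (at x0 within S)"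
  unfolding has_vector_derivative_iff_difference_quotient tendsto_at_iff_sequentially
proof (intro allI impI)
  fix X assume X: "\<forall>i. X i \<in> S - {x0}" and lim: "X \<longlonglongrightarrow> x0"
  have XS: "X i \<in> S" "X i \<noteq> x0" for i using X by auto
  define q where "q i y = (f (X i) y - f x0 y) /\<^sub>R (X i - x0)" for i y
  have "(\<lambda>i. \<integral>y. q i y \<partial>M) \<longlonglongrightarrow> (\<integral>y. f' x0 y \<partial>M)"
  proof (rule integral_dominated_convergence[where w = b])
    show "q i \<in> borel_measurable M" for i
      unfolding q_def using int[OF XS(1)[of i]] int[OF S(2)] by measurable
    show "AE y in M. (\<lambda>i. q i y) \<longlonglongrightarrow> f' x0 y"
    proof (intro AE_I2)
      fix y assume "y \<in> space M"
      from der[OF S(2) this] show "(\<lambda>i. q i y) \<longlonglongrightarrow> f' x0 y"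
        unfolding has_vector_derivative_iff_difference_quotient tendsto_at_iff_sequentially q_def
        using X lim by (auto simp: comp_def)
    qed
    show "AE y in M. norm (q i y) \<le> b y" for i
    proof (intro AE_I2)
      fix y assume y: "y \<in> space M"
      have "norm (f (X i) y - f x0 y) \<le> b y * norm (X i - x0)"
      proof (rule differentiable_bound[OF S(1)])
        show "((\<lambda>x. f x y) has_derivative (\<lambda>h. h *\<^sub>R f' x y)) (at x within S)" if "x \<in> S" for x
          using der[OF that y] by (simp add: has_vector_derivative_def)
        show "onorm (\<lambda>h. h *\<^sub>R f' x y) \<le> b y" if "x \<in> S" for x
          using bd[OF that y] by (intro onorm_le) (auto simp: mult.commute[of _ "norm (f' x y)"] intro!: mult_right_mono)
      qed (use XS S in auto)
      then show "norm (q i y) \<le> b y"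
        using XS(2)[of i] unfolding q_def norm_scaleR norm_inverse
        by (simp add: field_simps del: scaleR_diff_right)
    qed
  qed (use b meas in auto)
  moreover have "(\<integral>y. q i y \<partial>M) = ((\<integral>y. f (X i) y \<partial>M) - (\<integral>y. f x0 y \<partial>M)) /\<^sub>R (X i - x0)" for i
    unfolding q_def using int[OF XS(1)[of i]] int[OF S(2)] by simp
  ultimately show "((\<lambda>y. (integral\<^sup>L M (f y) - integral\<^sup>L M (f x0)) /\<^sub>R (y - x0)) \<circ> X)
      \<longlonglongrightarrow> (\<integral>y. f' x0 y \<partial>M)"
    by (simp add: comp_def)
qed

lemma continuous_on_integral_dominated:
  fixes f :: "'c::metric_space \<Rightarrow> 'a \<Rightarrow> 'b::{banach,second_countable_topology}"
  assumes meas: "\<And>x. x \<in> S \<Longrightarrow> f x \<in> borel_measurable M"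
    and cont: "\<And>y. y \<in> space M \<Longrightarrow> continuous_on S (\<lambda>x. f x y)"
    and bd: "\<And>x y. x \<in> S \<Longrightarrow> y \<in> space M \<Longrightarrow> norm (f x y) \<le> b y"
    and b: "integrable M b"
  shows "continuous_on S (\<lambda>x. \<integral>y. f x y \<partial>M)"
  unfolding continuous_on_sequentially
proof (intro allI ballI impI)
  fix X a assume a: "a \<in> S" and X: "(\<forall>n. X n \<in> S) \<and> X \<longlonglongrightarrow> a"
  show "((\<lambda>x. \<integral>y. f x y \<partial>M) \<circ> X) \<longlonglongrightarrow> (\<integral>y. f a y \<partial>M)"
    unfolding comp_def
  proof (rule integral_dominated_convergence[where w = b])
    show "AE y in M. (\<lambda>i. f (X i) y) \<longlonglongrightarrow> f a y"
      using cont a X unfolding continuous_on_sequentially by (intro AE_I2) (auto simp: comp_def)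
  qed (use meas a X b bd in auto)
qed

text \<open>The integrand is known only on the triangle 0 <= y <= x. Extending it beyond the
  diagonal by its tangent line in x gives a family on the whole square that is continuously
  differentiable in x. Leibniz' rule with fixed limits then applies, and the contribution of the
  affine extension is computed and subtracted.\<close>

lemma has_vector_derivative_integral_variable_limit:
  fixes F Fx :: "real \<Rightarrow> real \<Rightarrow> 'b::banach"
  assumes R: "x0 \<in> {0..R}"
    and contF: "continuous_on {(x, y). 0 \<le> y \<and> y \<le> x \<and> x \<le> R} (\<lambda>(x, y). F x y)"
    and contFx: "continuous_on {(x, y). 0 \<le> y \<and> y \<le> x \<and> x \<le> R} (\<lambda>(x, y). Fx x y)"
    and der: "\<And>x y. 0 \<le> y \<Longrightarrow> y \<le> x \<Longrightarrow> x \<le> R \<Longrightarrow>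
        ((\<lambda>x. F x y) has_vector_derivative Fx x y) (at x within {y..R})"
  shows "((\<lambda>x. integral {0..x} (F x)) has_vector_derivative
    (F x0 x0 + integral {0..x0} (Fx x0))) (at x0 within {0..R})"
proof -
  let ?T = "{(x, y). 0 \<le> y \<and> y \<le> x \<and> x \<le> R}"
  define F2 where "F2 x y = F (max x y) y + (x - max x y) *\<^sub>R Fx y y" for x y
  define Fx2 where "Fx2 x y = Fx (max x y) y" for x y
  have cFx2: "continuous_on ({0..R} \<times> {0..R}) (\<lambda>(x, y). Fx2 x y)"
    unfolding Fx2_def case_prod_unfold
    by (rule continuous_on_compose2[OF contFx, of _ "\<lambda>z. (max (fst z) (snd z), snd z)",
          unfolded case_prod_unfold fst_conv snd_conv])
       (auto intro!: continuous_intros)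
  have cd: "continuous_on {0..R} (\<lambda>y. F y y)"
    by (rule continuous_on_compose2[OF contF, of _ "\<lambda>z. (z, z)",
          unfolded case_prod_unfold fst_conv snd_conv]) (auto intro!: continuous_intros)
  have cdx: "continuous_on {0..R} (\<lambda>y. Fx y y)"
    by (rule continuous_on_compose2[OF contFx, of _ "\<lambda>z. (z, z)",
          unfolded case_prod_unfold fst_conv snd_conv]) (auto intro!: continuous_intros)
  have cF2: "continuous_on {0..R} (F2 x)" if "x \<in> {0..R}" for x
  proof -
    have "continuous_on {0..R} (\<lambda>y. F (max x y) y)"
      by (rule continuous_on_compose2[OF contF, of _ "\<lambda>z. (max x z, z)",
          unfolded case_prod_unfold fst_conv snd_conv]) (use that in \<open>auto intro!: continuous_intros\<close>)
    then show ?thesis unfolding F2_def by (auto intro!: continuous_intros cdx)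
  qed
  have below: "F2 x y = F x y" if "y \<le> x" for x y using that by (simp add: F2_def)
  have above: "F2 x y = F y y + (x - y) *\<^sub>R Fx y y" if "x \<le> y" for x y
    using that by (simp add: F2_def max_def)
  have der2: "((\<lambda>x. F2 x y) has_vector_derivative Fx2 x y) (at x within {0..R})"
    if x: "x \<in> {0..R}" and y: "y \<in> {0..R}" for x y
  proof -
    have lin: "((\<lambda>x. F y y + (x - y) *\<^sub>R Fx y y) has_vector_derivative Fx y y) (at x within A)" for x A
      by (auto intro!: derivative_eq_intros)
    have up: "((\<lambda>x. F2 x y) has_vector_derivative Fx2 x y) (at x within {y..R})" if "y \<le> x"
    proof -
      have "Fx2 x y = Fx x y" using that by (simp add: Fx2_def)
      then show ?thesis
        using that x y below by (auto intro!: has_vector_derivative_transform[OF _ _ der[of y x]])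
    qed
    have lo: "((\<lambda>x. F2 x y) has_vector_derivative Fx2 x y) (at x within {0..y})" if "x \<le> y"
      by (rule has_vector_derivative_transform[of _ _ _ "\<lambda>x. F y y + (x - y) *\<^sub>R Fx y y"])
         (use that x y above lin in \<open>auto simp: Fx2_def max_def\<close>)
    consider "x < y" | "x = y" | "x > y" by linarith
    then show ?thesis
    proof cases
      case 1
      have "at x within {0..R} = at x within {0..y}"
        using 1 y by (intro at_within_nhd[of _ "{..<y}"]) auto
      then show ?thesis using lo 1 by simp
    next
      case 2
      have "((\<lambda>x. F2 x y) has_vector_derivative Fx2 x y) (at x within ({0..y} \<union> {y..R}))"
        using lo up 2 by (simp add: has_vector_derivative_def has_derivative_at_within Lim_within_Un)
      moreover have "{0..y} \<union> {y..R} = {0..R}" using y by auto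
      ultimately show ?thesis by simp
    next
      case 3
      have "at x within {0..R} = at x within {y..R}"
        using 3 y by (intro at_within_nhd[of _ "{y<..}"]) auto
      then show ?thesis using up 3 by simp
    qed
  qed
  have int: "F2 x integrable_on {a..b}" if "x \<in> {0..R}" "0 \<le> a" "b \<le> R" for x a b
    by (rule integrable_continuous_interval[OF continuous_on_subset[OF cF2]]) (use that in auto)
  have A: "((\<lambda>x. integral {0..R} (F2 x)) has_vector_derivative integral {0..R} (Fx2 x0)) (at x0 within {0..R})"
    using leibniz_rule_vector_derivative[of "{0..R}" 0 R F2 Fx2 x0] der2 int cFx2 R by simp
  \<comment> \<open>\<open>P y + x * Q y\<close> is the affine extension sorted by powers of x, so
    that x occurs in its integral over {x..R} only as a factor and as a limit.\<close>
  define P where "P = (\<lambda>y. F y y - y *\<^sub>R Fx y y)"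
  define Q where "Q = (\<lambda>y. Fx y y)"
  have cP: "continuous_on {0..R} P" unfolding P_def by (intro continuous_intros cd cdx)
  have cQ: "continuous_on {0..R} Q" unfolding Q_def by (rule cdx)
  have B: "((\<lambda>x. integral {x..R} P + x *\<^sub>R integral {x..R} Q) has_vector_derivative
      (- P x0 + (x0 *\<^sub>R (- Q x0) + 1 *\<^sub>R integral {x0..R} Q))) (at x0 within {0..R})"
    using cP cQ R
    by (intro has_vector_derivative_add has_vector_derivative_scaleR integral_has_vector_derivative')
       (auto intro!: derivative_eq_intros)
  have eq: "integral {0..x} (F x) = integral {0..R} (F2 x) - (integral {x..R} P + x *\<^sub>R integral {x..R} Q)"
    if x: "x \<in> {0..R}" for x
  proof -
    have "integral {0..x} (F x) = integral {0..x} (F2 x)"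
      by (rule integral_cong) (auto simp: below)
    moreover have "integral {x..R} (F2 x) = integral {x..R} (\<lambda>y. P y + x *\<^sub>R Q y)"
      by (rule integral_cong) (auto simp: above P_def Q_def algebra_simps)
    moreover have "\<dots> = integral {x..R} P + x *\<^sub>R integral {x..R} Q"
    proof -
      have "P integrable_on {x..R}" "Q integrable_on {x..R}"
        using x by (auto intro!: integrable_continuous_interval continuous_on_subset[OF cP] continuous_on_subset[OF cQ])
      then show ?thesis by (simp add: integral_add integrable_cmul)
    qed
    moreover have "integral {0..x} (F2 x) + integral {x..R} (F2 x) = integral {0..R} (F2 x)"
      using x by (intro Henstock_Kurzweil_Integration.integral_combine int) auto
    ultimately show ?thesis by (simp add: algebra_simps)
  qed
  have "((\<lambda>x. integral {0..x} (F x)) has_vector_derivative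
     (integral {0..R} (Fx2 x0) - (- P x0 + (x0 *\<^sub>R (- Q x0) + 1 *\<^sub>R integral {x0..R} Q)))) (at x0 within {0..R})"
    by (rule has_vector_derivative_transform[OF R _ has_vector_derivative_diff[OF A B]]) (use eq in auto)
  moreover have "integral {0..R} (Fx2 x0) = integral {0..x0} (Fx x0) + integral {x0..R} Q"
  proof -
    have "continuous_on {0..R} (Fx2 x0)"
      by (rule continuous_on_compose2[OF cFx2, of _ "\<lambda>z. (x0, z)",
          unfolded case_prod_unfold fst_conv snd_conv]) (use R in \<open>auto intro!: continuous_intros\<close>)
    then have "Fx2 x0 integrable_on {0..R}" by (rule integrable_continuous_interval)
    then have "integral {0..x0} (Fx2 x0) + integral {x0..R} (Fx2 x0) = integral {0..R} (Fx2 x0)"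
      using R by (intro Henstock_Kurzweil_Integration.integral_combine) auto
    moreover have "integral {0..x0} (Fx2 x0) = integral {0..x0} (Fx x0)"
      by (rule integral_cong) (auto simp: Fx2_def)
    moreover have "integral {x0..R} (Fx2 x0) = integral {x0..R} Q"
      by (rule integral_cong) (auto simp: Fx2_def Q_def max_def)
    ultimately show ?thesis by simp
  qed
  ultimately show ?thesis by (simp add: P_def Q_def algebra_simps)
qed

section \<open>The Cauchy-Schwarz inequality for square integrable functions\<close>

lemma integrable_mult_squares:
  fixes f g :: "'a \<Rightarrow> complex"
  assumes [measurable]: "f \<in> borel_measurable M" "g \<in> borel_measurable M"
    and "integrable M (\<lambda>x. (cmod (f x))\<^sup>2)" "integrable M (\<lambda>x. (cmod (g x))\<^sup>2)"
  shows "integrable M (\<lambda>x. f x * g x)"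
proof (rule Bochner_Integration.integrable_bound)
  show "integrable M (\<lambda>x. (cmod (f x))\<^sup>2 + (cmod (g x))\<^sup>2)" using assms by simp
  have "cmod (f x) * cmod (g x) \<le> (cmod (f x))\<^sup>2 + (cmod (g x))\<^sup>2" for x
    using sum_squares_bound[of "cmod (f x)" "cmod (g x)"] zero_le_power2[of "cmod (f x)"]
      mult_nonneg_nonneg[OF norm_ge_zero norm_ge_zero, of "f x" "g x"] by linarith
  then show "AE x in M. norm (f x * g x) \<le> norm ((cmod (f x))\<^sup>2 + (cmod (g x))\<^sup>2)"
    by (auto simp: norm_mult)
qed simp

lemma integral_mult_squares_le:
  fixes f g :: "'a \<Rightarrow> complex"
  assumes [measurable]: "f \<in> borel_measurable M" "g \<in> borel_measurable M"
    and f: "integrable M (\<lambda>x. (cmod (f x))\<^sup>2)" and g: "integrable M (\<lambda>x. (cmod (g x))\<^sup>2)"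
  shows "(\<integral>x. cmod (f x) * cmod (g x) \<partial>M) \<le> sqrt (\<integral>x. (cmod (f x))\<^sup>2 \<partial>M) * sqrt (\<integral>x. (cmod (g x))\<^sup>2 \<partial>M)"
proof -
  have fg: "integrable M (\<lambda>x. cmod (f x) * cmod (g x))"
    using integrable_mult_squares[OF assms] integrable_norm by (fastforce simp: norm_mult)
  have "(\<integral>\<^sup>+x. ennreal (cmod (f x)) * ennreal (cmod (g x)) \<partial>M)\<^sup>2
      \<le> (\<integral>\<^sup>+x. (ennreal (cmod (f x)))\<^sup>2 \<partial>M) * (\<integral>\<^sup>+x. (ennreal (cmod (g x)))\<^sup>2 \<partial>M)"
    by (rule Cauchy_Schwarz_nn_integral) measurable
  then have "(\<integral>x. cmod (f x) * cmod (g x) \<partial>M)\<^sup>2 \<le> (\<integral>x. (cmod (f x))\<^sup>2 \<partial>M) * (\<integral>x. (cmod (g x))\<^sup>2 \<partial>M)"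
    unfolding ennreal_power[OF norm_ge_zero] ennreal_mult[OF norm_ge_zero norm_ge_zero, symmetric]
      nn_integral_eq_integral[OF f AE_I2[OF zero_le_power2]] nn_integral_eq_integral[OF g AE_I2[OF zero_le_power2]]
      nn_integral_eq_integral[OF fg AE_I2[OF mult_nonneg_nonneg[OF norm_ge_zero norm_ge_zero]]]
    by (subst (asm) ennreal_power, simp, subst (asm) ennreal_mult[symmetric]) (simp_all add: ennreal_le_iff)
  then show ?thesis unfolding real_sqrt_mult[symmetric] by (rule real_le_rsqrt)
qed

section \<open>The Dirichlet inverse on the half-line\<close>

text \<open>Nonnegative frequencies: the Fourier transforms of Hardy space functions live here, and
  the variable x of the half-line operators is itself a frequency.\<close>

abbreviation hl :: "real measure" where "hl \<equiv> restrict_space lborel {0..}"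

lemma space_hl [simp]: "space hl = {0..}"
  by (simp add: space_restrict_space)

lemma integrable_hl_iff:
  fixes f :: "real \<Rightarrow> 'b::{banach,second_countable_topology}"
  shows "integrable hl f \<longleftrightarrow> set_integrable lborel {0..} f"
  by (simp add: integrable_restrict_space set_integrable_def)

lemma integral_hl_eq:
  fixes f :: "real \<Rightarrow> 'b::{banach,second_countable_topology}"
  shows "integral\<^sup>L hl f = (LINT x:{0..}|lborel. f x)"
  by (simp add: integral_restrict_space set_lebesgue_integral_def)

lemma continuous_on_hl_measurable:
  fixes f :: "real \<Rightarrow> 'b::topological_space"
  assumes "continuous_on {0..} f"
  shows "f \<in> borel_measurable hl"
proof -
  have "f \<in> borel_measurable (restrict_space borel {0..})"
    by (rule borel_measurable_continuous_on_restrict[OF assms])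
  then show ?thesis
    by (simp add: measurable_def sets_restrict_space space_restrict_space)
qed

lemma at_within_Icc_Ici: "x < R \<Longrightarrow> at x within {0..R::real} = at x within {0..}"
  by (intro at_within_nhd[of _ "{..<R}"]) auto

lemma indefinite_integral_has_vector_derivative:
  fixes f :: "real \<Rightarrow> 'b::banach"
  assumes "continuous_on {0..} f" "x \<ge> 0"
  shows "((\<lambda>u. integral {0..u} f) has_vector_derivative f x) (at x within {0..})"
proof -
  have "((\<lambda>u. integral {0..u} f) has_vector_derivative f x) (at x within {0..x+1})"
    using assms by (intro integral_has_vector_derivative continuous_on_subset[OF assms(1)]) auto
  then show ?thesis by (simp add: at_within_Icc_Ici)
qed

lemma FTC_halfline_finite:
  fixes f :: "real \<Rightarrow> 'b::banach"
  assumes "\<And>x. x \<ge> 0 \<Longrightarrow> (f has_vector_derivative f' x) (at x within {0..})" "R \<ge> 0"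
  shows "(f' has_integral (f R - f 0)) {0..R}"
  using assms by (intro fundamental_theorem_of_calculus has_vector_derivative_within_subset[OF assms(1)]) auto

lemma integrable_hl_exp: "a > 0 \<Longrightarrow> integrable hl (\<lambda>x. exp (- a * x) :: real)"
proof -
  assume "a > 0"
  have "(\<lambda>x. exp (- a * x) :: real) absolutely_integrable_on {0..}"
    by (rule nonnegative_absolutely_integrable_1[OF integrable_on_exp_minus_to_infinity[OF \<open>a > 0\<close>]]) auto
  then have "set_integrable lborel {0..} (\<lambda>x. exp (- a * x) :: real)"
    unfolding set_integrable_def by (subst (asm) integrable_completion) auto
  then show ?thesis by (simp add: integrable_hl_iff)
qed

text \<open>A class stable under products, multiplication by x and both factors of the Dirichlet
  inverse, for which all integrals converge and boundary terms at infinity vanish. Continuity gives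
  a meaning to the value at 0. The rate is existential because multiplication by x lowers
  it.\<close>

definition exp_decay :: "(real \<Rightarrow> complex) \<Rightarrow> bool" where
  "exp_decay f \<longleftrightarrow> continuous_on {0..} f \<and> (\<exists>a>0. \<exists>C. \<forall>x\<ge>0. cmod (f x) \<le> C * exp (- a * x))"

lemma exp_decayI:
  assumes "continuous_on {0..} f" "a > 0" "\<And>x. x \<ge> 0 \<Longrightarrow> cmod (f x) \<le> C * exp (- a * x)"
  shows "exp_decay f"
  using assms unfolding exp_decay_def by blast

text \<open>The rate is lowered below 1 because the kernel of \<open>Sop\<close> decays only like
  exp(-x) and cannot preserve a rate of 1 or more.\<close>

lemma exp_decayE:
  assumes "exp_decay f"
  obtains a C where "0 < a" "a < 1" "C \<ge> 0" "\<And>x. x \<ge> 0 \<Longrightarrow> cmod (f x) \<le> C * exp (- a * x)"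
proof -
  obtain a C where a: "a > 0" and C: "\<And>x. x \<ge> 0 \<Longrightarrow> cmod (f x) \<le> C * exp (- a * x)"
    using assms unfolding exp_decay_def by blast
  have C0: "C \<ge> 0" using C[of 0] norm_ge_zero[of "f 0"] by (simp del: norm_ge_zero)
  show thesis
  proof (rule that[of "min a (1/2)" C])
    fix x :: real assume x: "x \<ge> 0"
    have "cmod (f x) \<le> C * exp (- a * x)" by (rule C[OF x])
    also have "\<dots> \<le> C * exp (- min a (1/2) * x)"
      using x C0 by (intro mult_left_mono) (auto intro!: mult_right_mono)
    finally show "cmod (f x) \<le> C * exp (- min a (1/2) * x)" .
  qed (use a C0 in auto)
qed

lemma exp_decay_continuous: "exp_decay f \<Longrightarrow> continuous_on {0..} f"
  by (simp add: exp_decay_def)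

lemma exp_decay_measurable: "exp_decay f \<Longrightarrow> f \<in> borel_measurable hl"
  by (intro continuous_on_hl_measurable exp_decay_continuous)

lemma exp_decay_integrable:
  assumes "exp_decay f" shows "integrable hl f"
proof -
  obtain a C where aC: "0 < a" "\<And>x. x \<ge> 0 \<Longrightarrow> cmod (f x) \<le> C * exp (- a * x)" "C \<ge> 0"
    using exp_decayE[OF assms] by metis
  show ?thesis
    by (rule Bochner_Integration.integrable_bound[OF integrable_mult_right[OF integrable_hl_exp[OF aC(1)], of C]])
       (use aC assms in \<open>auto intro!: AE_I2 exp_decay_measurable\<close>)
qed

lemma exp_decay_tendsto_0:
  assumes "exp_decay f" shows "(f \<longlongrightarrow> 0) at_top"
proof -
  obtain a C where aC: "0 < a" "\<And>x. x \<ge> 0 \<Longrightarrow> cmod (f x) \<le> C * exp (- a * x)"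
    using exp_decayE[OF assms] by metis
  have "filterlim (\<lambda>x. - (a * x)) at_bot at_top"
    using aC(1) by (auto intro!: filterlim_uminus_at_bot_at_top[THEN filterlim_compose]
        filterlim_tendsto_pos_mult_at_top[OF tendsto_const] filterlim_ident simp: filterlim_uminus_at_bot)
  then have "((\<lambda>x. C * exp (- (a * x))) \<longlongrightarrow> C * 0) at_top"
    by (intro tendsto_intros filterlim_compose[OF exp_at_bot])
  then have "((\<lambda>x. C * exp (- a * x)) \<longlongrightarrow> 0) at_top" by simp
  then show ?thesis
    by (rule Lim_null_comparison[rotated])
       (rule eventually_mono[OF eventually_ge_at_top[of 0] aC(2)])
qed

lemma exp_decay_add: assumes "exp_decay f" "exp_decay g" shows "exp_decay (\<lambda>x. f x + g x)"
proof -
  obtain a C where f: "0 < a" "C \<ge> 0" "\<And>x. x \<ge> 0 \<Longrightarrow> cmod (f x) \<le> C * exp (- a * x)"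
    using exp_decayE[OF assms(1)] by metis
  obtain b D where g: "0 < b" "D \<ge> 0" "\<And>x. x \<ge> 0 \<Longrightarrow> cmod (g x) \<le> D * exp (- b * x)"
    using exp_decayE[OF assms(2)] by metis
  show ?thesis
  proof (rule exp_decayI[of _ "min a b" "C + D"])
    fix x :: real assume x: "x \<ge> 0"
    have "cmod (f x + g x) \<le> C * exp (- a * x) + D * exp (- b * x)"
      using norm_triangle_ineq[of "f x" "g x"] f(3)[OF x] g(3)[OF x] by linarith
    also have "\<dots> \<le> C * exp (- min a b * x) + D * exp (- min a b * x)"
      using x f g by (intro add_mono mult_left_mono) (auto intro!: mult_right_mono)
    finally show "cmod (f x + g x) \<le> (C + D) * exp (- min a b * x)" by (simp add: distrib_right)
  qed (use f g assms exp_decay_continuous in \<open>auto intro!: continuous_intros\<close>)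
qed

lemma exp_decay_mult_bounded:
  assumes "exp_decay f" "continuous_on {0..} g" "\<And>x. x \<ge> 0 \<Longrightarrow> cmod (g x) \<le> B"
  shows "exp_decay (\<lambda>x. g x * f x)"
proof -
  obtain a C where f: "0 < a" "C \<ge> 0" "\<And>x. x \<ge> 0 \<Longrightarrow> cmod (f x) \<le> C * exp (- a * x)"
    using exp_decayE[OF assms(1)] by metis
  show ?thesis
  proof (rule exp_decayI[of _ a "B * C"])
    fix x :: real assume x: "x \<ge> 0"
    show "cmod (g x * f x) \<le> B * C * exp (- a * x)"
      unfolding norm_mult mult.assoc
      using assms(3)[OF x] f(3)[OF x] order_trans[OF norm_ge_zero assms(3)[OF x]]
      by (intro mult_mono) auto
  qed (use f assms exp_decay_continuous in \<open>auto intro!: continuous_intros\<close>)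
qed

lemma exp_decay_cmult: "exp_decay f \<Longrightarrow> exp_decay (\<lambda>x. c * f x)"
  by (rule exp_decay_mult_bounded[where B = "cmod c"]) auto

lemma exp_decay_uminus: "exp_decay f \<Longrightarrow> exp_decay (\<lambda>x. - f x)"
  using exp_decay_cmult[of f "-1"] by simp

lemma exp_decay_diff: "exp_decay f \<Longrightarrow> exp_decay g \<Longrightarrow> exp_decay (\<lambda>x. f x - g x)"
  using exp_decay_add[of f "\<lambda>x. - g x"] exp_decay_uminus by simp

lemma exp_decay_cnj: "exp_decay f \<Longrightarrow> exp_decay (\<lambda>x. cnj (f x))"
  unfolding exp_decay_def by (auto intro!: continuous_intros)

lemma exp_decay_bounded: "exp_decay f \<Longrightarrow> \<exists>B. \<forall>x\<ge>0. cmod (f x) \<le> B"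
proof -
  assume "exp_decay f"
  then obtain a C where f: "0 < a" "C \<ge> 0" "\<And>x. x \<ge> 0 \<Longrightarrow> cmod (f x) \<le> C * exp (- a * x)"
    using exp_decayE by metis
  have "cmod (f x) \<le> C" if "x \<ge> 0" for x
    using f(3)[OF that] mult_left_mono[OF _ f(2), of "exp (- a * x)" 1] f(1) that
    by (auto intro: order_trans)
  then show ?thesis by blast
qed

lemma exp_decay_mult: "exp_decay f \<Longrightarrow> exp_decay g \<Longrightarrow> exp_decay (\<lambda>x. f x * g x)"
  using exp_decay_bounded[of f] exp_decay_continuous[of f] exp_decay_mult_bounded[of g f] by blast

lemma linear_le_exp: assumes "a > 0" shows "x \<le> exp (a * x) / (a::real)"
proof -
  have "a * x \<le> exp (a * x)" using exp_ge_add_one_self[of "a * x"] by linarith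
  then show ?thesis using assms by (simp add: field_simps)
qed

lemma exp_decay_times_id:
  assumes "exp_decay f" shows "exp_decay (\<lambda>x. of_real x * f x)"
proof -
  obtain a C where f: "0 < a" "C \<ge> 0" "\<And>x. x \<ge> 0 \<Longrightarrow> cmod (f x) \<le> C * exp (- a * x)"
    using exp_decayE[OF assms(1)] by metis
  show ?thesis
  proof (rule exp_decayI[of _ "a/2" "2 / a * C"])
    fix x :: real assume x: "x \<ge> 0"
    have "cmod (of_real x * f x) = x * cmod (f x)" using x by (simp add: norm_mult)
    also have "\<dots> \<le> (exp (a/2 * x) / (a/2)) * (C * exp (- a * x))"
      using x f linear_le_exp[of "a/2" x] by (intro mult_mono) auto
    also have "\<dots> = 2 / a * C * (exp (a/2 * x) * exp (- a * x))" by simp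
    also have "exp (a/2 * x) * exp (- a * x) = exp (- (a/2) * x)"
      by (simp add: exp_add[symmetric] field_simps)
    finally show "cmod (of_real x * f x) \<le> 2 / a * C * exp (- (a/2) * x)" .
  qed (use f assms exp_decay_continuous in \<open>auto intro!: continuous_intros\<close>)
qed

lemma exp_decay_cmod_square_integrable:
  assumes "exp_decay f" shows "integrable hl (\<lambda>x. (cmod (f x))\<^sup>2)"
proof -
  have "integrable hl (\<lambda>x. f x * cnj (f x))"
    by (intro exp_decay_integrable exp_decay_mult exp_decay_cnj assms)
  then have "integrable hl (\<lambda>x. Re (f x * cnj (f x)))" by (rule integrable_Re)
  then show ?thesis unfolding cmod_power2 by (simp add: power2_eq_square)
qed

lemma integral_hl_tendsto:
  fixes f :: "real \<Rightarrow> 'b::euclidean_space"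
  assumes f: "integrable hl f"
  shows "((\<lambda>N. integral {0..N} f) \<longlongrightarrow> integral\<^sup>L hl f) at_top"
proof -
  have *: "set_integrable lborel {0..} f" using f by (simp add: integrable_hl_iff)
  have "((\<lambda>b. set_lebesgue_integral lborel {0..b} f) \<longlongrightarrow> set_lebesgue_integral lborel {0..} f) at_top"
    by (rule tendsto_set_lebesgue_integral_at_top[OF _ *]) auto
  moreover have "set_lebesgue_integral lborel {0..b} f = integral {0..b} f" for b
    by (intro set_borel_integral_eq_integral set_integrable_subset[OF *]) auto
  ultimately show ?thesis by (simp add: integral_hl_eq)
qed

lemma integral_hl_derivative:
  assumes "exp_decay f" "exp_decay f'"
    and "\<And>x. x \<ge> 0 \<Longrightarrow> (f has_vector_derivative f' x) (at x within {0..})"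
  shows "integral\<^sup>L hl f' = - f 0"
proof -
  have "((\<lambda>N. integral {0..N} f') \<longlongrightarrow> integral\<^sup>L hl f') at_top"
    by (intro integral_hl_tendsto exp_decay_integrable assms)
  moreover have "((\<lambda>N. integral {0..N} f') \<longlongrightarrow> 0 - f 0) at_top"
  proof (rule Lim_transform_eventually)
    show "((\<lambda>N. f N - f 0) \<longlongrightarrow> 0 - f 0) at_top"
      by (intro tendsto_intros exp_decay_tendsto_0 assms)
    show "\<forall>\<^sub>F x in at_top. f x - f 0 = integral {0..x} f'"
      using FTC_halfline_finite[OF assms(3)]
      by (intro eventually_mono[OF eventually_ge_at_top[of 0]]) (metis integral_unique)
  qed
  ultimately show ?thesis using tendsto_unique[OF trivial_limit_at_top_linorder] by fastforce
qed

text \<open>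
  In frequency space the operator \<open>f \<mapsto> (1 - d\<^sup>2/dx\<^sup>2)\<^sup>-\<^sup>1 f\<close> with Dirichlet condition at \<open>0\<close> factors as
  \<open>Sop \<circ> Sst\<close>, where \<open>p = Sst f\<close> is the bounded solution of \<open>p' = p - f\<close> and \<open>w = Sop q\<close>
  solves \<open>w' = q - w\<close>, \<open>w 0 = 0\<close>.
\<close>

definition ell :: "(real \<Rightarrow> complex) \<Rightarrow> complex" where
  "ell f = (\<integral>x. exp (- x) *\<^sub>R f x \<partial>hl)"

definition Sst :: "(real \<Rightarrow> complex) \<Rightarrow> real \<Rightarrow> complex" where
  "Sst f x = exp x *\<^sub>R (ell f - integral {0..x} (\<lambda>z. exp (- z) *\<^sub>R f z))"

definition Sop :: "(real \<Rightarrow> complex) \<Rightarrow> real \<Rightarrow> complex" where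
  "Sop q x = exp (- x) *\<^sub>R integral {0..x} (\<lambda>z. exp z *\<^sub>R q z)"

definition Gop :: "(real \<Rightarrow> complex) \<Rightarrow> real \<Rightarrow> complex" where
  "Gop f = Sop (Sst f)"

lemma exp_weight_decay: "exp_decay f \<Longrightarrow> exp_decay (\<lambda>x. exp (- x) *\<^sub>R f x)"
  unfolding scaleR_conv_of_real
  by (rule exp_decay_mult_bounded[where B = 1]) (auto intro!: continuous_intros)

lemma exp_weight_integrable: "exp_decay f \<Longrightarrow> integrable hl (\<lambda>x. exp (- x) *\<^sub>R f x)"
  by (intro exp_decay_integrable exp_weight_decay)

lemma Sst_0 [simp]: "Sst f 0 = ell f" by (simp add: Sst_def)

lemma Sop_0 [simp]: "Sop q 0 = 0" by (simp add: Sop_def)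

lemma Gop_0 [simp]: "Gop f 0 = 0" by (simp add: Gop_def)

lemma Sst_derivative:
  assumes "continuous_on {0..} f" "x \<ge> 0"
  shows "(Sst f has_vector_derivative (Sst f x - f x)) (at x within {0..})"
proof -
  have c: "continuous_on {0..} (\<lambda>z. exp (- z) *\<^sub>R f z)"
    using assms by (intro continuous_intros) auto
  have "((\<lambda>x. exp x *\<^sub>R (ell f - integral {0..x} (\<lambda>z. exp (- z) *\<^sub>R f z))) has_vector_derivative
     (exp x *\<^sub>R (0 - exp (- x) *\<^sub>R f x) + exp x *\<^sub>R (ell f - integral {0..x} (\<lambda>z. exp (- z) *\<^sub>R f z))))
     (at x within {0..})"
    by (intro has_vector_derivative_scaleR has_vector_derivative_diff
        indefinite_integral_has_vector_derivative[OF c assms(2)])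
       (auto intro!: derivative_eq_intros)
  then show ?thesis
    unfolding Sst_def[abs_def] by (simp add: exp_add[symmetric] mult_exp_exp algebra_simps)
qed

lemma Sop_derivative:
  assumes "continuous_on {0..} q" "x \<ge> 0"
  shows "(Sop q has_vector_derivative (q x - Sop q x)) (at x within {0..})"
proof -
  have c: "continuous_on {0..} (\<lambda>z. exp z *\<^sub>R q z)"
    using assms by (intro continuous_intros) auto
  have "((\<lambda>x. exp (- x) *\<^sub>R integral {0..x} (\<lambda>z. exp z *\<^sub>R q z)) has_vector_derivative
     (exp (- x) *\<^sub>R (exp x *\<^sub>R q x) + (- exp (- x)) *\<^sub>R integral {0..x} (\<lambda>z. exp z *\<^sub>R q z)))
     (at x within {0..})"
    by (intro has_vector_derivative_scaleR indefinite_integral_has_vector_derivative[OF c assms(2)])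
       (auto intro!: derivative_eq_intros)
  then show ?thesis
    unfolding Sop_def[abs_def] by (simp add: exp_add[symmetric] mult_exp_exp algebra_simps)
qed

lemma has_vector_derivative_continuous_on_halfline:
  assumes "\<And>x. x \<ge> 0 \<Longrightarrow> (f has_vector_derivative f' x) (at x within {0..})"
  shows "continuous_on {0..} f"
  using assms by (auto simp: continuous_on_eq_continuous_within intro: has_vector_derivative_continuous)

lemma Sst_continuous: "continuous_on {0..} f \<Longrightarrow> continuous_on {0..} (Sst f)"
  using Sst_derivative by (rule has_vector_derivative_continuous_on_halfline)

lemma Sop_continuous: "continuous_on {0..} f \<Longrightarrow> continuous_on {0..} (Sop f)"
  using Sop_derivative by (rule has_vector_derivative_continuous_on_halfline)

lemma exp_antiderivative:
  assumes "c \<noteq> 0"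
  shows "((\<lambda>z. - C * exp (- c * z) / c) has_vector_derivative C * exp (- c * z)) (at z within S)"
  unfolding has_real_derivative_iff_has_vector_derivative[symmetric]
  using assms by (auto intro!: derivative_eq_intros)

text \<open>\<open>Sst f x\<close> is the integral of \<open>exp (x - z) * f z\<close> over z >= x,
  obtained as the limit of the integrals over {x..N}. The kernel has mass 1 and looks only to the
  right, so every rate of decay passes through with the same constant.\<close>

lemma Sst_bound:
  assumes f: "exp_decay f" and a: "a \<ge> 0" "C \<ge> 0"
    and le: "\<And>x. x \<ge> 0 \<Longrightarrow> cmod (f x) \<le> C * exp (- a * x)" and x: "x \<ge> 0"
  shows "cmod (Sst f x) \<le> C * exp (- a * x)"
proof -
  let ?h = "\<lambda>z. exp (- z) *\<^sub>R f z"
  have c: "continuous_on {0..} ?h"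
    using f by (intro continuous_intros exp_decay_continuous) auto
  have int: "?h integrable_on {p..q}" if "p \<ge> 0" for p q
    using that by (intro integrable_continuous_interval continuous_on_subset[OF c]) auto
  have "((\<lambda>N. cmod (integral {0..N} ?h - integral {0..x} ?h)) \<longlongrightarrow>
        cmod (ell f - integral {0..x} ?h)) at_top"
    unfolding ell_def by (intro tendsto_intros integral_hl_tendsto exp_weight_integrable f)
  moreover have "\<forall>\<^sub>F N in at_top. cmod (integral {0..N} ?h - integral {0..x} ?h) \<le> C * exp (- (1 + a) * x)"
  proof (rule eventually_mono[OF eventually_ge_at_top[of x]])
    fix N assume N: "N \<ge> x"
    have "integral {0..N} ?h - integral {0..x} ?h = integral {x..N} ?h"
      using Henstock_Kurzweil_Integration.integral_combine[of 0 x N ?h] int[of 0] N x by (simp add: algebra_simps)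
    also have "cmod \<dots> \<le> C * exp (- (1 + a) * x) / (1 + a) - C * exp (- (1 + a) * N) / (1 + a)"
    proof -
      have hi: "((\<lambda>z. C * exp (- (1 + a) * z)) has_integral
          (- C * exp (- (1 + a) * N) / (1 + a) - (- C * exp (- (1 + a) * x) / (1 + a)))) {x..N}"
      proof (intro fundamental_theorem_of_calculus)
        have b: "1 + a \<noteq> 0" using a by simp
        show "((\<lambda>z. - C * exp (- (1 + a) * z) / (1 + a)) has_vector_derivative C * exp (- (1 + a) * z))
            (at z within {x..N})" for z
          by (rule exp_antiderivative[OF b])
      qed (use N in auto)
      have "cmod (integral {x..N} ?h) \<le> integral {x..N} (\<lambda>z. C * exp (- (1 + a) * z))"
      proof (rule Henstock_Kurzweil_Integration.integral_norm_bound_integral)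
        show "?h integrable_on {x..N}" using int x by simp
        show "(\<lambda>z. C * exp (- (1 + a) * z)) integrable_on {x..N}" using hi by (rule has_integral_integrable)
        fix z assume z: "z \<in> {x..N}"
        then have "cmod (?h z) \<le> exp (- z) * (C * exp (- a * z))"
          using le[of z] x by simp
        also have "\<dots> = C * exp (- (1 + a) * z)"
          by (simp add: exp_add[symmetric] algebra_simps)
        finally show "cmod (?h z) \<le> C * exp (- (1 + a) * z)" .
      qed
      then show ?thesis unfolding integral_unique[OF hi] by simp
    qed
    also have "\<dots> \<le> C * exp (- (1 + a) * x) / (1 + a)" using a by simp
    also have "\<dots> \<le> C * exp (- (1 + a) * x)" using a divide_left_mono[of 1 "1 + a" "C * exp (- (1 + a) * x)"] by simp
    finally show "cmod (integral {0..N} ?h - integral {0..x} ?h) \<le> C * exp (- (1 + a) * x)" .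
  qed
  ultimately have "cmod (ell f - integral {0..x} ?h) \<le> C * exp (- (1 + a) * x)"
    by (rule tendsto_upperbound) simp
  then have "exp x * cmod (ell f - integral {0..x} ?h) \<le> exp x * (C * exp (- (1 + a) * x))"
    by (intro mult_left_mono) auto
  also have "\<dots> = C * exp (- a * x)" by (simp add: exp_add[symmetric] algebra_simps)
  finally show ?thesis unfolding Sst_def by simp
qed

text \<open>Here the kernel \<open>exp (z - x)\<close> looks to the left, z <= x; integrating it
  against \<open>exp (- a * z)\<close> costs the factor \<open>1 / (1 - a)\<close> and needs
  \<open>a < 1\<close>.\<close>

lemma Sop_bound:
  assumes q: "continuous_on {0..} q" and a: "0 \<le> a" "a < 1" "C \<ge> 0"
    and le: "\<And>x. x \<ge> 0 \<Longrightarrow> cmod (q x) \<le> C * exp (- a * x)" and x: "x \<ge> 0"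
  shows "cmod (Sop q x) \<le> C / (1 - a) * exp (- a * x)"
proof -
  let ?h = "\<lambda>z. exp z *\<^sub>R q z"
  have c: "continuous_on {0..} ?h" using q by (intro continuous_intros) auto
  have hi: "((\<lambda>z. C * exp ((1 - a) * z)) has_integral
      (C * exp ((1 - a) * x) / (1 - a) - (C * exp ((1 - a) * 0) / (1 - a)))) {0..x}"
    using a x
    by (intro fundamental_theorem_of_calculus)
       (auto intro!: derivative_eq_intros simp: has_real_derivative_iff_has_vector_derivative[symmetric])
  have "cmod (integral {0..x} ?h) \<le> integral {0..x} (\<lambda>z. C * exp ((1 - a) * z))"
  proof (rule Henstock_Kurzweil_Integration.integral_norm_bound_integral)
    show "?h integrable_on {0..x}"
      by (intro integrable_continuous_interval continuous_on_subset[OF c]) auto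
    show "(\<lambda>z. C * exp ((1 - a) * z)) integrable_on {0..x}" using hi by (rule has_integral_integrable)
    fix z assume z: "z \<in> {0..x}"
    then have "cmod (?h z) \<le> exp z * (C * exp (- a * z))"
      using le[of z] x by simp
    also have "\<dots> = C * exp ((1 - a) * z)"
      by (simp add: exp_add[symmetric] algebra_simps)
    finally show "cmod (?h z) \<le> C * exp ((1 - a) * z)" .
  qed
  also have "\<dots> \<le> C * exp ((1 - a) * x) / (1 - a)" using a unfolding integral_unique[OF hi] by simp
  finally have "exp (- x) * cmod (integral {0..x} ?h) \<le> exp (- x) * (C * exp ((1 - a) * x) / (1 - a))"
    by (intro mult_left_mono) auto
  also have "\<dots> = C / (1 - a) * (exp (- x) * exp ((1 - a) * x))" by simp
  also have "exp (- x) * exp ((1 - a) * x) = exp (- a * x)" by (simp add: exp_add[symmetric] algebra_simps)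
  finally show ?thesis unfolding Sop_def by simp
qed

lemma exp_decay_Sst: assumes "exp_decay f" shows "exp_decay (Sst f)"
proof -
  obtain a C where aC: "0 < a" "C \<ge> 0" "\<And>x. x \<ge> 0 \<Longrightarrow> cmod (f x) \<le> C * exp (- a * x)"
    using exp_decayE[OF assms] by metis
  show ?thesis
    by (rule exp_decayI[OF Sst_continuous[OF exp_decay_continuous[OF assms]] aC(1)
          Sst_bound[OF assms less_imp_le[OF aC(1)] aC(2,3)]])
qed

lemma exp_decay_Sop: assumes "exp_decay f" shows "exp_decay (Sop f)"
proof -
  obtain a C where aC: "0 < a" "a < 1" "C \<ge> 0" "\<And>x. x \<ge> 0 \<Longrightarrow> cmod (f x) \<le> C * exp (- a * x)"
    using exp_decayE[OF assms] by metis
  have c: "continuous_on {0..} f" by (rule exp_decay_continuous[OF assms])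
  show ?thesis
    by (rule exp_decayI[OF Sop_continuous[OF c] aC(1)
          Sop_bound[OF c less_imp_le[OF aC(1)] aC(2,3,4)]])
qed

lemma exp_decay_Gop: "exp_decay f \<Longrightarrow> exp_decay (Gop f)"
  unfolding Gop_def by (intro exp_decay_Sop exp_decay_Sst)

lemma Gop_derivative:
  assumes "continuous_on {0..} f" "x \<ge> 0"
  shows "(Gop f has_vector_derivative (Sst f x - Gop f x)) (at x within {0..})"
  unfolding Gop_def using assms by (intro Sop_derivative Sst_continuous)

text \<open>Two solutions of q' = q - f differ by a multiple of exp(x), hence boundedness alone
  selects \<open>Sst f\<close>. Linearity, commutation rules and closed formulas for
  \<open>Sst\<close> are later checked through this criterion instead of through integrals.\<close>

lemma Sst_unique:
  assumes der: "\<And>x. x \<ge> 0 \<Longrightarrow> (q has_vector_derivative (q x - f x)) (at x within {0..})"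
    and f: "exp_decay f" and q: "\<And>x. x \<ge> 0 \<Longrightarrow> cmod (q x) \<le> B" and x: "x \<ge> 0"
  shows "Sst f x = q x"
proof -
  define d where "d x = q x - Sst f x" for x
  have "((\<lambda>x. exp (- x) *\<^sub>R d x) has_vector_derivative 0) (at x within {0..})" if "x \<ge> 0" for x
  proof -
    have "((\<lambda>x. exp (- x) *\<^sub>R d x) has_vector_derivative
        (exp (- x) *\<^sub>R ((q x - f x) - (Sst f x - f x)) + (- exp (- x)) *\<^sub>R d x)) (at x within {0..})"
      unfolding d_def
      by (intro has_vector_derivative_scaleR has_vector_derivative_diff der that
            Sst_derivative exp_decay_continuous f) (auto intro!: derivative_eq_intros)
    then show ?thesis by (simp add: d_def)
  qed
  then obtain c where c: "\<And>x. x \<in> {0..} \<Longrightarrow> exp (- x) *\<^sub>R d x = c"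
    using has_vector_derivative_zero_constant[of "{0..}" "\<lambda>x. exp (- x) *\<^sub>R d x"] by (auto simp: convex_real_interval)
  obtain B' where B': "\<And>x. x \<ge> 0 \<Longrightarrow> cmod (Sst f x) \<le> B'"
    using exp_decay_bounded[OF exp_decay_Sst[OF f]] by blast
  have dc: "d x = exp x *\<^sub>R c" if "x \<ge> 0" for x
  proof -
    have "exp x *\<^sub>R (exp (- x) *\<^sub>R d x) = exp x *\<^sub>R c" using c[of x] that by simp
    then show ?thesis by (simp add: exp_add[symmetric] mult_exp_exp)
  qed
  have "c = 0"
  proof (rule ccontr)
    assume "c \<noteq> 0"
    define y where "y = (B + B') / cmod c"
    have Bnn: "B + B' \<ge> 0" using q[of 0] B'[of 0] norm_ge_zero[of "q 0"] norm_ge_zero[of "Sst f 0"]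
      by (simp del: norm_ge_zero)
    then have y: "y \<ge> 0" by (simp add: y_def)
    have "(1 + y) * cmod c \<le> exp y * cmod c" by (intro mult_right_mono exp_ge_add_one_self) auto
    also have "\<dots> = cmod (d y)" using dc[OF y] by simp
    also have "\<dots> \<le> B + B'" unfolding d_def
      using norm_triangle_ineq4[of "q y" "Sst f y"] q[OF y] B'[OF y] by linarith
    finally have "(1 + y) * cmod c \<le> y * cmod c" using \<open>c \<noteq> 0\<close> by (simp add: y_def)
    then show False using \<open>c \<noteq> 0\<close> by simp
  qed
  then show ?thesis using dc[OF x] by (simp add: d_def)
qed

lemma Sop_unique:
  assumes der: "\<And>x. x \<ge> 0 \<Longrightarrow> (w has_vector_derivative (q x - w x)) (at x within {0..})"
    and q: "continuous_on {0..} q" and w: "w 0 = 0" and x: "x \<ge> 0"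
  shows "Sop q x = w x"
proof -
  define d where "d x = w x - Sop q x" for x
  have "((\<lambda>x. exp x *\<^sub>R d x) has_vector_derivative 0) (at x within {0..})" if "x \<ge> 0" for x
  proof -
    have "((\<lambda>x. exp x *\<^sub>R d x) has_vector_derivative
        (exp x *\<^sub>R ((q x - w x) - (q x - Sop q x)) + exp x *\<^sub>R d x)) (at x within {0..})"
      unfolding d_def
      by (intro has_vector_derivative_scaleR has_vector_derivative_diff der that
            Sop_derivative q) (auto intro!: derivative_eq_intros)
    then show ?thesis by (simp add: d_def algebra_simps)
  qed
  then obtain c where c: "\<And>x. x \<in> {0..} \<Longrightarrow> exp x *\<^sub>R d x = c"
    using has_vector_derivative_zero_constant[of "{0..}" "\<lambda>x. exp x *\<^sub>R d x"] by (auto simp: convex_real_interval)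
  have "c = 0" using c[of 0] w by (simp add: d_def)
  then show ?thesis using c[of x] x by (simp add: d_def)
qed

lemma Sst_deriv_comm:
  assumes f: "exp_decay f" "exp_decay f'"
    and der: "\<And>x. x \<ge> 0 \<Longrightarrow> (f has_vector_derivative f' x) (at x within {0..})" and x: "x \<ge> 0"
  shows "Sst f' x = Sst f x - f x"
proof -
  obtain B where B: "\<And>x. x \<ge> 0 \<Longrightarrow> cmod (Sst f x - f x) \<le> B"
    using exp_decay_bounded[OF exp_decay_diff[OF exp_decay_Sst[OF f(1)] f(1)]] by blast
  show ?thesis
    by (rule Sst_unique[where B = B])
       (use f B x in \<open>auto intro!: has_vector_derivative_diff der Sst_derivative exp_decay_continuous\<close>)
qed

lemma ell_deriv:
  assumes f: "exp_decay f" "exp_decay f'"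
    and der: "\<And>x. x \<ge> 0 \<Longrightarrow> (f has_vector_derivative f' x) (at x within {0..})"
  shows "ell f' = ell f - f 0"
  using Sst_deriv_comm[OF assms, of 0] by simp

text \<open>\<open>Sst f - Gop f\<close> is the derivative of \<open>Gop f\<close>; its value at 0
  is \<open>ell f\<close> instead of 0. Subtracting \<open>ell f\<close> times exp(-x), which lies
  in the kernel of 1 - d^2/dx^2, restores the Dirichlet condition. This is the source of the rank
  one term in the commutator with the Lax operator.\<close>

lemma Gop_deriv_comm:
  assumes f: "exp_decay f" "exp_decay f'"
    and der: "\<And>x. x \<ge> 0 \<Longrightarrow> (f has_vector_derivative f' x) (at x within {0..})" and x: "x \<ge> 0"
  shows "Gop f' x = Sst f x - Gop f x - exp (- x) *\<^sub>R ell f"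
proof -
  have cSf': "continuous_on {0..} (Sst f')" using f by (intro Sst_continuous exp_decay_continuous)
  show ?thesis unfolding Gop_def[of f']
  proof (rule Sop_unique[OF _ cSf' _ x])
    fix x :: real assume x: "x \<ge> 0"
    have "((\<lambda>x. Sst f x - Gop f x - exp (- x) *\<^sub>R ell f) has_vector_derivative
      ((Sst f x - f x) - (Sst f x - Gop f x) - (exp (- x) *\<^sub>R 0 + (- exp (- x)) *\<^sub>R ell f))) (at x within {0..})"
      by (intro has_vector_derivative_diff has_vector_derivative_scaleR Sst_derivative Gop_derivative
           exp_decay_continuous f x) (auto intro!: derivative_eq_intros)
    then show "((\<lambda>x. Sst f x - Gop f x - exp (- x) *\<^sub>R ell f) has_vector_derivative
      (Sst f' x - (Sst f x - Gop f x - exp (- x) *\<^sub>R ell f))) (at x within {0..})"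
      by (rule has_vector_derivative_eq_rhs) (use Sst_deriv_comm[OF f der x] in \<open>simp add: algebra_simps\<close>)
  qed simp
qed

section \<open>The inner product of the half-line and norm bounds for the Dirichlet inverse\<close>

definition ip :: "(real \<Rightarrow> complex) \<Rightarrow> (real \<Rightarrow> complex) \<Rightarrow> complex" where
  "ip f g = (\<integral>x. f x * cnj (g x) \<partial>hl)"

definition nsq :: "(real \<Rightarrow> complex) \<Rightarrow> real" where
  "nsq f = (\<integral>x. (cmod (f x))\<^sup>2 \<partial>hl)"

lemma ip_integrable: "exp_decay f \<Longrightarrow> exp_decay g \<Longrightarrow> integrable hl (\<lambda>x. f x * cnj (g x))"
  by (intro exp_decay_integrable exp_decay_mult exp_decay_cnj)

lemma nsq_nonneg [simp]: "nsq f \<ge> 0" by (simp add: nsq_def)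

lemma ip_self: "ip f f = of_real (nsq f)"
proof -
  have "(\<lambda>x. f x * cnj (f x)) = (\<lambda>x. complex_of_real ((cmod (f x))\<^sup>2))"
    by (auto simp: complex_mult_cnj cmod_power2)
  then show ?thesis unfolding ip_def nsq_def by (simp only: integral_complex_of_real)
qed

lemma ip_cnj: "cnj (ip f g) = ip g f"
proof -
  have "cnj (ip f g) = (\<integral>x. cnj (f x * cnj (g x)) \<partial>hl)" unfolding ip_def by (rule Bochner_Integration.integral_cnj[symmetric])
  then show ?thesis by (simp add: ip_def mult.commute)
qed

lemma ip_add_left: "exp_decay f \<Longrightarrow> exp_decay g \<Longrightarrow> exp_decay h \<Longrightarrow>
   ip (\<lambda>x. f x + g x) h = ip f h + ip g h"
  unfolding ip_def using ip_integrable by (simp add: distrib_right)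

lemma ip_diff_left: "exp_decay f \<Longrightarrow> exp_decay g \<Longrightarrow> exp_decay h \<Longrightarrow>
   ip (\<lambda>x. f x - g x) h = ip f h - ip g h"
  unfolding ip_def using ip_integrable by (simp add: left_diff_distrib)

lemma ip_cmult_left: "ip (\<lambda>x. c * f x) g = c * ip f g"
  unfolding ip_def by (simp add: mult.assoc)

lemma ip_cmult_right: "ip f (\<lambda>x. c * g x) = cnj c * ip f g"
  unfolding ip_def by (simp add: mult.left_commute)

lemma ip_add_right: "exp_decay f \<Longrightarrow> exp_decay g \<Longrightarrow> exp_decay h \<Longrightarrow>
   ip h (\<lambda>x. f x + g x) = ip h f + ip h g"
  unfolding ip_def using ip_integrable by (simp add: distrib_left)

lemma ip_le: assumes "exp_decay f" "exp_decay g"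
  shows "cmod (ip f g) \<le> sqrt (nsq f) * sqrt (nsq g)"
proof -
  have "cmod (ip f g) \<le> (\<integral>x. cmod (f x) * cmod (g x) \<partial>hl)"
    unfolding ip_def using integral_norm_bound[of hl "\<lambda>x. f x * cnj (g x)"] by (simp add: norm_mult)
  also have "\<dots> \<le> sqrt (nsq f) * sqrt (nsq g)"
    unfolding nsq_def by (intro integral_mult_squares_le exp_decay_measurable
        exp_decay_cmod_square_integrable assms)
  finally show ?thesis .
qed

text \<open>The two first order factors are adjoint to each other: the integrands differ by the
  derivative of \<open>Sop q * cnj (Sst f)\<close>, which vanishes at 0 and at infinity.
  Consequently \<open>Gop\<close> is symmetric and nonnegative.\<close>

lemma ip_Sop: assumes "exp_decay f" "exp_decay q"
  shows "ip (Sop q) f = ip q (Sst f)"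
proof -
  have "integral\<^sup>L hl (\<lambda>x. q x * cnj (Sst f x) - Sop q x * cnj (f x)) = - (Sop q 0 * cnj (Sst f 0))"
  proof (rule integral_hl_derivative)
    fix x :: real assume x: "x \<ge> 0"
    have "((\<lambda>x. Sop q x * cnj (Sst f x)) has_vector_derivative
      (Sop q x * cnj (Sst f x - f x) + (q x - Sop q x) * cnj (Sst f x))) (at x within {0..})"
      by (intro has_vector_derivative_mult has_vector_derivative_cnj Sst_derivative Sop_derivative
           exp_decay_continuous assms x)
    then show "((\<lambda>x. Sop q x * cnj (Sst f x)) has_vector_derivative
      (q x * cnj (Sst f x) - Sop q x * cnj (f x))) (at x within {0..})"
      by (simp add: algebra_simps)
  qed (intro exp_decay_diff exp_decay_mult exp_decay_cnj exp_decay_Sst exp_decay_Sop assms)+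
  then show ?thesis unfolding ip_def
    using ip_integrable[of q "Sst f"] ip_integrable[of "Sop q" f] assms by (simp add: exp_decay_Sst exp_decay_Sop)
qed

lemma ip_Gop: assumes "exp_decay f" "exp_decay g" shows "ip (Gop f) g = ip (Sst f) (Sst g)"
  unfolding Gop_def using assms by (intro ip_Sop exp_decay_Sst)

lemma ip_Gop_sym: assumes "exp_decay f" "exp_decay g" shows "ip (Gop f) g = ip f (Gop g)"
  using ip_Gop[OF assms] ip_Gop[OF assms(2,1)] ip_cnj[of "Gop g" f] ip_cnj[of "Sst g" "Sst f"] by simp

lemma Re_mult_cnj_le: "2 * Re (a * cnj b) \<le> (cmod a)\<^sup>2 + (cmod b)\<^sup>2"
proof -
  have "0 \<le> (cmod (a - b))\<^sup>2" by simp
  also have "\<dots> = (cmod a)\<^sup>2 + (cmod b)\<^sup>2 - 2 * Re (a * cnj b)"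
    unfolding cmod_power2 by (simp add: power2_eq_square algebra_simps)
  finally show ?thesis by simp
qed

lemma Sst_cmod_square_derivative:
  assumes "continuous_on {0..} f" "x \<ge> 0"
  shows "((\<lambda>x. (cmod (Sst f x))\<^sup>2) has_vector_derivative
     (2 * (cmod (Sst f x))\<^sup>2 - 2 * Re (f x * cnj (Sst f x)))) (at x within {0..})"
proof -
  have "((\<lambda>x. Sst f x * cnj (Sst f x)) has_vector_derivative
      (Sst f x * cnj (Sst f x - f x) + (Sst f x - f x) * cnj (Sst f x))) (at x within {0..})"
    by (intro has_vector_derivative_mult has_vector_derivative_cnj Sst_derivative assms)
  from bounded_linear.has_vector_derivative[OF bounded_linear_Re this] show ?thesis
    unfolding cmod_power2 by (simp add: power2_eq_square algebra_simps)
qed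

text \<open>Integrating the derivative of \<open>|Sst f|^2\<close> over the half-line gives
  \<open>- |Sst f 0|^2 <= 0\<close>, that is, \<open>nsq (Sst f) <= Re (ip f (Sst f))\<close>; the
  elementary inequality \<open>Re_mult_cnj_le\<close> finishes.\<close>

lemma nsq_Sst_le: assumes f: "exp_decay f" shows "nsq (Sst f) \<le> nsq f"
proof -
  let ?d = "\<lambda>x. 2 * (cmod (Sst f x))\<^sup>2 - 2 * Re (f x * cnj (Sst f x))"
  note intros = exp_decay_Sst f
  have i1: "integrable hl (\<lambda>x. (cmod (Sst f x))\<^sup>2)" "integrable hl (\<lambda>x. (cmod (f x))\<^sup>2)"
    by (intro exp_decay_cmod_square_integrable intros)+
  have i2: "integrable hl (\<lambda>x. f x * cnj (Sst f x))" by (intro ip_integrable intros)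
  have i2': "integrable hl (\<lambda>x. Re (f x * cnj (Sst f x)))" using i2 by (rule integrable_Re)
  have i: "integrable hl ?d" using i1 i2' by (intro Bochner_Integration.integrable_diff integrable_mult_right) auto
  have "((\<lambda>N. integral {0..N} ?d) \<longlongrightarrow> integral\<^sup>L hl ?d) at_top"
    by (rule integral_hl_tendsto[OF i])
  moreover have "\<forall>\<^sub>F N in at_top. integral {0..N} ?d \<le> (cmod (Sst f N))\<^sup>2"
  proof (rule eventually_mono[OF eventually_ge_at_top[of 0]])
    fix N :: real assume "N \<ge> 0"
    then have "integral {0..N} ?d = (cmod (Sst f N))\<^sup>2 - (cmod (Sst f 0))\<^sup>2"
      by (intro integral_unique FTC_halfline_finite Sst_cmod_square_derivative exp_decay_continuous f)
    then show "integral {0..N} ?d \<le> (cmod (Sst f N))\<^sup>2" by simp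
  qed
  moreover have "((\<lambda>N. (cmod (Sst f N))\<^sup>2) \<longlongrightarrow> (cmod 0)\<^sup>2) at_top"
    by (intro tendsto_intros exp_decay_tendsto_0 intros)
  ultimately have "integral\<^sup>L hl ?d \<le> (cmod 0)\<^sup>2"
    by (intro tendsto_le[OF trivial_limit_at_top_linorder])
  then have "integral\<^sup>L hl ?d \<le> 0" by simp
  moreover have "integral\<^sup>L hl ?d = 2 * nsq (Sst f) - 2 * (\<integral>x. Re (f x * cnj (Sst f x)) \<partial>hl)"
    unfolding nsq_def using i1 i2' by (subst Bochner_Integration.integral_diff) (auto intro!: integrable_mult_right simp del: times_complex.sel)
  moreover have "(\<integral>x. 2 * Re (f x * cnj (Sst f x)) \<partial>hl) \<le> (\<integral>x. (cmod (f x))\<^sup>2 + (cmod (Sst f x))\<^sup>2 \<partial>hl)"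
    using i1 i2' by (intro integral_mono Bochner_Integration.integrable_add integrable_mult_right Re_mult_cnj_le)
  ultimately show ?thesis unfolding nsq_def using i1 i2' by (simp del: times_complex.sel)
qed

text \<open>The sum of \<open>|Sst f x|^2\<close> and the integral of \<open>|f|^2\<close> over
  {0..x} is nondecreasing in x and tends to \<open>nsq f\<close>. Through
  \<open>Gop_sup_bound\<close> this is how the energy norm, the only quantity controlled along
  trajectories, yields pointwise bounds.\<close>

lemma Sst_sup_bound: assumes f: "exp_decay f" and x: "x \<ge> 0"
  shows "cmod (Sst f x) \<le> sqrt (nsq f)"
proof -
  have cf: "continuous_on {0..} f" by (rule exp_decay_continuous[OF f])
  define F where "F x = (cmod (Sst f x))\<^sup>2 + integral {0..x} (\<lambda>z. (cmod (f z))\<^sup>2)" for x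
  define F' where "F' x = 2 * (cmod (Sst f x))\<^sup>2 - 2 * Re (f x * cnj (Sst f x)) + (cmod (f x))\<^sup>2" for x
  have der: "(F has_vector_derivative F' x) (at x within {0..})" if "x \<ge> 0" for x
    unfolding F_def F'_def
    by (intro has_vector_derivative_add Sst_cmod_square_derivative cf that
         indefinite_integral_has_vector_derivative continuous_intros)
  have F'0: "F' x \<ge> 0" for x
    using Re_mult_cnj_le[of "f x" "Sst f x"] zero_le_power2[of "cmod (Sst f x)"] unfolding F'_def by linarith
  have mono: "F x \<le> F y" if "y \<ge> x" for y
  proof -
    have "(F' has_integral (F y - F x)) {x..y}"
      using that x by (intro fundamental_theorem_of_calculus has_vector_derivative_within_subset[OF der]) auto
    then have "0 \<le> F y - F x" by (rule has_integral_nonneg) (use F'0 in auto)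
    then show ?thesis by simp
  qed
  have "(F \<longlongrightarrow> (cmod 0)\<^sup>2 + nsq f) at_top"
    unfolding F_def nsq_def
    by (intro tendsto_intros exp_decay_tendsto_0 exp_decay_Sst f integral_hl_tendsto exp_decay_cmod_square_integrable)
  then have "F x \<le> (cmod 0)\<^sup>2 + nsq f"
    by (rule tendsto_lowerbound) (auto intro!: eventually_mono[OF eventually_ge_at_top[of x]] mono)
  moreover have "integral {0..x} (\<lambda>z. (cmod (f z))\<^sup>2) \<ge> 0"
    by (rule integral_nonneg) (auto intro!: integrable_continuous_interval continuous_intros continuous_on_subset[OF cf])
  ultimately have "(cmod (Sst f x))\<^sup>2 \<le> nsq f" unfolding F_def by simp
  then show ?thesis by (rule real_le_rsqrt)
qed

lemma Gop_sup_bound: assumes f: "exp_decay f" and x: "x \<ge> 0"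
  shows "cmod (Gop f x) \<le> sqrt (nsq f)"
  unfolding Gop_def
  using Sop_bound[OF Sst_continuous[OF exp_decay_continuous[OF f]], of 0 "sqrt (nsq f)" x]
    Sst_sup_bound[OF f] x by simp

lemma Sst_add:
  assumes "exp_decay f" "exp_decay g" "x \<ge> 0"
  shows "Sst (\<lambda>x. f x + g x) x = Sst f x + Sst g x"
proof -
  obtain B where B: "\<And>x. x \<ge> 0 \<Longrightarrow> cmod (Sst f x + Sst g x) \<le> B"
    using exp_decay_bounded[OF exp_decay_add[OF exp_decay_Sst exp_decay_Sst, OF assms(1,2)]] by blast
  show ?thesis
  proof (rule Sst_unique[where B = B])
    fix x :: real assume x: "x \<ge> 0"
    have "((\<lambda>x. Sst f x + Sst g x) has_vector_derivative ((Sst f x - f x) + (Sst g x - g x))) (at x within {0..})"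
      by (intro has_vector_derivative_add Sst_derivative exp_decay_continuous assms x)
    then show "((\<lambda>x. Sst f x + Sst g x) has_vector_derivative (Sst f x + Sst g x - (f x + g x))) (at x within {0..})"
      by (simp add: algebra_simps)
  qed (use assms B in \<open>auto intro: exp_decay_add\<close>)
qed

lemma Sst_cmult:
  assumes "exp_decay f" "x \<ge> 0"
  shows "Sst (\<lambda>x. c * f x) x = c * Sst f x"
proof -
  obtain B where B: "\<And>x. x \<ge> 0 \<Longrightarrow> cmod (c * Sst f x) \<le> B"
    using exp_decay_bounded[OF exp_decay_cmult[OF exp_decay_Sst, OF assms(1)]] by blast
  show ?thesis
  proof (rule Sst_unique[where B = B])
    fix x :: real assume x: "x \<ge> 0"
    have "((\<lambda>x. c * Sst f x) has_vector_derivative (c * (Sst f x - f x) + 0 * Sst f x)) (at x within {0..})"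
      by (intro has_vector_derivative_mult Sst_derivative exp_decay_continuous assms x) auto
    then show "((\<lambda>x. c * Sst f x) has_vector_derivative (c * Sst f x - c * f x)) (at x within {0..})"
      by (simp add: algebra_simps)
  qed (use assms B in \<open>auto intro: exp_decay_cmult\<close>)
qed

lemma Sop_cong: "(\<And>x. x \<ge> 0 \<Longrightarrow> f x = g x) \<Longrightarrow> Sop f x = Sop g x"
  unfolding Sop_def by (intro arg_cong2[where f = "(*\<^sub>R)"] refl integral_cong) auto

lemma ell_cong: "(\<And>x. x \<ge> 0 \<Longrightarrow> f x = g x) \<Longrightarrow> ell f = ell g"
  unfolding ell_def by (intro Bochner_Integration.integral_cong) auto

lemma Sst_cong: "(\<And>x. x \<ge> 0 \<Longrightarrow> f x = g x) \<Longrightarrow> Sst f x = Sst g x"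
proof -
  assume *: "\<And>x. x \<ge> 0 \<Longrightarrow> f x = g x"
  have "integral {0..x} (\<lambda>z. exp (- z) *\<^sub>R f z) = integral {0..x} (\<lambda>z. exp (- z) *\<^sub>R g z)"
    by (rule integral_cong) (use * in auto)
  then show ?thesis unfolding Sst_def using ell_cong[OF *] by simp
qed

lemma Gop_cong: "(\<And>x. x \<ge> 0 \<Longrightarrow> f x = g x) \<Longrightarrow> Gop f x = Gop g x"
  unfolding Gop_def by (intro Sop_cong Sst_cong)

lemma Sop_add:
  assumes "continuous_on {0..} f" "continuous_on {0..} g" "x \<ge> 0"
  shows "Sop (\<lambda>x. f x + g x) x = Sop f x + Sop g x"
proof (rule Sop_unique)
  fix x :: real assume x: "x \<ge> 0"
  have "((\<lambda>x. Sop f x + Sop g x) has_vector_derivative ((f x - Sop f x) + (g x - Sop g x))) (at x within {0..})"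
    by (intro has_vector_derivative_add Sop_derivative assms x)
  then show "((\<lambda>x. Sop f x + Sop g x) has_vector_derivative (f x + g x - (Sop f x + Sop g x))) (at x within {0..})"
    by (simp add: algebra_simps)
qed (use assms in \<open>auto intro: continuous_intros\<close>)

lemma Sop_cmult:
  assumes "continuous_on {0..} f" "x \<ge> 0"
  shows "Sop (\<lambda>x. c * f x) x = c * Sop f x"
proof (rule Sop_unique)
  fix x :: real assume x: "x \<ge> 0"
  have "((\<lambda>x. c * Sop f x) has_vector_derivative (c * (f x - Sop f x) + 0 * Sop f x)) (at x within {0..})"
    by (intro has_vector_derivative_mult Sop_derivative assms x) auto
  then show "((\<lambda>x. c * Sop f x) has_vector_derivative (c * f x - c * Sop f x)) (at x within {0..})"
    by (simp add: algebra_simps)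
qed (use assms in \<open>auto intro: continuous_intros\<close>)

lemma Gop_add:
  assumes "exp_decay f" "exp_decay g" "x \<ge> 0"
  shows "Gop (\<lambda>x. f x + g x) x = Gop f x + Gop g x"
proof -
  have "Gop (\<lambda>x. f x + g x) x = Sop (\<lambda>x. Sst f x + Sst g x) x"
    unfolding Gop_def by (intro Sop_cong Sst_add assms)
  also have "\<dots> = Gop f x + Gop g x"
    unfolding Gop_def by (intro Sop_add Sst_continuous exp_decay_continuous assms)
  finally show ?thesis .
qed

lemma Gop_cmult:
  assumes "exp_decay f" "x \<ge> 0"
  shows "Gop (\<lambda>x. c * f x) x = c * Gop f x"
proof -
  have "Gop (\<lambda>x. c * f x) x = Sop (\<lambda>x. c * Sst f x) x"
    unfolding Gop_def by (intro Sop_cong Sst_cmult assms)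
  also have "\<dots> = c * Gop f x"
    unfolding Gop_def by (intro Sop_cmult Sst_continuous exp_decay_continuous assms)
  finally show ?thesis .
qed

section \<open>Families of exponentially decaying functions\<close>

lemma continuous_on_quadrant_local:
  fixes f :: "real \<times> real \<Rightarrow> 'b::topological_space"
  assumes "\<And>R. R > 0 \<Longrightarrow> continuous_on ({0..R} \<times> {0..}) f"
  shows "continuous_on ({0..} \<times> {0..}) f"
  unfolding continuous_on_eq_continuous_within
proof
  fix z :: "real \<times> real" assume z: "z \<in> {0..} \<times> {0..}"
  define R where "R = fst z + 1"
  have "continuous (at z within {0..R} \<times> {0..}) f"
    using assms[of R] z unfolding continuous_on_eq_continuous_within R_def by auto
  moreover have "at z within {0..R} \<times> {0..} = at z within {0..} \<times> {0..}"
    by (rule at_within_nhd[of _ "{..<R} \<times> UNIV"]) (auto simp: R_def open_Times mem_Times_iff)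
  ultimately show "continuous (at z within {0..} \<times> {0..}) f" by simp
qed

lemma continuous_on_halfline_local:
  fixes f :: "real \<Rightarrow> 'b::topological_space"
  assumes "\<And>R. R > 0 \<Longrightarrow> continuous_on {0..R} f"
  shows "continuous_on {0..} f"
  unfolding continuous_on_eq_continuous_within
proof
  fix z :: "real" assume z: "z \<in> {0..}"
  have "continuous (at z within {0..z+1}) f"
    using assms[of "z+1"] z unfolding continuous_on_eq_continuous_within by auto
  then show "continuous (at z within {0..}) f" by (simp add: at_within_Icc_Ici)
qed

text \<open>Moving the variable limit into the integrand reduces joint continuity of indefinite
  integrals to the theorem for a fixed interval.\<close>

lemma integral_Icc_rescale:
  fixes f :: "real \<Rightarrow> 'b::banach"
  assumes f: "continuous_on {0..x} f" and x: "x \<ge> 0"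
  shows "integral {0..x} f = x *\<^sub>R integral {0..1} (\<lambda>s. f (x * s))"
proof -
  have "((\<lambda>s. integral {0..s * x} f) has_vector_derivative x *\<^sub>R f (s * x)) (at s within {0..1})"
    if "s \<in> {0..1}" for s
  proof -
    have sx: "0 \<le> s * x" "s * x \<le> x" using that x by (auto simp: mult_left_le_one_le)
    have "((\<lambda>u. integral {0..u} f) has_vector_derivative f (s * x)) (at (s * x) within (\<lambda>s. s * x) ` {0..1})"
      by (rule has_vector_derivative_within_subset[OF integral_has_vector_derivative[OF f]])
         (use sx x in \<open>auto simp: mult_left_le_one_le\<close>)
    moreover have "((\<lambda>s. s * x) has_vector_derivative x) (at s within {0..1})"
      by (auto intro!: derivative_eq_intros)
    ultimately show ?thesis
      by (intro vector_diff_chain_within[of "\<lambda>s. s * x" x s "{0..1}" "\<lambda>u. integral {0..u} f", unfolded comp_def])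
  qed
  then have "((\<lambda>s. x *\<^sub>R f (s * x)) has_integral (integral {0..1 * x} f - integral {0..0 * x} f)) {0..1}"
    by (intro fundamental_theorem_of_calculus) auto
  then have "((\<lambda>s. x *\<^sub>R f (s * x)) has_integral integral {0..x} f) {0..1}" by simp
  from integral_unique[OF this] have "x *\<^sub>R integral {0..1} (\<lambda>s. f (s * x)) = integral {0..x} f" by simp
  then show ?thesis by (simp add: mult.commute)
qed

text \<open>Jointly continuous families with exponential decay in x whose rate and constant are
  uniform for r in compact sets; both may deteriorate as r grows. The uniformity supplies the
  dominating functions for integrals over x.\<close>

definition tame :: "(real \<Rightarrow> real \<Rightarrow> complex) \<Rightarrow> bool" where
  "tame h \<longleftrightarrow> continuous_on ({0..} \<times> {0..}) (\<lambda>(r, x). h r x) \<and>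
     (\<forall>R. \<exists>a>0. \<exists>C. \<forall>r\<in>{0..R}. \<forall>x\<ge>0. cmod (h r x) \<le> C * exp (- a * x))"

lemma tameI:
  assumes "continuous_on ({0..} \<times> {0..}) (\<lambda>(r, x). h r x)"
    and "\<And>R. R > 0 \<Longrightarrow> \<exists>a>0. \<exists>C. \<forall>r\<in>{0..R}. \<forall>x\<ge>0. cmod (h r x) \<le> C * exp (- a * x)"
  shows "tame h"
  unfolding tame_def
proof (intro conjI allI assms(1))
  fix R :: real
  show "\<exists>a>0. \<exists>C. \<forall>r\<in>{0..R}. \<forall>x\<ge>0. cmod (h r x) \<le> C * exp (- a * x)"
    using assms(2)[of "max 1 R"] by fastforce
qed

lemma tameE:
  assumes "tame h"
  obtains a C where "0 < a" "a < 1" "C \<ge> 0"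
    "\<And>r x. 0 \<le> r \<Longrightarrow> r \<le> R \<Longrightarrow> x \<ge> 0 \<Longrightarrow> cmod (h r x) \<le> C * exp (- a * x)"
proof -
  obtain a C where a: "a > 0" and C: "\<And>r x. r \<in> {0..R} \<Longrightarrow> x \<ge> 0 \<Longrightarrow> cmod (h r x) \<le> C * exp (- a * x)"
    using assms unfolding tame_def by meson
  show thesis
  proof (rule that[of "min a (1/2)" "max C 0"])
    fix r x :: real assume r: "0 \<le> r" "r \<le> R" and x: "x \<ge> 0"
    have "cmod (h r x) \<le> C * exp (- a * x)" using C r x by simp
    also have "\<dots> \<le> max C 0 * exp (- a * x)" by (intro mult_right_mono) auto
    also have "\<dots> \<le> max C 0 * exp (- min a (1/2) * x)"
      using x by (intro mult_left_mono) (auto intro!: mult_right_mono)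
    finally show "cmod (h r x) \<le> max C 0 * exp (- min a (1/2) * x)" .
  qed (use a in auto)
qed

lemma tame_continuous: "tame h \<Longrightarrow> continuous_on ({0..} \<times> {0..}) (\<lambda>(r, x). h r x)"
  by (simp add: tame_def)

lemma tame_compose:
  assumes "tame h" "continuous_on S u" "continuous_on S v" "\<And>z. z \<in> S \<Longrightarrow> u z \<ge> 0" "\<And>z. z \<in> S \<Longrightarrow> v z \<ge> 0"
  shows "continuous_on S (\<lambda>z. h (u z) (v z))"
  by (rule continuous_on_compose2[OF tame_continuous[OF assms(1)], of S "\<lambda>z. (u z, v z)",
        unfolded case_prod_unfold fst_conv snd_conv])
     (use assms in \<open>auto intro!: continuous_intros\<close>)

lemma tame_exp_decay: assumes "tame h" "r \<ge> 0" shows "exp_decay (h r)"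
proof -
  obtain a C where aC: "0 < a" "\<And>s x. 0 \<le> s \<Longrightarrow> s \<le> r \<Longrightarrow> x \<ge> 0 \<Longrightarrow> cmod (h s x) \<le> C * exp (- a * x)"
    using tameE[OF assms(1), of r] by metis
  show ?thesis
    by (rule exp_decayI[of _ a C])
       (use aC assms in \<open>auto intro!: tame_compose[OF assms(1)] continuous_intros\<close>)
qed

lemma tame_const: assumes "exp_decay f" shows "tame (\<lambda>_. f)"
proof (rule tameI)
  show "continuous_on ({0..} \<times> {0..}) (\<lambda>(r::real, x). f x)"
    unfolding case_prod_unfold
    by (rule continuous_on_compose2[OF exp_decay_continuous[OF assms]]) (auto intro!: continuous_intros)
  show "\<exists>a>0. \<exists>C. \<forall>r\<in>{0..R}. \<forall>x\<ge>0. cmod (f x) \<le> C * exp (- a * x)" for R :: real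
    using assms unfolding exp_decay_def by auto
qed

lemma tame_add: assumes "tame f" "tame g" shows "tame (\<lambda>r x. f r x + g r x)"
proof (rule tameI)
  show "continuous_on ({0..} \<times> {0..}) (\<lambda>(r, x). f r x + g r x)"
    using assms[THEN tame_continuous] unfolding case_prod_unfold by (intro continuous_intros)
  fix R :: real assume "R > 0"
  obtain a C where f: "0 < a" "C \<ge> 0" "\<And>r x. 0 \<le> r \<Longrightarrow> r \<le> R \<Longrightarrow> x \<ge> 0 \<Longrightarrow> cmod (f r x) \<le> C * exp (- a * x)"
    using tameE[OF assms(1), of R] by metis
  obtain b D where g: "0 < b" "D \<ge> 0" "\<And>r x. 0 \<le> r \<Longrightarrow> r \<le> R \<Longrightarrow> x \<ge> 0 \<Longrightarrow> cmod (g r x) \<le> D * exp (- b * x)"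
    using tameE[OF assms(2), of R] by metis
  have "cmod (f r x + g r x) \<le> (C + D) * exp (- min a b * x)" if r: "r \<in> {0..R}" and x: "x \<ge> 0" for r x
  proof -
    have "cmod (f r x + g r x) \<le> C * exp (- a * x) + D * exp (- b * x)"
      using norm_triangle_ineq[of "f r x" "g r x"] f(3)[of r x] g(3)[of r x] r x by fastforce
    also have "\<dots> \<le> C * exp (- min a b * x) + D * exp (- min a b * x)"
      using x f g by (intro add_mono mult_left_mono) (auto intro!: mult_right_mono)
    finally show ?thesis by (simp add: distrib_right)
  qed
  moreover have "min a b > 0" using f g by simp
  ultimately show "\<exists>a>0. \<exists>C. \<forall>r\<in>{0..R}. \<forall>x\<ge>0. cmod (f r x + g r x) \<le> C * exp (- a * x)"
    by blast
qed

lemma continuous_on_Icc_bounded: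
  fixes c :: "real \<Rightarrow> complex"
  assumes "continuous_on {0..} c"
  obtains B where "B \<ge> 0" "\<And>r. 0 \<le> r \<Longrightarrow> r \<le> R \<Longrightarrow> cmod (c r) \<le> B"
proof -
  have "compact (c ` {0..R})"
    by (intro compact_continuous_image continuous_on_subset[OF assms]) auto
  then obtain B where "\<And>r. r \<in> {0..R} \<Longrightarrow> cmod (c r) \<le> B"
    using compact_imp_bounded bounded_iff by (metis imageI)
  then show thesis using that[of "max B 0"] by force
qed

lemma tame_cmult: assumes "tame f" "continuous_on {0..} c" shows "tame (\<lambda>r x. c r * f r x)"
proof (rule tameI)
  have "continuous_on ({0..} \<times> {0..}) (\<lambda>z::real\<times>real. c (fst z))"
    by (rule continuous_on_compose2[OF assms(2)]) (auto intro!: continuous_intros)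
  then show "continuous_on ({0..} \<times> {0..}) (\<lambda>(r, x). c r * f r x)"
    using assms(1)[THEN tame_continuous] unfolding case_prod_unfold by (intro continuous_intros)
  fix R :: real assume "R > 0"
  obtain a C where f: "0 < a" "C \<ge> 0" "\<And>r x. 0 \<le> r \<Longrightarrow> r \<le> R \<Longrightarrow> x \<ge> 0 \<Longrightarrow> cmod (f r x) \<le> C * exp (- a * x)"
    using tameE[OF assms(1), of R] by metis
  obtain B where B: "B \<ge> 0" "\<And>r. 0 \<le> r \<Longrightarrow> r \<le> R \<Longrightarrow> cmod (c r) \<le> B"
    using continuous_on_Icc_bounded[OF assms(2)] by metis
  have "cmod (c r * f r x) \<le> (B * C) * exp (- a * x)" if "r \<in> {0..R}" "x \<ge> 0" for r x
    unfolding norm_mult mult.assoc using that B f by (intro mult_mono) auto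
  then show "\<exists>a>0. \<exists>C. \<forall>r\<in>{0..R}. \<forall>x\<ge>0. cmod (c r * f r x) \<le> C * exp (- a * x)"
    using f(1) by blast
qed

lemma tame_scale: "tame f \<Longrightarrow> tame (\<lambda>r x. c * f r x)"
  by (rule tame_cmult) auto

lemma tame_uminus: "tame f \<Longrightarrow> tame (\<lambda>r x. - f r x)"
  using tame_scale[of f "-1"] by simp

lemma tame_diff: "tame f \<Longrightarrow> tame g \<Longrightarrow> tame (\<lambda>r x. f r x - g r x)"
  using tame_add[of f "\<lambda>r x. - g r x"] tame_uminus by simp

lemma tame_cnj: "tame f \<Longrightarrow> tame (\<lambda>r x. cnj (f r x))"
  unfolding tame_def case_prod_unfold by (auto intro!: continuous_intros)

lemma tame_mult: assumes "tame f" "tame g" shows "tame (\<lambda>r x. f r x * g r x)"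
proof (rule tameI)
  show "continuous_on ({0..} \<times> {0..}) (\<lambda>(r, x). f r x * g r x)"
    using assms[THEN tame_continuous] unfolding case_prod_unfold by (intro continuous_intros)
  fix R :: real assume "R > 0"
  obtain a C where f: "0 < a" "C \<ge> 0" "\<And>r x. 0 \<le> r \<Longrightarrow> r \<le> R \<Longrightarrow> x \<ge> 0 \<Longrightarrow> cmod (f r x) \<le> C * exp (- a * x)"
    using tameE[OF assms(1), of R] by metis
  obtain b D where g: "0 < b" "D \<ge> 0" "\<And>r x. 0 \<le> r \<Longrightarrow> r \<le> R \<Longrightarrow> x \<ge> 0 \<Longrightarrow> cmod (g r x) \<le> D * exp (- b * x)"
    using tameE[OF assms(2), of R] by metis
  have "cmod (f r x * g r x) \<le> (D * C) * exp (- a * x)" if r: "r \<in> {0..R}" and x: "x \<ge> 0" for r x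
  proof -
    have "cmod (f r x * g r x) = cmod (g r x) * cmod (f r x)" by (simp add: norm_mult)
    also have "\<dots> \<le> (D * 1) * (C * exp (- a * x))"
      using f(3)[of r x] r x f(2) g order_trans[OF g(3)[of r x] mult_left_mono[of "exp (- b * x)" 1 D]]
      by (intro mult_mono) auto
    finally show ?thesis by simp
  qed
  then show "\<exists>a>0. \<exists>C. \<forall>r\<in>{0..R}. \<forall>x\<ge>0. cmod (f r x * g r x) \<le> C * exp (- a * x)"
    using f(1) by blast
qed

lemma tame_times_id: assumes "tame f" shows "tame (\<lambda>r x. of_real x * f r x)"
proof (rule tameI)
  show "continuous_on ({0..} \<times> {0..}) (\<lambda>(r, x). of_real x * f r x)"
    using assms[THEN tame_continuous] unfolding case_prod_unfold by (intro continuous_intros)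
  fix R :: real assume "R > 0"
  obtain a C where f: "0 < a" "C \<ge> 0" "\<And>r x. 0 \<le> r \<Longrightarrow> r \<le> R \<Longrightarrow> x \<ge> 0 \<Longrightarrow> cmod (f r x) \<le> C * exp (- a * x)"
    using tameE[OF assms(1), of R] by metis
  have "cmod (of_real x * f r x) \<le> (2 / a * C) * exp (- (a / 2) * x)" if r: "r \<in> {0..R}" and x: "x \<ge> 0" for r x
  proof -
    have "cmod (of_real x * f r x) = x * cmod (f r x)" using x by (simp add: norm_mult)
    also have "\<dots> \<le> (exp (a/2 * x) / (a/2)) * (C * exp (- a * x))"
      using x f linear_le_exp[of "a/2" x] r by (intro mult_mono) auto
    also have "\<dots> = 2 / a * C * (exp (a/2 * x) * exp (- a * x))" by simp
    also have "exp (a/2 * x) * exp (- a * x) = exp (- (a/2) * x)"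
      by (simp add: exp_add[symmetric] field_simps)
    finally show ?thesis .
  qed
  moreover have "a / 2 > 0" using f by simp
  ultimately show "\<exists>a>0. \<exists>C. \<forall>r\<in>{0..R}. \<forall>x\<ge>0. cmod (of_real x * f r x) \<le> C * exp (- a * x)"
    by blast
qed

lemma tame_integral_continuous:
  assumes "tame f" shows "continuous_on {0..} (\<lambda>r. \<integral>x. f r x \<partial>hl)"
proof (rule continuous_on_halfline_local)
  fix R :: real assume "R > 0"
  obtain a C where f: "0 < a" "C \<ge> 0" "\<And>r x. 0 \<le> r \<Longrightarrow> r \<le> R \<Longrightarrow> x \<ge> 0 \<Longrightarrow> cmod (f r x) \<le> C * exp (- a * x)"
    using tameE[OF assms(1), of R] by metis
  show "continuous_on {0..R} (\<lambda>r. \<integral>x. f r x \<partial>hl)"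
  proof (rule continuous_on_integral_dominated[where b = "\<lambda>x. C * exp (- a * x)"])
    show "f r \<in> borel_measurable hl" if "r \<in> {0..R}" for r
      using that by (intro exp_decay_measurable tame_exp_decay[OF assms]) auto
    show "continuous_on {0..R} (\<lambda>r. f r x)" if "x \<in> space hl" for x
      using that by (intro tame_compose[OF assms] continuous_intros) auto
    show "integrable hl (\<lambda>x. C * exp (- a * x))"
      using integrable_mult_right[OF integrable_hl_exp[OF f(1)], of C] by simp
  qed (use f in auto)
qed

lemma exp_weight_tame: assumes "tame f" shows "tame (\<lambda>r x. exp (- x) *\<^sub>R f r x)"
proof -
  have "exp_decay (\<lambda>x. complex_of_real (exp (- x)))"
    by (rule exp_decayI[of _ 1 1]) (auto intro!: continuous_intros)
  from tame_mult[OF tame_const[OF this] assms] show ?thesis by (simp add: scaleR_conv_of_real)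
qed

lemma tame_ell_continuous: "tame f \<Longrightarrow> continuous_on {0..} (\<lambda>r. ell (f r))"
  unfolding ell_def by (intro tame_integral_continuous exp_weight_tame)

lemma continuous_on_parametric_Icc:
  fixes f :: "'a::topological_space \<Rightarrow> real \<Rightarrow> real \<Rightarrow> 'b::banach"
  assumes f: "continuous_on (U \<times> {0..1}) (\<lambda>(z, s). f z (u z) (u z * s))"
    and u: "continuous_on U u" "\<And>z. z \<in> U \<Longrightarrow> u z \<ge> 0"
    and c: "\<And>z. z \<in> U \<Longrightarrow> continuous_on {0..u z} (f z (u z))"
  shows "continuous_on U (\<lambda>z. integral {0..u z} (f z (u z)))"
proof -
  have "continuous_on U (\<lambda>z. u z *\<^sub>R integral (cbox 0 1) (\<lambda>s. f z (u z) (u z * s)))"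
    using f u(1) by (intro continuous_intros integral_continuous_on_param) (simp_all add: cbox_interval)
  then show ?thesis
    by (rule continuous_on_eq) (use integral_Icc_rescale[OF c] u(2) in auto)
qed

lemma tame_indefinite_integral_continuous:
  assumes f: "tame f" and c: "continuous_on {0..} (c::real \<Rightarrow> real)"
  shows "continuous_on ({0..} \<times> {0..}) (\<lambda>z. integral {0..snd z} (\<lambda>y. c y *\<^sub>R f (fst z) y))"
proof (rule continuous_on_parametric_Icc[where f = "\<lambda>z u y. c y *\<^sub>R f (fst z) y"])
  have "continuous_on (({0..} \<times> {0..}) \<times> {0..1}) (\<lambda>z::(real\<times>real)\<times>real. c (snd (fst z) * snd z))"
    by (rule continuous_on_compose2[OF c]) (auto intro!: continuous_intros)
  then show "continuous_on (({0..} \<times> {0..}) \<times> {0..1})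
     (\<lambda>(z, s). c (snd z * s) *\<^sub>R f (fst z) (snd z * s))"
    unfolding case_prod_unfold
    by (intro continuous_intros tame_compose[OF f]) (auto intro!: continuous_intros)
  show "continuous_on {0..snd z} (\<lambda>y. c y *\<^sub>R f (fst z) y)" if "z \<in> {0..} \<times> {0..}" for z
    using that by (intro continuous_intros tame_compose[OF f] continuous_on_subset[OF c]) auto
qed (auto intro!: continuous_intros)

lemma tame_Sst: assumes f: "tame f" shows "tame (\<lambda>r. Sst (f r))"
proof (rule tameI)
  have "continuous_on ({0..} \<times> {0..}) (\<lambda>z::real\<times>real. ell (f (fst z)))"
    by (rule continuous_on_compose2[OF tame_ell_continuous[OF f]]) (auto intro!: continuous_intros)
  moreover have "continuous_on ({0..} \<times> {0..}) (\<lambda>z. integral {0..snd z} (\<lambda>y. exp (- y) *\<^sub>R f (fst z) y))"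
    by (rule tame_indefinite_integral_continuous[OF f]) (auto intro!: continuous_intros)
  ultimately show "continuous_on ({0..} \<times> {0..}) (\<lambda>(r, x). Sst (f r) x)"
    unfolding Sst_def case_prod_unfold by (intro continuous_intros)
  fix R :: real
  obtain a C where aC: "0 < a" "a < 1" "C \<ge> 0" "\<And>r x. 0 \<le> r \<Longrightarrow> r \<le> R \<Longrightarrow> x \<ge> 0 \<Longrightarrow> cmod (f r x) \<le> C * exp (- a * x)"
    using tameE[OF f, of R] by metis
  have "cmod (Sst (f r) x) \<le> C * exp (- a * x)" if "r \<in> {0..R}" "x \<ge> 0" for r x
    using that aC by (intro Sst_bound tame_exp_decay[OF f]) auto
  then show "\<exists>a>0. \<exists>C. \<forall>r\<in>{0..R}. \<forall>x\<ge>0. cmod (Sst (f r) x) \<le> C * exp (- a * x)"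
    using aC(1) by blast
qed

lemma tame_Sop: assumes f: "tame f" shows "tame (\<lambda>r. Sop (f r))"
proof (rule tameI)
  have "continuous_on ({0..} \<times> {0..}) (\<lambda>z. integral {0..snd z} (\<lambda>y. exp y *\<^sub>R f (fst z) y))"
    by (rule tame_indefinite_integral_continuous[OF f]) (auto intro!: continuous_intros)
  then show "continuous_on ({0..} \<times> {0..}) (\<lambda>(r, x). Sop (f r) x)"
    unfolding Sop_def case_prod_unfold by (intro continuous_intros)
  fix R :: real
  obtain a C where aC: "0 < a" "a < 1" "C \<ge> 0" "\<And>r x. 0 \<le> r \<Longrightarrow> r \<le> R \<Longrightarrow> x \<ge> 0 \<Longrightarrow> cmod (f r x) \<le> C * exp (- a * x)"
    using tameE[OF f, of R] by metis
  have "cmod (Sop (f r) x) \<le> C / (1 - a) * exp (- a * x)" if "r \<in> {0..R}" "x \<ge> 0" for r x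
    using that aC by (intro Sop_bound exp_decay_continuous tame_exp_decay[OF f]) auto
  then show "\<exists>a>0. \<exists>C. \<forall>r\<in>{0..R}. \<forall>x\<ge>0. cmod (Sop (f r) x) \<le> C * exp (- a * x)"
    using aC(1) by blast
qed

lemma tame_Gop: "tame f \<Longrightarrow> tame (\<lambda>r. Gop (f r))"
  unfolding Gop_def by (intro tame_Sop tame_Sst)

section \<open>Derivatives of tame families in the parameter r and in the variable x\<close>

definition tder :: "(real \<Rightarrow> real \<Rightarrow> complex) \<Rightarrow> (real \<Rightarrow> real \<Rightarrow> complex) \<Rightarrow> bool" where
  "tder h h' \<longleftrightarrow> tame h \<and> tame h' \<and>
     (\<forall>r\<ge>0. \<forall>x\<ge>0. ((\<lambda>r. h r x) has_vector_derivative h' r x) (at r within {0..}))"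

definition xder :: "(real \<Rightarrow> real \<Rightarrow> complex) \<Rightarrow> (real \<Rightarrow> real \<Rightarrow> complex) \<Rightarrow> bool" where
  "xder h h' \<longleftrightarrow> tame h \<and> tame h' \<and>
     (\<forall>r\<ge>0. \<forall>x\<ge>0. (h r has_vector_derivative h' r x) (at x within {0..}))"

lemma tder_integral:
  assumes "tder h h'" "r \<ge> 0"
  shows "((\<lambda>r. \<integral>x. h r x \<partial>hl) has_vector_derivative (\<integral>x. h' r x \<partial>hl)) (at r within {0..})"
proof -
  have h: "tame h" "tame h'" using assms by (auto simp: tder_def)
  obtain a C where aC: "0 < a" "\<And>s x. 0 \<le> s \<Longrightarrow> s \<le> r + 1 \<Longrightarrow> x \<ge> 0 \<Longrightarrow> cmod (h' s x) \<le> C * exp (- a * x)"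
    using tameE[OF h(2), of "r + 1"] by metis
  have "((\<lambda>r. \<integral>x. h r x \<partial>hl) has_vector_derivative (\<integral>x. h' r x \<partial>hl)) (at r within {0..r+1})"
  proof (rule has_vector_derivative_integral_dominated[where b = "\<lambda>x. C * exp (- a * x)"])
    show "integrable hl (h s)" if "s \<in> {0..r+1}" for s
      using that by (intro exp_decay_integrable tame_exp_decay h) auto
    show "((\<lambda>s. h s x) has_vector_derivative h' s x) (at s within {0..r+1})"
      if "s \<in> {0..r+1}" "x \<in> space hl" for s x
      by (rule has_vector_derivative_within_subset[of _ _ _ "{0..}"])
         (use assms that in \<open>auto simp: tder_def\<close>)
    show "integrable hl (\<lambda>x. C * exp (- a * x))"
      using integrable_mult_right[OF integrable_hl_exp[OF aC(1)], of C] by simp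
    show "h' r \<in> borel_measurable hl" by (intro exp_decay_measurable tame_exp_decay h assms)
  qed (use aC assms in auto)
  then show ?thesis by (simp add: at_within_Icc_Ici)
qed

lemma tder_add: "tder f f' \<Longrightarrow> tder g g' \<Longrightarrow> tder (\<lambda>r x. f r x + g r x) (\<lambda>r x. f' r x + g' r x)"
  unfolding tder_def by (auto intro!: tame_add has_vector_derivative_add)

lemma tder_mult: "tder f f' \<Longrightarrow> tder g g' \<Longrightarrow>
   tder (\<lambda>r x. f r x * g r x) (\<lambda>r x. f r x * g' r x + f' r x * g r x)"
  unfolding tder_def by (auto intro!: tame_add tame_mult has_vector_derivative_mult)

lemma tder_cnj: "tder f f' \<Longrightarrow> tder (\<lambda>r x. cnj (f r x)) (\<lambda>r x. cnj (f' r x))"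
  unfolding tder_def by (auto intro!: tame_cnj has_vector_derivative_cnj)

lemma tder_cmult:
  assumes "tder f f'" "\<And>r. r \<ge> 0 \<Longrightarrow> (c has_vector_derivative c' r) (at r within {0..})" "continuous_on {0..} c'"
  shows "tder (\<lambda>r x. c r * f r x) (\<lambda>r x. c r * f' r x + c' r * f r x)"
  using assms has_vector_derivative_continuous_on_halfline[OF assms(2)]
  unfolding tder_def by (auto intro!: tame_add tame_cmult has_vector_derivative_mult)

lemma tder_scale: "tder f f' \<Longrightarrow> tder (\<lambda>r x. c * f r x) (\<lambda>r x. c * f' r x)"
  unfolding tder_def by (auto intro!: tame_scale has_vector_derivative_mult_right)

lemma tder_times_id: "tder f f' \<Longrightarrow> tder (\<lambda>r x. of_real x * f r x) (\<lambda>r x. of_real x * f' r x)"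
  unfolding tder_def by (auto intro!: tame_times_id has_vector_derivative_mult_right)

lemma tder_const: "exp_decay f \<Longrightarrow> tder (\<lambda>_. f) (\<lambda>_ _. 0)"
  using tame_const[of f] tame_scale[of "\<lambda>_. f" 0] unfolding tder_def by auto

lemma tder_exp_weight: "tder f f' \<Longrightarrow> tder (\<lambda>r x. exp (- x) *\<^sub>R f r x) (\<lambda>r x. exp (- x) *\<^sub>R f' r x)"
  unfolding tder_def
  by (auto intro!: exp_weight_tame bounded_linear.has_vector_derivative[OF bounded_linear_scaleR_right])

lemma tder_ell:
  assumes "tder f f'" "r \<ge> 0"
  shows "((\<lambda>r. ell (f r)) has_vector_derivative ell (f' r)) (at r within {0..})"
  unfolding ell_def by (rule tder_integral[OF tder_exp_weight[OF assms(1)] assms(2)])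

lemma tder_indefinite_integral:
  assumes f: "tder f f'" and r: "r \<ge> 0" and c: "continuous_on {0..} (c::real \<Rightarrow> real)"
  shows "((\<lambda>r. integral {0..x} (\<lambda>y. c y *\<^sub>R f r y)) has_vector_derivative
    integral {0..x} (\<lambda>y. c y *\<^sub>R f' r y)) (at r within {0..})"
proof -
  have t: "tame f" "tame f'" using f by (auto simp: tder_def)
  have "continuous_on ({0..} \<times> cbox 0 x) (\<lambda>z::real\<times>real. c (snd z))"
    by (rule continuous_on_compose2[OF c]) (auto intro!: continuous_intros simp: cbox_interval)
  then have *: "continuous_on ({0..} \<times> cbox 0 x) (\<lambda>(r, y). c y *\<^sub>R f' r y)"
    unfolding case_prod_unfold
    by (intro continuous_intros tame_compose[OF t(2)]) (auto intro!: continuous_intros simp: cbox_interval)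
  have "((\<lambda>r. integral (cbox 0 x) (\<lambda>y. c y *\<^sub>R f r y)) has_vector_derivative
    integral (cbox 0 x) (\<lambda>y. c y *\<^sub>R f' r y)) (at r within {0..})"
  proof (rule leibniz_rule_vector_derivative[OF _ _ *])
    show "((\<lambda>r. c y *\<^sub>R f r y) has_vector_derivative c y *\<^sub>R f' r y) (at r within {0..})"
      if "r \<in> {0..}" "y \<in> cbox 0 x" for r y
      using f that by (intro bounded_linear.has_vector_derivative[OF bounded_linear_scaleR_right]) (auto simp: tder_def cbox_interval)
    show "(\<lambda>y. c y *\<^sub>R f r y) integrable_on cbox 0 x" if "r \<in> {0..}" for r
      unfolding cbox_interval using that
      by (intro integrable_continuous_interval continuous_intros tame_compose[OF t(1)] continuous_on_subset[OF c]) auto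
  qed (use r in auto)
  then show ?thesis by (simp add: cbox_interval)
qed

lemma tder_Sst: assumes "tder f f'" shows "tder (\<lambda>r. Sst (f r)) (\<lambda>r. Sst (f' r))"
  unfolding tder_def
proof (intro conjI allI impI)
  show "tame (\<lambda>r. Sst (f r))" "tame (\<lambda>r. Sst (f' r))" using assms by (auto simp: tder_def intro: tame_Sst)
  fix r x :: real assume "r \<ge> 0" "x \<ge> 0"
  then show "((\<lambda>r. Sst (f r) x) has_vector_derivative Sst (f' r) x) (at r within {0..})"
    unfolding Sst_def
    by (intro bounded_linear.has_vector_derivative[OF bounded_linear_scaleR_right]
        has_vector_derivative_diff tder_ell[OF assms] tder_indefinite_integral[OF assms])
       (auto intro!: continuous_intros)
qed

lemma tder_Sop: assumes "tder f f'" shows "tder (\<lambda>r. Sop (f r)) (\<lambda>r. Sop (f' r))"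
  unfolding tder_def
proof (intro conjI allI impI)
  show "tame (\<lambda>r. Sop (f r))" "tame (\<lambda>r. Sop (f' r))" using assms by (auto simp: tder_def intro: tame_Sop)
  fix r x :: real assume "r \<ge> 0" "x \<ge> 0"
  then show "((\<lambda>r. Sop (f r) x) has_vector_derivative Sop (f' r) x) (at r within {0..})"
    unfolding Sop_def
    by (intro bounded_linear.has_vector_derivative[OF bounded_linear_scaleR_right]
        tder_indefinite_integral[OF assms])
       (auto intro!: continuous_intros)
qed

lemma tder_Gop: "tder f f' \<Longrightarrow> tder (\<lambda>r. Gop (f r)) (\<lambda>r. Gop (f' r))"
  unfolding Gop_def by (intro tder_Sop tder_Sst)

lemma tame_cong:
  assumes "tame f" "\<And>r x. r \<ge> 0 \<Longrightarrow> x \<ge> 0 \<Longrightarrow> f r x = g r x" shows "tame g"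
proof -
  have "continuous_on ({0..} \<times> {0..}) (\<lambda>(r, x). g r x)"
    by (rule continuous_on_eq[OF tame_continuous[OF assms(1)]]) (use assms(2) in auto)
  then show ?thesis using assms unfolding tame_def by (fastforce simp: Ball_def)
qed

lemma tder_eqI:
  assumes "tder f f'" "\<And>r x. r \<ge> 0 \<Longrightarrow> x \<ge> 0 \<Longrightarrow> f' r x = f'' r x" shows "tder f f''"
  using assms tame_cong[of f' f''] unfolding tder_def by auto

lemma xder_add: "xder f f' \<Longrightarrow> xder g g' \<Longrightarrow> xder (\<lambda>r x. f r x + g r x) (\<lambda>r x. f' r x + g' r x)"
  unfolding xder_def by (auto intro!: tame_add has_vector_derivative_add)

lemma xder_cmult:
  assumes "xder f f'" "continuous_on {0..} c"
  shows "xder (\<lambda>r x. c r * f r x) (\<lambda>r x. c r * f' r x)"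
  using assms unfolding xder_def by (auto intro!: tame_cmult has_vector_derivative_mult_right)

section \<open>The transport equation with the Lax operator\<close>

text \<open>The lines on which x + r is constant are the characteristics of h_r = h_x. Only partial
  derivatives are given; joint continuity of the x-derivative makes the function totally
  differentiable.\<close>

lemma total_derivative_antidiagonal:
  assumes x: "xder h hx" and t: "tder h ht" and s: "s \<in> {0..R}"
  shows "((\<lambda>s. h s (R - s)) has_vector_derivative (ht s (R - s) - hx s (R - s))) (at s within {0..R})"
proof -
  let ?fy = "\<lambda>r x. blinfun_scaleR_left (hx r x) :: real \<Rightarrow>\<^sub>L complex"
  have D: "((\<lambda>(r, x). h r x) has_derivative (\<lambda>(tr, tx). tr *\<^sub>R ht s (R - s) + ?fy s (R - s) tx))
      (at (s, R - s) within {0..} \<times> {0..})"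
  proof (rule has_derivative_partialsI)
    show "((\<lambda>x. h x (R - s)) has_derivative (\<lambda>u. u *\<^sub>R ht s (R - s))) (at s within {0..})"
      using t s unfolding tder_def has_vector_derivative_def by simp
    show "(h r has_derivative blinfun_apply (?fy r y)) (at y within {0..})" if "r \<in> {0..}" "y \<in> {0..}" for r y
      using x that unfolding xder_def has_vector_derivative_def by simp
    have "continuous_on ({0..} \<times> {0..}) (\<lambda>(r, x). hx r x)"
      using x unfolding xder_def by (intro tame_continuous) simp
    then have "continuous_on ({0..} \<times> {0..}) (\<lambda>(r, x). ?fy r x)"
      unfolding case_prod_unfold
      by (rule bounded_linear.continuous_on[OF bounded_linear_blinfun_scaleR_left])
    then show "continuous (at (s, R - s) within {0..} \<times> {0..}) (\<lambda>(r, x). ?fy r x)"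
      using s unfolding continuous_on_eq_continuous_within by auto
  qed (use s in auto)
  have lin: "((\<lambda>s. (s, R - s)) has_derivative (\<lambda>u. (u, - u))) (at s within {0..R})"
    by (auto intro!: derivative_eq_intros)
  have "((\<lambda>(r, x). h r x) has_derivative (\<lambda>(tr, tx). tr *\<^sub>R ht s (R - s) + ?fy s (R - s) tx))
      (at (s, R - s) within (\<lambda>s. (s, R - s)) ` {0..R})"
    by (rule has_derivative_subset[OF D]) auto
  from has_derivative_in_compose[OF lin this] show ?thesis
    unfolding has_vector_derivative_def by (simp add: algebra_simps scaleR_diff_right)
qed

lemma has_vector_derivative_cis:
  assumes "(\<theta> has_real_derivative d) (at r within S)"
  shows "((\<lambda>r. exp (\<i> * of_real (\<theta> r))) has_vector_derivative (\<i> * of_real d * exp (\<i> * of_real (\<theta> r)))) (at r within S)"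
proof -
  have "((\<lambda>r. \<i> * of_real (\<theta> r)) has_vector_derivative (\<i> * of_real d)) (at r within S)"
    by (intro has_vector_derivative_mult_right has_vector_derivative_of_real assms)
  from field_vector_diff_chain_within[OF this, of exp "exp (\<i> * of_real (\<theta> r))"]
  show ?thesis by (simp add: comp_def DERIV_subset[OF DERIV_exp])
qed

definition ee :: "real \<Rightarrow> complex" where "ee x = of_real (exp (- x))"

lemma exp_decay_ee: "exp_decay ee"
  unfolding ee_def by (rule exp_decayI[of _ 1 1]) (auto intro!: continuous_intros)

lemma ee_0 [simp]: "ee 0 = 1" by (simp add: ee_def)

lemma ell_ip: "ell f = ip f ee"
  unfolding ell_def ip_def ee_def by (simp add: scaleR_conv_of_real mult.commute)

lemma nsq_ee: "nsq ee = 1 / 2"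
proof -
  let ?f = "\<lambda>x. complex_of_real (- exp (- 2 * x) / 2)"
  let ?f' = "\<lambda>x. ee x * cnj (ee x)"
  have "integral\<^sup>L hl ?f' = - ?f 0"
  proof (rule integral_hl_derivative)
    show "exp_decay ?f" by (rule exp_decayI[of _ 2 "1/2"]) (auto intro!: continuous_intros)
    show "exp_decay ?f'" by (intro exp_decay_mult exp_decay_cnj exp_decay_ee)
    have "((\<lambda>x. - exp (- 2 * x) / 2) has_vector_derivative exp (- 2 * x)) (at x within {0..})" for x :: real
      unfolding has_real_derivative_iff_has_vector_derivative[symmetric] by (auto intro!: derivative_eq_intros)
    from has_vector_derivative_of_real[OF this[folded has_real_derivative_iff_has_vector_derivative], where 'a = complex]
    show "(?f has_vector_derivative ?f' x) (at x within {0..})" for x :: real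
      by (simp add: ee_def exp_add[symmetric] flip: of_real_mult)
  qed
  then show ?thesis using ip_self[of ee] unfolding ip_def by (simp add: complex_eq_iff)
qed

lemma nsq_cong: "(\<And>x. x \<ge> 0 \<Longrightarrow> f x = g x) \<Longrightarrow> nsq f = nsq g"
  unfolding nsq_def by (intro Bochner_Integration.integral_cong) auto

lemma ip_cong: "(\<And>x. x \<ge> 0 \<Longrightarrow> f x = f' x) \<Longrightarrow> (\<And>x. x \<ge> 0 \<Longrightarrow> g x = g' x) \<Longrightarrow> ip f g = ip f' g'"
  unfolding ip_def by (intro Bochner_Integration.integral_cong) auto

lemma ell_le: assumes "exp_decay f" shows "cmod (ell f) \<le> sqrt (nsq f)"
proof -
  have "cmod (ell f) \<le> sqrt (nsq f) * sqrt (1 / 2)"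
    using ip_le[OF assms exp_decay_ee] by (simp add: ell_ip nsq_ee)
  also have "\<dots> \<le> sqrt (nsq f) * 1" by (intro mult_left_mono) (auto simp: real_sqrt_le_1_iff)
  finally show ?thesis by simp
qed

section \<open>The Lax operator and classical solutions of the transport equation with
  sources\<close>

locale ccm =
  fixes \<kappa> :: real
  assumes kappa_pos: "\<kappa> > 0"
begin

text \<open>
  \<open>Lop\<close> is the Fourier-side Lax operator \<open>f \<mapsto> -i f' - u\<^sub>0 \<Pi>\<^sup>+(cnj u\<^sub>0 f)\<close> of \<open>u\<^sub>0(x) = \<surd>(2\<kappa>) / (1 - i x)\<close>, whose
  Fourier transform is a multiple of \<open>ee\<close>.
\<close>

definition Lop :: "(real \<Rightarrow> complex) \<Rightarrow> real \<Rightarrow> complex" where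
  "Lop f x = of_real x * f x - of_real (2 * \<kappa>) * Gop f x"

lemma Lop_0 [simp]: "Lop f 0 = 0" by (simp add: Lop_def)

lemma Lop_cong: "(\<And>x. x \<ge> 0 \<Longrightarrow> f x = g x) \<Longrightarrow> x \<ge> 0 \<Longrightarrow> Lop f x = Lop g x"
  using Gop_cong[of f g] unfolding Lop_def by auto

lemma exp_decay_Lop: "exp_decay f \<Longrightarrow> exp_decay (Lop f)"
  unfolding Lop_def by (intro exp_decay_diff exp_decay_times_id exp_decay_cmult exp_decay_Gop)

lemma tame_Lop: "tame h \<Longrightarrow> tame (\<lambda>r. Lop (h r))"
  unfolding Lop_def by (intro tame_diff tame_times_id tame_scale tame_Gop)

lemma Lop_add: "exp_decay f \<Longrightarrow> exp_decay g \<Longrightarrow> x \<ge> 0 \<Longrightarrow> Lop (\<lambda>x. f x + g x) x = Lop f x + Lop g x"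
  unfolding Lop_def by (simp add: Gop_add algebra_simps)

lemma Lop_cmult: "exp_decay f \<Longrightarrow> x \<ge> 0 \<Longrightarrow> Lop (\<lambda>x. c * f x) x = c * Lop f x"
  unfolding Lop_def by (simp add: Gop_cmult algebra_simps)

lemma tder_Lop:
  assumes "tder h h'" shows "tder (\<lambda>r. Lop (h r)) (\<lambda>r. Lop (h' r))"
proof -
  have "tder (\<lambda>r x. of_real x * h r x + (- of_real (2 * \<kappa>)) * Gop (h r) x)
     (\<lambda>r x. of_real x * h' r x + (- of_real (2 * \<kappa>)) * Gop (h' r) x)"
    by (intro tder_add tder_scale tder_times_id tder_Gop assms)
  then show ?thesis unfolding Lop_def by simp
qed

lemma ip_Lop_sym: assumes "exp_decay f" "exp_decay g" shows "ip (Lop f) g = ip f (Lop g)"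
proof -
  note e = exp_decay_times_id exp_decay_Gop exp_decay_cmult assms
  have "ip (Lop f) g = ip (\<lambda>x. of_real x * f x) g - ip (\<lambda>x. of_real (2 * \<kappa>) * Gop f x) g"
    unfolding Lop_def by (intro ip_diff_left e)
  also have "\<dots> = ip f (\<lambda>x. of_real x * g x) + ip f (\<lambda>x. (- of_real (2 * \<kappa>)) * Gop g x)"
    unfolding ip_cmult_left ip_cmult_right ip_Gop_sym[OF assms]
    by (simp add: ip_def mult.assoc mult.left_commute)
  also have "\<dots> = ip f (\<lambda>x. of_real x * g x + (- of_real (2 * \<kappa>)) * Gop g x)"
    by (intro ip_add_right[symmetric] e)
  finally show ?thesis unfolding Lop_def by simp
qed

text \<open>
  \<open>sol t h hx s\<close>: \<open>h\<close> is a classical solution of \<open>h\<^sub>r = h\<^sub>x - 2it Lop h + s\<close>, i.e. of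
  \<open>h\<^sub>r = -i (A + 2t L) h + s\<close> with \<open>A = i d/dx\<close> on the half-line; the flow of \<open>A + 2t L\<close> is the
  one occurring in the explicit formula for the equation.
\<close>

definition sol :: "real \<Rightarrow> (real \<Rightarrow> real \<Rightarrow> complex) \<Rightarrow> (real \<Rightarrow> real \<Rightarrow> complex) \<Rightarrow> (real \<Rightarrow> real \<Rightarrow> complex) \<Rightarrow> bool" where
  "sol t h hx s \<longleftrightarrow> xder h hx \<and> tame s \<and> tder h (\<lambda>r x. hx r x - 2 * \<i> * of_real t * Lop (h r) x + s r x)"

lemma sol_tame: "sol t h hx s \<Longrightarrow> tame h" "sol t h hx s \<Longrightarrow> tame hx" "sol t h hx s \<Longrightarrow> tame s"
  by (auto simp: sol_def xder_def)

lemma sol_cong: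
  assumes "sol t h hx s" "\<And>r x. r \<ge> 0 \<Longrightarrow> x \<ge> 0 \<Longrightarrow> s r x = s' r x"
  shows "sol t h hx s'"
  using assms tame_cong[of s s'] tder_eqI[of h _ "\<lambda>r x. hx r x - 2 * \<i> * of_real t * Lop (h r) x + s' r x"]
  unfolding sol_def by auto

lemma sol_add:
  assumes "sol t h hx s" "sol t k kx r"
  shows "sol t (\<lambda>a x. h a x + k a x) (\<lambda>a x. hx a x + kx a x) (\<lambda>a x. s a x + r a x)"
  unfolding sol_def
proof (intro conjI)
  show "xder (\<lambda>a x. h a x + k a x) (\<lambda>a x. hx a x + kx a x)" "tame (\<lambda>a x. s a x + r a x)"
    using assms by (auto simp: sol_def intro: xder_add tame_add)
  have "tder (\<lambda>a x. h a x + k a x) (\<lambda>a x. (hx a x - 2 * \<i> * of_real t * Lop (h a) x + s a x) +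
      (kx a x - 2 * \<i> * of_real t * Lop (k a) x + r a x))"
    using assms by (intro tder_add) (auto simp: sol_def)
  then show "tder (\<lambda>a x. h a x + k a x) (\<lambda>a x. hx a x + kx a x
       - 2 * \<i> * of_real t * Lop (\<lambda>x. h a x + k a x) x + (s a x + r a x))"
    by (rule tder_eqI)
       (simp add: Lop_add tame_exp_decay[OF sol_tame(1)[OF assms(1)]] tame_exp_decay[OF sol_tame(1)[OF assms(2)]] algebra_simps)
qed

lemma sol_cmult:
  assumes "sol t h hx s" "\<And>r. r \<ge> 0 \<Longrightarrow> (c has_vector_derivative c' r) (at r within {0..})" "continuous_on {0..} c'"
  shows "sol t (\<lambda>a x. c a * h a x) (\<lambda>a x. c a * hx a x) (\<lambda>a x. c a * s a x + c' a * h a x)"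
  unfolding sol_def
proof (intro conjI)
  have cc: "continuous_on {0..} c" using has_vector_derivative_continuous_on_halfline[OF assms(2)] .
  show "xder (\<lambda>a x. c a * h a x) (\<lambda>a x. c a * hx a x)"
    using assms cc by (auto simp: sol_def intro: xder_cmult)
  show "tame (\<lambda>a x. c a * s a x + c' a * h a x)"
    using assms cc by (auto intro!: tame_add tame_cmult intro: sol_tame)
  have "tder (\<lambda>a x. c a * h a x) (\<lambda>a x. c a * (hx a x - 2 * \<i> * of_real t * Lop (h a) x + s a x) + c' a * h a x)"
    using assms by (intro tder_cmult) (auto simp: sol_def)
  then show "tder (\<lambda>a x. c a * h a x) (\<lambda>a x. c a * hx a x
       - 2 * \<i> * of_real t * Lop (\<lambda>x. c a * h a x) x + (c a * s a x + c' a * h a x))"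
    by (rule tder_eqI) (simp add: Lop_cmult tame_exp_decay[OF sol_tame(1)[OF assms(1)]] algebra_simps)
qed

lemma sol_scale:
  assumes "sol t h hx s" shows "sol t (\<lambda>a x. c * h a x) (\<lambda>a x. c * hx a x) (\<lambda>a x. c * s a x)"
  using sol_cmult[OF assms, of "\<lambda>_. c" "\<lambda>_. 0"] by simp

lemma sol_diff:
  assumes "sol t h hx s" "sol t k kx r"
  shows "sol t (\<lambda>a x. h a x - k a x) (\<lambda>a x. hx a x - kx a x) (\<lambda>a x. s a x - r a x)"
  using sol_add[OF assms(1) sol_scale[OF assms(2), of "-1"]] by simp

text \<open>A solution for the parameter t solves the equation for t' with an additional source of
  size \<open>t' - t\<close>. Trajectories belonging to different times are compared in this
  way.\<close>

lemma sol_change_t: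
  assumes "sol t h hx s"
  shows "sol t' h hx (\<lambda>r x. s r x + 2 * \<i> * of_real (t' - t) * Lop (h r) x)"
  unfolding sol_def
proof (intro conjI)
  show "tame (\<lambda>r x. s r x + 2 * \<i> * of_real (t' - t) * Lop (h r) x)"
    using assms by (intro tame_add tame_scale tame_Lop) (auto intro: sol_tame)
  show "tder h (\<lambda>r x. hx r x - 2 * \<i> * of_real t' * Lop (h r) x + (s r x + 2 * \<i> * of_real (t' - t) * Lop (h r) x))"
    by (rule tder_eqI[of _ "\<lambda>r x. hx r x - 2 * \<i> * of_real t * Lop (h r) x + s r x"])
       (use assms in \<open>auto simp: sol_def algebra_simps\<close>)
qed (use assms in \<open>auto simp: sol_def\<close>)

text \<open>\<open>Lop\<close> commutes with complex conjugation, so conjugation only reverses the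
  sign of \<open>\<i> * t\<close>. For this datum it is the time reversal symmetry.\<close>

lemma sol_cnj:
  assumes "sol t h hx s"
  shows "sol (- t) (\<lambda>r x. cnj (h r x)) (\<lambda>r x. cnj (hx r x)) (\<lambda>r x. cnj (s r x))"
proof -
  have ell: "ell (\<lambda>x. cnj (f x)) = cnj (ell f)" for f
  proof -
    have "ell (\<lambda>x. cnj (f x)) = (\<integral>x. cnj (exp (- x) *\<^sub>R f x) \<partial>hl)" unfolding ell_def by simp
    also have "\<dots> = cnj (ell f)" unfolding ell_def by (rule Bochner_Integration.integral_cnj)
    finally show ?thesis .
  qed
  have int: "integral {0..x} (\<lambda>z. c z *\<^sub>R cnj (f z)) = cnj (integral {0..x} (\<lambda>z. c z *\<^sub>R f z))" for c :: "real \<Rightarrow> real" and f x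
    unfolding Henstock_Kurzweil_Integration.integral_cnj by (simp only: complex_cnj_scaleR)
  have S: "Sst (\<lambda>x. cnj (f x)) = (\<lambda>x. cnj (Sst f x))" for f unfolding Sst_def ell int by simp
  have G: "Gop (\<lambda>x. cnj (f x)) = (\<lambda>x. cnj (Gop f x))" for f unfolding Gop_def S unfolding Sop_def int by simp
  have L: "Lop (\<lambda>x. cnj (f x)) x = cnj (Lop f x)" for f x unfolding Lop_def G by simp
  show ?thesis unfolding sol_def L
  proof (intro conjI)
    show "xder (\<lambda>r x. cnj (h r x)) (\<lambda>r x. cnj (hx r x))"
      using assms by (auto simp: sol_def xder_def intro!: tame_cnj has_vector_derivative_cnj)
    show "tame (\<lambda>r x. cnj (s r x))" by (rule tame_cnj[OF sol_tame(3)[OF assms]])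
    show "tder (\<lambda>r x. cnj (h r x)) (\<lambda>r x. cnj (hx r x) - 2 * \<i> * of_real (- t) * cnj (Lop (h r) x) + cnj (s r x))"
      by (rule tder_eqI[OF tder_cnj, of h "\<lambda>r x. hx r x - 2 * \<i> * of_real t * Lop (h r) x + s r x"])
         (use assms in \<open>auto simp: sol_def\<close>)
  qed
qed

lemma sol_shift:
  assumes "sol t h hx s" "K \<ge> 0"
  shows "sol t (\<lambda>r. h (K + r)) (\<lambda>r. hx (K + r)) (\<lambda>r. s (K + r))"
proof -
  have tame: "tame (\<lambda>r. f (K + r))" if f: "tame f" for f
  proof (rule tameI)
    show "continuous_on ({0..} \<times> {0..}) (\<lambda>(r, x). f (K + r) x)"
      unfolding case_prod_unfold by (rule tame_compose[OF f]) (use assms in \<open>auto intro!: continuous_intros\<close>)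
    fix R :: real
    obtain a C where "0 < a" "\<And>r x. 0 \<le> r \<Longrightarrow> r \<le> K + R \<Longrightarrow> x \<ge> 0 \<Longrightarrow> cmod (f r x) \<le> C * exp (- a * x)"
      using tameE[OF f, of "K + R"] by metis
    then show "\<exists>a>0. \<exists>C. \<forall>r\<in>{0..R}. \<forall>x\<ge>0. cmod (f (K + r) x) \<le> C * exp (- a * x)"
      using assms(2) by (intro exI[of _ a] exI[of _ C] conjI) auto
  qed
  have der: "((\<lambda>r. f (K + r)) has_vector_derivative d) (at r within {0..})"
    if "(f has_vector_derivative d) (at (K + r) within {0..})" for f :: "real \<Rightarrow> complex" and d r
  proof -
    have "((\<lambda>r. K + r) has_vector_derivative 1) (at r within {0..})" by (auto intro!: derivative_eq_intros)
    moreover have "(f has_vector_derivative d) (at (K + r) within (\<lambda>r. K + r) ` {0..})"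
      by (rule has_vector_derivative_within_subset[OF that]) (use assms in auto)
    ultimately show ?thesis
      using vector_diff_chain_within[of "\<lambda>r. K + r" 1 r "{0..}" f d] by (simp add: comp_def)
  qed
  show ?thesis using assms unfolding sol_def xder_def tder_def
    by (auto intro!: tame[of h] tame[of hx] tame[of s] der
        tame[of "\<lambda>r x. hx r x - 2 * \<i> * of_real t * Lop (h r) x + s r x"])
qed

text \<open>The first bracket is the derivative of \<open>Lop f\<close>, see
  \<open>Lop_derivative\<close>; the rest is the commutator. The term \<open>- f x\<close> comes
  from multiplication by x, the multiple of \<open>ee\<close> from the Dirichlet condition in
  \<open>Gop\<close>.\<close>

lemma Lop_deriv_comm:
  assumes "exp_decay f" "exp_decay f'"
    and "\<And>x. x \<ge> 0 \<Longrightarrow> (f has_vector_derivative f' x) (at x within {0..})" and x: "x \<ge> 0"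
  shows "Lop f' x = (f x + of_real x * f' x - of_real (2 * \<kappa>) * (Sst f x - Gop f x)) - f x
     + of_real (2 * \<kappa>) * ell f * ee x"
proof -
  have "Gop f' x = Sst f x - Gop f x - exp (- x) *\<^sub>R ell f"
    by (rule Gop_deriv_comm) (use assms in auto)
  then have "Gop f' x = Sst f x - Gop f x - ee x * ell f" by (simp add: ee_def scaleR_conv_of_real)
  then show ?thesis
    unfolding Lop_def by (simp only: ring_distribs) simp
qed

lemma Lop_derivative:
  assumes "continuous_on {0..} f"
    and "(f has_vector_derivative f') (at x within {0..})" and x: "x \<ge> 0"
  shows "(Lop f has_vector_derivative (f x + of_real x * f' - of_real (2 * \<kappa>) * (Sst f x - Gop f x))) (at x within {0..})"
proof -
  have "((\<lambda>x. complex_of_real x * f x - of_real (2 * \<kappa>) * Gop f x) has_vector_derivative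
     ((complex_of_real x * f' + of_real 1 * f x) - of_real (2 * \<kappa>) * (Sst f x - Gop f x))) (at x within {0..})"
    by (intro has_vector_derivative_diff has_vector_derivative_mult has_vector_derivative_mult_right
        has_vector_derivative_of_real Gop_derivative assms DERIV_ident)
  then show ?thesis unfolding Lop_def[abs_def] by (simp add: algebra_simps)
qed

text \<open>Since d/dx is the only part of the generator that does not commute with
  \<open>Lop\<close>, the commutator appears as a source.\<close>

lemma sol_Lop:
  assumes "sol t h hx s"
  shows "sol t (\<lambda>r. Lop (h r)) (\<lambda>r x. h r x + of_real x * hx r x - of_real (2 * \<kappa>) * (Sst (h r) x - Gop (h r) x))
    (\<lambda>r x. Lop (s r) x - h r x + of_real (2 * \<kappa>) * ell (h r) * ee x)"
proof -
  note T = sol_tame[OF assms]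
  note E = T[THEN tame_exp_decay]
  have xd: "(h r has_vector_derivative hx r x) (at x within {0..})" if "r \<ge> 0" "x \<ge> 0" for r x
    using assms that by (auto simp: sol_def xder_def)
  show ?thesis unfolding sol_def
  proof (intro conjI)
    show "xder (\<lambda>r. Lop (h r)) (\<lambda>r x. h r x + of_real x * hx r x - of_real (2 * \<kappa>) * (Sst (h r) x - Gop (h r) x))"
      unfolding xder_def
    proof (intro conjI allI impI)
      show "tame (\<lambda>r x. h r x + of_real x * hx r x - of_real (2 * \<kappa>) * (Sst (h r) x - Gop (h r) x))"
        by (intro tame_add tame_diff tame_scale tame_times_id tame_Sst tame_Gop T)
      fix r x :: real assume "r \<ge> 0" "x \<ge> 0"
      then show "(Lop (h r) has_vector_derivative
          (h r x + of_real x * hx r x - of_real (2 * \<kappa>) * (Sst (h r) x - Gop (h r) x))) (at x within {0..})"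
        by (intro Lop_derivative xd exp_decay_continuous E)
    qed (intro tame_Lop T)
    have "tame (\<lambda>r x. ell (h r) * ee x)"
      by (rule tame_cmult[OF tame_const[OF exp_decay_ee] tame_ell_continuous[OF T(1)]])
    then have t1: "tame (\<lambda>r x. of_real (2 * \<kappa>) * ell (h r) * ee x)"
      unfolding mult.assoc by (rule tame_scale)
    show "tame (\<lambda>r x. Lop (s r) x - h r x + of_real (2 * \<kappa>) * ell (h r) * ee x)"
      by (intro tame_add tame_diff tame_Lop T t1)
    let ?ht = "\<lambda>r x. hx r x - 2 * \<i> * of_real t * Lop (h r) x + s r x"
    have "tder (\<lambda>r. Lop (h r)) (\<lambda>r. Lop (?ht r))"
      using assms by (intro tder_Lop) (auto simp: sol_def)
    then show "tder (\<lambda>r. Lop (h r)) (\<lambda>r x. h r x + of_real x * hx r x - of_real (2 * \<kappa>) * (Sst (h r) x - Gop (h r) x)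
       - 2 * \<i> * of_real t * Lop (Lop (h r)) x + (Lop (s r) x - h r x + of_real (2 * \<kappa>) * ell (h r) * ee x))"
    proof (rule tder_eqI)
      fix r x :: real assume rx: "r \<ge> 0" "x \<ge> 0"
      note E' = E[OF rx(1)]
      have e1: "exp_decay (\<lambda>x. (- 2 * \<i> * of_real t) * Lop (h r) x)"
        by (intro exp_decay_cmult exp_decay_Lop E')
      have "Lop (?ht r) x = Lop (\<lambda>x. (hx r x + (- 2 * \<i> * of_real t) * Lop (h r) x) + s r x) x" by simp
      also have "\<dots> = Lop (hx r) x + (- 2 * \<i> * of_real t) * Lop (Lop (h r)) x + Lop (s r) x"
        using rx by (simp only: Lop_add Lop_cmult exp_decay_add e1 E' exp_decay_Lop)
      finally show "Lop (?ht r) x = h r x + of_real x * hx r x - of_real (2 * \<kappa>) * (Sst (h r) x - Gop (h r) x)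
       - 2 * \<i> * of_real t * Lop (Lop (h r)) x + (Lop (s r) x - h r x + of_real (2 * \<kappa>) * ell (h r) * ee x)"
        using Lop_deriv_comm[of "h r" "hx r" x] E' xd rx by simp
    qed
  qed
qed

text \<open>\<open>Lop\<close> is symmetric and enters with an imaginary coefficient, hence cancels.
  Apart from the sources, the pairing changes only by what the transport carries out through x =
  0.\<close>

lemma sol_energy:
  assumes h: "sol t h hx s" and k: "sol t k kx q" and r: "r \<ge> 0"
  shows "((\<lambda>r. ip (h r) (k r)) has_vector_derivative
     (- (h r 0 * cnj (k r 0)) + ip (s r) (k r) + ip (h r) (q r))) (at r within {0..})"
proof -
  note Eh = sol_tame[OF h, THEN tame_exp_decay, OF r]
  note Ek = sol_tame[OF k, THEN tame_exp_decay, OF r]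
  let ?ht = "\<lambda>r x. hx r x - 2 * \<i> * of_real t * Lop (h r) x + s r x"
  let ?kt = "\<lambda>r x. kx r x - 2 * \<i> * of_real t * Lop (k r) x + q r x"
  have "tder (\<lambda>r x. h r x * cnj (k r x)) (\<lambda>r x. h r x * cnj (?kt r x) + ?ht r x * cnj (k r x))"
    using h k by (intro tder_mult tder_cnj) (auto simp: sol_def)
  from tder_integral[OF this r]
  have D: "((\<lambda>r. ip (h r) (k r)) has_vector_derivative
     (\<integral>x. h r x * cnj (?kt r x) + ?ht r x * cnj (k r x) \<partial>hl)) (at r within {0..})"
    unfolding ip_def .
  have bd: "(\<integral>x. h r x * cnj (kx r x) + hx r x * cnj (k r x) \<partial>hl) = - (h r 0 * cnj (k r 0))"
    using h k r
    by (intro integral_hl_derivative exp_decay_add exp_decay_mult exp_decay_cnj Eh Ek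
        has_vector_derivative_mult has_vector_derivative_cnj) (auto simp: sol_def xder_def)
  let ?c = "2 * \<i> * of_real t :: complex"
  have "(\<integral>x. h r x * cnj (?kt r x) + ?ht r x * cnj (k r x) \<partial>hl) =
     (\<integral>x. (h r x * cnj (kx r x) + hx r x * cnj (k r x)) + ?c * (h r x * cnj (Lop (k r) x)) - ?c * (Lop (h r) x * cnj (k r x))
        + h r x * cnj (q r x) + s r x * cnj (k r x) \<partial>hl)"
    by (rule Bochner_Integration.integral_cong) (auto simp: algebra_simps)
  also have "\<dots> = - (h r 0 * cnj (k r 0)) + ?c * ip (h r) (Lop (k r)) - ?c * ip (Lop (h r)) (k r) + ip (h r) (q r) + ip (s r) (k r)"
    unfolding bd[symmetric] ip_def
    by (simp add: exp_decay_integrable exp_decay_mult exp_decay_cnj exp_decay_Lop exp_decay_add exp_decay_diff exp_decay_cmult Eh Ek)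
  also have "\<dots> = - (h r 0 * cnj (k r 0)) + ip (s r) (k r) + ip (h r) (q r)"
    using ip_Lop_sym[OF Eh(1) Ek(1)] by simp
  finally show ?thesis using D by simp
qed

text \<open>Following the characteristic from (0, R) to (R, 0), the unbounded part of
  \<open>Lop\<close>, multiplication by x, only turns the phase. What remains is \<open>Gop\<close>,
  bounded pointwise by the norm \<open>A\<close>, and the source.\<close>

lemma sol_sup_bound:
  assumes h: "sol t h hx s" and R: "R \<ge> 0"
    and A: "\<And>r. 0 \<le> r \<Longrightarrow> r \<le> R \<Longrightarrow> sqrt (nsq (h r)) \<le> A"
    and B: "\<And>r x. 0 \<le> r \<Longrightarrow> r \<le> R \<Longrightarrow> x \<ge> 0 \<Longrightarrow> cmod (s r x) \<le> B"
  shows "cmod (h R 0) \<le> cmod (h 0 R) + R * (4 * \<kappa> * \<bar>t\<bar> * A + B)"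
proof -
  let ?ht = "\<lambda>r x. hx r x - 2 * \<i> * of_real t * Lop (h r) x + s r x"
  \<comment> \<open>Integrating factor for the term -2itx at x = R - r: the exponent has derivative
    2it(R - r).\<close>
  define ph where "ph r = exp (\<i> * of_real (2 * t * (R * r - r\<^sup>2 / 2)))" for r :: real
  define F where "F r = ph r * h r (R - r)" for r
  define F' where "F' r = ph r * (of_real (4 * \<kappa> * t) * \<i> * Gop (h r) (R - r) + s r (R - r))" for r
  have "(F has_vector_derivative F' r) (at r within {0..R})" if r: "r \<in> {0..R}" for r
  proof -
    have p: "(ph has_vector_derivative (\<i> * of_real (2 * t * (R - r)) * ph r)) (at r within {0..R})"
      unfolding ph_def by (rule has_vector_derivative_cis) (auto intro!: derivative_eq_intros simp: field_simps)
    have d: "((\<lambda>r. h r (R - r)) has_vector_derivative (?ht r (R - r) - hx r (R - r))) (at r within {0..R})"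
      using h by (intro total_derivative_antidiagonal r) (auto simp: sol_def)
    have "(F has_vector_derivative (ph r * (?ht r (R - r) - hx r (R - r)) + (\<i> * of_real (2 * t * (R - r)) * ph r) * h r (R - r)))
        (at r within {0..R})"
      unfolding F_def by (rule has_vector_derivative_mult[OF p d])
    then show ?thesis by (rule has_vector_derivative_eq_rhs) (simp add: F'_def Lop_def algebra_simps)
  qed
  moreover have "cmod (F' r) \<le> 4 * \<kappa> * \<bar>t\<bar> * A + B" if r: "r \<in> {0..R}" for r
  proof -
    have "cmod (F' r) = cmod (of_real (4 * \<kappa> * t) * \<i> * Gop (h r) (R - r) + s r (R - r))"
      by (simp add: F'_def ph_def norm_mult)
    also have "\<dots> \<le> 4 * \<kappa> * \<bar>t\<bar> * cmod (Gop (h r) (R - r)) + cmod (s r (R - r))"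
      using kappa_pos by (intro order_trans[OF norm_triangle_ineq]) (simp add: norm_mult abs_mult)
    also have "\<dots> \<le> 4 * \<kappa> * \<bar>t\<bar> * A + B"
      using r kappa_pos B[of r "R - r"] A[of r]
        Gop_sup_bound[OF tame_exp_decay[OF sol_tame(1)[OF h]], of r "R - r"]
      by (intro add_mono mult_left_mono) auto
    finally show ?thesis .
  qed
  ultimately have "cmod (F R - F 0) \<le> (4 * \<kappa> * \<bar>t\<bar> * A + B) * norm (R - 0)"
    using R
    by (intro differentiable_bound[of "{0..R}" F "\<lambda>r h. h *\<^sub>R F' r"])
       (auto simp: has_vector_derivative_def intro!: onorm_le mult_right_mono simp: mult.commute[of _ "cmod (F' _)"])
  then have "cmod (F R) \<le> cmod (F 0) + R * (4 * \<kappa> * \<bar>t\<bar> * A + B)"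
    using norm_triangle_sub[of "F R" "F 0"] R by (simp add: mult.commute)
  then show ?thesis by (simp add: F_def ph_def norm_mult)
qed

end

section \<open>Convolution and existence\<close>

definition conv :: "(real \<Rightarrow> complex) \<Rightarrow> (real \<Rightarrow> real \<Rightarrow> complex) \<Rightarrow> real \<Rightarrow> real \<Rightarrow> complex" where
  "conv p g r x = integral {0..r} (\<lambda>y. p y * g (r - y) x)"

lemma conv_integrand_continuous:
  assumes "continuous_on {0..} p" "tame g" "r \<ge> 0" "x \<ge> 0"
  shows "continuous_on {0..r} (\<lambda>y. p y * g (r - y) x)"
  using assms(3,4)
  by (intro continuous_intros tame_compose[OF assms(2)] continuous_on_subset[OF assms(1)]) auto

lemma conv_integrable:
  assumes "continuous_on {0..} p" "tame g" "r \<ge> 0" "x \<ge> 0"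
  shows "(\<lambda>y. p y * g (r - y) x) integrable_on {0..r}"
  by (rule integrable_continuous_interval[OF conv_integrand_continuous[OF assms]])

lemma conv_add:
  assumes "continuous_on {0..} p" "tame f" "tame g" "r \<ge> 0" "x \<ge> 0"
  shows "conv p (\<lambda>r x. f r x + g r x) r x = conv p f r x + conv p g r x"
  unfolding conv_def using assms by (simp add: distrib_left integral_add conv_integrable)

lemma conv_cmult: "conv p (\<lambda>r x. c * f r x) r x = c * conv p f r x"
proof -
  have "(\<lambda>y. p y * (c * f (r - y) x)) = (\<lambda>y. c * (p y * f (r - y) x))" by (auto simp: algebra_simps)
  then show ?thesis unfolding conv_def by simp
qed

lemma conv_times_id: "conv p (\<lambda>r x. of_real x * f r x) r x = of_real x * conv p f r x"
proof -
  have "(\<lambda>y. p y * (of_real x * f (r - y) x)) = (\<lambda>y. of_real x * (p y * f (r - y) x))" by (auto simp: algebra_simps)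
  then show ?thesis unfolding conv_def by simp
qed

lemma conv_diff:
  assumes "continuous_on {0..} p" "tame f" "tame g" "r \<ge> 0" "x \<ge> 0"
  shows "conv p (\<lambda>r x. f r x - g r x) r x = conv p f r x - conv p g r x"
  using conv_add[OF assms(1,2) tame_uminus[OF assms(3)] assms(4,5)] conv_cmult[of p "-1" g r x] by simp

lemma conv_bound:
  assumes p: "continuous_on {0..} p" "tame g" "r \<ge> 0" "x \<ge> 0"
    and B: "B \<ge> 0" "\<And>y. 0 \<le> y \<Longrightarrow> y \<le> r \<Longrightarrow> cmod (p y) \<le> B"
    and C: "\<And>y. 0 \<le> y \<Longrightarrow> y \<le> r \<Longrightarrow> cmod (g y x) \<le> C"
  shows "cmod (conv p g r x) \<le> B * C * r"
proof -
  have "norm (integral {0..r} (\<lambda>y. p y * g (r - y) x)) \<le> (B * C) * (r - 0)"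
  proof (rule integral_bound[OF p(3) conv_integrand_continuous[OF p]])
    show "cmod (p y * g (r - y) x) \<le> B * C" if "y \<in> {0..r}" for y
      unfolding norm_mult using that B C[of "r - y"] by (intro mult_mono) auto
  qed
  then show ?thesis by (simp add: conv_def)
qed

lemma tame_conv:
  assumes p: "continuous_on {0..} p" and g: "tame g"
  shows "tame (conv p g)"
proof (rule tameI)
  have "continuous_on ({0..} \<times> {0..}) (\<lambda>z. integral {0..fst z} (\<lambda>y. p y * g (fst z - y) (snd z)))"
  proof (rule continuous_on_parametric_Icc[where f = "\<lambda>z u y. p y * g (fst z - y) (snd z)"])
    have "continuous_on (({0..} \<times> {0..}) \<times> {0..1}) (\<lambda>z::(real\<times>real)\<times>real. p (fst (fst z) * snd z))"
      by (rule continuous_on_compose2[OF p]) (auto intro!: continuous_intros)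
    then show "continuous_on (({0..} \<times> {0..}) \<times> {0..1})
       (\<lambda>(z, s). p (fst z * s) * g (fst z - fst z * s) (snd z))"
      unfolding case_prod_unfold
      by (intro continuous_intros tame_compose[OF g]) (auto intro!: continuous_intros simp: mult_left_le)
    show "continuous_on {0..fst z} (\<lambda>y. p y * g (fst z - y) (snd z))" if "z \<in> {0..} \<times> {0..}" for z
      using that by (intro conv_integrand_continuous p g) auto
  qed (auto intro!: continuous_intros)
  then show "continuous_on ({0..} \<times> {0..}) (\<lambda>(r, x). conv p g r x)"
    unfolding conv_def case_prod_unfold .
  fix R :: real assume "R > 0"
  obtain a C where f: "0 < a" "C \<ge> 0" "\<And>r x. 0 \<le> r \<Longrightarrow> r \<le> R \<Longrightarrow> x \<ge> 0 \<Longrightarrow> cmod (g r x) \<le> C * exp (- a * x)"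
    using tameE[OF g, of R] by metis
  obtain B where B: "B \<ge> 0" "\<And>r. 0 \<le> r \<Longrightarrow> r \<le> R \<Longrightarrow> cmod (p r) \<le> B"
    using continuous_on_Icc_bounded[OF p] by metis
  have "cmod (conv p g r x) \<le> (B * C * R) * exp (- a * x)" if r: "r \<in> {0..R}" "x \<ge> 0" for r x
  proof -
    have "cmod (conv p g r x) \<le> B * (C * exp (- a * x)) * r"
      by (rule conv_bound[OF p g]) (use r B f in auto)
    also have "\<dots> \<le> B * (C * exp (- a * x)) * R"
      using r B f by (intro mult_left_mono) auto
    finally show ?thesis by (simp add: mult_ac)
  qed
  then show "\<exists>a>0. \<exists>C. \<forall>r\<in>{0..R}. \<forall>x\<ge>0. cmod (conv p g r x) \<le> C * exp (- a * x)"
    using f(1) by blast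
qed

lemma xder_conv:
  assumes p: "continuous_on {0..} p" and g: "xder g gx"
  shows "xder (conv p g) (conv p gx)"
proof -
  have t: "tame g" "tame gx" using g by (auto simp: xder_def)
  show ?thesis unfolding xder_def
  proof (intro conjI allI impI tame_conv p t)
    fix r x :: real assume r: "r \<ge> 0" "x \<ge> 0"
    have "continuous_on ({0..} \<times> cbox 0 r) (\<lambda>z::real\<times>real. p (snd z))"
      by (rule continuous_on_compose2[OF p]) (auto intro!: continuous_intros simp: cbox_interval)
    then have *: "continuous_on ({0..} \<times> cbox 0 r) (\<lambda>(x, y). p y * gx (r - y) x)"
      unfolding case_prod_unfold
      by (intro continuous_intros tame_compose[OF t(2)]) (auto intro!: continuous_intros simp: cbox_interval)
    have "((\<lambda>x. integral (cbox 0 r) (\<lambda>y. p y * g (r - y) x)) has_vector_derivative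
        integral (cbox 0 r) (\<lambda>y. p y * gx (r - y) x)) (at x within {0..})"
    proof (rule leibniz_rule_vector_derivative[OF _ _ *])
      show "((\<lambda>x. p y * g (r - y) x) has_vector_derivative p y * gx (r - y) x) (at x within {0..})"
        if "x \<in> {0..}" "y \<in> cbox 0 r" for x y
        using g that by (intro has_vector_derivative_mult_right) (auto simp: xder_def cbox_interval)
      show "(\<lambda>y. p y * g (r - y) x) integrable_on cbox 0 r" if "x \<in> {0..}" for x
        unfolding cbox_interval using that r by (intro conv_integrable p t) auto
    qed (use r in auto)
    then show "(conv p g r has_vector_derivative conv p gx r x) (at x within {0..})"
      by (simp add: conv_def[abs_def] cbox_interval)
  qed
qed

lemma has_vector_derivative_shift_left:
  fixes f :: "real \<Rightarrow> 'b::real_normed_vector"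
  assumes "(f has_vector_derivative d) (at (x - y) within {0..})" "0 \<le> y"
  shows "((\<lambda>x. f (x - y)) has_vector_derivative d) (at x within {y..R})"
proof -
  have "((\<lambda>x. x - y) has_vector_derivative 1) (at x within {y..R})" by (auto intro!: derivative_eq_intros)
  moreover have "(f has_vector_derivative d) (at (x - y) within (\<lambda>x. x - y) ` {y..R})"
    by (rule has_vector_derivative_within_subset[OF assms(1)]) auto
  ultimately show ?thesis
    using vector_diff_chain_within[of "\<lambda>x. x - y" 1 x "{y..R}" f d] by (simp add: comp_def)
qed

lemma tder_conv:
  assumes p: "continuous_on {0..} p" and g: "tder g gt"
  shows "tder (conv p g) (\<lambda>r x. p r * g 0 x + conv p gt r x)"
proof -
  have t: "tame g" "tame gt" using g by (auto simp: tder_def)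
  have t0: "tame (\<lambda>r. g 0)" by (intro tame_const tame_exp_decay t) simp
  show ?thesis unfolding tder_def
  proof (intro conjI allI impI tame_conv tame_add tame_cmult p t t0)
    fix r x :: real assume r: "r \<ge> 0" "x \<ge> 0"
    let ?T = "{(a, b). 0 \<le> b \<and> b \<le> a \<and> a \<le> r + 1} :: (real \<times> real) set"
    have cp: "continuous_on ?T (\<lambda>z. p (snd z))"
      by (rule continuous_on_compose2[OF p]) (auto intro!: continuous_intros)
    have "((\<lambda>r. integral {0..r} (\<lambda>y. p y * g (r - y) x)) has_vector_derivative
       (p r * g (r - r) x + integral {0..r} (\<lambda>y. p y * gt (r - y) x))) (at r within {0..r+1})"
    proof (rule has_vector_derivative_integral_variable_limit)
      show "continuous_on ?T (\<lambda>(a, b). p b * g (a - b) x)" "continuous_on ?T (\<lambda>(a, b). p b * gt (a - b) x)"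
        using r unfolding case_prod_unfold
        by (intro continuous_intros cp[unfolded case_prod_unfold] tame_compose[OF t(1)] tame_compose[OF t(2)]; auto intro!: continuous_intros)+
      fix a b :: real assume ab: "0 \<le> b" "b \<le> a" "a \<le> r + 1"
      show "((\<lambda>a. p b * g (a - b) x) has_vector_derivative p b * gt (a - b) x) (at a within {b..r+1})"
        using g ab r
        by (intro has_vector_derivative_mult_right has_vector_derivative_shift_left[where f = "\<lambda>r. g r x"])
           (auto simp: tder_def)
    qed (use r in auto)
    then show "((\<lambda>r. conv p g r x) has_vector_derivative p r * g 0 x + conv p gt r x) (at r within {0..})"
      by (simp add: conv_def at_within_Icc_Ici)
  qed
qed

lemma xder_Sst: "tame g \<Longrightarrow> xder (\<lambda>r. Sst (g r)) (\<lambda>r x. Sst (g r) x - g r x)"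
  unfolding xder_def
  by (auto intro!: tame_Sst tame_diff Sst_derivative exp_decay_continuous tame_exp_decay)

lemma xder_Sop: "tame g \<Longrightarrow> xder (\<lambda>r. Sop (g r)) (\<lambda>r x. g r x - Sop (g r) x)"
  unfolding xder_def
  by (auto intro!: tame_Sop tame_diff Sop_derivative exp_decay_continuous tame_exp_decay)

lemma xder_Gop: "tame g \<Longrightarrow> xder (\<lambda>r. Gop (g r)) (\<lambda>r x. Sst (g r) x - Gop (g r) x)"
  unfolding Gop_def by (intro xder_Sop tame_Sst)

text \<open>The convolution acts on r and the operator on x. That they commute is verified by the
  uniqueness criterion, since both sides solve the same first order equation in x.\<close>

lemma Sst_conv:
  assumes p: "continuous_on {0..} p" and g: "tame g" and r: "r \<ge> 0" "x \<ge> 0"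
  shows "Sst (conv p g r) x = conv p (\<lambda>r. Sst (g r)) r x"
proof -
  have "xder (conv p (\<lambda>r. Sst (g r))) (conv p (\<lambda>r x. Sst (g r) x - g r x))"
    by (intro xder_conv xder_Sst p g)
  then have d: "(conv p (\<lambda>r. Sst (g r)) r has_vector_derivative conv p (\<lambda>r x. Sst (g r) x - g r x) r x) (at x within {0..})"
    if "x \<ge> 0" for x using r that by (auto simp: xder_def)
  have "exp_decay (conv p (\<lambda>r. Sst (g r)) r)"
    by (intro tame_exp_decay[OF tame_conv] p tame_Sst g r)
  then obtain B where B: "\<And>x. x \<ge> 0 \<Longrightarrow> cmod (conv p (\<lambda>r. Sst (g r)) r x) \<le> B"
    using exp_decay_bounded by blast
  show ?thesis
  proof (rule Sst_unique[where B = B])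
    show "exp_decay (conv p g r)" by (intro tame_exp_decay[OF tame_conv] p g r)
    show "(conv p (\<lambda>r. Sst (g r)) r has_vector_derivative conv p (\<lambda>r. Sst (g r)) r x - conv p g r x) (at x within {0..})"
      if x: "x \<ge> 0" for x
      using d[OF x] conv_diff[OF p tame_Sst[OF g] g r(1) x] by simp
  qed (use B r in auto)
qed

lemma Sop_conv:
  assumes p: "continuous_on {0..} p" and g: "tame g" and r: "r \<ge> 0" "x \<ge> 0"
  shows "Sop (conv p g r) x = conv p (\<lambda>r. Sop (g r)) r x"
proof -
  have "xder (conv p (\<lambda>r. Sop (g r))) (conv p (\<lambda>r x. g r x - Sop (g r) x))"
    by (intro xder_conv xder_Sop p g)
  then have d: "(conv p (\<lambda>r. Sop (g r)) r has_vector_derivative conv p (\<lambda>r x. g r x - Sop (g r) x) r x) (at x within {0..})"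
    if "x \<ge> 0" for x using r that by (auto simp: xder_def)
  show ?thesis
  proof (rule Sop_unique)
    show "continuous_on {0..} (conv p g r)" by (intro exp_decay_continuous tame_exp_decay[OF tame_conv] p g r)
    show "(conv p (\<lambda>r. Sop (g r)) r has_vector_derivative conv p g r x - conv p (\<lambda>r. Sop (g r)) r x) (at x within {0..})"
      if x: "x \<ge> 0" for x
      using d[OF x] conv_diff[OF p g tame_Sop[OF g] r(1) x] by simp
  qed (use r in \<open>auto simp: conv_def\<close>)
qed

lemma Gop_conv:
  assumes p: "continuous_on {0..} p" and g: "tame g" and r: "r \<ge> 0" "x \<ge> 0"
  shows "Gop (conv p g r) x = conv p (\<lambda>r. Gop (g r)) r x"
proof -
  have "Gop (conv p g r) x = Sop (conv p (\<lambda>r. Sst (g r)) r) x"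
    unfolding Gop_def by (subst Sop_cong[OF Sst_conv[OF p g r(1)]]) auto
  also have "\<dots> = conv p (\<lambda>r. Gop (g r)) r x"
    unfolding Gop_def by (rule Sop_conv[OF p tame_Sst[OF g] r])
  finally show ?thesis .
qed

text \<open>A Duhamel integral: the source q created at y is shifted left by r - y and multiplied by
  m. The multiplier is left general because differentiating the free propagator produces polynomial
  factors.\<close>

definition Du :: "(real \<Rightarrow> real \<Rightarrow> complex) \<Rightarrow> (real \<Rightarrow> real \<Rightarrow> complex) \<Rightarrow> real \<Rightarrow> real \<Rightarrow> complex" where
  "Du m q r x = integral {0..r} (\<lambda>y. m (r - y) x * q y (x + r - y))"

lemma quadrant_compose:
  assumes "continuous_on ({0..} \<times> {0..}) (\<lambda>(r, x). m r x)"
    "continuous_on S u" "continuous_on S v" "\<And>z. z \<in> S \<Longrightarrow> u z \<ge> (0::real)" "\<And>z. z \<in> S \<Longrightarrow> v z \<ge> (0::real)"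
  shows "continuous_on S (\<lambda>z. m (u z) (v z))"
  by (rule continuous_on_compose2[OF assms(1), of S "\<lambda>z. (u z, v z)",
        unfolded case_prod_unfold fst_conv snd_conv])
     (use assms in \<open>auto intro!: continuous_intros\<close>)

lemma Du_integrand_continuous:
  assumes m: "continuous_on ({0..} \<times> {0..}) (\<lambda>(r, x). m r x)" and q: "tame q" and r: "r \<ge> 0" "x \<ge> 0"
  shows "continuous_on {0..r} (\<lambda>y. m (r - y) x * q y (x + r - y))"
  using r by (intro continuous_intros quadrant_compose[OF m] tame_compose[OF q]) auto

lemma Du_bound:
  assumes m: "continuous_on ({0..} \<times> {0..}) (\<lambda>(r, x). m r x)" and q: "tame q" and r: "r \<ge> 0" "x \<ge> 0"
    and B: "B \<ge> 0" "\<And>y. 0 \<le> y \<Longrightarrow> y \<le> r \<Longrightarrow> cmod (m y x) \<le> B"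
    and C: "C \<ge> 0" "a \<ge> 0" "\<And>y x. 0 \<le> y \<Longrightarrow> y \<le> r \<Longrightarrow> x \<ge> 0 \<Longrightarrow> cmod (q y x) \<le> C * exp (- a * x)"
  shows "cmod (Du m q r x) \<le> B * C * r * exp (- a * x)"
proof -
  have "norm (integral {0..r} (\<lambda>y. m (r - y) x * q y (x + r - y))) \<le> (B * (C * exp (- a * x))) * (r - 0)"
  proof (rule integral_bound[OF r(1) Du_integrand_continuous[OF m q r]])
    show "cmod (m (r - y) x * q y (x + r - y)) \<le> B * (C * exp (- a * x))" if y: "y \<in> {0..r}" for y
    proof -
      have "cmod (q y (x + r - y)) \<le> C * exp (- a * (x + r - y))" using y r by (intro C) auto
      also have "\<dots> \<le> C * exp (- a * x)" using C y by (intro mult_left_mono) (auto intro!: mult_left_mono)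
      finally show ?thesis unfolding norm_mult using y B by (intro mult_mono) auto
    qed
  qed
  then show ?thesis by (simp add: Du_def mult_ac)
qed

lemma tame_Du:
  assumes m: "continuous_on ({0..} \<times> {0..}) (\<lambda>(r, x). m r x)" and q: "tame q"
    and mb: "\<And>R. \<exists>B. \<forall>r\<in>{0..R}. \<forall>x\<ge>0. cmod (m r x) \<le> B"
  shows "tame (Du m q)"
proof (rule tameI)
  have "continuous_on ({0..} \<times> {0..}) (\<lambda>z. integral {0..fst z} (\<lambda>y. m (fst z - y) (snd z) * q y (snd z + fst z - y)))"
  proof (rule continuous_on_parametric_Icc[where f = "\<lambda>z u y. m (fst z - y) (snd z) * q y (snd z + fst z - y)"])
    have *: "a * s \<le> b + a" if "(0::real) \<le> a" "(0::real) \<le> b" "s \<le> 1" for a b s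
      using mult_left_le[of s a] that by simp
    show "continuous_on (({0..} \<times> {0..}) \<times> {0..1})
       (\<lambda>(z, s). m (fst z - fst z * s) (snd z) * q (fst z * s) (snd z + fst z - fst z * s))"
      unfolding case_prod_unfold
      by (intro continuous_intros quadrant_compose[OF m] tame_compose[OF q])
         (use * in \<open>auto intro!: continuous_intros simp: mult_left_le\<close>)
    show "continuous_on {0..fst z} (\<lambda>y. m (fst z - y) (snd z) * q y (snd z + fst z - y))" if "z \<in> {0..} \<times> {0..}" for z
      using that by (intro Du_integrand_continuous m q) auto
  qed (auto intro!: continuous_intros)
  then show "continuous_on ({0..} \<times> {0..}) (\<lambda>(r, x). Du m q r x)"
    unfolding Du_def case_prod_unfold .
  fix R :: real assume "R > 0"
  obtain a C where f: "0 < a" "C \<ge> 0" "\<And>r x. 0 \<le> r \<Longrightarrow> r \<le> R \<Longrightarrow> x \<ge> 0 \<Longrightarrow> cmod (q r x) \<le> C * exp (- a * x)"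
    using tameE[OF q, of R] by metis
  obtain B0 where B0: "\<And>r x. r \<in> {0..R} \<Longrightarrow> x \<ge> 0 \<Longrightarrow> cmod (m r x) \<le> B0" using mb[of R] by blast
  define B where "B = max B0 0"
  have B: "B \<ge> 0" "\<And>r x. r \<in> {0..R} \<Longrightarrow> x \<ge> 0 \<Longrightarrow> cmod (m r x) \<le> B" using B0 unfolding B_def by fastforce+
  have "cmod (Du m q r x) \<le> (B * C * R) * exp (- a * x)" if r: "r \<in> {0..R}" "x \<ge> 0" for r x
  proof -
    have "cmod (Du m q r x) \<le> B * C * r * exp (- a * x)"
      by (rule Du_bound[OF m q]) (use r B f in auto)
    also have "\<dots> \<le> B * C * R * exp (- a * x)"
      using r B f by (intro mult_right_mono mult_left_mono) auto
    finally show ?thesis .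
  qed
  then show "\<exists>a>0. \<exists>C. \<forall>r\<in>{0..R}. \<forall>x\<ge>0. cmod (Du m q r x) \<le> C * exp (- a * x)"
    using f(1) by blast
qed

context ccm
begin

lemma Lop_conv:
  assumes p: "continuous_on {0..} p" and g: "tame g" and r: "r \<ge> 0" "x \<ge> 0"
  shows "Lop (conv p g r) x = conv p (\<lambda>r. Lop (g r)) r x"
  unfolding Lop_def Gop_conv[OF assms]
  by (subst conv_diff[OF p tame_times_id[OF g] tame_scale[OF tame_Gop[OF g]] r])
     (simp only: conv_times_id conv_cmult)

text \<open>Superposition of copies of g that start at y with amplitude \<open>p y\<close>; the
  source is the copy being started at r. It is used to remove sources proportional to
  \<open>ee\<close>.\<close>

lemma sol_conv:
  assumes p: "continuous_on {0..} p" and g: "sol t g gx (\<lambda>_ _. 0)"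
  shows "sol t (conv p g) (conv p gx) (\<lambda>r x. p r * g 0 x)"
  unfolding sol_def
proof (intro conjI)
  note T = sol_tame[OF g]
  show "xder (conv p g) (conv p gx)" using g by (intro xder_conv p) (simp add: sol_def)
  have t0: "tame (\<lambda>r. g 0)" by (intro tame_const tame_exp_decay T) simp
  then show "tame (\<lambda>r x. p r * g 0 x)" by (intro tame_cmult p)
  have "tder (conv p g) (\<lambda>r x. p r * g 0 x + conv p (\<lambda>r x. hx r x) r x)" if "tder g hx" for hx
    using tder_conv[OF p that] .
  moreover have "tder g (\<lambda>r x. gx r x - 2 * \<i> * of_real t * Lop (g r) x + 0)" using g by (simp add: sol_def)
  ultimately have "tder (conv p g) (\<lambda>r x. p r * g 0 x + conv p (\<lambda>r x. gx r x - 2 * \<i> * of_real t * Lop (g r) x + 0) r x)"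
    by blast
  then show "tder (conv p g) (\<lambda>r x. conv p gx r x - 2 * \<i> * of_real t * Lop (conv p g r) x + p r * g 0 x)"
  proof (rule tder_eqI)
    fix r x :: real assume r: "r \<ge> 0" "x \<ge> 0"
    have "conv p (\<lambda>r x. gx r x - 2 * \<i> * of_real t * Lop (g r) x + 0) r x
       = conv p gx r x - conv p (\<lambda>r x. 2 * \<i> * of_real t * Lop (g r) x) r x"
      by (simp add: conv_diff[OF p T(2) tame_scale[OF tame_Lop[OF T(1)]] r])
    also have "conv p (\<lambda>r x. 2 * \<i> * of_real t * Lop (g r) x) r x = 2 * \<i> * of_real t * Lop (conv p g r) x"
      unfolding conv_cmult Lop_conv[OF p T(1) r] ..
    finally show "p r * g 0 x + conv p (\<lambda>r x. gx r x - 2 * \<i> * of_real t * Lop (g r) x + 0) r x =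
      conv p gx r x - 2 * \<i> * of_real t * Lop (conv p g r) x + p r * g 0 x" by simp
  qed
qed

text \<open>The free propagator: multiplication by \<open>E\<close> after a left shift solves \<open>h\<^sub>r = h\<^sub>x - 2itx h\<close>.\<close>

definition E :: "real \<Rightarrow> real \<Rightarrow> real \<Rightarrow> complex" where
  "E t r x = exp (\<i> * of_real (- t * (2 * r * x + r\<^sup>2)))"

lemma E_norm [simp]: "cmod (E t r x) = 1" by (simp add: E_def)

lemma E_continuous: "continuous_on S (\<lambda>z. E t (fst z) (snd z))"
  unfolding E_def by (auto intro!: continuous_intros)

lemma E_der_x: "((\<lambda>x. E t r x) has_vector_derivative (- 2 * \<i> * of_real t * of_real r * E t r x)) (at x within S)"
  unfolding E_def
  by (rule has_vector_derivative_eq_rhs[OF has_vector_derivative_cis[where d = "- t * (2 * r)"]])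
     (auto intro!: derivative_eq_intros)

lemma E_der_r: "((\<lambda>r. E t r x) has_vector_derivative (- 2 * \<i> * of_real t * of_real (x + r) * E t r x)) (at r within S)"
  unfolding E_def
  by (rule has_vector_derivative_eq_rhs[OF has_vector_derivative_cis[where d = "- t * (2 * x + 2 * r)"]])
     (auto intro!: derivative_eq_intros simp: algebra_simps)

lemma duhamel_xder:
  assumes q: "xder q qx"
  shows "xder (Du (E t) q) (\<lambda>r x. Du (E t) qx r x + Du (\<lambda>r x. (- 2 * \<i> * of_real t * of_real r) * E t r x) q r x)"
proof -
  have T: "tame q" "tame qx" using q by (auto simp: xder_def)
  let ?m2 = "\<lambda>r x. (- 2 * \<i> * of_real t * of_real r) * E t r x"
  have cE: "continuous_on ({0..} \<times> {0..}) (\<lambda>(r, x). E t r x)"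
    using E_continuous unfolding case_prod_unfold .
  have cm2: "continuous_on ({0..} \<times> {0..}) (\<lambda>(r, x). ?m2 r x)"
    using cE unfolding case_prod_unfold by (intro continuous_intros) auto
  have m2b: "\<exists>B. \<forall>r\<in>{0..R}. \<forall>x\<ge>0. cmod (?m2 r x) \<le> B" for R
    by (intro exI[of _ "2 * \<bar>t\<bar> * R"]) (auto simp: norm_mult intro!: mult_left_mono)
  show ?thesis unfolding xder_def
  proof (intro conjI allI impI tame_add tame_Du T cE cm2 m2b)
    show "\<exists>B. \<forall>r\<in>{0..R}. \<forall>x\<ge>0. cmod (E t r x) \<le> B" for R by auto
    then show "\<exists>B. \<forall>r\<in>{0..R}. \<forall>x\<ge>0. cmod (E t r x) \<le> B" for R .
    fix r x :: real assume r: "r \<ge> 0" "x \<ge> 0"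
    let ?f' = "\<lambda>x y. E t (r - y) x * qx y (x + r - y) + ?m2 (r - y) x * q y (x + r - y)"
    have "continuous_on ({0..} \<times> cbox 0 r) (\<lambda>(x, y). ?f' x y)"
      unfolding case_prod_unfold
      by (intro continuous_intros tame_compose[OF T(1)] tame_compose[OF T(2)] quadrant_compose[OF cE])
         (auto intro!: continuous_intros simp: cbox_interval)
    then have "((\<lambda>x. integral (cbox 0 r) (\<lambda>y. E t (r - y) x * q y (x + r - y))) has_vector_derivative
        integral (cbox 0 r) (?f' x)) (at x within {0..})"
    proof (rule leibniz_rule_vector_derivative[rotated 2])
      fix x y :: real assume xy: "x \<in> {0..}" "y \<in> cbox 0 r"
      have "((\<lambda>x. x + r - y) has_vector_derivative 1) (at x within {0..})" by (auto intro!: derivative_eq_intros)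
      moreover have "(q y has_vector_derivative qx y (x + r - y)) (at (x + r - y) within ((\<lambda>x. x + r - y) ` {0..}))"
        using xy q unfolding xder_def
        by (rule_tac has_vector_derivative_within_subset[of "q y" _ _ "{0..}"]) (auto simp: cbox_interval)
      ultimately have "((\<lambda>x. q y (x + r - y)) has_vector_derivative qx y (x + r - y)) (at x within {0..})"
        using vector_diff_chain_within[of "\<lambda>x. x + r - y" 1 x "{0..}" "q y" "qx y (x + r - y)"] by (simp add: comp_def)
      from has_vector_derivative_mult[OF E_der_x this]
      show "((\<lambda>x. E t (r - y) x * q y (x + r - y)) has_vector_derivative ?f' x y) (at x within {0..})" .
    next
      show "(\<lambda>y. E t (r - y) x * q y (x + r - y)) integrable_on cbox 0 r" if "x \<in> {0..}" for x
        unfolding cbox_interval using that r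
        by (intro integrable_continuous_interval Du_integrand_continuous cE T) auto
    qed (use r in auto)
    moreover have "integral {0..r} (?f' x) = Du (E t) qx r x + Du ?m2 q r x"
      unfolding Du_def
      by (intro integral_add integrable_continuous_interval Du_integrand_continuous cE cm2 T r)
    ultimately show "(Du (E t) q r has_vector_derivative Du (E t) qx r x + Du ?m2 q r x) (at x within {0..})"
      by (simp add: Du_def[abs_def] cbox_interval)
  qed
qed

lemma duhamel_tder:
  assumes q: "xder q qx"
  shows "tder (Du (E t) q) (\<lambda>r x. (Du (E t) qx r x + Du (\<lambda>r x. (- 2 * \<i> * of_real t * of_real r) * E t r x) q r x)
      - 2 * \<i> * of_real t * of_real x * Du (E t) q r x + q r x)"
proof -
  have T: "tame q" "tame qx" using q by (auto simp: xder_def)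
  let ?m2 = "\<lambda>r x. (- 2 * \<i> * of_real t * of_real r) * E t r x"
  let ?m3 = "\<lambda>r x. (- 2 * \<i> * of_real t * of_real (x + r)) * E t r x"
  have xd: "xder (Du (E t) q) (\<lambda>r x. Du (E t) qx r x + Du ?m2 q r x)" by (rule duhamel_xder[OF q])
  have cE: "continuous_on ({0..} \<times> {0..}) (\<lambda>(r, x). E t r x)"
    using E_continuous unfolding case_prod_unfold .
  have cm2: "continuous_on ({0..} \<times> {0..}) (\<lambda>(r, x). ?m2 r x)"
    using cE unfolding case_prod_unfold by (intro continuous_intros) auto
  have t1: "tame (\<lambda>r x. 2 * \<i> * of_real t * (of_real x * Du (E t) q r x))"
    using xd by (intro tame_scale tame_times_id) (simp add: xder_def)
  show ?thesis unfolding tder_def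
  proof (intro conjI allI impI tame_add tame_diff T)
    show "tame (Du (E t) q)" "tame (\<lambda>r x. 2 * \<i> * of_real t * of_real x * Du (E t) q r x)"
      using xd t1 by (auto simp: xder_def mult.assoc)
    show "tame (Du (E t) qx)" by (rule tame_Du[OF cE T(2)]) auto
    show "tame (Du ?m2 q)"
    proof (rule tame_Du[OF cm2 T(1)])
      show "\<exists>B. \<forall>r\<in>{0..R}. \<forall>x\<ge>0. cmod (?m2 r x) \<le> B" for R
        by (intro exI[of _ "2 * \<bar>t\<bar> * R"]) (auto simp: norm_mult intro!: mult_left_mono)
    qed
    fix r x :: real assume r: "r \<ge> 0" "x \<ge> 0"
    let ?T = "{(a, b). 0 \<le> b \<and> b \<le> a \<and> a \<le> r + 1} :: (real \<times> real) set"
    let ?f' = "\<lambda>a b. E t (a - b) x * qx b (x + a - b) + ?m3 (a - b) x * q b (x + a - b)"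
    have D: "((\<lambda>r. integral {0..r} (\<lambda>y. E t (r - y) x * q y (x + r - y))) has_vector_derivative
       (E t (r - r) x * q r (x + r - r) + integral {0..r} (?f' r))) (at r within {0..r+1})"
    proof (rule has_vector_derivative_integral_variable_limit)
      show "continuous_on ?T (\<lambda>(a, b). E t (a - b) x * q b (x + a - b))"
        using r unfolding case_prod_unfold
        by (intro continuous_intros quadrant_compose[OF cE] tame_compose[OF T(1)]; auto intro!: continuous_intros)
      show "continuous_on ?T (\<lambda>(a, b). ?f' a b)"
        using r unfolding case_prod_unfold
        by (intro continuous_intros quadrant_compose[OF cE] tame_compose[OF T(1)] tame_compose[OF T(2)]; auto intro!: continuous_intros)
      fix a b :: real assume ab: "0 \<le> b" "b \<le> a" "a \<le> r + 1"
      have e: "((\<lambda>a. E t (a - b) x) has_vector_derivative ?m3 (a - b) x) (at a within {b..r+1})"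
        by (intro has_vector_derivative_shift_left[where f = "\<lambda>r. E t r x"] E_der_r ab)
      have "((\<lambda>a. x + a - b) has_vector_derivative 1) (at a within {b..r+1})" by (auto intro!: derivative_eq_intros)
      moreover have "(q b has_vector_derivative qx b (x + a - b)) (at (x + a - b) within ((\<lambda>a. x + a - b) ` {b..r+1}))"
        using ab r q unfolding xder_def
        by (rule_tac has_vector_derivative_within_subset[of "q b" _ _ "{0..}"]) auto
      ultimately have "((\<lambda>a. q b (x + a - b)) has_vector_derivative qx b (x + a - b)) (at a within {b..r+1})"
        using vector_diff_chain_within[of "\<lambda>a. x + a - b" 1 a "{b..r+1}" "q b" "qx b (x + a - b)"] by (simp add: comp_def)
      from has_vector_derivative_mult[OF e this]
      show "((\<lambda>a. E t (a - b) x * q b (x + a - b)) has_vector_derivative ?f' a b) (at a within {b..r+1})" .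
    qed (use r in auto)
    have I: "integral {0..r} (?f' r) = (Du (E t) qx r x + Du ?m2 q r x) - 2 * \<i> * of_real t * of_real x * Du (E t) q r x"
    proof -
      have "?f' r = (\<lambda>y. (E t (r - y) x * qx y (x + r - y) + ?m2 (r - y) x * q y (x + r - y))
         - (2 * \<i> * of_real t * of_real x) * (E t (r - y) x * q y (x + r - y)))"
        by (auto simp: algebra_simps)
      then show ?thesis
        unfolding Du_def
        by (simp only:) (simp only: integral_add integral_diff integral_mult_right integrable_add integrable_diff integrable_on_mult_right
          integrable_continuous_interval[OF Du_integrand_continuous[OF cE T(1) r]]
          integrable_continuous_interval[OF Du_integrand_continuous[OF cE T(2) r]]
          integrable_continuous_interval[OF Du_integrand_continuous[OF cm2 T(1) r]])
    qed
    have E0: "E t 0 x = 1" by (simp add: E_def)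
    show "((\<lambda>r. Du (E t) q r x) has_vector_derivative
       (Du (E t) qx r x + Du ?m2 q r x) - 2 * \<i> * of_real t * of_real x * Du (E t) q r x + q r x) (at r within {0..})"
    proof (rule has_vector_derivative_eq_rhs)
      show "((\<lambda>r. Du (E t) q r x) has_vector_derivative
         (E t (r - r) x * q r (x + r - r) + integral {0..r} (?f' r))) (at r within {0..})"
        using D by (simp only: Du_def at_within_Icc_Ici less_add_one)
    qed (unfold I, simp add: E0)
  qed
qed

end

lemma tame_bounded_mult:
  assumes m: "continuous_on ({0..} \<times> {0..}) (\<lambda>(r, x). m r x)" and q: "tame q"
    and mb: "\<And>R. \<exists>B. \<forall>r\<in>{0..R}. \<forall>x\<ge>0. cmod (m r x) \<le> B"
  shows "tame (\<lambda>r x. m r x * q r x)"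
proof (rule tameI)
  show "continuous_on ({0..} \<times> {0..}) (\<lambda>(r, x). m r x * q r x)"
    using m tame_continuous[OF q] unfolding case_prod_unfold by (intro continuous_intros)
  fix R :: real
  obtain a C where f: "0 < a" "C \<ge> 0" "\<And>r x. 0 \<le> r \<Longrightarrow> r \<le> R \<Longrightarrow> x \<ge> 0 \<Longrightarrow> cmod (q r x) \<le> C * exp (- a * x)"
    using tameE[OF q, of R] by metis
  obtain B where B: "\<And>r x. r \<in> {0..R} \<Longrightarrow> x \<ge> 0 \<Longrightarrow> cmod (m r x) \<le> B" using mb[of R] by blast
  have "cmod (m r x * q r x) \<le> (B * C) * exp (- a * x)" if "r \<in> {0..R}" "x \<ge> 0" for r x
    unfolding norm_mult mult.assoc
    using that B[OF that] f order_trans[OF norm_ge_zero B[OF that]] by (intro mult_mono) auto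
  then show "\<exists>a>0. \<exists>C. \<forall>r\<in>{0..R}. \<forall>x\<ge>0. cmod (m r x * q r x) \<le> C * exp (- a * x)"
    using f(1) by blast
qed

lemma Gop_diff:
  assumes "exp_decay f" "exp_decay g" "x \<ge> 0"
  shows "Gop (\<lambda>x. f x - g x) x = Gop f x - Gop g x"
  using Gop_add[OF assms(1) exp_decay_cmult[OF assms(2)] assms(3), of "-1"] Gop_cmult[OF assms(2,3), of "-1"]
  by simp

lemma Gop_bound:
  assumes f: "exp_decay f" and a: "0 \<le> a" "a < 1" "C \<ge> 0"
    and le: "\<And>x. x \<ge> 0 \<Longrightarrow> cmod (f x) \<le> C * exp (- a * x)" and x: "x \<ge> 0"
  shows "cmod (Gop f x) \<le> C / (1 - a) * exp (- a * x)"
  unfolding Gop_def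
  by (rule Sop_bound[OF Sst_continuous[OF exp_decay_continuous[OF f]] a Sst_bound[OF f a(1,3) le] x])

lemma has_integral_power_over_fact:
  "r \<ge> 0 \<Longrightarrow> ((\<lambda>y. (b * y) ^ n / fact n) has_integral (b ^ n * r ^ Suc n / fact (Suc n))) {0..r::real}"
proof -
  assume r: "r \<ge> 0"
  have "((\<lambda>y. (b * y) ^ n / fact n) has_integral (b ^ n * r ^ Suc n / fact (Suc n) - b ^ n * 0 ^ Suc n / fact (Suc n))) {0..r}"
  proof (rule fundamental_theorem_of_calculus[OF r])
    fix y assume "y \<in> {0..r}"
    have "((\<lambda>y. b ^ n * y ^ Suc n / fact (Suc n)) has_real_derivative b ^ n * (real (Suc n) * y ^ n) / fact (Suc n)) (at y within {0..r})"
      by (auto intro!: derivative_eq_intros simp del: power_Suc)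
    also have "b ^ n * (real (Suc n) * y ^ n) / fact (Suc n) = (b * y) ^ n / fact n"
      by (simp add: power_mult_distrib fact_Suc del: of_nat_Suc)
    finally show "((\<lambda>y. b ^ n * y ^ Suc n / fact (Suc n)) has_vector_derivative (b * y) ^ n / fact n) (at y within {0..r})"
      by (simp add: has_real_derivative_iff_has_vector_derivative)
  qed
  then show ?thesis by simp
qed

section \<open>Picard iteration for the homogeneous equation with initial value ee\<close>

context ccm
begin

text \<open>The mild form of the equation with initial value \<open>ee\<close>. Transport and
  multiplication by x, both unbounded, are absorbed in the free propagator; only the bounded
  operator \<open>Gop\<close> is iterated.\<close>

definition Phi :: "real \<Rightarrow> (real \<Rightarrow> real \<Rightarrow> complex) \<Rightarrow> real \<Rightarrow> real \<Rightarrow> complex" where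
  "Phi t k r x = E t r x * ee (x + r) + 4 * \<i> * of_real (\<kappa> * t) * Du (E t) (\<lambda>r. Gop (k r)) r x"

lemma ee_add: "ee (x + r) = ee r * ee x"
  by (simp add: ee_def exp_add[symmetric] flip: of_real_mult)

lemma ee_derivative: "(ee has_vector_derivative (- ee x)) (at x within S)"
proof -
  have "((\<lambda>x. exp (- x)) has_real_derivative - exp (- x)) (at x within S)"
    by (auto intro!: derivative_eq_intros)
  from has_vector_derivative_of_real[OF this, where 'a = complex] show ?thesis
    by (simp add: ee_def[abs_def])
qed

lemma ee_shift_derivative: "((\<lambda>x. ee (x + r)) has_vector_derivative (- ee (x + r))) (at x within S)"
  unfolding ee_add using has_vector_derivative_mult_right[OF ee_derivative[of x S], of "ee r"] by simp

lemma E_cont: "continuous_on ({0..} \<times> {0..}) (\<lambda>(r, x). E t r x)"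
  using E_continuous unfolding case_prod_unfold .

lemma tame_ee_shift: "tame (\<lambda>r x. ee (x + r))"
  unfolding ee_add
  by (intro tame_cmult tame_const exp_decay_ee) (auto simp: ee_def intro!: continuous_intros)

text \<open>\<open>Gop\<close> gains a derivative in x, so \<open>Phi t k\<close> is a classical
  solution of the linear problem with source from k even when k is only tame. A fixed point is
  therefore automatically classical.\<close>

lemma Phi_derivatives:
  assumes k: "tame k"
  obtains Px where "xder (Phi t k) Px"
    "tder (Phi t k) (\<lambda>r x. Px r x - 2 * \<i> * of_real t * of_real x * Phi t k r x + 4 * \<i> * of_real (\<kappa> * t) * Gop (k r) x)"
proof -
  let ?F = "\<lambda>r x. E t r x * ee (x + r)"
  let ?Fx = "\<lambda>r x. (- 2 * \<i> * of_real t * of_real r - 1) * (E t r x * ee (x + r))"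
  let ?D = "Du (E t) (\<lambda>r. Gop (k r))"
  let ?Dx = "\<lambda>r x. Du (E t) (\<lambda>r x. Sst (k r) x - Gop (k r) x) r x + Du (\<lambda>r x. (- 2 * \<i> * of_real t * of_real r) * E t r x) (\<lambda>r. Gop (k r)) r x"
  let ?c = "4 * \<i> * of_real (\<kappa> * t)"
  have tF: "tame ?F" by (rule tame_bounded_mult[OF E_cont tame_ee_shift]) auto
  have tFx: "tame ?Fx" by (rule tame_cmult[OF tF]) (auto intro!: continuous_intros)
  have F: "xder ?F ?Fx" unfolding xder_def
  proof (intro conjI allI impI tF tFx)
    fix r x :: real
    show "((\<lambda>x. ?F r x) has_vector_derivative ?Fx r x) (at x within {0..})"
      by (rule has_vector_derivative_eq_rhs[OF has_vector_derivative_mult[OF E_der_x ee_shift_derivative]])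
         (simp add: algebra_simps)
  qed
  have Ft: "tder ?F (\<lambda>r x. ?Fx r x - 2 * \<i> * of_real t * (of_real x * ?F r x))" unfolding tder_def
  proof (intro conjI allI impI tF tame_diff tFx tame_scale tame_times_id)
    fix r x :: real
    have "((\<lambda>r. ee (x + r)) has_vector_derivative (- ee (x + r))) (at r within {0..})"
      using ee_shift_derivative[of x r] by (simp add: add.commute)
    from has_vector_derivative_mult[OF E_der_r this]
    show "((\<lambda>r. ?F r x) has_vector_derivative (?Fx r x - 2 * \<i> * of_real t * (of_real x * ?F r x))) (at r within {0..})"
      by (rule has_vector_derivative_eq_rhs) (simp add: algebra_simps)
  qed
  have D: "xder ?D ?Dx" by (rule duhamel_xder[OF xder_Gop[OF k]])
  have Dt: "tder ?D (\<lambda>r x. ?Dx r x - 2 * \<i> * of_real t * of_real x * ?D r x + Gop (k r) x)"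
    by (rule duhamel_tder[OF xder_Gop[OF k]])
  have X: "xder (Phi t k) (\<lambda>r x. ?Fx r x + ?c * ?Dx r x)"
    unfolding Phi_def by (intro xder_add F xder_cmult[OF D]) auto
  have "tder (Phi t k) (\<lambda>r x. (?Fx r x - 2 * \<i> * of_real t * (of_real x * ?F r x)) +
      ?c * (?Dx r x - 2 * \<i> * of_real t * of_real x * ?D r x + Gop (k r) x))"
    unfolding Phi_def by (intro tder_add Ft tder_scale Dt)
  then have "tder (Phi t k) (\<lambda>r x. (?Fx r x + ?c * ?Dx r x) - 2 * \<i> * of_real t * of_real x * Phi t k r x + ?c * Gop (k r) x)"
    by (rule tder_eqI) (simp add: Phi_def algebra_simps)
  with X show thesis by (rule that)
qed

lemma tame_Phi: "tame k \<Longrightarrow> tame (Phi t k)"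
  using Phi_derivatives[of k t] by (metis xder_def)

lemma Phi_fixpoint_sol:
  assumes k: "tame k" and fxp: "\<And>r x. r \<ge> 0 \<Longrightarrow> x \<ge> 0 \<Longrightarrow> Phi t k r x = k r x"
  shows "\<exists>kx. sol t k kx (\<lambda>_ _. 0)"
proof -
  obtain Px where X: "xder (Phi t k) Px"
    and T: "tder (Phi t k) (\<lambda>r x. Px r x - 2 * \<i> * of_real t * of_real x * Phi t k r x + 4 * \<i> * of_real (\<kappa> * t) * Gop (k r) x)"
    using Phi_derivatives[OF k] by blast
  have "sol t k Px (\<lambda>_ _. 0)" unfolding sol_def
  proof (intro conjI)
    show "xder k Px" unfolding xder_def
    proof (intro conjI allI impI k)
      show "tame Px" using X by (simp add: xder_def)
      fix r x :: real assume "r \<ge> 0" "x \<ge> 0"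
      then show "(k r has_vector_derivative Px r x) (at x within {0..})"
        using X fxp unfolding xder_def by (intro has_vector_derivative_transform[of x "{0..}" "k r" "Phi t k r"]) auto
    qed
    have "tder k (\<lambda>r x. Px r x - 2 * \<i> * of_real t * of_real x * Phi t k r x + 4 * \<i> * of_real (\<kappa> * t) * Gop (k r) x)"
      unfolding tder_def
    proof (intro conjI allI impI k)
      fix r x :: real assume "r \<ge> 0" "x \<ge> 0"
      then show "((\<lambda>r. k r x) has_vector_derivative (Px r x - 2 * \<i> * of_real t * of_real x * Phi t k r x + 4 * \<i> * of_real (\<kappa> * t) * Gop (k r) x)) (at r within {0..})"
        using T fxp unfolding tder_def
        by (intro has_vector_derivative_transform[of r "{0..}" "\<lambda>r. k r x" "\<lambda>r. Phi t k r x"]) auto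
    qed (use T in \<open>simp add: tder_def\<close>)
    then show "tder k (\<lambda>r x. Px r x - 2 * \<i> * of_real t * Lop (k r) x + 0)"
      by (rule tder_eqI) (simp add: fxp Lop_def algebra_simps)
    show "tame (\<lambda>_ _. 0)" using tame_scale[OF k, of 0] by simp
  qed
  then show ?thesis by blast
qed

text \<open>The weight exp(-x/2) is preserved because a left shift does not increase it. For the
  rate 1/2, \<open>Gop_bound\<close> costs a factor 2, whence the constant 8 in place of 4.\<close>

lemma Phi_diff_bound:
  assumes k: "tame k" "tame k'" and r: "r \<ge> 0" "x \<ge> 0"
    and M: "\<And>y. y \<in> {0..r} \<Longrightarrow> M y \<ge> 0" "(M has_integral I) {0..r}"
    and le: "\<And>y x. y \<in> {0..r} \<Longrightarrow> x \<ge> 0 \<Longrightarrow> cmod (k y x - k' y x) \<le> M y * exp (- (1/2) * x)"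
  shows "cmod (Phi t k r x - Phi t k' r x) \<le> 8 * \<kappa> * \<bar>t\<bar> * I * exp (- (1/2) * x)"
proof -
  let ?q = "\<lambda>k y. E t (r - y) x * Gop (k y) (x + r - y)"
  have int: "?q k integrable_on {0..r}" if "tame k" for k
    by (intro integrable_continuous_interval Du_integrand_continuous E_cont tame_Gop that r)
  have "Phi t k r x - Phi t k' r x = 4 * \<i> * of_real (\<kappa> * t) * integral {0..r} (\<lambda>y. ?q k y - ?q k' y)"
    unfolding Phi_def Du_def by (subst integral_diff[OF int[OF k(1)] int[OF k(2)]]) (simp add: algebra_simps)
  then have "cmod (Phi t k r x - Phi t k' r x) = 4 * \<kappa> * \<bar>t\<bar> * cmod (integral {0..r} (\<lambda>y. ?q k y - ?q k' y))"
    using kappa_pos by (simp add: norm_mult abs_mult)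
  also have "\<dots> \<le> 4 * \<kappa> * \<bar>t\<bar> * integral {0..r} (\<lambda>y. M y * (2 * exp (- (1/2) * x)))"
  proof (intro mult_left_mono Henstock_Kurzweil_Integration.integral_norm_bound_integral)
    show "(\<lambda>y. ?q k y - ?q k' y) integrable_on {0..r}" by (intro integrable_diff int k)
    show "(\<lambda>y. M y * (2 * exp (- (1/2) * x))) integrable_on {0..r}"
      using has_integral_mult_left[OF M(2)] by (rule has_integral_integrable)
    fix y assume y: "y \<in> {0..r}"
    then have ry: "y \<ge> 0" "x + r - y \<ge> 0" using r by auto
    have "?q k y - ?q k' y = E t (r - y) x * Gop (\<lambda>x. k y x - k' y x) (x + r - y)"
      unfolding Gop_diff[OF tame_exp_decay[OF k(1) ry(1)] tame_exp_decay[OF k(2) ry(1)] ry(2)] by (simp only: right_diff_distrib)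
    then have "cmod (?q k y - ?q k' y) = cmod (Gop (\<lambda>x. k y x - k' y x) (x + r - y))" by (simp add: norm_mult)
    also have "\<dots> \<le> M y / (1 - 1/2) * exp (- (1/2) * (x + r - y))"
      using y by (intro Gop_bound exp_decay_diff tame_exp_decay[OF k(1)] tame_exp_decay[OF k(2)] le M ry) auto
    also have "\<dots> \<le> M y / (1 - 1/2) * exp (- (1/2) * x)"
      using y M(1)[OF y] by (intro mult_left_mono) auto
    finally show "cmod (?q k y - ?q k' y) \<le> M y * (2 * exp (- (1/2) * x))" by simp
  qed (use kappa_pos in auto)
  also have "integral {0..r} (\<lambda>y. M y * (2 * exp (- (1/2) * x))) = I * (2 * exp (- (1/2) * x))"
    using has_integral_mult_left[OF M(2)] by (rule integral_unique)
  finally show ?thesis by simp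
qed

text \<open>Differences of consecutive iterates are bounded by the terms of the exponential series
  in \<open>8 * \<kappa> * \<bar>t\<bar> * r\<close>, so the iteration converges for every r,
  uniformly on compact r-intervals, with no smallness condition.\<close>

lemma sol_exists: "\<exists>g gx. sol t g gx (\<lambda>_ _. 0) \<and> (\<forall>x\<ge>0. g 0 x = ee x)"
proof -
  define s where "s n = (Phi t ^^ n) (\<lambda>_ _. 0)" for n
  have s_Suc: "s (Suc n) = Phi t (s n)" for n by (simp add: s_def)
  have ts: "tame (s n)" for n
  proof (induction n)
    case 0
    have "tame (\<lambda>_ _. 0)" using tame_scale[OF tame_ee_shift, of 0] by simp
    then show ?case by (simp add: s_def)
  qed (simp add: s_Suc tame_Phi)
  define b where "b = 8 * \<kappa> * \<bar>t\<bar>"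
  have b0: "b \<ge> 0" using kappa_pos by (simp add: b_def)
  define w where "w x = exp (- (1/2) * x)" for x :: real
  have w0: "w x > 0" for x by (simp add: w_def)
  have diff: "cmod (s (Suc n) r x - s n r x) \<le> (b * r) ^ n / fact n * w x" if "r \<ge> 0" "x \<ge> 0" for n r x
    using that
  proof (induction n arbitrary: r x)
    case 0
    have "Gop (\<lambda>_. 0) y = 0" if "y \<ge> 0" for y
      using Gop_cmult[OF exp_decay_ee that, of 0] by simp
    then have "Du (E t) (\<lambda>r. Gop ((\<lambda>_ _. 0) r)) r x = integral {0..r} (\<lambda>y. 0)"
      unfolding Du_def using 0 by (intro integral_cong) auto
    then have "cmod (s (Suc 0) r x - s 0 r x) = exp (- x - r)"
      by (simp add: s_def Phi_def norm_mult ee_def)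
    also have "\<dots> \<le> w x" using 0 by (simp add: w_def)
    finally show ?case by simp
  next
    case (Suc n)
    have "cmod (Phi t (s (Suc n)) r x - Phi t (s n) r x) \<le> 8 * \<kappa> * \<bar>t\<bar> * (b ^ n * r ^ Suc n / fact (Suc n)) * exp (- (1/2) * x)"
      by (rule Phi_diff_bound[OF ts ts Suc.prems, where M = "\<lambda>y. (b * y) ^ n / fact n"])
         (use Suc has_integral_power_over_fact b0 in \<open>auto simp: w_def\<close>)
    also have "8 * \<kappa> * \<bar>t\<bar> * (b ^ n * r ^ Suc n / fact (Suc n)) = (b * r) ^ Suc n / fact (Suc n)"
      unfolding b_def[symmetric] by (simp add: power_mult_distrib)
    finally show ?case by (simp add: s_Suc w_def)
  qed
  have sm: "summable (\<lambda>n. (b * r) ^ n / fact n)" for r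
    using summable_exp[of "b * r"] by (simp add: field_simps)
  define f where "f n r x = s (Suc n) r x - s n r x" for n r x
  have fs: "(\<Sum>i<n. f i r x) = s n r x" for n r x
    by (induction n) (simp_all add: f_def s_def)
  define g where "g r x = (\<Sum>n. f n r x)" for r x
  \<comment> \<open>Tails of that exponential series; they control both the uniform limit and,
    through \<open>Phi_diff_bound\<close>, the passage to the limit inside
    \<open>Phi\<close>.\<close>
  define T where "T n R = (\<Sum>m. (b * R) ^ (m + n) / fact (m + n))" for n R
  have fb: "cmod (f n r x) \<le> (b * R) ^ n / fact n * w x" if "0 \<le> r" "r \<le> R" "x \<ge> 0" for n r x R
  proof -
    have "cmod (f n r x) \<le> (b * r) ^ n / fact n * w x" unfolding f_def by (rule diff) (use that in auto)
    also have "\<dots> \<le> (b * R) ^ n / fact n * w x"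
      using that b0 w0[of x] by (intro mult_right_mono divide_right_mono power_mono mult_left_mono) auto
    finally show ?thesis .
  qed
  have sf: "summable (\<lambda>n. cmod (f n r x))" if "0 \<le> r" "x \<ge> 0" for r x
    by (rule summable_comparison_test'[OF summable_mult2[OF sm[of r], of "w x"], of 0])
       (use fb[OF that(1) order_refl that(2)] in auto)
  have tail: "cmod (g r x - s n r x) \<le> T n R * w x" if rx: "0 \<le> r" "r \<le> R" "x \<ge> 0" for n r x R
  proof -
    have "g r x - s n r x = (\<Sum>m. f (m + n) r x)"
      using suminf_minus_initial_segment[OF summable_norm_cancel[OF sf[OF rx(1,3)]], of n]
      by (simp add: g_def fs)
    also have "cmod \<dots> \<le> (\<Sum>m. cmod (f (m + n) r x))"
      by (rule summable_norm) (rule summable_ignore_initial_segment[OF sf[OF rx(1,3)]])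
    also have "\<dots> \<le> (\<Sum>m. (b * R) ^ (m + n) / fact (m + n) * w x)"
      by (rule suminf_le[OF fb[OF rx] summable_ignore_initial_segment[OF sf[OF rx(1,3)]]
            summable_ignore_initial_segment[OF summable_mult2[OF sm]]])
    also have "\<dots> = T n R * w x" unfolding T_def
      by (rule suminf_mult2[symmetric, OF summable_ignore_initial_segment[OF sm]])
    finally show ?thesis .
  qed
  have Tlim: "(\<lambda>n. T n R) \<longlonglongrightarrow> 0" for R
  proof -
    have "T n R = (\<Sum>m. (b * R) ^ m / fact m) - (\<Sum>m<n. (b * R) ^ m / fact m)" for n
      unfolding T_def by (rule suminf_minus_initial_segment[OF sm])
    moreover have "(\<lambda>n. (\<Sum>m. (b * R) ^ m / fact m) - (\<Sum>m<n. (b * R) ^ m / fact m)) \<longlonglongrightarrow>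
        (\<Sum>m. (b * R) ^ m / fact m) - (\<Sum>m. (b * R) ^ m / fact m)"
      by (intro tendsto_intros summable_LIMSEQ sm)
    ultimately show ?thesis by simp
  qed
  have tg: "tame g"
  proof (rule tameI)
    show "continuous_on ({0..} \<times> {0..}) (\<lambda>(r, x). g r x)"
    proof (rule continuous_on_quadrant_local)
      fix R :: real assume "R > 0"
      have "uniform_limit ({0..R} \<times> {0..}) (\<lambda>n (r, x). s n r x) (\<lambda>(r, x). g r x) sequentially"
        unfolding uniform_limit_iff
      proof (intro allI impI)
        fix e :: real assume "e > 0"
        then have "\<forall>\<^sub>F n in sequentially. T n R < e" by (rule order_tendstoD(2)[OF Tlim])
        then show "\<forall>\<^sub>F n in sequentially. \<forall>z\<in>{0..R} \<times> {0..}. dist (case z of (r, x) \<Rightarrow> s n r x) (case z of (r, x) \<Rightarrow> g r x) < e"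
        proof eventually_elim
          case (elim n)
          have "dist (s n r x) (g r x) < e" if "0 \<le> r" "r \<le> R" "x \<ge> 0" for r x
          proof -
            have "T n R \<ge> 0" using tail[OF that, of n] w0[of x]
              by (metis norm_ge_zero order_trans zero_le_mult_iff not_le)
            have "dist (s n r x) (g r x) \<le> T n R * w x" using tail[OF that, of n] by (simp add: dist_norm norm_minus_commute)
            also have "\<dots> \<le> T n R * 1" using \<open>T n R \<ge> 0\<close> that by (intro mult_left_mono) (auto simp: w_def)
            finally show ?thesis using elim by simp
          qed
          then show ?case by auto
        qed
      qed
      then show "continuous_on ({0..R} \<times> {0..}) (\<lambda>(r, x). g r x)"
        by (rule uniform_limit_theorem[rotated])
           (auto intro!: continuous_on_subset[OF tame_continuous[OF ts]] always_eventually)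
    qed
    fix R :: real
    have "cmod (g r x) \<le> T 0 R * exp (- (1/2) * x)" if "r \<in> {0..R}" "x \<ge> 0" for r x
      using tail[of r R x 0] that by (simp add: s_def w_def)
    moreover have "(1/2::real) > 0" by simp
    ultimately show "\<exists>a>0. \<exists>C. \<forall>r\<in>{0..R}. \<forall>x\<ge>0. cmod (g r x) \<le> C * exp (- a * x)"
      by blast
  qed
  have fixp: "Phi t g r x = g r x" if rx: "r \<ge> 0" "x \<ge> 0" for r x
  proof -
    have "(\<lambda>n. s (Suc n) r x) \<longlonglongrightarrow> Phi t g r x"
    proof (rule Lim_transform_bound[THEN LIM_zero_cancel])
      show "(\<lambda>n. 8 * \<kappa> * \<bar>t\<bar> * (r * T n r) * exp (- (1/2) * x)) \<longlonglongrightarrow> 0"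
        using tendsto_mult_right_zero[OF Tlim[of r], of "8 * \<kappa> * \<bar>t\<bar> * r * exp (- (1/2) * x)"]
        by (simp add: mult_ac)
      have "norm (s (Suc n) r x - Phi t g r x) \<le> 8 * \<kappa> * \<bar>t\<bar> * (r * T n r) * exp (- (1/2) * x)" for n
      proof -
        have T0: "T n r \<ge> 0"
          unfolding T_def using b0 rx by (intro suminf_nonneg summable_ignore_initial_segment[OF sm]) auto
        have "norm (Phi t g r x - Phi t (s n) r x) \<le> 8 * \<kappa> * \<bar>t\<bar> * (r * T n r) * exp (- (1/2) * x)"
        proof (rule Phi_diff_bound[OF tg ts rx, where M = "\<lambda>_. T n r"])
          show "((\<lambda>_. T n r) has_integral r * T n r) {0..r}"
            using has_integral_const_real[of "T n r" 0 r] rx by simp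
        qed (use tail T0 in \<open>auto simp: w_def\<close>)
        then show ?thesis by (simp add: s_Suc norm_minus_commute)
      qed
      then show "\<forall>\<^sub>F n in sequentially. norm (s (Suc n) r x - Phi t g r x) \<le> norm (8 * \<kappa> * \<bar>t\<bar> * (r * T n r) * exp (- (1/2) * x))"
        by (intro always_eventually allI) (simp only: real_norm_def order_trans[OF _ abs_ge_self])
    qed
    moreover have "(\<lambda>n. s (Suc n) r x) \<longlonglongrightarrow> g r x"
      using LIMSEQ_Suc[OF summable_LIMSEQ[OF summable_norm_cancel[OF sf[OF rx]]]] by (simp add: fs g_def)
    ultimately show ?thesis by (rule LIMSEQ_unique)
  qed
  obtain gx where "sol t g gx (\<lambda>_ _. 0)" using Phi_fixpoint_sol[OF tg fixp] by blast
  moreover have "g 0 x = ee x" if "x \<ge> 0" for x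
    using fixp[of 0 x] that by (simp add: Phi_def Du_def E_def)
  ultimately show ?thesis by blast
qed

end

section \<open>The trajectory and its derivative in time\<close>

lemma halfline_derivative_le:
  fixes f g :: "real \<Rightarrow> real"
  assumes "\<And>r. r \<ge> 0 \<Longrightarrow> (f has_vector_derivative f' r) (at r within {0..})"
    and "\<And>r. r \<ge> 0 \<Longrightarrow> (g has_vector_derivative g' r) (at r within {0..})"
    and "\<And>r. 0 \<le> r \<Longrightarrow> r \<le> R \<Longrightarrow> f' r \<le> g' r" and "R \<ge> 0"
  shows "f R - f 0 \<le> g R - g 0"
  by (rule has_integral_le[OF FTC_halfline_finite[OF assms(1,4)] FTC_halfline_finite[OF assms(2,4)]])
     (use assms(3) in auto)

lemma tame_nsq_continuous: "tame s \<Longrightarrow> continuous_on {0..} (\<lambda>r. nsq (s r))"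
proof -
  assume s: "tame s"
  have "continuous_on {0..} (\<lambda>r. \<integral>x. s r x * cnj (s r x) \<partial>hl)"
    by (intro tame_integral_continuous tame_mult tame_cnj s)
  then have "continuous_on {0..} (\<lambda>r. Re (complex_of_real (nsq (s r))))"
    unfolding ip_self[symmetric] ip_def by (intro continuous_intros)
  then show ?thesis by simp
qed

lemma tame_bounds:
  assumes s: "tame s"
  obtains S B where "S \<ge> 0" "B \<ge> 0" "\<And>r. 0 \<le> r \<Longrightarrow> r \<le> R \<Longrightarrow> nsq (s r) \<le> S"
    "\<And>r x. 0 \<le> r \<Longrightarrow> r \<le> R \<Longrightarrow> x \<ge> 0 \<Longrightarrow> cmod (s r x) \<le> B"
proof -
  obtain a C where aC: "0 < a" "C \<ge> 0" "\<And>r x. 0 \<le> r \<Longrightarrow> r \<le> R \<Longrightarrow> x \<ge> 0 \<Longrightarrow> cmod (s r x) \<le> C * exp (- a * x)"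
    using tameE[OF s, of R] by metis
  have B: "cmod (s r x) \<le> C" if "0 \<le> r" "r \<le> R" "x \<ge> 0" for r x
    using aC(3)[OF that] mult_left_mono[OF _ aC(2), of "exp (- a * x)" 1] aC(1) that by (auto intro: order_trans)
  have "continuous_on {0..} (\<lambda>r. complex_of_real (nsq (s r)))"
    by (intro continuous_intros tame_nsq_continuous s)
  then obtain S where S: "S \<ge> 0" "\<And>r. 0 \<le> r \<Longrightarrow> r \<le> R \<Longrightarrow> cmod (complex_of_real (nsq (s r))) \<le> S"
    using continuous_on_Icc_bounded by metis
  show thesis by (rule that[OF S(1) aC(2) _ B]) (use S(2) in auto)
qed

lemma nsq_cmult: "nsq (\<lambda>x. c * f x) = (cmod c)\<^sup>2 * nsq f"
  unfolding nsq_def by (simp add: norm_mult power_mult_distrib)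

lemma nsq_zero [simp]: "nsq (\<lambda>_. 0) = 0" by (simp add: nsq_def)

lemma ell_zero [simp]: "ell (\<lambda>_. 0) = 0" by (simp add: ell_def)

lemma Gop_zero [simp]: "Gop (\<lambda>_. 0) x = 0"
  by (simp add: Gop_def Sop_def Sst_def)

lemma nsq_le_of_cmod:
  assumes "exp_decay f" "exp_decay g" "\<And>x. x \<ge> 0 \<Longrightarrow> cmod (f x) \<le> cmod (g x)"
  shows "nsq f \<le> nsq g"
  unfolding nsq_def
  by (intro integral_mono exp_decay_cmod_square_integrable assms power_mono) (use assms in auto)

context ccm
begin

lemma Lop_zero [simp]: "Lop (\<lambda>_. 0) x = 0" by (simp add: Lop_def)

lemma sol_nsq_derivative:
  assumes h: "sol t h hx s" and r: "r \<ge> 0"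
  shows "((\<lambda>r. nsq (h r)) has_vector_derivative (2 * Re (ip (s r) (h r)) - (cmod (h r 0))\<^sup>2)) (at r within {0..})"
proof -
  have "ip (h r) (s r) = cnj (ip (s r) (h r))" by (simp add: ip_cnj)
  then have "Re (- (h r 0 * cnj (h r 0)) + ip (s r) (h r) + ip (h r) (s r)) = 2 * Re (ip (s r) (h r)) - (cmod (h r 0))\<^sup>2"
    unfolding cmod_power2 by (simp add: power2_eq_square)
  then show ?thesis
    using bounded_linear.has_vector_derivative[OF bounded_linear_Re sol_energy[OF h h r]]
    by (simp only: ip_self Re_complex_of_real)
qed

text \<open>Gronwall's argument with integrating factor exp(-r); the boundary term has a favourable
  sign and is dropped.\<close>

lemma sol_nsq_growth:
  assumes h: "sol t h hx s" and R: "R \<ge> 0" and S: "\<And>r. 0 \<le> r \<Longrightarrow> r \<le> R \<Longrightarrow> nsq (s r) \<le> S"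
    and h0: "nsq (h 0) = 0" and r: "0 \<le> r" "r \<le> R"
  shows "nsq (h r) \<le> R * exp R * S"
proof -
  have S0: "S \<ge> 0" using S[of 0] R nsq_nonneg[of "s 0"] by linarith
  let ?d = "\<lambda>r. 2 * Re (ip (s r) (h r)) - (cmod (h r 0))\<^sup>2"
  have "exp (- r) * nsq (h r) - exp (- 0) * nsq (h 0) \<le> S * r - S * 0"
  proof (rule halfline_derivative_le[OF _ _ _ r(1)])
    fix a :: real assume a: "a \<ge> 0"
    show "((\<lambda>r. exp (- r) * nsq (h r)) has_vector_derivative (exp (- a) * ?d a + (- exp (- a)) * nsq (h a))) (at a within {0..})"
      by (intro has_vector_derivative_mult sol_nsq_derivative[OF h a])
         (auto intro!: derivative_eq_intros simp: has_real_derivative_iff_has_vector_derivative[symmetric])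
    show "((\<lambda>r. S * r) has_vector_derivative S) (at a within {0..})"
      by (auto intro!: derivative_eq_intros)
  next
    fix a assume a: "0 \<le> a" "a \<le> r"
    note E = sol_tame[OF h, THEN tame_exp_decay, OF a(1)]
    have "2 * Re (ip (s a) (h a)) \<le> 2 * (sqrt (nsq (s a)) * sqrt (nsq (h a)))"
      using complex_Re_le_cmod[of "ip (s a) (h a)"] ip_le[OF E(3,1)] by linarith
    also have "\<dots> \<le> (sqrt (nsq (s a)))\<^sup>2 + (sqrt (nsq (h a)))\<^sup>2"
      using sum_squares_bound[of "sqrt (nsq (s a))" "sqrt (nsq (h a))"] by simp
    also have "\<dots> = nsq (s a) + nsq (h a)" by simp
    also have "\<dots> \<le> S + nsq (h a)" using S[of a] a r by simp
    finally have "?d a - nsq (h a) \<le> S" using zero_le_power2[of "cmod (h a 0)"] by linarith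
    then have "exp (- a) * (?d a - nsq (h a)) \<le> exp (- a) * S" by (intro mult_left_mono) auto
    also have "\<dots> \<le> 1 * S" using a S0 by (intro mult_right_mono) auto
    finally show "exp (- a) * ?d a + (- exp (- a)) * nsq (h a) \<le> S" by (simp add: algebra_simps)
  qed
  then have "nsq (h r) \<le> exp r * (S * r)" using h0 by (simp add: exp_minus field_simps)
  also have "\<dots> \<le> exp R * (S * R)" using r S0 by (intro mult_mono) auto
  finally show ?thesis by (simp add: mult_ac)
qed

text \<open>The constant depends on s, T and R, but not on t or the amplitude c. With c = 0 this is
  uniqueness of the boundary values, with c proportional to a time increment Lipschitz continuity,
  and with its square differentiability in time. The energy is bounded first, and then gives the
  pointwise bound along characteristics.\<close>

lemma sol_perturb_bound:
  assumes s: "tame s" and R: "R \<ge> 0"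
  obtains C where "C \<ge> 0" "\<And>t d dx c r. \<bar>t\<bar> \<le> T \<Longrightarrow> sol t d dx (\<lambda>r x. c * s r x) \<Longrightarrow> (\<And>x. x \<ge> 0 \<Longrightarrow> d 0 x = 0) \<Longrightarrow>
     0 \<le> r \<Longrightarrow> r \<le> R \<Longrightarrow> cmod (d r 0) \<le> C * cmod c"
proof -
  obtain S B where SB: "S \<ge> 0" "B \<ge> 0" "\<And>r. 0 \<le> r \<Longrightarrow> r \<le> R \<Longrightarrow> nsq (s r) \<le> S"
    "\<And>r x. 0 \<le> r \<Longrightarrow> r \<le> R \<Longrightarrow> x \<ge> 0 \<Longrightarrow> cmod (s r x) \<le> B"
    using tame_bounds[OF s] by metis
  let ?C = "R * (4 * \<kappa> * \<bar>T\<bar> * sqrt (R * exp R * S) + B)"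
  show thesis
  proof (rule that[of ?C])
    show "?C \<ge> 0" using R SB kappa_pos by auto
    fix t d dx c r assume t: "\<bar>t\<bar> \<le> T" and d: "sol t d dx (\<lambda>r x. c * s r x)" "\<And>x. x \<ge> 0 \<Longrightarrow> d 0 x = 0"
      and r: "0 \<le> r" "r \<le> R"
    have d0: "nsq (d 0) = 0" using nsq_cong[of "d 0" "\<lambda>_. 0"] d(2) by simp
    have "nsq (d a) \<le> R * exp R * ((cmod c)\<^sup>2 * S)" if "0 \<le> a" "a \<le> R" for a
      by (rule sol_nsq_growth[OF d(1) R _ d0 that]) (simp add: nsq_cmult SB mult_left_mono)
    then have A: "sqrt (nsq (d a)) \<le> cmod c * sqrt (R * exp R * S)" if "0 \<le> a" "a \<le> R" for a
      using real_sqrt_le_mono[of "nsq (d a)" "(cmod c)\<^sup>2 * (R * exp R * S)"] that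
      by (simp add: real_sqrt_mult mult_ac)
    have "cmod (d r 0) \<le> cmod (d 0 r) + r * (4 * \<kappa> * \<bar>t\<bar> * (cmod c * sqrt (R * exp R * S)) + cmod c * B)"
    proof (rule sol_sup_bound[OF d(1) r(1)])
      show "sqrt (nsq (d a)) \<le> cmod c * sqrt (R * exp R * S)" if "0 \<le> a" "a \<le> r" for a
        using A that r by simp
      show "cmod (c * s a x) \<le> cmod c * B" if "0 \<le> a" "a \<le> r" "x \<ge> 0" for a x
        using SB(4)[of a x] that r by (simp add: norm_mult mult_left_mono)
    qed
    also have "\<dots> \<le> 0 + R * (4 * \<kappa> * \<bar>T\<bar> * (cmod c * sqrt (R * exp R * S)) + cmod c * B)"
    proof (rule add_mono)
      have X: "0 \<le> cmod c * sqrt (R * exp R * S)" using SB R by simp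
      have "4 * \<kappa> * \<bar>t\<bar> * (cmod c * sqrt (R * exp R * S)) \<le> 4 * \<kappa> * \<bar>T\<bar> * (cmod c * sqrt (R * exp R * S))"
        using t kappa_pos by (intro mult_right_mono mult_left_mono X) auto
      moreover have "0 \<le> 4 * \<kappa> * \<bar>t\<bar> * (cmod c * sqrt (R * exp R * S))" "0 \<le> cmod c * B"
        using X kappa_pos SB by (auto intro!: mult_nonneg_nonneg)
      ultimately show "r * (4 * \<kappa> * \<bar>t\<bar> * (cmod c * sqrt (R * exp R * S)) + cmod c * B)
          \<le> R * (4 * \<kappa> * \<bar>T\<bar> * (cmod c * sqrt (R * exp R * S)) + cmod c * B)"
        using r R by (intro mult_mono) linarith+
    qed (use d(2)[OF r(1)] in simp)
    also have "\<dots> = ?C * cmod c" by (simp add: algebra_simps)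
    finally show "cmod (d r 0) \<le> ?C * cmod c" .
  qed
qed

text \<open>A solution is picked by choice; \<open>sol_trace_eq_gam\<close> shows that its boundary
  values do not depend on the choice.\<close>

definition gg :: "real \<Rightarrow> real \<Rightarrow> real \<Rightarrow> complex" where
  "gg t = (SOME g. (\<exists>gx. sol t g gx (\<lambda>_ _. 0)) \<and> (\<forall>x\<ge>0. g 0 x = ee x))"

definition ggx :: "real \<Rightarrow> real \<Rightarrow> real \<Rightarrow> complex" where
  "ggx t = (SOME gx. sol t (gg t) gx (\<lambda>_ _. 0))"

lemma gg_spec: "(\<exists>gx. sol t (gg t) gx (\<lambda>_ _. 0)) \<and> (\<forall>x\<ge>0. gg t 0 x = ee x)"
proof -
  obtain g gx where "sol t g gx (\<lambda>_ _. 0)" "\<forall>x\<ge>0. g 0 x = ee x" using sol_exists by metis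
  then have "\<exists>g. (\<exists>gx. sol t g gx (\<lambda>_ _. 0)) \<and> (\<forall>x\<ge>0. g 0 x = ee x)"
    by (intro exI[of _ g] conjI exI[of _ gx])
  from someI_ex[OF this] show ?thesis unfolding gg_def .
qed

lemma gg_sol: "sol t (gg t) (ggx t) (\<lambda>_ _. 0)"
  unfolding ggx_def by (rule someI_ex[OF conjunct1[OF gg_spec]])

lemma gg_0: "x \<ge> 0 \<Longrightarrow> gg t 0 x = ee x" using gg_spec by blast

definition gam :: "real \<Rightarrow> real \<Rightarrow> complex" where "gam t r = gg t r 0"

definition N :: "real \<Rightarrow> real \<Rightarrow> real" where "N t r = nsq (gg t r)"

text \<open>At stable times this is, up to a constant, the Fourier transform of the density
  \<open>|u(t)|^2\<close> at frequency r, as \<open>corr_uh\<close> shows.\<close>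

definition mt :: "real \<Rightarrow> real \<Rightarrow> complex" where "mt t r = ell (gg t r)"

lemmas gg_tame = sol_tame(1)[OF gg_sol]

lemma gg_exp_decay: "r \<ge> 0 \<Longrightarrow> exp_decay (gg t r)"
  by (rule tame_exp_decay[OF gg_tame])

lemma gam_0 [simp]: "gam t 0 = 1" by (simp add: gam_def gg_0)

lemma N_0 [simp]: "N t 0 = 1 / 2"
  unfolding N_def nsq_ee[symmetric] by (rule nsq_cong) (rule gg_0)

lemma N_nonneg [simp]: "N t r \<ge> 0" by (simp add: N_def)

lemma tame_trace_continuous: "tame h \<Longrightarrow> continuous_on {0..} (\<lambda>r. h r 0)"
  by (rule tame_compose) (auto intro!: continuous_intros)

lemma gam_continuous: "continuous_on {0..} (gam t)"
  unfolding gam_def by (rule tame_trace_continuous[OF gg_tame])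

lemma mt_continuous: "continuous_on {0..} (mt t)"
  unfolding mt_def by (rule tame_ell_continuous[OF gg_tame])

lemma sol_nsq_eq:
  assumes h: "sol t h hx (\<lambda>_ _. 0)" and r: "r \<ge> 0"
  shows "((\<lambda>y. (cmod (h y 0))\<^sup>2) has_integral (nsq (h 0) - nsq (h r))) {0..r}"
proof -
  have "((\<lambda>y. 2 * Re (ip (\<lambda>_. 0) (h y)) - (cmod (h y 0))\<^sup>2) has_integral nsq (h r) - nsq (h 0)) {0..r}"
    by (rule FTC_halfline_finite[OF sol_nsq_derivative[OF h] r])
  from has_integral_neg[OF this] show ?thesis by (simp add: ip_def)
qed

lemma N_eq: "r \<ge> 0 \<Longrightarrow> ((\<lambda>y. (cmod (gam t y))\<^sup>2) has_integral (1 / 2 - N t r)) {0..r}"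
  using sol_nsq_eq[OF gg_sol, of r t] N_0[of t] unfolding gam_def N_def by simp

lemma N_derivative: "r \<ge> 0 \<Longrightarrow> (N t has_vector_derivative (- (cmod (gam t r))\<^sup>2)) (at r within {0..})"
  using sol_nsq_derivative[OF gg_sol, of r t] unfolding gam_def N_def[abs_def] by (simp add: ip_def)

lemma sol_nsq_antimono:
  assumes h: "sol t h hx (\<lambda>_ _. 0)" and r: "0 \<le> r" "r \<le> r'"
  shows "nsq (h r') \<le> nsq (h r)"
proof -
  have "((\<lambda>y. 2 * Re (ip (\<lambda>_. 0) (h y)) - (cmod (h y 0))\<^sup>2) has_integral nsq (h r') - nsq (h r)) {r..r'}"
    using r by (intro fundamental_theorem_of_calculus has_vector_derivative_within_subset[OF sol_nsq_derivative[OF h]]) auto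
  from has_integral_nonneg[OF has_integral_neg[OF this]] have "0 \<le> - (nsq (h r') - nsq (h r))"
    by (simp add: ip_def)
  then show ?thesis by simp
qed

lemma N_antimono: "0 \<le> r \<Longrightarrow> r \<le> r' \<Longrightarrow> N t r' \<le> N t r"
  unfolding N_def by (rule sol_nsq_antimono[OF gg_sol])

lemma N_le_half: "0 \<le> r \<Longrightarrow> N t r \<le> 1 / 2"
  using N_antimono[of 0 r t] by simp

text \<open>The difference of two solutions starting from \<open>ee\<close> has zero data and zero
  source, so \<open>sol_perturb_bound\<close> with amplitude 0 annihilates its trace.\<close>

lemma sol_trace_eq_gam:
  assumes h: "sol t h hx (\<lambda>_ _. 0)" and h0: "\<And>x. x \<ge> 0 \<Longrightarrow> h 0 x = ee x" and r: "r \<ge> 0"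
  shows "h r 0 = gam t r"
proof -
  have S: "sol t (\<lambda>r x. h r x - gg t r x) (\<lambda>r x. hx r x - ggx t r x) (\<lambda>_ _. 0 * 0)"
    using sol_diff[OF h gg_sol] by simp
  obtain C where C: "\<And>t' d dx c a. \<bar>t'\<bar> \<le> \<bar>t\<bar> \<Longrightarrow> sol t' d dx (\<lambda>_ _. c * 0) \<Longrightarrow> (\<And>x. x \<ge> 0 \<Longrightarrow> d 0 x = 0) \<Longrightarrow>
     0 \<le> a \<Longrightarrow> a \<le> r \<Longrightarrow> cmod (d a 0) \<le> C * cmod c"
    using sol_perturb_bound[OF sol_tame(3)[OF gg_sol] r] by metis
  have "cmod (h r 0 - gg t r 0) \<le> C * cmod 0"
    by (rule C[OF _ S _ r order_refl]) (auto simp: gg_0 h0)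
  then show ?thesis by (simp add: gam_def)
qed

lemma gam_uminus: assumes r: "r \<ge> 0" shows "gam (- t) r = cnj (gam t r)"
proof -
  have S: "sol (- t) (\<lambda>r x. cnj (gg t r x)) (\<lambda>r x. cnj (ggx t r x)) (\<lambda>_ _. 0)"
    using sol_cnj[OF gg_sol[of t]] by simp
  have "cnj (gg t r 0) = gam (- t) r"
    by (rule sol_trace_eq_gam[OF S _ r]) (auto simp: gg_0 ee_def)
  then show ?thesis by (simp add: gam_def)
qed

lemma N_uminus: assumes r: "r \<ge> 0" shows "N (- t) r = N t r"
proof -
  have "((\<lambda>y. (cmod (gam (- t) y))\<^sup>2) has_integral (1 / 2 - N t r)) {0..r}"
    by (rule has_integral_eq[OF _ N_eq[OF r]]) (simp add: gam_uminus)
  from has_integral_unique[OF this N_eq[OF r]] show ?thesis by simp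
qed

lemma sol_ip_eq:
  assumes h: "sol t h hx (\<lambda>_ _. 0)" and k: "sol t k kx (\<lambda>_ _. 0)" and r: "r \<ge> 0"
  shows "ip (h 0) (k 0) = ip (h r) (k r) + integral {0..r} (\<lambda>y. h y 0 * cnj (k y 0))"
proof -
  have "((\<lambda>y. - (h y 0 * cnj (k y 0)) + ip (\<lambda>_. 0) (k y) + ip (h y) (\<lambda>_. 0)) has_integral
      (ip (h r) (k r) - ip (h 0) (k 0))) {0..r}"
    by (rule FTC_halfline_finite[OF sol_energy[OF h k] r])
  then have "((\<lambda>y. - (h y 0 * cnj (k y 0))) has_integral (ip (h r) (k r) - ip (h 0) (k 0))) {0..r}"
    by (simp add: ip_def)
  from integral_unique[OF has_integral_neg[OF this]] show ?thesis by simp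
qed

text \<open>\<open>ell\<close> is the pairing with \<open>ee\<close>, the initial value of
  \<open>gg t\<close>. Transporting both arguments over a length K conserves the pairing except for
  the boundary contributions. Whether the remaining inner product tends to 0 as K grows is exactly
  where stability enters.\<close>

lemma ell_split:
  assumes h: "sol t h hx (\<lambda>_ _. 0)" and r: "r \<ge> 0" and K: "K \<ge> 0"
  shows "ell (h r) = ip (h (r + K)) (gg t K) + integral {0..K} (\<lambda>y. h (r + y) 0 * cnj (gam t y))"
proof -
  have "sol t (\<lambda>y. h (r + y)) (\<lambda>y. hx (r + y)) (\<lambda>_ _. 0)" using sol_shift[OF h r] by simp
  from sol_ip_eq[OF this gg_sol K] have "ip (h r) (gg t 0) = ip (h (r + K)) (gg t K) + integral {0..K} (\<lambda>y. h (r + y) 0 * cnj (gam t y))"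
    by (simp add: gam_def)
  then show ?thesis unfolding ell_ip using ip_cong[of "h r" "h r" "gg t 0" ee] gg_0 by simp
qed

section \<open>Differentiability in time of the boundary values\<close>

definition Ec :: "real \<Rightarrow> real \<Rightarrow> real \<Rightarrow> complex" where
  "Ec t r x = (- 2 * \<i> * of_real r) * Lop (gg t r) x + (- \<i> * of_real (r\<^sup>2)) * gg t r x
     + 4 * \<i> * of_real \<kappa> * conv (\<lambda>y. of_real y * mt t y) (gg t) r x"

text \<open>\<open>Ec t\<close> is the \<open>t\<close>-derivative of \<open>gg t\<close>; the commutator of \<open>A\<close> and \<open>L\<close> makes it explicit.\<close>

lemma Ec_sol: "\<exists>ex. sol t (Ec t) ex (\<lambda>r x. - 2 * \<i> * Lop (gg t r) x)"
proof -
  have c: "continuous_on {0..} (\<lambda>y. of_real y * mt t y)" by (intro continuous_intros mt_continuous)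
  have d1: "((\<lambda>r. - 2 * \<i> * of_real r) has_vector_derivative - 2 * \<i>) (at r within {0..})" for r
    by (rule has_vector_derivative_eq_rhs[OF has_vector_derivative_mult_right[OF has_vector_derivative_of_real[OF DERIV_ident]]]) simp
  have d2: "((\<lambda>r. - \<i> * of_real (r\<^sup>2)) has_vector_derivative - \<i> * of_real (2 * r)) (at r within {0..})" for r
    by (intro has_vector_derivative_mult_right has_vector_derivative_of_real) (auto intro!: derivative_eq_intros)
  have c2: "continuous_on {0..} (\<lambda>r. - \<i> * complex_of_real (2 * r))" by (intro continuous_intros)
  obtain ax where A: "sol t (\<lambda>r x. (- 2 * \<i> * of_real r) * Lop (gg t r) x) ax
      (\<lambda>r x. (- 2 * \<i> * of_real r) * (Lop (\<lambda>_. 0) x - gg t r x + of_real (2 * \<kappa>) * ell (gg t r) * ee x) + (- 2 * \<i>) * Lop (gg t r) x)"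
    using sol_cmult[OF sol_Lop[OF gg_sol] d1] by auto
  obtain bx where B: "sol t (\<lambda>r x. (- \<i> * of_real (r\<^sup>2)) * gg t r x) bx
      (\<lambda>r x. (- \<i> * of_real (r\<^sup>2)) * 0 + (- \<i> * of_real (2 * r)) * gg t r x)"
    using sol_cmult[OF gg_sol d2 c2] by blast
  obtain cx where C: "sol t (\<lambda>r x. 4 * \<i> * of_real \<kappa> * conv (\<lambda>y. of_real y * mt t y) (gg t) r x) cx
      (\<lambda>r x. 4 * \<i> * of_real \<kappa> * (of_real r * mt t r * gg t 0 x))"
    using sol_scale[OF sol_conv[OF c gg_sol]] by blast
  \<comment> \<open>The sources proportional to \<open>r * gg\<close> cancel between the first two
    terms, those proportional to \<open>r * mt * ee\<close> between the first and the convolution.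
    The product rule leaves \<open>-2 * \<i> * Lop (gg t r)\<close>, the source created by
    differentiating the equation in t.\<close>
  have "sol t (Ec t) (\<lambda>r x. ax r x + bx r x + cx r x) (\<lambda>r x. - 2 * \<i> * Lop (gg t r) x)"
    unfolding Ec_def
    by (rule sol_cong[OF sol_add[OF sol_add[OF A B] C]]) (simp add: gg_0 mt_def algebra_simps)
  then show ?thesis by blast
qed

lemma Ec_0: "x \<ge> 0 \<Longrightarrow> Ec t 0 x = 0" by (simp add: Ec_def conv_def)

lemma gam_lipschitz:
  assumes R: "R \<ge> 0"
  obtains C where "C \<ge> 0" "\<And>t' r. \<bar>t' - t\<bar> \<le> 1 \<Longrightarrow> 0 \<le> r \<Longrightarrow> r \<le> R \<Longrightarrow> cmod (gam t' r - gam t r) \<le> C * \<bar>t' - t\<bar>"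
proof -
  obtain C where C: "C \<ge> 0" "\<And>t' d dx c r. \<bar>t'\<bar> \<le> \<bar>t\<bar> + 1 \<Longrightarrow> sol t' d dx (\<lambda>r x. c * Lop (gg t r) x) \<Longrightarrow>
      (\<And>x. x \<ge> 0 \<Longrightarrow> d 0 x = 0) \<Longrightarrow> 0 \<le> r \<Longrightarrow> r \<le> R \<Longrightarrow> cmod (d r 0) \<le> C * cmod c"
    using sol_perturb_bound[OF tame_Lop[OF gg_tame[of t]] R, of "\<bar>t\<bar> + 1"] by metis
  show thesis
  proof (rule that[of "2 * C"])
    fix t' r assume t': "\<bar>t' - t\<bar> \<le> 1" and r: "0 \<le> r" "r \<le> R"
    have s: "sol t' (\<lambda>r x. gg t' r x - gg t r x) (\<lambda>r x. ggx t' r x - ggx t r x) (\<lambda>r x. (- 2 * \<i> * of_real (t' - t)) * Lop (gg t r) x)"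
      by (rule sol_cong[OF sol_diff[OF gg_sol sol_change_t[OF gg_sol]]]) simp
    have "cmod (gg t' r 0 - gg t r 0) \<le> C * cmod (- 2 * \<i> * of_real (t' - t))"
      by (rule C(2)[OF _ s _ r]) (use t' in \<open>auto simp: gg_0\<close>)
    also have "cmod (- 2 * \<i> * of_real (t' - t)) = 2 * \<bar>t' - t\<bar>" unfolding norm_mult norm_of_real by simp
    finally show "cmod (gam t' r - gam t r) \<le> 2 * C * \<bar>t' - t\<bar>" by (simp add: gam_def mult_ac)
  qed (use C in simp)
qed

text \<open>The first order Taylor remainder of \<open>gg\<close> in time solves the equation at t'
  with zero data and a source of size \<open>(t' - t)^2\<close>, hence its trace is quadratically
  small. In the trace of \<open>Ec\<close> the term with \<open>Lop\<close> vanishes, which leaves a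
  closed formula in \<open>gam\<close> and \<open>mt\<close>.\<close>

lemma gam_t_derivative:
  assumes R: "R \<ge> 0"
  shows "((\<lambda>t. gam t R) has_vector_derivative
    (- \<i> * of_real (R\<^sup>2) * gam t R + 4 * \<i> * of_real \<kappa> * integral {0..R} (\<lambda>y. of_real y * mt t y * gam t (R - y)))) (at t)"
proof -
  obtain ex where Es: "sol t (Ec t) ex (\<lambda>r x. - 2 * \<i> * Lop (gg t r) x)" using Ec_sol by blast
  obtain C where C: "C \<ge> 0" "\<And>t' d dx c r. \<bar>t'\<bar> \<le> \<bar>t\<bar> + 1 \<Longrightarrow> sol t' d dx (\<lambda>r x. c * Lop (Ec t r) x) \<Longrightarrow>
      (\<And>x. x \<ge> 0 \<Longrightarrow> d 0 x = 0) \<Longrightarrow> 0 \<le> r \<Longrightarrow> r \<le> R \<Longrightarrow> cmod (d r 0) \<le> C * cmod c"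
    using sol_perturb_bound[OF tame_Lop[OF sol_tame(1)[OF Es]] R, of "\<bar>t\<bar> + 1"] by metis
  have bd: "cmod (gam t' R - gam t R - (t' - t) *\<^sub>R Ec t R 0) \<le> 2 * C * (t' - t)\<^sup>2" if t': "\<bar>t' - t\<bar> \<le> 1" for t'
  proof -
    let ?d = "of_real (t' - t) :: complex"
    have s: "sol t' (\<lambda>r x. (gg t' r x - gg t r x) - ?d * Ec t r x) (\<lambda>r x. (ggx t' r x - ggx t r x) - ?d * ex r x)
        (\<lambda>r x. (- 2 * \<i> * ?d\<^sup>2) * Lop (Ec t r) x)"
      by (rule sol_cong[OF sol_diff[OF sol_diff[OF gg_sol sol_change_t[OF gg_sol]] sol_scale[OF sol_change_t[OF Es]]]])
         (simp add: algebra_simps power2_eq_square)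
    have "cmod ((gg t' R 0 - gg t R 0) - ?d * Ec t R 0) \<le> C * cmod (- 2 * \<i> * ?d\<^sup>2)"
      by (rule C(2)[OF _ s _ R]) (use t' in \<open>auto simp: gg_0 Ec_0\<close>)
    also have "cmod (- 2 * \<i> * ?d\<^sup>2) = 2 * (t' - t)\<^sup>2" unfolding norm_mult norm_power norm_of_real by simp
    finally show ?thesis by (simp add: gam_def mult_ac scaleR_conv_of_real)
  qed
  have "((\<lambda>t. gam t R) has_vector_derivative Ec t R 0) (at t)"
    unfolding has_vector_derivative_iff_difference_quotient
  proof (rule LIM_zero_cancel, rule Lim_null_comparison)
    show "((\<lambda>y. 2 * C * \<bar>y - t\<bar>) \<longlongrightarrow> 0) (at t)"
      by (rule tendsto_eq_intros | simp)+
    have "eventually (\<lambda>y. \<bar>y - t\<bar> < 1 \<and> y \<noteq> t) (at t)"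
      unfolding eventually_at by (intro exI[of _ 1]) (auto simp: dist_real_def)
    then show "\<forall>\<^sub>F y in at t. norm ((gam y R - gam t R) /\<^sub>R (y - t) - Ec t R 0) \<le> 2 * C * \<bar>y - t\<bar>"
    proof eventually_elim
      case (elim y)
      then have e: "(gam y R - gam t R) /\<^sub>R (y - t) - Ec t R 0 = (gam y R - gam t R - (y - t) *\<^sub>R Ec t R 0) /\<^sub>R (y - t)"
        by (simp add: scaleR_diff_right)
      have "norm ((gam y R - gam t R) /\<^sub>R (y - t) - Ec t R 0) \<le> (2 * C * (y - t)\<^sup>2) / \<bar>y - t\<bar>"
        using bd[of y] elim unfolding e norm_scaleR by (simp add: field_simps)
      also have "\<dots> = 2 * C * \<bar>y - t\<bar>"
      proof -
        have "(y - t)\<^sup>2 = \<bar>y - t\<bar> * \<bar>y - t\<bar>" by (simp add: power2_eq_square)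
        then show ?thesis using elim by (simp del: abs_mult_self_eq)
      qed
      finally show ?case .
    qed
  qed
  then show ?thesis by (simp add: Ec_def gam_def conv_def mult.assoc)
qed

lemma gam_locally_bounded:
  assumes R: "R \<ge> 0"
  obtains B where "\<And>t' r. \<bar>t' - t\<bar> \<le> 1 \<Longrightarrow> 0 \<le> r \<Longrightarrow> r \<le> R \<Longrightarrow> cmod (gam t' r) \<le> B"
proof -
  obtain C where C: "C \<ge> 0" "\<And>t' r. \<bar>t' - t\<bar> \<le> 1 \<Longrightarrow> 0 \<le> r \<Longrightarrow> r \<le> R \<Longrightarrow> cmod (gam t' r - gam t r) \<le> C * \<bar>t' - t\<bar>"
    using gam_lipschitz[OF R] by metis
  obtain B where B: "\<And>r. 0 \<le> r \<Longrightarrow> r \<le> R \<Longrightarrow> cmod (gam t r) \<le> B"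
    using continuous_on_Icc_bounded[OF gam_continuous[of t]] by metis
  show thesis
  proof (rule that[of "C + B"])
    fix t' r assume t: "\<bar>t' - t\<bar> \<le> 1" and r: "0 \<le> r" "r \<le> R"
    have "cmod (gam t' r) \<le> cmod (gam t' r - gam t r) + cmod (gam t r)" using norm_triangle_sub[of "gam t' r" "gam t r"] by simp
    also have "\<dots> \<le> C * \<bar>t' - t\<bar> + B" using C(2)[OF t r] B[OF r] by simp
    also have "\<dots> \<le> C * 1 + B" using C(1) t by (intro add_mono mult_left_mono) auto
    finally show "cmod (gam t' r) \<le> C + B" by simp
  qed
qed

text \<open>Continuity in time is available for the traces, so N is recovered from
  \<open>N_eq\<close> as 1/2 minus the integral of \<open>|gam|^2\<close>.\<close>

lemma N_t_lipschitz:
  assumes R: "R \<ge> 0"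
  obtains C where "\<And>t'. \<bar>t' - t\<bar> \<le> 1 \<Longrightarrow> \<bar>N t' R - N t R\<bar> \<le> C * \<bar>t' - t\<bar>"
proof -
  obtain C where C: "C \<ge> 0" "\<And>t' r. \<bar>t' - t\<bar> \<le> 1 \<Longrightarrow> 0 \<le> r \<Longrightarrow> r \<le> R \<Longrightarrow> cmod (gam t' r - gam t r) \<le> C * \<bar>t' - t\<bar>"
    using gam_lipschitz[OF R] by metis
  obtain B where B: "\<And>t' r. \<bar>t' - t\<bar> \<le> 1 \<Longrightarrow> 0 \<le> r \<Longrightarrow> r \<le> R \<Longrightarrow> cmod (gam t' r) \<le> B"
    using gam_locally_bounded[OF R] by metis
  show thesis
  proof (rule that[of "C * (2 * B) * R"])
    fix t' assume t': "\<bar>t' - t\<bar> \<le> 1"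
    have h: "((\<lambda>y. (cmod (gam t y))\<^sup>2 - (cmod (gam t' y))\<^sup>2) has_integral ((1/2 - N t R) - (1/2 - N t' R))) {0..R}"
      by (intro has_integral_diff N_eq R)
    have "norm ((1/2 - N t R) - (1/2 - N t' R)) \<le> C * \<bar>t' - t\<bar> * (2 * B) * measure lborel {0..R}"
    proof (rule has_integral_bound_real[OF _ finite.emptyI h])
      show "0 \<le> C * \<bar>t' - t\<bar> * (2 * B)" using C(1) B[of t 0] R by (auto intro: order_trans[OF norm_ge_zero])
      fix y assume "y \<in> {0..R} - {}"
      then have y: "y \<in> {0..R}" by simp
      have "(cmod (gam t y))\<^sup>2 - (cmod (gam t' y))\<^sup>2 = (cmod (gam t y) - cmod (gam t' y)) * (cmod (gam t y) + cmod (gam t' y))"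
        by (simp add: power2_eq_square algebra_simps)
      then have "\<bar>(cmod (gam t y))\<^sup>2 - (cmod (gam t' y))\<^sup>2\<bar> = \<bar>cmod (gam t y) - cmod (gam t' y)\<bar> * (cmod (gam t y) + cmod (gam t' y))"
        by (simp add: abs_mult)
      also have "\<dots> \<le> (C * \<bar>t' - t\<bar>) * (B + B)"
        using y t' norm_triangle_ineq3[of "gam t' y" "gam t y"] C(2)[OF t', of y] B[of t y] B[OF t', of y]
        by (intro mult_mono add_mono) (auto simp: abs_minus_commute)
      finally show "norm ((cmod (gam t y))\<^sup>2 - (cmod (gam t' y))\<^sup>2) \<le> C * \<bar>t' - t\<bar> * (2 * B)" by simp
    qed
    then show "\<bar>N t' R - N t R\<bar> \<le> C * (2 * B) * R * \<bar>t' - t\<bar>" using R by (simp add: mult_ac)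
  qed
qed

end

section \<open>Quantisation of the lost mass\<close>

lemma integral_mult_cnj_le:
  assumes f: "continuous_on {0..K} f" and g: "continuous_on {0..K} g"
    and A: "((\<lambda>y. (cmod (f y))\<^sup>2) has_integral A) {0..K}" and B: "((\<lambda>y. (cmod (g y))\<^sup>2) has_integral B) {0..K::real}"
  shows "cmod (integral {0..K} (\<lambda>y. f y * cnj (g y))) \<le> sqrt A * sqrt B"
proof -
  let ?M = "restrict_space lborel {0..K}"
  have conv: "integrable ?M h" "integral\<^sup>L ?M h = integral {0..K} h" if "continuous_on {0..K} h"
    for h :: "real \<Rightarrow> 'b::euclidean_space"
  proof -
    have *: "set_integrable lborel {0..K} h" by (rule borel_integrable_atLeastAtMost'[OF that])
    then show "integrable ?M h" by (simp add: integrable_restrict_space set_integrable_def)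
    show "integral\<^sup>L ?M h = integral {0..K} h"
      using set_borel_integral_eq_integral(2)[OF *] by (simp add: integral_restrict_space set_lebesgue_integral_def)
  qed
  have cf: "continuous_on {0..K} (\<lambda>y. (cmod (f y))\<^sup>2)" "continuous_on {0..K} (\<lambda>y. (cmod (g y))\<^sup>2)"
    "continuous_on {0..K} (\<lambda>y. f y * cnj (g y))"
    using f g by (auto intro!: continuous_intros)
  have mf: "f \<in> borel_measurable ?M" "g \<in> borel_measurable ?M"
    using conv(1)[OF f] conv(1)[OF g] by auto
  have "cmod (integral {0..K} (\<lambda>y. f y * cnj (g y))) = cmod (integral\<^sup>L ?M (\<lambda>y. f y * cnj (g y)))"
    using conv(2)[OF cf(3)] by simp
  also have "\<dots> \<le> (\<integral>y. cmod (f y) * cmod (g y) \<partial>?M)"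
    using integral_norm_bound[of ?M "\<lambda>y. f y * cnj (g y)"] by (simp add: norm_mult)
  also have "\<dots> \<le> sqrt (\<integral>y. (cmod (f y))\<^sup>2 \<partial>?M) * sqrt (\<integral>y. (cmod (g y))\<^sup>2 \<partial>?M)"
    by (intro integral_mult_squares_le mf conv(1) cf)
  also have "\<dots> = sqrt A * sqrt B"
    unfolding conv(2)[OF cf(1)] conv(2)[OF cf(2)] integral_unique[OF A] integral_unique[OF B] ..
  finally show ?thesis .
qed

lemma recip_derivative:
  assumes b: "b \<ge> 0"
  shows "((\<lambda>r. 1 / (2 * (1 + r))) has_vector_derivative (- (1 / (2 * (1 + b)\<^sup>2)))) (at (b::real) within S)"
proof -
  define c where "c = 1 + b"
  have c: "c > 0" using b by (simp add: c_def)
  have "((\<lambda>r. 1 / (2 * (1 + r))) has_real_derivative ((0 * (2 * c) - 1 * 2) / ((2 * c) * (2 * c)))) (at b within S)"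
    unfolding c_def by (rule DERIV_divide) (use b in \<open>auto intro!: derivative_eq_intros\<close>)
  moreover have "(0 * (2 * c) - 1 * 2) / ((2 * c) * (2 * c)) = - (1 / (2 * c\<^sup>2))"
    using c by (simp add: power2_eq_square)
  ultimately show ?thesis
    unfolding has_real_derivative_iff_has_vector_derivative[symmetric] c_def by (simp only:)
qed

context ccm
begin

definition stable :: "real \<Rightarrow> bool" where "stable t \<longleftrightarrow> (N t \<longlongrightarrow> 0) at_top"

text \<open>Cauchy-Schwarz on both terms of \<open>ell_split\<close>: the first is measured by the
  norms still present after the length K, the second by the norms already lost through the
  boundary.\<close>

lemma ell_split_bound:
  assumes h: "sol t h hx (\<lambda>_ _. 0)" and r: "r \<ge> 0" and K: "K \<ge> 0"
  shows "cmod (ell (h r)) \<le> sqrt (nsq (h (r + K))) * sqrt (N t K) + sqrt (nsq (h r) - nsq (h (r + K))) * sqrt (1 / 2 - N t K)"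
proof -
  have hs: "sol t (\<lambda>y. h (r + y)) (\<lambda>y. hx (r + y)) (\<lambda>_ _. 0)" using sol_shift[OF h r] by simp
  note E = tame_exp_decay[OF sol_tame(1)[OF h]]
  have "cmod (ell (h r)) \<le> cmod (ip (h (r + K)) (gg t K)) + cmod (integral {0..K} (\<lambda>y. h (r + y) 0 * cnj (gam t y)))"
    unfolding ell_split[OF h r K] by (rule norm_triangle_ineq)
  also have "cmod (ip (h (r + K)) (gg t K)) \<le> sqrt (nsq (h (r + K))) * sqrt (N t K)"
    unfolding N_def using r K by (intro ip_le E gg_exp_decay) auto
  also have "cmod (integral {0..K} (\<lambda>y. h (r + y) 0 * cnj (gam t y))) \<le> sqrt (nsq (h r) - nsq (h (r + K))) * sqrt (1 / 2 - N t K)"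
  proof (rule integral_mult_cnj_le)
    show "continuous_on {0..K} (\<lambda>y. h (r + y) 0)"
      by (rule continuous_on_subset[OF tame_trace_continuous[OF sol_tame(1)[OF hs]]]) auto
    show "continuous_on {0..K} (gam t)" by (rule continuous_on_subset[OF gam_continuous]) auto
    show "((\<lambda>y. (cmod (h (r + y) 0))\<^sup>2) has_integral nsq (h r) - nsq (h (r + K))) {0..K}"
      using sol_nsq_eq[OF hs K] by simp
  qed (rule N_eq[OF K])
  finally show ?thesis by simp
qed

lemma mt_bound:
  assumes "r \<ge> 0" "K \<ge> 0"
  shows "cmod (mt t r) \<le> sqrt (N t (r + K)) * sqrt (N t K) + sqrt (N t r - N t (r + K)) * sqrt (1 / 2 - N t K)"
  using ell_split_bound[OF gg_sol assms, of t] unfolding mt_def N_def .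

lemma mt_le_sqrt_N: "r \<ge> 0 \<Longrightarrow> cmod (mt t r) \<le> sqrt (N t r)"
  unfolding mt_def N_def by (intro ell_le gg_exp_decay)

text \<open>The quadratic form of the Lax operator along the trajectory, used as a monovariant: it
  is bounded below, while its derivative compares \<open>mt\<close> with \<open>N\<close>.\<close>

definition qq :: "real \<Rightarrow> real \<Rightarrow> real" where "qq t r = Re (ip (Lop (gg t r)) (gg t r))"

lemma gg_Lop_sol:
  "\<exists>hx. sol t (\<lambda>r. Lop (gg t r)) hx (\<lambda>r x. (- 1) * gg t r x + (of_real (2 * \<kappa>) * mt t r) * ee x)"
  using sol_cong[OF sol_Lop[OF gg_sol[of t]], of "\<lambda>r x. (- 1) * gg t r x + (of_real (2 * \<kappa>) * mt t r) * ee x"]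
  by (auto simp: mt_def)

lemma ip_gg_Lop_source:
  assumes r: "r \<ge> 0" and f: "exp_decay f"
  shows "ip (\<lambda>x. (- 1) * gg t r x + (of_real (2 * \<kappa>) * mt t r) * ee x) f
    = - ip (gg t r) f + of_real (2 * \<kappa>) * mt t r * ip ee f"
proof -
  have "ip (\<lambda>x. (- 1) * gg t r x + (of_real (2 * \<kappa>) * mt t r) * ee x) f
      = ip (\<lambda>x. (- 1) * gg t r x) f + ip (\<lambda>x. (of_real (2 * \<kappa>) * mt t r) * ee x) f"
    by (intro ip_add_left exp_decay_cmult gg_exp_decay r f exp_decay_ee)
  then show ?thesis unfolding ip_cmult_left by simp
qed

text \<open>There is no boundary term because \<open>Lop\<close> vanishes at 0. The two sources in
  \<open>sol_Lop\<close>, paired with the trajectory, give the two summands.\<close>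

lemma qq_derivative:
  assumes r: "r \<ge> 0"
  shows "(qq t has_vector_derivative (2 * \<kappa> * (cmod (mt t r))\<^sup>2 - N t r)) (at r within {0..})"
proof -
  obtain hx where L: "sol t (\<lambda>r. Lop (gg t r)) hx (\<lambda>r x. (- 1) * gg t r x + (of_real (2 * \<kappa>) * mt t r) * ee x)"
    using gg_Lop_sol by blast
  have "ip ee (gg t r) = cnj (mt t r)" unfolding mt_def ell_ip by (simp add: ip_cnj)
  then have "Re (- (Lop (gg t r) 0 * cnj (gg t r 0)) +
      ip (\<lambda>x. (- 1) * gg t r x + (of_real (2 * \<kappa>) * mt t r) * ee x) (gg t r) + ip (Lop (gg t r)) (\<lambda>_. 0))
      = 2 * \<kappa> * (cmod (mt t r))\<^sup>2 - N t r"
    unfolding ip_gg_Lop_source[OF r gg_exp_decay[OF r]] cmod_power2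
    by (simp add: ip_self N_def power2_eq_square algebra_simps) (simp add: ip_def)
  then show ?thesis
    using bounded_linear.has_vector_derivative[OF bounded_linear_Re sol_energy[OF L gg_sol r]]
    unfolding qq_def[abs_def] by (simp only:)
qed

text \<open>Multiplication by x is nonnegative on the half-line, and
  \<open>ip (Gop f) f = nsq (Sst f) <= nsq f\<close>.\<close>

lemma Lop_lower_bound:
  assumes f: "exp_decay f" shows "Re (ip (Lop f) f) \<ge> - (2 * \<kappa>) * nsq f"
proof -
  note e = exp_decay_times_id exp_decay_Gop exp_decay_cmult f
  have "ip (Lop f) f = ip (\<lambda>x. of_real x * f x) f - of_real (2 * \<kappa>) * ip (Gop f) f"
    unfolding Lop_def ip_cmult_left[symmetric] by (intro ip_diff_left e)
  also have "ip (Gop f) f = of_real (nsq (Sst f))" by (simp add: ip_Gop f ip_self)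
  finally have "Re (ip (Lop f) f) = Re (ip (\<lambda>x. of_real x * f x) f) - 2 * \<kappa> * nsq (Sst f)" by simp
  moreover have "Re (ip (\<lambda>x. of_real x * f x) f) \<ge> 0"
  proof -
    have "ip (\<lambda>x. of_real x * f x) f = (\<integral>x. complex_of_real (x * (cmod (f x))\<^sup>2) \<partial>hl)"
      unfolding ip_def by (rule Bochner_Integration.integral_cong) (auto simp: complex_mult_cnj cmod_power2 mult.assoc)
    also have "\<dots> = of_real (\<integral>x. x * (cmod (f x))\<^sup>2 \<partial>hl)" by (rule integral_complex_of_real)
    finally show ?thesis by (auto intro!: Bochner_Integration.integral_nonneg)
  qed
  moreover have "2 * \<kappa> * nsq (Sst f) \<le> 2 * \<kappa> * nsq f"
    using kappa_pos nsq_Sst_le[OF f] by (intro mult_left_mono) auto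
  ultimately show ?thesis by simp
qed

lemma qq_lower: "r \<ge> 0 \<Longrightarrow> qq t r \<ge> - (2 * \<kappa>) * N t r"
  unfolding qq_def N_def by (intro Lop_lower_bound gg_exp_decay)

definition q0 :: real where "q0 = Re (ip (Lop ee) ee)"

lemma qq_0: "qq t 0 = q0"
  unfolding qq_def q0_def using Lop_cong[of "gg t 0" ee] gg_0
  by (intro arg_cong[where f = Re] ip_cong) auto

lemma N_tendsto_Inf: "(N t \<longlongrightarrow> Inf (N t ` {0..})) at_top"
proof (rule order_tendstoI)
  have bdd: "bdd_below (N t ` {0..})" by (rule bdd_belowI2[of _ 0]) simp
  fix a assume "a < Inf (N t ` {0..})"
  then show "\<forall>\<^sub>F r in at_top. a < N t r"
    by (intro eventually_mono[OF eventually_ge_at_top[of 0]]) (auto intro: less_le_trans cINF_lower[OF bdd])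
next
  have bdd: "bdd_below (N t ` {0..})" by (rule bdd_belowI2[of _ 0]) simp
  fix a assume "Inf (N t ` {0..}) < a"
  then obtain r where r: "r \<ge> 0" "N t r < a" using cINF_less_iff[OF _ bdd, of a] by auto
  then show "\<forall>\<^sub>F r in at_top. N t r < a"
    by (intro eventually_mono[OF eventually_ge_at_top[of r]]) (meson N_antimono le_less_trans)
qed

text \<open>
  Quantisation: mass that is lost by the semigroup comes in portions of at least \<open>1 / (2\<kappa>)\<close>
  (that is, \<open>2\<pi>\<close> in the original normalisation), because \<open>qq\<close> is bounded below and its derivative tends
  to \<open>2\<kappa>\<rho>\<^sup>2 - \<rho>\<close>, where \<open>\<rho>\<close> is the limit of \<open>N t\<close>.
\<close>

lemma stable_if_small:
  assumes r0: "r0 \<ge> 0" and small: "N t r0 < 1 / (2 * \<kappa>)"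
  shows "stable t"
proof (rule ccontr)
  assume ns: "\<not> stable t"
  define \<rho> where "\<rho> = Inf (N t ` {0..})"
  have bdd: "bdd_below (N t ` {0..})" by (rule bdd_belowI2[of _ 0]) simp
  have lim: "(N t \<longlongrightarrow> \<rho>) at_top" unfolding \<rho>_def by (rule N_tendsto_Inf)
  have le: "\<rho> \<le> N t r" if "r \<ge> 0" for r unfolding \<rho>_def using that by (intro cINF_lower[OF bdd]) simp
  have "\<rho> \<ge> 0" unfolding \<rho>_def by (rule cINF_greatest) auto
  moreover have "\<rho> \<noteq> 0" using ns lim by (auto simp: stable_def)
  ultimately have pos: "\<rho> > 0" by simp
  have "\<rho> < 1 / (2 * \<kappa>)" using le[OF r0] small by simp
  then have gap: "2 * \<kappa> * \<rho>\<^sup>2 < \<rho>"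
    using pos kappa_pos by (simp add: field_simps power2_eq_square)
  \<comment> \<open>\<open>m^2\<close> is the midpoint of \<open>\<rho>^2\<close> and
    \<open>\<rho> / (2 * \<kappa>)\<close>; then m exceeds \<rho>, and half of the gap
    \<open>\<rho> - 2 * \<kappa> * \<rho>^2\<close> is left as \<eta>.\<close>
  define m where "m = sqrt ((\<rho>\<^sup>2 + \<rho> / (2 * \<kappa>)) / 2)"
  have m2: "m\<^sup>2 = (\<rho>\<^sup>2 + \<rho> / (2 * \<kappa>)) / 2" unfolding m_def using pos kappa_pos by simp
  have "\<rho>\<^sup>2 < \<rho> / (2 * \<kappa>)" using gap kappa_pos by (simp add: field_simps)
  then have "\<rho>\<^sup>2 < m\<^sup>2" using m2 by simp
  then have m: "\<rho> < m" by (rule power_less_imp_less_base) (auto simp: m_def pos kappa_pos less_imp_le)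
  define \<eta> where "\<eta> = \<rho> - 2 * \<kappa> * m\<^sup>2"
  have "\<eta> = (\<rho> - 2 * \<kappa> * \<rho>\<^sup>2) / 2" unfolding \<eta>_def m2 using kappa_pos by (simp add: field_simps)
  then have \<eta>: "\<eta> > 0" using gap by simp
  \<comment> \<open>The limit K -> infinity of \<open>mt_bound\<close>. As r grows, the norm still
    to be lost tends to 0 and the right side tends to \<rho>.\<close>
  have mtle: "cmod (mt t r) \<le> sqrt \<rho> * sqrt \<rho> + sqrt (N t r - \<rho>) * sqrt (1 / 2 - \<rho>)" if "r \<ge> 0" for r
  proof (rule tendsto_lowerbound)
    have "filterlim (\<lambda>K. r + K) at_top at_top"
      by (rule filterlim_tendsto_add_at_top[OF tendsto_const filterlim_ident])
    then have l2: "((\<lambda>K. N t (r + K)) \<longlongrightarrow> \<rho>) at_top" by (rule filterlim_compose[OF lim])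
    show "((\<lambda>K. sqrt (N t (r + K)) * sqrt (N t K) + sqrt (N t r - N t (r + K)) * sqrt (1 / 2 - N t K))
        \<longlongrightarrow> sqrt \<rho> * sqrt \<rho> + sqrt (N t r - \<rho>) * sqrt (1 / 2 - \<rho>)) at_top"
      by (intro tendsto_intros lim l2)
    show "\<forall>\<^sub>F K in at_top. cmod (mt t r) \<le> sqrt (N t (r + K)) * sqrt (N t K) + sqrt (N t r - N t (r + K)) * sqrt (1 / 2 - N t K)"
      by (intro eventually_mono[OF eventually_ge_at_top[of 0]] mt_bound that)
  qed simp
  have "((\<lambda>r. sqrt \<rho> * sqrt \<rho> + sqrt (N t r - \<rho>) * sqrt (1 / 2 - \<rho>)) \<longlongrightarrow> sqrt \<rho> * sqrt \<rho> + sqrt (\<rho> - \<rho>) * sqrt (1 / 2 - \<rho>)) at_top"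
    by (intro tendsto_intros lim)
  then have "((\<lambda>r. sqrt \<rho> * sqrt \<rho> + sqrt (N t r - \<rho>) * sqrt (1 / 2 - \<rho>)) \<longlongrightarrow> \<rho>) at_top" using pos by simp
  from order_tendstoD(2)[OF this m] obtain r1 where r1: "\<And>r. r \<ge> r1 \<Longrightarrow> sqrt \<rho> * sqrt \<rho> + sqrt (N t r - \<rho>) * sqrt (1 / 2 - \<rho>) < m"
    unfolding eventually_at_top_linorder by blast
  define r2 where "r2 = max r1 0"
  have q': "2 * \<kappa> * (cmod (mt t r))\<^sup>2 - N t r \<le> - \<eta>" if "r \<ge> r2" for r
  proof -
    have r: "r \<ge> 0" "r \<ge> r1" using that by (auto simp: r2_def)
    have "cmod (mt t r) \<le> m" using mtle[OF r(1)] r1[OF r(2)] by linarith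
    then have "(cmod (mt t r))\<^sup>2 \<le> m\<^sup>2" by (rule power_mono) simp
    then have "2 * \<kappa> * (cmod (mt t r))\<^sup>2 \<le> 2 * \<kappa> * m\<^sup>2" using kappa_pos by (intro mult_left_mono) auto
    then show ?thesis using le[OF r(1)] by (simp add: \<eta>_def)
  qed
  \<comment> \<open>Far enough for a decrease at rate \<eta> to push \<open>qq\<close> to at most
    -2\<kappa> - 1, contradicting the lower bound -\<kappa> that follows from N <= 1/2.\<close>
  define r3 where "r3 = r2 + (qq t r2 + 2 * \<kappa> + 1 + \<bar>qq t r2\<bar>) / \<eta>"
  have r3: "r3 \<ge> r2" unfolding r3_def using \<eta> kappa_pos by (auto intro!: divide_nonneg_pos)
  have "((\<lambda>r. 2 * \<kappa> * (cmod (mt t r))\<^sup>2 - N t r) has_integral (qq t r3 - qq t r2)) {r2..r3}"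
    using r3 by (intro fundamental_theorem_of_calculus has_vector_derivative_within_subset[OF qq_derivative])
      (auto simp: r2_def)
  moreover have "((\<lambda>r. - \<eta>) has_integral ((r3 - r2) *\<^sub>R (- \<eta>))) {r2..r3}"
    using has_integral_const_real[of "- \<eta>" r2 r3] r3 by simp
  ultimately have "qq t r3 - qq t r2 \<le> (r3 - r2) *\<^sub>R (- \<eta>)"
    by (rule has_integral_le) (use q' in auto)
  also have "\<dots> = - (qq t r2 + 2 * \<kappa> + 1 + \<bar>qq t r2\<bar>)" unfolding r3_def using \<eta> by simp
  finally have "qq t r3 \<le> - 2 * \<kappa> - 1" by simp
  moreover have r3p: "r3 \<ge> 0" using r3 by (simp add: r2_def)
  then have "- (2 * \<kappa>) * (1 / 2) \<le> qq t r3"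
    using qq_lower[OF r3p, of t] kappa_pos
      mult_left_mono[OF N_le_half[OF r3p, of t], of "2 * \<kappa>"] by linarith
  ultimately show False using kappa_pos by simp
qed

section \<open>Bounds on the trajectory that are uniform in time\<close>

lemma stable_uminus: "stable (- t) \<longleftrightarrow> stable t"
  unfolding stable_def
  by (intro filterlim_cong eventually_mono[OF eventually_ge_at_top[of 0]]) (auto simp: N_uminus)

lemma not_stable_N_ge: "\<not> stable t \<Longrightarrow> r \<ge> 0 \<Longrightarrow> N t r \<ge> 1 / (2 * \<kappa>)"
  using stable_if_small[of r t] by force

lemma N_continuous: "continuous_on {0..} (N t)"
  using N_derivative by (rule has_vector_derivative_continuous_on_halfline)

text \<open>Once N t K is small, the first term of \<open>mt_bound\<close> costs only half of
  \<open>N t r\<close>. The rest is a difference of shifted values, and its integral over r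
  telescopes.\<close>

lemma mt_square_bound:
  assumes K: "K \<ge> 0" "4 * \<kappa> * N t K \<le> 1 / 2" and r: "r \<ge> 0"
  shows "2 * \<kappa> * (cmod (mt t r))\<^sup>2 \<le> N t r / 2 + 2 * \<kappa> * (N t r - N t (r + K))"
proof -
  let ?a = "sqrt (N t (r + K)) * sqrt (N t K)" and ?b = "sqrt (N t r - N t (r + K)) * sqrt (1 / 2 - N t K)"
  have le: "N t (r + K) \<le> N t r" by (rule N_antimono) (use r K in auto)
  have hK: "N t K \<le> 1 / 2" by (rule N_le_half[OF K(1)])
  have b2: "?b\<^sup>2 = (N t r - N t (r + K)) * (1 / 2 - N t K)"
    using le hK by (simp add: power_mult_distrib)
  have "(cmod (mt t r))\<^sup>2 \<le> (?a + ?b)\<^sup>2" by (rule power_mono[OF mt_bound[OF r K(1)]]) simp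
  also have "\<dots> \<le> 2 * ?a\<^sup>2 + 2 * ?b\<^sup>2" using sum_squares_bound[of ?a ?b] by (simp add: power2_sum)
  also have "?a\<^sup>2 = N t (r + K) * N t K" by (simp add: power_mult_distrib)
  also have "?b\<^sup>2 \<le> (N t r - N t (r + K)) * (1 / 2)" unfolding b2 using le by (intro mult_left_mono) auto
  also have "N t (r + K) * N t K \<le> N t r * N t K" using le by (intro mult_right_mono) auto
  finally have "2 * \<kappa> * (cmod (mt t r))\<^sup>2 \<le> 2 * \<kappa> * (2 * (N t r * N t K) + 2 * ((N t r - N t (r + K)) * (1 / 2)))"
    using kappa_pos by (intro mult_left_mono) auto
  also have "\<dots> = (4 * \<kappa> * N t K) * N t r + 2 * \<kappa> * (N t r - N t (r + K))" by (simp add: algebra_simps)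
  also have "(4 * \<kappa> * N t K) * N t r \<le> 1 / 2 * N t r" using K by (intro mult_right_mono) auto
  finally show ?thesis by simp
qed

lemma continuous_mult_id: "continuous_on {0..} f \<Longrightarrow> continuous_on {0..} (\<lambda>y::real. y * f y :: real)"
  by (intro continuous_intros)

text \<open>The bound depends on t only through the smallness of N t K, so one K serves for a whole
  neighbourhood of times. The derivative of \<open>qq\<close> bounds the integral of N; weighting it
  with r bounds the integral of r N, which amounts to control of \<open>r^2 * |gam|^2\<close>. The
  inequality between arithmetic and geometric mean then gives the integral of
  \<open>|gam|\<close>.\<close>

lemma regularity_bound:
  assumes K: "K \<ge> 0"
  obtains C where "C \<ge> 0" "\<And>t r. 4 * \<kappa> * N t K \<le> 1 / 2 \<Longrightarrow> r \<ge> 0 \<Longrightarrow> integral {0..r} (\<lambda>y. cmod (gam t y)) \<le> C"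
proof -
  define C1 where "C1 = 2 * (\<bar>q0\<bar> + \<kappa> * K + \<kappa>)"
  define l where "l = sqrt (nsq (Lop ee))"
  define C2 where "C2 = l\<^sup>2 / 2 + 2 * \<kappa> * l * C1"
  define C3 where "C3 = 2 * (4 * \<kappa> * K * C1 + C2 + 2 * \<kappa> * C1)"
  have l0: "l \<ge> 0" by (simp add: l_def)
  have C1: "C1 \<ge> 0" unfolding C1_def using kappa_pos K by auto
  have C2: "C2 \<ge> 0" unfolding C2_def using kappa_pos l0 C1 by auto
  have C3: "C3 \<ge> 0" unfolding C3_def using kappa_pos K C1 C2 by (auto intro!: add_nonneg_nonneg mult_nonneg_nonneg)
  have key: "integral {0..r} (\<lambda>y. cmod (gam t y)) \<le> 2 * C3 + 1" if small: "4 * \<kappa> * N t K \<le> 1 / 2" and r: "r \<ge> 0" for t r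
  proof -
    define I where "I a = integral {0..a} (N t)" for a
    define J where "J a = integral {0..a} (\<lambda>y. y * N t y)" for a
    define Q where "Q a = integral {0..a} (qq t)" for a
    have cq: "continuous_on {0..} (qq t)" using qq_derivative by (rule has_vector_derivative_continuous_on_halfline)
    have I': "(I has_vector_derivative N t a) (at a within {0..})" if "a \<ge> 0" for a
      unfolding I_def by (rule indefinite_integral_has_vector_derivative[OF N_continuous that])
    have J': "(J has_vector_derivative a * N t a) (at a within {0..})" if "a \<ge> 0" for a
      unfolding J_def by (rule indefinite_integral_has_vector_derivative[OF continuous_mult_id[OF N_continuous] that])
    have Q': "(Q has_vector_derivative qq t a) (at a within {0..})" if "a \<ge> 0" for a
      unfolding Q_def by (rule indefinite_integral_has_vector_derivative[OF cq that])
    have shift: "((\<lambda>a. f (a + K)) has_vector_derivative f' (a + K)) (at a within {0..})"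
      if "\<And>a. a \<ge> 0 \<Longrightarrow> (f has_vector_derivative f' a) (at a within {0..})" "a \<ge> 0" for f f' :: "real \<Rightarrow> real" and a
    proof -
      have "((\<lambda>r. r + K) has_vector_derivative 1) (at a within {0..})" by (auto intro!: derivative_eq_intros)
      moreover have "(f has_vector_derivative f' (a + K)) (at (a + K) within (\<lambda>r. r + K) ` {0..})"
        by (rule has_vector_derivative_within_subset[OF that(1)]) (use that K in auto)
      ultimately show ?thesis
        using vector_diff_chain_within[of "\<lambda>r. r + K" 1 a "{0..}" f "f' (a + K)"] by (simp add: comp_def)
    qed
    have zero: "((\<lambda>_. 0::real) has_vector_derivative 0) (at a within {0..})" for a :: real by simp
    have I0: "I 0 = 0" "J 0 = 0" "Q 0 = 0" by (simp_all add: I_def J_def Q_def)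
    have mono: "f a \<le> f b" if "\<And>a. a \<ge> 0 \<Longrightarrow> (f has_vector_derivative f' a) (at a within {0..})" "\<And>a. a \<ge> 0 \<Longrightarrow> f' a \<ge> 0" "0 \<le> a" "a \<le> b"
      for f f' :: "real \<Rightarrow> real" and a b
    proof -
      have "(f' has_integral (f b - f a)) {a..b}"
        using that by (intro fundamental_theorem_of_calculus has_vector_derivative_within_subset[OF that(1)]) auto
      then have "0 \<le> f b - f a" by (rule has_integral_nonneg) (use that in auto)
      then show ?thesis by simp
    qed
    have Imono: "I a \<le> I b" if "0 \<le> a" "a \<le> b" for a b by (rule mono[OF I' _ that]) auto
    have Jmono: "J a \<le> J b" if "0 \<le> a" "a \<le> b" for a b by (rule mono[OF J' _ that]) auto
    have IK: "I K \<le> K / 2"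
    proof -
      have "I K - I 0 \<le> K / 2 - 0 / 2"
      proof (rule halfline_derivative_le[OF I' _ N_le_half K])
        show "((\<lambda>a. a / 2) has_vector_derivative (1 / 2)) (at b within {0..})" for b :: real
          unfolding has_real_derivative_iff_has_vector_derivative[symmetric] by (auto intro!: derivative_eq_intros)
      qed
      then show ?thesis by (simp add: I0)
    qed
    \<comment> \<open>\<open>I a - I (a + K)\<close> is an antiderivative of the shifted difference
      in \<open>mt_square_bound\<close>. Its total increase is at most \<open>I K\<close>, so the
      remaining half of -N in the derivative of \<open>qq\<close> can be integrated.\<close>
    have IC1: "I a \<le> C1" if a: "a \<ge> 0" for a
    proof -
      have "(qq t a + I a / 2 - 2 * \<kappa> * (I a - I (a + K))) - (qq t 0 + I 0 / 2 - 2 * \<kappa> * (I 0 - I (0 + K))) \<le> 0 - 0"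
      proof (rule halfline_derivative_le[OF _ zero _ a])
        fix b :: real assume b: "b \<ge> 0"
        show "((\<lambda>a. qq t a + I a / 2 - 2 * \<kappa> * (I a - I (a + K))) has_vector_derivative
           ((2 * \<kappa> * (cmod (mt t b))\<^sup>2 - N t b) + N t b / 2 - 2 * \<kappa> * (N t b - N t (b + K)))) (at b within {0..})"
          by (intro has_vector_derivative_add has_vector_derivative_diff has_vector_derivative_divide has_vector_derivative_mult_right
              qq_derivative I' shift b)
      next
        fix b :: real assume "0 \<le> b" "b \<le> a"
        then show "(2 * \<kappa> * (cmod (mt t b))\<^sup>2 - N t b) + N t b / 2 - 2 * \<kappa> * (N t b - N t (b + K)) \<le> 0"
          using mt_square_bound[OF K small, of b] by linarith
      qed
      then have "I a / 2 \<le> q0 + 2 * \<kappa> * I K - qq t a + 2 * \<kappa> * (I a - I (a + K))" by (simp add: I0 qq_0)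
      moreover have "2 * \<kappa> * (I a - I (a + K)) \<le> 2 * \<kappa> * 0"
        using kappa_pos Imono[of a "a + K"] a K by (intro mult_left_mono) auto
      moreover have "2 * \<kappa> * I K \<le> 2 * \<kappa> * (K / 2)" using kappa_pos IK by (intro mult_left_mono) auto
      moreover have "- qq t a \<le> 2 * \<kappa> * N t a" using qq_lower[OF a, of t] by simp
      moreover have "2 * \<kappa> * N t a \<le> 2 * \<kappa> * (1 / 2)" using kappa_pos N_le_half[OF a] by (intro mult_left_mono) auto
      ultimately show ?thesis unfolding C1_def using abs_ge_self[of q0] by (simp add: algebra_simps)
    qed
    \<comment> \<open>N is nonincreasing, so its integral up to a dominates a times its value
      there.\<close>
    have aN: "a * N t a \<le> C1" if a: "a \<ge> 0" for a
    proof -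
      have "a * N t a - 0 * N t 0 \<le> I a - I 0"
      proof (rule halfline_derivative_le[OF _ I' _ a])
        fix b :: real assume b: "b \<ge> 0"
        show "((\<lambda>a. a * N t a) has_vector_derivative (b * (- (cmod (gam t b))\<^sup>2) + 1 * N t b)) (at b within {0..})"
          by (intro has_vector_derivative_mult N_derivative b) auto
      qed auto
      then show ?thesis using IC1[OF a] by (simp add: I0)
    qed
    \<comment> \<open>The derivative of the norm of \<open>Lop (gg t r)\<close> contains
      \<open>-2 * qq\<close>, which bounds the integral of \<open>qq\<close> from above. The other
      term pairs \<open>ee\<close> with \<open>Lop (gg t r)\<close>; by symmetry \<open>Lop\<close>
      moves to \<open>ee\<close>, leaving a multiple of N.\<close>
    have QC2: "Q a \<le> C2" if a: "a \<ge> 0" for a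
    proof -
      obtain hx where L: "sol t (\<lambda>r. Lop (gg t r)) hx (\<lambda>r x. (- 1) * gg t r x + (of_real (2 * \<kappa>) * mt t r) * ee x)"
        using gg_Lop_sol by blast
      let ?s = "\<lambda>r x. (- 1) * gg t r x + (of_real (2 * \<kappa>) * mt t r) * ee x"
      have "(nsq (Lop (gg t a)) + 2 * Q a - 4 * \<kappa> * l * I a) - (nsq (Lop (gg t 0)) + 2 * Q 0 - 4 * \<kappa> * l * I 0) \<le> 0 - 0"
      proof (rule halfline_derivative_le[OF _ zero _ a])
        fix b :: real assume b: "b \<ge> 0"
        show "((\<lambda>a. nsq (Lop (gg t a)) + 2 * Q a - 4 * \<kappa> * l * I a) has_vector_derivative
           ((2 * Re (ip (?s b) (Lop (gg t b))) - (cmod (Lop (gg t b) 0))\<^sup>2) + 2 * qq t b - 4 * \<kappa> * l * N t b)) (at b within {0..})"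
          by (intro has_vector_derivative_add has_vector_derivative_diff has_vector_derivative_mult_right
              sol_nsq_derivative[OF L] Q' I' b)
      next
        fix b :: real assume b: "0 \<le> b" "b \<le> a"
        note E = gg_exp_decay[OF b(1), of t]
        have e1: "ip (?s b) (Lop (gg t b)) = - ip (gg t b) (Lop (gg t b)) + of_real (2 * \<kappa>) * mt t b * ip ee (Lop (gg t b))"
          by (rule ip_gg_Lop_source[OF b(1) exp_decay_Lop[OF E]])
        have e2: "Re (ip (gg t b) (Lop (gg t b))) = qq t b"
          unfolding qq_def ip_cnj[of "Lop (gg t b)" "gg t b", symmetric] by simp
        have "cmod (ip ee (Lop (gg t b))) \<le> l * sqrt (N t b)"
          unfolding ip_Lop_sym[OF exp_decay_ee E, symmetric] l_def N_def
          by (intro ip_le exp_decay_Lop exp_decay_ee E)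
        then have "cmod (mt t b) * cmod (ip ee (Lop (gg t b))) \<le> sqrt (N t b) * (l * sqrt (N t b))"
          using mt_le_sqrt_N[OF b(1)] by (intro mult_mono) auto
        also have "\<dots> = l * N t b" by simp
        finally have e3: "Re (mt t b * ip ee (Lop (gg t b))) \<le> l * N t b"
          using complex_Re_le_cmod[of "mt t b * ip ee (Lop (gg t b))"] by (simp add: norm_mult)
        have "Re (ip (?s b) (Lop (gg t b))) = - qq t b + 2 * \<kappa> * Re (mt t b * ip ee (Lop (gg t b)))"
          unfolding e1 by (simp add: e2 mult.assoc)
        also have "\<dots> \<le> - qq t b + 2 * \<kappa> * (l * N t b)" using kappa_pos by (intro add_mono mult_left_mono e3) auto
        finally show "(2 * Re (ip (?s b) (Lop (gg t b))) - (cmod (Lop (gg t b) 0))\<^sup>2) + 2 * qq t b - 4 * \<kappa> * l * N t b \<le> 0" by simp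
      qed
      moreover have "nsq (Lop (gg t 0)) = l\<^sup>2"
      proof -
        have "nsq (Lop (gg t 0)) = nsq (Lop ee)" by (intro nsq_cong Lop_cong gg_0)
        then show ?thesis by (simp add: l_def)
      qed
      moreover have "4 * \<kappa> * l * I a \<le> 4 * \<kappa> * l * C1" using kappa_pos l0 by (intro mult_left_mono IC1 a) auto
      ultimately show ?thesis using nsq_nonneg[of "Lop (gg t a)"] unfolding C2_def I0 by linarith
    qed
    \<comment> \<open>The same argument with weight r. Differentiating \<open>a * qq t a\<close>
      leaves the term \<open>qq\<close>, which is why its integral Q had to be bounded; the shift by
      K in the weighted difference is compensated by \<open>K * I (a + K)\<close>.\<close>
    have JC3: "J a \<le> C3" if a: "a \<ge> 0" for a
    proof -
      let ?P = "\<lambda>a. a * qq t a - Q a + J a / 2 - 2 * \<kappa> * (J a - J (a + K) + K * I (a + K))"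
      have "?P a - ?P 0 \<le> 0 - 0"
      proof (rule halfline_derivative_le[OF _ zero _ a])
        fix b :: real assume b: "b \<ge> 0"
        show "(?P has_vector_derivative ((b * (2 * \<kappa> * (cmod (mt t b))\<^sup>2 - N t b) + 1 * qq t b) - qq t b + b * N t b / 2
            - 2 * \<kappa> * (b * N t b - (b + K) * N t (b + K) + K * N t (b + K)))) (at b within {0..})"
          by (intro has_vector_derivative_add has_vector_derivative_diff has_vector_derivative_divide has_vector_derivative_mult_right
              has_vector_derivative_mult qq_derivative Q' J' I' shift b) auto
      next
        fix b :: real assume b: "0 \<le> b" "b \<le> a"
        have "b * (2 * \<kappa> * (cmod (mt t b))\<^sup>2) \<le> b * (N t b / 2 + 2 * \<kappa> * (N t b - N t (b + K)))"
          using b by (intro mult_left_mono mt_square_bound[OF K small]) auto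
        then show "(b * (2 * \<kappa> * (cmod (mt t b))\<^sup>2 - N t b) + 1 * qq t b) - qq t b + b * N t b / 2
            - 2 * \<kappa> * (b * N t b - (b + K) * N t (b + K) + K * N t (b + K)) \<le> 0"
          by (simp add: algebra_simps)
      qed
      then have "J a / 2 \<le> Q a - a * qq t a + 2 * \<kappa> * (J a - J (a + K)) + 2 * \<kappa> * K * I (a + K) + 2 * \<kappa> * (J K - K * I K)"
        by (simp add: I0 algebra_simps)
      moreover have "2 * \<kappa> * (J a - J (a + K)) \<le> 2 * \<kappa> * 0"
        using kappa_pos Jmono[of a "a + K"] a K by (intro mult_left_mono) auto
      moreover have "2 * \<kappa> * K * I (a + K) \<le> 2 * \<kappa> * K * C1" using kappa_pos K a by (intro mult_left_mono IC1) auto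
      moreover have "2 * \<kappa> * (J K - K * I K) \<le> 2 * \<kappa> * (K * C1)"
      proof (intro mult_left_mono)
        have "J K - J 0 \<le> K * I K - K * I 0"
        proof (rule halfline_derivative_le[OF J' _ _ K])
          show "((\<lambda>a. K * I a) has_vector_derivative K * N t b) (at b within {0..})" if "b \<ge> 0" for b
            by (intro has_vector_derivative_mult_right I' that)
        qed (auto intro: mult_right_mono)
        then show "J K - K * I K \<le> K * C1" using mult_nonneg_nonneg[OF K C1] unfolding I0 by linarith
      qed (use kappa_pos in auto)
      moreover have "- (a * qq t a) \<le> 2 * \<kappa> * C1"
      proof -
        have "a * (- qq t a) \<le> a * (2 * \<kappa> * N t a)" using qq_lower[OF a, of t] a by (intro mult_left_mono) auto
        also have "\<dots> = 2 * \<kappa> * (a * N t a)" by simp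
        also have "\<dots> \<le> 2 * \<kappa> * C1" using kappa_pos by (intro mult_left_mono aN a) auto
        finally show ?thesis by simp
      qed
      ultimately show ?thesis unfolding C3_def using QC2[OF a] by (simp add: algebra_simps)
    qed
    have cg: "continuous_on {0..} (\<lambda>y. cmod (gam t y))" "continuous_on {0..} (\<lambda>y. y\<^sup>2 * (cmod (gam t y))\<^sup>2)"
      "continuous_on {0..} (\<lambda>y. (cmod (gam t y))\<^sup>2)"
      by (intro continuous_intros gam_continuous)+
    \<comment> \<open>The comparison function has derivative
      \<open>(1 + r^2) * |gam|^2 + 1 / (2 * (1 + r)^2)\<close>: integration by parts of
      \<open>r^2 * |gam|^2 = - r^2 * N'\<close> turns it into
      \<open>2 * J - r^2 * N\<close>.\<close>
    have "integral {0..r} (\<lambda>y. cmod (gam t y)) - integral {0..0} (\<lambda>y. cmod (gam t y)) \<le>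
       ((- N t r) + (2 * J r - r\<^sup>2 * N t r) - 1 / (2 * (1 + r))) - ((- N t 0) + (2 * J 0 - 0\<^sup>2 * N t 0) - 1 / (2 * (1 + 0)))"
    proof (rule halfline_derivative_le[OF indefinite_integral_has_vector_derivative[OF cg(1)] _ _ r])
      fix b :: real assume b: "b \<ge> 0"
      have d1: "((\<lambda>r. 1 / (2 * (1 + r))) has_vector_derivative (- (1 / (2 * (1 + b)\<^sup>2)))) (at b within {0..})"
        by (rule recip_derivative[OF b])
      have d2: "((\<lambda>r. r\<^sup>2) has_vector_derivative 2 * b) (at b within {0..})"
        unfolding has_real_derivative_iff_has_vector_derivative[symmetric] by (auto intro!: derivative_eq_intros)
      show "((\<lambda>r. (- N t r) + (2 * J r - r\<^sup>2 * N t r) - 1 / (2 * (1 + r))) has_vector_derivative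
         ((- (- (cmod (gam t b))\<^sup>2)) + (2 * (b * N t b) - (b\<^sup>2 * (- (cmod (gam t b))\<^sup>2) + 2 * b * N t b)) - (- (1 / (2 * (1 + b)\<^sup>2)))))
         (at b within {0..})"
        by (intro has_vector_derivative_add has_vector_derivative_diff has_vector_derivative_minus has_vector_derivative_mult_right
             has_vector_derivative_mult N_derivative J' d1 d2 b)
    next
      fix b :: real assume b: "0 \<le> b" "b \<le> r"
      let ?g = "cmod (gam t b)"
      have "2 * ((1 + b) * ?g) * (1 / (1 + b)) \<le> ((1 + b) * ?g)\<^sup>2 + (1 / (1 + b))\<^sup>2" by (rule sum_squares_bound)
      moreover have "2 * ((1 + b) * ?g) * (1 / (1 + b)) = 2 * ?g" using b by simp
      moreover have "((1 + b) * ?g)\<^sup>2 \<le> 2 * (1 + b\<^sup>2) * ?g\<^sup>2"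
        unfolding power_mult_distrib using sum_squares_bound[of 1 b] by (intro mult_right_mono) (simp_all add: power2_sum)
      moreover have "(1 / (1 + b))\<^sup>2 = 2 * (1 / (2 * (1 + b)\<^sup>2))" by (simp add: power_divide)
      ultimately have "?g \<le> (1 + b\<^sup>2) * ?g\<^sup>2 + 1 / (2 * (1 + b)\<^sup>2)" by linarith
      then show "?g \<le> (- (- ?g\<^sup>2)) + (2 * (b * N t b) - (b\<^sup>2 * (- ?g\<^sup>2) + 2 * b * N t b)) - (- (1 / (2 * (1 + b)\<^sup>2)))"
        by (simp add: algebra_simps)
    qed
    also have "\<dots> \<le> 2 * J r + 1"
    proof -
      have "0 \<le> r\<^sup>2 * N t r" "0 \<le> 1 / (2 * (1 + r))" using r by auto
      moreover have "(- N t 0) + (2 * J 0 - 0\<^sup>2 * N t 0) - 1 / (2 * (1 + 0)) = - 1" by (simp add: I0)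
      ultimately show ?thesis using N_nonneg[of t r] by linarith
    qed
    also have "\<dots> \<le> 2 * C3 + 1" using JC3[OF r] by simp
    finally show ?thesis by simp
  qed
  show thesis by (rule that[of "2 * C3 + 1"]) (use C3 key in auto)
qed

end

section \<open>Rapid decay\<close>

lemma integral_reflect_Icc:
  fixes f :: "real \<Rightarrow> 'b::banach"
  assumes f: "continuous_on {0..r} f" and r: "r \<ge> 0"
  shows "integral {0..r} (\<lambda>y. f (r - y)) = integral {0..r} f"
proof -
  have "(f has_integral integral {0..r} f) (cbox 0 r)"
    using integrable_continuous_interval[OF f] by (simp add: integrable_integral)
  from has_integral_affinity[OF this, of "- 1" r]
  have "((\<lambda>y. f (r - y)) has_integral integral {0..r} f) ((\<lambda>y. r - y) ` {0..r})" by simp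
  moreover have "(\<lambda>y. r - y) ` {0..r} = {0..r}" by simp
  ultimately show ?thesis by (simp add: integral_unique)
qed

lemma integral_norm_mult_le:
  fixes f g :: "real \<Rightarrow> complex"
  assumes c: "continuous_on {0..r} f" "continuous_on {0..r} g" and b: "\<And>y. y \<in> {0..r} \<Longrightarrow> cmod (f y * g y) \<le> h y"
    and h: "h integrable_on {0..r::real}"
  shows "cmod (integral {0..r} (\<lambda>y. f y * g y)) \<le> integral {0..r} h"
  by (rule Henstock_Kurzweil_Integration.integral_norm_bound_integral[OF _ h b])
     (auto intro!: integrable_continuous_interval continuous_intros c)

context ccm
begin

primrec hs :: "real \<Rightarrow> nat \<Rightarrow> real \<Rightarrow> real \<Rightarrow> complex" where
  "hs t 0 = gg t"
| "hs t (Suc j) = (\<lambda>r x. Lop (hs t j r) x + of_real r * hs t j r x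
     + (- of_real (2 * \<kappa>)) * conv (\<lambda>y. ell (hs t j y)) (gg t) r x)"

primrec le :: "nat \<Rightarrow> real \<Rightarrow> complex" where
  "le 0 = ee"
| "le (Suc j) = Lop (le j)"

text \<open>\<open>hs t j\<close> is the trajectory starting from the \<open>j\<close>-th power of the Lax operator applied to \<open>ee\<close>.\<close>

lemma hs_sol: "\<exists>hx. sol t (hs t j) hx (\<lambda>_ _. 0)"
proof (induction j)
  case 0
  then show ?case using gg_sol by auto
next
  case (Suc j)
  then obtain hx where h: "sol t (hs t j) hx (\<lambda>_ _. 0)" by blast
  have c: "continuous_on {0..} (\<lambda>y. ell (hs t j y))" by (rule tame_ell_continuous[OF sol_tame(1)[OF h]])
  obtain ax where A: "sol t (\<lambda>r. Lop (hs t j r)) ax (\<lambda>r x. Lop (\<lambda>_. 0) x - hs t j r x + of_real (2 * \<kappa>) * ell (hs t j r) * ee x)"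
    using sol_Lop[OF h] by blast
  have d: "((\<lambda>r. complex_of_real r) has_vector_derivative 1) (at r within {0..})" for r
    using has_vector_derivative_of_real[OF DERIV_ident, where 'a = complex] by simp
  obtain bx where B: "sol t (\<lambda>r x. of_real r * hs t j r x) bx (\<lambda>r x. of_real r * 0 + 1 * hs t j r x)"
    using sol_cmult[OF h d] by auto
  obtain cx where C: "sol t (\<lambda>r x. (- of_real (2 * \<kappa>)) * conv (\<lambda>y. ell (hs t j y)) (gg t) r x) cx
     (\<lambda>r x. (- of_real (2 * \<kappa>)) * (ell (hs t j r) * gg t 0 x))"
    using sol_scale[OF sol_conv[OF c gg_sol]] by blast
  \<comment> \<open>The commutator sources of \<open>Lop h\<close> are \<open>- h\<close> and a
    multiple of \<open>ell h * ee\<close>. Multiplication by r cancels the former and the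
    convolution the latter; both corrections vanish at r = 0, so the initial value is that of
    \<open>Lop h\<close>.\<close>
  have "sol t (hs t (Suc j)) (\<lambda>r x. ax r x + bx r x + cx r x) (\<lambda>_ _. 0)"
    unfolding hs.simps by (rule sol_cong[OF sol_add[OF sol_add[OF A B] C]]) (simp add: gg_0)
  then show ?case by blast
qed

lemma hs_tame: "tame (hs t j)"
  using hs_sol[of t j] sol_tame(1) by blast

lemma hs_0: "x \<ge> 0 \<Longrightarrow> hs t j 0 x = le j x"
proof (induction j arbitrary: x)
  case 0
  then show ?case by (simp add: gg_0)
next
  case (Suc j)
  then show ?case using Lop_cong[of "hs t j 0" "le j" x] by (simp add: conv_def)
qed

lemma exp_decay_le: "exp_decay (le j)"
  by (induction j) (auto intro: exp_decay_ee exp_decay_Lop)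

definition eta :: "real \<Rightarrow> nat \<Rightarrow> real \<Rightarrow> complex" where "eta t j r = hs t j r 0"

definition mj :: "real \<Rightarrow> nat \<Rightarrow> real \<Rightarrow> complex" where "mj t j r = ell (hs t j r)"

lemma eta_zero: "eta t 0 = gam t" by (auto simp: eta_def gam_def)

lemma mj_continuous: "continuous_on {0..} (mj t j)"
  unfolding mj_def by (rule tame_ell_continuous[OF hs_tame])

text \<open>The trace of the recursion at x = 0, where \<open>Lop\<close> vanishes. A factor r, that
  is decay, is thereby exchanged for a power of \<open>Lop\<close> on the smooth initial value, at
  the price of a convolution.\<close>

lemma eta_Suc: "of_real r * eta t j r = eta t (Suc j) r + of_real (2 * \<kappa>) * integral {0..r} (\<lambda>y. mj t j y * gam t (r - y))"
  by (simp add: eta_def mj_def gam_def conv_def)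

lemma hs_nsq_le: assumes r: "r \<ge> 0" shows "nsq (hs t j r) \<le> nsq (le j)"
proof -
  obtain hx where h: "sol t (hs t j) hx (\<lambda>_ _. 0)" using hs_sol by blast
  have "nsq (hs t j r) \<le> nsq (hs t j 0)" by (rule sol_nsq_antimono[OF h]) (use r in auto)
  also have "\<dots> = nsq (le j)" by (rule nsq_cong) (rule hs_0)
  finally show ?thesis .
qed

lemma mj_le: "r \<ge> 0 \<Longrightarrow> cmod (mj t j r) \<le> sqrt (nsq (le j))"
  unfolding mj_def using ell_le[OF tame_exp_decay[OF hs_tame], of r t j] hs_nsq_le[of r t j]
  by (meson order_trans real_sqrt_le_mono)

lemma eta_linear_bound:
  obtains C where "C \<ge> 0" "\<And>t r. \<bar>t\<bar> \<le> R \<Longrightarrow> r \<ge> 0 \<Longrightarrow> cmod (eta t j r) \<le> C * (1 + r)"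
proof -
  obtain B where B: "\<And>x. x \<ge> 0 \<Longrightarrow> cmod (le j x) \<le> B" using exp_decay_bounded[OF exp_decay_le] by blast
  have B0: "B \<ge> 0" using B[of 0] norm_ge_zero[of "le j 0"] by (simp del: norm_ge_zero)
  let ?S = "4 * \<kappa> * \<bar>R\<bar> * sqrt (nsq (le j))"
  have S0: "?S \<ge> 0" using kappa_pos by simp
  show thesis
  proof (rule that[of "B + ?S"])
    fix t r assume t: "\<bar>t\<bar> \<le> R" and r: "r \<ge> (0::real)"
    obtain hx where h: "sol t (hs t j) hx (\<lambda>_ _. 0)" using hs_sol by blast
    have "cmod (hs t j r 0) \<le> cmod (hs t j 0 r) + r * (4 * \<kappa> * \<bar>t\<bar> * sqrt (nsq (le j)) + 0)"
      by (rule sol_sup_bound[OF h r]) (auto intro: hs_nsq_le)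
    also have "\<dots> \<le> B + r * ?S"
      using B[OF r] hs_0[OF r] r t kappa_pos by (intro add_mono mult_left_mono) (auto intro!: mult_right_mono mult_left_mono)
    also have "\<dots> \<le> (B + ?S) * (1 + r)" using B0 S0 r by (simp add: algebra_simps)
    finally show "cmod (eta t j r) \<le> (B + ?S) * (1 + r)" by (simp add: eta_def)
  qed (use B0 S0 in auto)
qed

text \<open>The set of times over which all decay constants are uniform: bounded, stable, and with a
  common K beyond which only a small part of the norm is left.\<close>

definition good :: "real \<Rightarrow> real \<Rightarrow> real \<Rightarrow> bool" where
  "good R K t \<longleftrightarrow> \<bar>t\<bar> \<le> R \<and> stable t \<and> 4 * \<kappa> * N t K \<le> 1 / 2"

lemma gam_reflect_integral:
  assumes "r \<ge> 0"
  shows "integral {0..r} (\<lambda>y. cmod (gam t (r - y))) = integral {0..r} (\<lambda>y. cmod (gam t y))"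
  by (rule integral_reflect_Icc[where f = "\<lambda>y. cmod (gam t y)"])
     (use assms in \<open>auto intro!: continuous_intros continuous_on_subset[OF gam_continuous]\<close>)

lemma gam_reflect_continuous: "continuous_on {0..r} (\<lambda>y. gam t (r - y))"
  by (rule continuous_on_compose2[OF gam_continuous]) (auto intro!: continuous_intros)

text \<open>By stability the inner product left over in \<open>ell_split\<close> vanishes as K tends
  to infinity, so \<open>mj\<close> is the correlation of \<open>eta\<close> with
  \<open>gam\<close>. Since \<open>gam\<close> is integrable, \<open>mj\<close> at r inherits the
  bound of \<open>eta\<close> beyond r.\<close>

lemma mj_tail_bound:
  assumes st: "stable t" and r: "r \<ge> 0"
    and C: "\<And>a. a \<ge> 0 \<Longrightarrow> integral {0..a} (\<lambda>y. cmod (gam t y)) \<le> C"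
    and D: "\<And>y. y \<ge> r \<Longrightarrow> cmod (eta t j y) \<le> D"
  shows "cmod (mj t j r) \<le> D * C"
proof -
  obtain hx where h: "sol t (hs t j) hx (\<lambda>_ _. 0)" using hs_sol by blast
  have D0: "D \<ge> 0" using D[of r] by (auto intro: order_trans[OF norm_ge_zero])
  have bd: "cmod (mj t j r) \<le> sqrt (nsq (le j)) * sqrt (N t K) + D * C" if K: "K \<ge> 0" for K
  proof -
    have c1: "continuous_on {0..K} (\<lambda>y. hs t j (r + y) 0)"
      by (rule continuous_on_compose2[OF tame_trace_continuous[OF hs_tame]]) (use r in \<open>auto intro!: continuous_intros\<close>)
    have c2: "continuous_on {0..K} (\<lambda>y. cnj (gam t y))"
      by (intro continuous_intros continuous_on_subset[OF gam_continuous]) auto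
    have ig: "(\<lambda>y. cmod (gam t y)) integrable_on {0..K}"
      by (intro integrable_continuous_interval continuous_intros continuous_on_subset[OF gam_continuous]) auto
    have "cmod (mj t j r) \<le> cmod (ip (hs t j (r + K)) (gg t K)) + cmod (integral {0..K} (\<lambda>y. hs t j (r + y) 0 * cnj (gam t y)))"
      unfolding mj_def ell_split[OF h r K] by (rule norm_triangle_ineq)
    also have "cmod (ip (hs t j (r + K)) (gg t K)) \<le> sqrt (nsq (hs t j (r + K))) * sqrt (nsq (gg t K))"
      by (intro ip_le tame_exp_decay[OF hs_tame] gg_exp_decay) (use r K in auto)
    also have "\<dots> \<le> sqrt (nsq (le j)) * sqrt (N t K)"
      unfolding N_def using r K by (intro mult_right_mono) (auto intro: hs_nsq_le)
    also have "cmod (integral {0..K} (\<lambda>y. hs t j (r + y) 0 * cnj (gam t y))) \<le> integral {0..K} (\<lambda>y. D * cmod (gam t y))"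
    proof (rule integral_norm_mult_le[OF c1 c2])
      fix y assume "y \<in> {0..K}"
      then show "cmod (hs t j (r + y) 0 * cnj (gam t y)) \<le> D * cmod (gam t y)"
        unfolding norm_mult complex_mod_cnj using D[of "r + y"] by (intro mult_right_mono) (auto simp: eta_def)
    qed (use ig in \<open>auto intro: integrable_on_mult_right\<close>)
    also have "integral {0..K} (\<lambda>y. D * cmod (gam t y)) = D * integral {0..K} (\<lambda>y. cmod (gam t y))" by simp
    also have "\<dots> \<le> D * C" by (intro mult_left_mono C K D0)
    finally show ?thesis by simp
  qed
  have "((\<lambda>K. sqrt (nsq (le j)) * sqrt (N t K) + D * C) \<longlongrightarrow> sqrt (nsq (le j)) * sqrt 0 + D * C) at_top"
    using st unfolding stable_def by (intro tendsto_intros)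
  then have "cmod (mj t j r) \<le> sqrt (nsq (le j)) * sqrt 0 + D * C"
    by (rule tendsto_lowerbound) (auto intro!: eventually_mono[OF eventually_ge_at_top[of 0]] bd)
  then show ?thesis by simp
qed

lemma powr_upgrade:
  fixes r b :: real
  assumes r: "r \<ge> 0" and x: "x \<ge> 0" and D: "D \<ge> 0" "r * x \<le> D * (1 + r) powr b" and C: "C \<ge> 0" "x \<le> C * (1 + r) powr b"
  shows "x \<le> (2 * D + 2 * C) * (1 + r) powr (b - 1)"
proof -
  let ?p = "(1 + r) powr b"
  have p: "?p \<ge> 0" by simp
  have "(1 + r) * x \<le> (2 * D + 2 * C) * ?p"
  proof (cases "r \<ge> 1")
    case True
    have "(1 + r) * x \<le> (2 * r) * x" using True x by (intro mult_right_mono) auto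
    also have "\<dots> \<le> 2 * (D * ?p)" using D(2) by simp
    also have "\<dots> \<le> (2 * D + 2 * C) * ?p" using mult_nonneg_nonneg[OF C(1) p] by (simp add: algebra_simps)
    finally show ?thesis .
  next
    case False
    have "(1 + r) * x \<le> 2 * x" using False x by (intro mult_right_mono) auto
    also have "\<dots> \<le> 2 * (C * ?p)" using C(2) by simp
    also have "\<dots> \<le> (2 * D + 2 * C) * ?p" using mult_nonneg_nonneg[OF D(1) p] by (simp add: algebra_simps)
    finally show ?thesis .
  qed
  then have "x \<le> (2 * D + 2 * C) * ?p / (1 + r)" using r by (simp add: field_simps)
  also have "\<dots> = (2 * D + 2 * C) * (1 + r) powr (b - 1)" using r by (simp add: powr_diff)
  finally show ?thesis .
qed

text \<open>All indices j are treated at once because \<open>eta_Suc\<close> bounds index j by index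
  j + 1; the constants may depend on j but not on the good time.\<close>

definition decays :: "real \<Rightarrow> real \<Rightarrow> real \<Rightarrow> bool" where
  "decays R K a \<longleftrightarrow> (\<forall>j. \<exists>C\<ge>0. \<forall>t r. good R K t \<longrightarrow> r \<ge> 0 \<longrightarrow> cmod (eta t j r) \<le> C * (1 + r) powr (- a))"

lemma decays_weaken: assumes "decays R K a" "a' \<le> a" shows "decays R K a'"
  unfolding decays_def
proof
  fix j
  obtain C where C: "C \<ge> 0" "\<And>t r. good R K t \<Longrightarrow> r \<ge> 0 \<Longrightarrow> cmod (eta t j r) \<le> C * (1 + r) powr (- a)"
    using assms(1) unfolding decays_def by meson
  have "cmod (eta t j r) \<le> C * (1 + r) powr (- a')" if "good R K t" "r \<ge> 0" for t r
    using C(2)[OF that] mult_left_mono[OF powr_mono[of "- a" "- a'" "1 + r"] C(1)] assms(2) that by simp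
  then show "\<exists>C\<ge>0. \<forall>t r. good R K t \<longrightarrow> r \<ge> 0 \<longrightarrow> cmod (eta t j r) \<le> C * (1 + r) powr (- a')" using C(1) by blast
qed

text \<open>Only boundedness of \<open>mj\<close> and integrability of \<open>gam\<close> are used,
  so the convolution in \<open>eta_Suc\<close> is bounded. This gains a full power as long as no
  decay is assumed yet, which is b >= 0.\<close>

lemma decays_step1:
  assumes K: "K \<ge> 0" and b: "b \<ge> 0" and P: "decays R K (- b)"
  shows "decays R K (1 - b)"
  unfolding decays_def
proof
  fix j
  obtain G where G: "G \<ge> 0" "\<And>t r. 4 * \<kappa> * N t K \<le> 1 / 2 \<Longrightarrow> r \<ge> 0 \<Longrightarrow> integral {0..r} (\<lambda>y. cmod (gam t y)) \<le> G"
    using regularity_bound[OF K] by metis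
  obtain C where C: "C \<ge> 0" "\<And>t r. good R K t \<Longrightarrow> r \<ge> 0 \<Longrightarrow> cmod (eta t j r) \<le> C * (1 + r) powr b"
    using P unfolding decays_def by (metis minus_minus)
  obtain C' where C': "C' \<ge> 0" "\<And>t r. good R K t \<Longrightarrow> r \<ge> 0 \<Longrightarrow> cmod (eta t (Suc j) r) \<le> C' * (1 + r) powr b"
    using P unfolding decays_def by (metis minus_minus)
  let ?B = "sqrt (nsq (le j))"
  let ?D = "C' + 2 * \<kappa> * (?B * G)"
  have D0: "?D \<ge> 0" using C' G kappa_pos by auto
  have "cmod (eta t j r) \<le> (2 * ?D + 2 * C) * (1 + r) powr (- (1 - b))" if t: "good R K t" and r: "r \<ge> 0" for t r
  proof -
    have ig: "(\<lambda>y. cmod (gam t (r - y))) integrable_on {0..r}"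
      by (intro integrable_continuous_interval continuous_intros gam_reflect_continuous)
    have "cmod (integral {0..r} (\<lambda>y. mj t j y * gam t (r - y))) \<le> integral {0..r} (\<lambda>y. ?B * cmod (gam t (r - y)))"
    proof (rule integral_norm_mult_le[OF continuous_on_subset[OF mj_continuous] gam_reflect_continuous])
      show "cmod (mj t j y * gam t (r - y)) \<le> ?B * cmod (gam t (r - y))" if "y \<in> {0..r}" for y
        unfolding norm_mult using that by (intro mult_right_mono mj_le) auto
    qed (use ig in \<open>auto intro: integrable_on_mult_right\<close>)
    also have "\<dots> = ?B * integral {0..r} (\<lambda>y. cmod (gam t y))" using gam_reflect_integral[OF r, of t] by simp
    also have "\<dots> \<le> ?B * G" using t r by (intro mult_left_mono G) (auto simp: good_def)
    finally have I: "cmod (integral {0..r} (\<lambda>y. mj t j y * gam t (r - y))) \<le> ?B * G" .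
    have "r * cmod (eta t j r) = cmod (of_real r * eta t j r)" using r by (simp add: norm_mult)
    also have "\<dots> \<le> cmod (eta t (Suc j) r) + 2 * \<kappa> * cmod (integral {0..r} (\<lambda>y. mj t j y * gam t (r - y)))"
      unfolding eta_Suc using kappa_pos by (intro order_trans[OF norm_triangle_ineq]) (simp add: norm_mult)
    also have "\<dots> \<le> C' * (1 + r) powr b + 2 * \<kappa> * (?B * G)"
      using kappa_pos C'(2)[OF t r] I by (intro add_mono mult_left_mono) auto
    also have "2 * \<kappa> * (?B * G) \<le> 2 * \<kappa> * (?B * G) * (1 + r) powr b"
      using mult_left_mono[of 1 "(1 + r) powr b" "2 * \<kappa> * (?B * G)"] b r kappa_pos G(1) by (simp add: ge_one_powr_ge_zero)
    finally have "r * cmod (eta t j r) \<le> ?D * (1 + r) powr b" by (simp add: algebra_simps)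
    from powr_upgrade[OF r norm_ge_zero D0 this C(1) C(2)[OF t r]] show ?thesis by simp
  qed
  then show "\<exists>C\<ge>0. \<forall>t r. good R K t \<longrightarrow> r \<ge> 0 \<longrightarrow> cmod (eta t j r) \<le> C * (1 + r) powr (- (1 - b))"
    using D0 C(1) by (intro exI[of _ "2 * ?D + 2 * C"]) auto
qed

lemma integral_inverse_sqrt:
  assumes r: "r \<ge> 0"
  shows "((\<lambda>y. (1 + y) powr (- (1 / 2))) has_integral (2 * (1 + r) powr (1 / 2) - 2)) {0..r::real}"
proof -
  have "((\<lambda>y. (1 + y) powr (- (1 / 2))) has_integral (2 * (1 + r) powr (1 / 2) - 2 * (1 + 0) powr (1 / 2))) {0..r::real}"
  proof (rule fundamental_theorem_of_calculus[OF r])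
    fix y assume "y \<in> {0..r}"
    then have y: "1 + y > 0" by auto
    have "((\<lambda>y. 1 + y) has_real_derivative 1) (at y)" by (auto intro!: derivative_eq_intros)
    from DERIV_fun_powr[OF this y, of "1 / 2"]
    have "((\<lambda>y. (1 + y) powr (1 / 2)) has_real_derivative (1 / 2) * (1 + y) powr (- (1 / 2))) (at y)" by simp
    from DERIV_cmult[OF DERIV_subset[OF this subset_UNIV], of 2]
    show "((\<lambda>y. 2 * (1 + y) powr (1 / 2)) has_vector_derivative (1 + y) powr (- (1 / 2))) (at y within {0..r})"
      unfolding has_real_derivative_iff_has_vector_derivative[symmetric] by simp
  qed
  then show ?thesis by simp
qed

text \<open>With decay at hand, \<open>mj\<close> decays as well by \<open>mj_tail_bound\<close>.
  Division by r gains one power and the convolution loses one half.\<close>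

lemma decays_step2:
  assumes K: "K \<ge> 0" and a: "a \<ge> 1" and P: "decays R K a"
  shows "decays R K (a + 1 / 2)"
  unfolding decays_def
proof
  fix j
  obtain G where G: "G \<ge> 0" "\<And>t r. 4 * \<kappa> * N t K \<le> 1 / 2 \<Longrightarrow> r \<ge> 0 \<Longrightarrow> integral {0..r} (\<lambda>y. cmod (gam t y)) \<le> G"
    using regularity_bound[OF K] by metis
  obtain C where C: "C \<ge> 0" "\<And>t r. good R K t \<Longrightarrow> r \<ge> 0 \<Longrightarrow> cmod (eta t j r) \<le> C * (1 + r) powr (- a)"
    using P unfolding decays_def by meson
  obtain C' where C': "C' \<ge> 0" "\<And>t r. good R K t \<Longrightarrow> r \<ge> 0 \<Longrightarrow> cmod (eta t (Suc j) r) \<le> C' * (1 + r) powr (- a)"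
    using P unfolding decays_def by meson
  obtain C0 where C0: "C0 \<ge> 0" "\<And>t r. good R K t \<Longrightarrow> r \<ge> 0 \<Longrightarrow> cmod (eta t 0 r) \<le> C0 * (1 + r) powr (- a)"
    using P unfolding decays_def by meson
  let ?b = "1 / 2 - a"
  let ?D = "C' + 2 * \<kappa> * (C * G * 2 powr a * (G + 2 * C0))"
  have D0: "?D \<ge> 0" using C' C C0 G kappa_pos by auto
  have "cmod (eta t j r) \<le> (2 * ?D + 2 * C) * (1 + r) powr (- (a + 1 / 2))" if t: "good R K t" and r: "r \<ge> 0" for t r
  proof -
    let ?h = "(1 + r / 2) powr (- a)"
    have mj: "cmod (mj t j y) \<le> (C * (1 + y) powr (- a)) * G" if y: "y \<ge> 0" for y
    proof (rule mj_tail_bound[OF _ y])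
      fix z assume z: "z \<ge> y"
      have "cmod (eta t j z) \<le> C * (1 + z) powr (- a)" using C(2)[OF t, of z] y z by simp
      also have "\<dots> \<le> C * (1 + y) powr (- a)" using y z a C(1) by (intro mult_left_mono powr_mono2') auto
      finally show "cmod (eta t j z) \<le> C * (1 + y) powr (- a)" .
    qed (use t G in \<open>auto simp: good_def\<close>)
    have ig: "(\<lambda>y. cmod (gam t (r - y))) integrable_on {0..r}"
      by (intro integrable_continuous_interval continuous_intros gam_reflect_continuous)
    note hsq = integral_inverse_sqrt[OF r]
    let ?w = "\<lambda>y. C * G * ?h * (cmod (gam t (r - y)) + C0 * (1 + y) powr (- (1 / 2)))"
    have "cmod (integral {0..r} (\<lambda>y. mj t j y * gam t (r - y))) \<le> integral {0..r} ?w"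
    proof (rule integral_norm_mult_le[OF continuous_on_subset[OF mj_continuous] gam_reflect_continuous])
      show "?w integrable_on {0..r}"
        by (intro integrable_on_mult_right integrable_add ig has_integral_integrable[OF hsq])
      fix y assume y: "y \<in> {0..r}"
      \<comment> \<open>Splitting at r/2: on the right half \<open>mj\<close> is small and
        \<open>gam\<close> integrable; on the left half \<open>gam\<close> is small, and the decay
        of \<open>mj\<close> is weakened to the exponent -1/2, whose integral grows like
        \<open>(1 + r) powr (1 / 2)\<close>.\<close>
      show "cmod (mj t j y * gam t (r - y)) \<le> ?w y"
      proof (cases "y \<ge> r / 2")
        case True
        have "cmod (mj t j y) \<le> C * (1 + y) powr (- a) * G" using mj y by simp
        also have "\<dots> \<le> C * ?h * G" using True r a C(1) G(1) by (intro mult_right_mono mult_left_mono powr_mono2') auto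
        finally have "cmod (mj t j y * gam t (r - y)) \<le> C * ?h * G * cmod (gam t (r - y))"
          unfolding norm_mult by (intro mult_right_mono) auto
        also have "\<dots> = C * G * ?h * (cmod (gam t (r - y)) + 0)" by simp
        also have "\<dots> \<le> ?w y" using C(1) G(1) C0(1) by (intro mult_left_mono add_left_mono) auto
        finally show ?thesis .
      next
        case False
        have "cmod (gam t (r - y)) \<le> C0 * (1 + (r - y)) powr (- a)" using C0(2)[OF t, of "r - y"] y by (simp add: eta_zero)
        also have "\<dots> \<le> C0 * ?h" using False r a C0(1) by (intro mult_left_mono powr_mono2') auto
        finally have g: "cmod (gam t (r - y)) \<le> C0 * ?h" .
        have "cmod (mj t j y) \<le> C * (1 + y) powr (- a) * G" using mj y by simp
        also have "\<dots> \<le> C * (1 + y) powr (- (1 / 2)) * G"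
          using a y C(1) G(1) by (intro mult_right_mono mult_left_mono powr_mono) auto
        finally have "cmod (mj t j y * gam t (r - y)) \<le> (C * (1 + y) powr (- (1 / 2)) * G) * (C0 * ?h)"
          unfolding norm_mult using g C(1) G(1) by (intro mult_mono) auto
        also have "\<dots> = C * G * ?h * (0 + C0 * (1 + y) powr (- (1 / 2)))" by simp
        also have "\<dots> \<le> ?w y" using C(1) G(1) by (intro mult_left_mono add_right_mono) auto
        finally show ?thesis .
      qed
    qed auto
    also have "\<dots> = C * G * ?h * (integral {0..r} (\<lambda>y. cmod (gam t y)) + C0 * (2 * (1 + r) powr (1 / 2) - 2))"
      using gam_reflect_integral[OF r, of t] integral_unique[OF hsq] ig has_integral_integrable[OF hsq]
      by (simp add: integral_add integrable_on_mult_right)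
    also have "\<dots> \<le> C * G * ?h * (G * (1 + r) powr (1 / 2) + C0 * (2 * (1 + r) powr (1 / 2)))"
    proof (intro mult_left_mono add_mono)
      have "integral {0..r} (\<lambda>y. cmod (gam t y)) \<le> G * 1" using G(2)[of t r] t r by (simp add: good_def)
      also have "\<dots> \<le> G * (1 + r) powr (1 / 2)" using G(1) r by (intro mult_left_mono ge_one_powr_ge_zero) auto
      finally show "integral {0..r} (\<lambda>y. cmod (gam t y)) \<le> G * (1 + r) powr (1 / 2)" .
    qed (use C(1) G(1) C0(1) in auto)
    also have "\<dots> = (C * G * (G + 2 * C0)) * (?h * (1 + r) powr (1 / 2))" by (simp add: algebra_simps)
    also have "\<dots> \<le> (C * G * (G + 2 * C0)) * (2 powr a * (1 + r) powr (- a) * (1 + r) powr (1 / 2))"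
    proof (intro mult_left_mono mult_right_mono)
      have "?h \<le> ((1 + r) / 2) powr (- a)" using r a by (intro powr_mono2') auto
      also have "\<dots> = 2 powr a * (1 + r) powr (- a)" using r by (simp add: powr_divide powr_minus field_simps)
      finally show "?h \<le> 2 powr a * (1 + r) powr (- a)" .
    qed (use C(1) G(1) C0(1) in auto)
    also have "\<dots> = C * G * 2 powr a * (G + 2 * C0) * (1 + r) powr ?b" by (simp add: powr_add[symmetric] mult_ac)
    finally have I: "cmod (integral {0..r} (\<lambda>y. mj t j y * gam t (r - y))) \<le> C * G * 2 powr a * (G + 2 * C0) * (1 + r) powr ?b" .
    have lift: "(1 + r) powr (- a) \<le> (1 + r) powr ?b" using r by (intro powr_mono) auto
    have "r * cmod (eta t j r) = cmod (of_real r * eta t j r)" using r by (simp add: norm_mult)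
    also have "\<dots> \<le> cmod (eta t (Suc j) r) + 2 * \<kappa> * cmod (integral {0..r} (\<lambda>y. mj t j y * gam t (r - y)))"
      unfolding eta_Suc using kappa_pos by (intro order_trans[OF norm_triangle_ineq]) (simp add: norm_mult)
    also have "\<dots> \<le> C' * (1 + r) powr ?b + 2 * \<kappa> * (C * G * 2 powr a * (G + 2 * C0) * (1 + r) powr ?b)"
      using kappa_pos order_trans[OF C'(2)[OF t r] mult_left_mono[OF lift C'(1)]] I by (intro add_mono mult_left_mono) auto
    finally have D: "r * cmod (eta t j r) \<le> ?D * (1 + r) powr ?b" by (simp add: algebra_simps)
    have Cb: "cmod (eta t j r) \<le> C * (1 + r) powr ?b" using order_trans[OF C(2)[OF t r] mult_left_mono[OF lift C(1)]] .
    have e: "- (a + 1 / 2) = ?b - 1" by simp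
    show ?thesis unfolding e by (rule powr_upgrade[OF r norm_ge_zero D0 D C(1) Cb])
  qed
  then show "\<exists>C\<ge>0. \<forall>t r. good R K t \<longrightarrow> r \<ge> 0 \<longrightarrow> cmod (eta t j r) \<le> C * (1 + r) powr (- (a + 1 / 2))"
    using D0 C(1) by (intro exI[of _ "2 * ?D + 2 * C"]) auto
qed

text \<open>The bootstrap starts from linear growth, exponent -1, which is the pointwise bound along
  characteristics. Two full steps reach exponent 1, then half steps reach any exponent.\<close>

lemma decays_all: assumes K: "K \<ge> 0" shows "decays R K a"
proof -
  have "decays R K (- 1)" unfolding decays_def
  proof
    fix j
    obtain C where C: "C \<ge> 0" "\<And>t r. \<bar>t\<bar> \<le> R \<Longrightarrow> r \<ge> 0 \<Longrightarrow> cmod (eta t j r) \<le> C * (1 + r)"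
      using eta_linear_bound by metis
    then show "\<exists>C\<ge>0. \<forall>t r. good R K t \<longrightarrow> r \<ge> 0 \<longrightarrow> cmod (eta t j r) \<le> C * (1 + r) powr (- (- 1))"
      by (intro exI[of _ C]) (auto simp: good_def)
  qed
  from decays_step1[OF K _ this] have "decays R K 0" by simp
  with decays_step1[OF K order_refl, of R] have 1: "decays R K 1" by simp
  have n: "decays R K (1 + real n / 2)" for n
  proof (induction n)
    case (Suc n)
    have "1 + real (Suc n) / 2 = (1 + real n / 2) + 1 / 2" by (simp add: field_simps)
    then show ?case using decays_step2[OF K _ Suc] by simp
  qed (use 1 in simp)
  obtain n :: nat where "2 * a \<le> real n" using real_arch_simple by blast
  then have "a \<le> 1 + real n / 2" by simp
  then show ?thesis using decays_weaken[OF n] by blast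
qed

lemma gam_decay:
  assumes K: "K \<ge> 0"
  obtains C where "C \<ge> 0" "\<And>t r. good R K t \<Longrightarrow> r \<ge> 0 \<Longrightarrow> cmod (gam t r) \<le> C * (1 + r) powr (- a)"
  using decays_all[OF K, of R a] unfolding decays_def by (metis eta_zero)

text \<open>The constant leaves room: \<open>N t K < 1 / (16 * \<kappa>)\<close> and an equally
  small change give \<open>N t' K <= 1 / (8 * \<kappa>)\<close>. This is the smallness in
  \<open>good\<close> and also lies below the quantum \<open>1 / (2 * \<kappa>)\<close>, so t' is
  stable by quantisation.\<close>

lemma good_nhd:
  assumes t: "stable t"
  obtains K d where "K \<ge> 0" "d > 0" "\<And>t'. \<bar>t' - t\<bar> < d \<Longrightarrow> good (\<bar>t\<bar> + 1) K t'"
proof -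
  have "\<forall>\<^sub>F K in at_top. N t K < 1 / (16 * \<kappa>)"
    using t kappa_pos unfolding stable_def by (intro order_tendstoD) auto
  then obtain K where K: "K \<ge> 0" "N t K < 1 / (16 * \<kappa>)"
    unfolding eventually_at_top_linorder by (metis linear max.cobounded1 max.cobounded2)
  obtain C where C: "\<And>t'. \<bar>t' - t\<bar> \<le> 1 \<Longrightarrow> \<bar>N t' K - N t K\<bar> \<le> C * \<bar>t' - t\<bar>" using N_t_lipschitz[OF K(1)] by metis
  define d where "d = min 1 (1 / (16 * \<kappa>) / (\<bar>C\<bar> + 1))"
  have d: "d > 0" unfolding d_def using kappa_pos by auto
  show thesis
  proof (rule that[OF K(1) d])
    fix t' assume t': "\<bar>t' - t\<bar> < d"
    have "\<bar>N t' K - N t K\<bar> \<le> C * \<bar>t' - t\<bar>" using t' by (intro C) (simp add: d_def)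
    also have "\<dots> \<le> (\<bar>C\<bar> + 1) * (1 / (16 * \<kappa>) / (\<bar>C\<bar> + 1))" using t' by (intro mult_mono) (auto simp: d_def)
    also have "\<dots> = 1 / (16 * \<kappa>)" by simp
    finally have "N t' K \<le> 1 / (8 * \<kappa>)" using K(2) by simp
    then have "4 * \<kappa> * N t' K \<le> 1 / 2" using kappa_pos by (simp add: field_simps)
    moreover have "N t' K < 1 / (2 * \<kappa>)" using \<open>N t' K \<le> 1 / (8 * \<kappa>)\<close> kappa_pos
      by (rule_tac le_less_trans) (auto intro!: divide_strict_left_mono)
    ultimately show "good (\<bar>t\<bar> + 1) K t'" using t' stable_if_small[OF K(1)] by (auto simp: good_def d_def)
  qed
qed

end

section \<open>Frequency growth\<close>

lemma at_within_Ici_neq_bot: "x \<ge> 0 \<Longrightarrow> at x within {0::real..} \<noteq> bot"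
  using islimpt_Icc[of 0 "x + 1" x] unfolding at_within_Icc_Ici[of x "x + 1", OF less_add_one, symmetric]
  by (simp add: trivial_limit_within)

context ccm
begin

lemma Lop_derivative_unique:
  assumes f: "exp_decay f" "\<And>x. x \<ge> 0 \<Longrightarrow> (f has_vector_derivative f' x) (at x within {0..})"
    and g: "\<And>x. x \<ge> 0 \<Longrightarrow> Lop f x = g x" "\<And>x. x \<ge> 0 \<Longrightarrow> (g has_vector_derivative g' x) (at x within {0..})"
    and x: "x \<ge> 0"
  shows "f x + of_real x * f' x - of_real (2 * \<kappa>) * (Sst f x - Gop f x) = g' x"
proof (rule vector_derivative_unique_within)
  show "at x within {0..} \<noteq> bot" by (rule at_within_Ici_neq_bot[OF x])
  show "(Lop f has_vector_derivative f x + of_real x * f' x - of_real (2 * \<kappa>) * (Sst f x - Gop f x)) (at x within {0..})"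
    by (intro Lop_derivative exp_decay_continuous f x)
  show "(Lop f has_vector_derivative g' x) (at x within {0..})"
    by (rule has_vector_derivative_transform[OF _ _ g(2)[OF x]]) (use x g(1) in auto)
qed

text \<open>
  Frequency growth. For an eigenfunction \<open>\<phi>0\<close> with eigenvalue \<open>-\<mu>\<close>, first order perturbation theory in \<open>1/t\<close>
  gives the approximate eigenfunction \<open>\<phi>0 + i/(4t) \<phi>0''\<close> of the adjoint of \<open>A + 2tL\<close> with error \<open>O(1/t)\<close>, so the
  trajectory keeps its overlap with it up to times proportional to \<open>t\<close>.
\<close>

lemma growth:
  assumes e: "exp_decay p0" "exp_decay p1" "exp_decay p2" "exp_decay p3"
    and d0: "\<And>x. x \<ge> 0 \<Longrightarrow> (p0 has_vector_derivative p1 x) (at x within {0..})"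
    and d1: "\<And>x. x \<ge> 0 \<Longrightarrow> (p1 has_vector_derivative p2 x) (at x within {0..})"
    and d2: "\<And>x. x \<ge> 0 \<Longrightarrow> (p2 has_vector_derivative p3 x) (at x within {0..})"
    and L0: "\<And>x. x \<ge> 0 \<Longrightarrow> Lop p0 x = - of_real \<mu> * p0 x" and mu: "\<mu> > 0" and l0: "ell p0 \<noteq> 0"
  obtains c t0 n0 where "c > 0" "t0 \<ge> 1" "n0 > 0" "\<And>t. t \<ge> t0 \<Longrightarrow> N t (c * t) \<ge> n0"
proof -
  \<comment> \<open>Evaluate the eigenvalue equation at 0, where \<open>Lop\<close> vanishes. Hence
    the boundary term in the energy identity is of order 1/t, and
    \<open>ell p1 = ell p0\<close>.\<close>
  have p00: "p0 0 = 0" using L0[of 0] mu by simp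
  have ell1: "ell p1 = ell p0" using ell_deriv[OF e(1,2) d0] p00 by simp
  have L1: "Lop p1 x = - of_real \<mu> * p1 x - p0 x + of_real (2 * \<kappa>) * ell p0 * ee x" if x: "x \<ge> 0" for x
  proof -
    have "p0 x + of_real x * p1 x - of_real (2 * \<kappa>) * (Sst p0 x - Gop p0 x) = - of_real \<mu> * p1 x"
      by (rule Lop_derivative_unique[OF e(1) d0 L0 _ x]) (auto intro!: has_vector_derivative_mult_right has_vector_derivative_minus d0)
    then show ?thesis using Lop_deriv_comm[OF e(1,2) d0 x] by simp
  qed
  \<comment> \<open>The multiples of \<open>ee\<close> from differentiating \<open>L1\<close> and
    from the commutator cancel because \<open>ell p1 = ell p0\<close>. What is left shows that the
    second derivative solves \<open>(Lop + \<mu>) p2 = - 2 * p1\<close>, which is the corrector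
    equation up to a factor.\<close>
  have L2: "Lop p2 x = - of_real \<mu> * p2 x - 2 * p1 x" if x: "x \<ge> 0" for x
  proof -
    have "p1 x + of_real x * p2 x - of_real (2 * \<kappa>) * (Sst p1 x - Gop p1 x)
        = - of_real \<mu> * p2 x - p1 x + of_real (2 * \<kappa>) * ell p0 * (- ee x)"
    proof (rule Lop_derivative_unique[OF e(2) d1 L1 _ x])
      fix x :: real assume "x \<ge> 0"
      then show "((\<lambda>x. - of_real \<mu> * p1 x - p0 x + of_real (2 * \<kappa>) * ell p0 * ee x) has_vector_derivative
          (- of_real \<mu> * p2 x - p1 x + of_real (2 * \<kappa>) * ell p0 * (- ee x))) (at x within {0..})"
        by (intro has_vector_derivative_add has_vector_derivative_diff has_vector_derivative_mult_right d0 d1 ee_derivative)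
    qed auto
    moreover have "Lop p2 x = (p1 x + of_real x * p2 x - of_real (2 * \<kappa>) * (Sst p1 x - Gop p1 x)) - p1 x
        + of_real (2 * \<kappa>) * ell p1 * ee x"
      by (rule Lop_deriv_comm[OF e(2,3) d1 x])
    ultimately show ?thesis unfolding ell1 by (simp only:) (simp add: algebra_simps)
  qed
  define b2 where "b2 = cmod (p2 0)"
  define b3 where "b3 = sqrt (nsq p3)"
  define B where "B = b2 + b3 + cmod (ell p2)"
  define l where "l = cmod (ell p0)"
  define X where "X = nsq (\<lambda>x. complex_of_real (cmod (p0 x) + cmod (p2 x)))"
  have bn: "b2 \<ge> 0" "b3 \<ge> 0" "B \<ge> 0" "l > 0" "X \<ge> 0" using l0 by (auto simp: b2_def b3_def B_def l_def X_def)
  have eX: "exp_decay (\<lambda>x. complex_of_real (cmod (p0 x) + cmod (p2 x)))"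
  proof -
    have *: "exp_decay (\<lambda>x. complex_of_real (cmod (f x)))" if f: "exp_decay f" for f
      using f unfolding exp_decay_def by (auto intro!: continuous_intros)
    show ?thesis unfolding of_real_add by (intro exp_decay_add * e)
  qed
  have main: "l - B * (1 + r) / (4 * t) \<le> sqrt (N t r) * sqrt X" if t: "t \<ge> 1" and r: "r \<ge> 0" for t r
  proof -
    let ?k = "\<i> / of_real (4 * t) :: complex"
    define ch where "ch x = p0 x + ?k * p2 x" for x
    define chx where "chx x = p1 x + ?k * p3 x" for x
    define s where "s x = (- 2 * \<i> * of_real (t * \<mu>)) * ch x + (- ?k) * p3 x" for x
    have ech: "exp_decay ch" "exp_decay chx" "exp_decay s"
      unfolding s_def ch_def chx_def by (intro exp_decay_add exp_decay_cmult e)+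
    have Lch: "Lop ch x = - of_real \<mu> * ch x - 2 * ?k * p1 x" if x: "x \<ge> 0" for x
    proof -
      have "Lop ch x = Lop p0 x + ?k * Lop p2 x"
        unfolding ch_def by (simp only: Lop_add[OF e(1) exp_decay_cmult[OF e(3)] x] Lop_cmult[OF e(3) x])
      then show ?thesis unfolding L0[OF x] L2[OF x] ch_def by (simp add: algebra_simps)
    qed
    \<comment> \<open>The corrected eigenfunction, constant in r, is regarded as a solution with
      source, so that the energy identity gives the derivative of its pairing with the trajectory.
      The choice \<open>4 * \<i> * t * ?k = -1\<close> cancels \<open>p1\<close>.\<close>
    have "sol t (\<lambda>_. ch) (\<lambda>_. chx) (\<lambda>_. s)" unfolding sol_def
    proof (intro conjI)
      show "xder (\<lambda>_. ch) (\<lambda>_. chx)" unfolding xder_def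
      proof (intro conjI allI impI tame_const ech)
        fix x :: real assume x: "x \<ge> 0"
        show "(ch has_vector_derivative chx x) (at x within {0..})" unfolding ch_def chx_def
          by (intro has_vector_derivative_add has_vector_derivative_mult_right d0 d2 x)
      qed
      show "tame (\<lambda>_. s)" by (rule tame_const[OF ech(3)])
      show "tder (\<lambda>_. ch) (\<lambda>r x. chx x - 2 * \<i> * of_real t * Lop ch x + s x)"
      proof (rule tder_eqI[OF tder_const[OF ech(1)]])
        fix r x :: real assume "x \<ge> 0"
        then have "chx x - 2 * \<i> * of_real t * Lop ch x + s x = p1 x + 4 * \<i> * of_real t * ?k * p1 x"
          unfolding Lch[OF \<open>x \<ge> 0\<close>] s_def chx_def by (simp add: algebra_simps)
        also have "4 * \<i> * of_real t * ?k = - 1" using t by simp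
        finally show "0 = chx x - 2 * \<i> * of_real t * Lop ch x + s x" by simp
      qed
    qed
    note en = sol_energy[OF gg_sol this]
    \<comment> \<open>The phase removes the contribution of the eigenvalue; the remaining derivative
      is of order 1/t.\<close>
    define P where "P r = exp (\<i> * of_real (- (2 * t * \<mu> * r))) * ip (gg t r) ch" for r
    define P' where "P' r = exp (\<i> * of_real (- (2 * t * \<mu> * r))) * (- (gam t r * cnj (ch 0)) + ?k * ip (gg t r) p3)" for r
    have P: "(P has_vector_derivative P' r) (at r within {0..})" if r: "r \<ge> 0" for r
    proof -
      have "((\<lambda>r. exp (\<i> * of_real (- (2 * t * \<mu> * r)))) has_vector_derivative
          (\<i> * of_real (- (2 * t * \<mu>)) * exp (\<i> * of_real (- (2 * t * \<mu> * r))))) (at r within {0..})"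
        by (rule has_vector_derivative_cis) (auto intro!: derivative_eq_intros)
      from has_vector_derivative_mult[OF this en[OF r]]
      show ?thesis unfolding P_def
      proof (rule has_vector_derivative_eq_rhs)
        have k: "cnj (- ?k) = ?k" by simp
        have "ip (gg t r) s = ip (gg t r) (\<lambda>x. (- 2 * \<i> * of_real (t * \<mu>)) * ch x) + ip (gg t r) (\<lambda>x. (- ?k) * p3 x)"
          unfolding s_def by (intro ip_add_right exp_decay_cmult ech e gg_exp_decay r)
        also have "\<dots> = 2 * \<i> * of_real (t * \<mu>) * ip (gg t r) ch + ?k * ip (gg t r) p3"
          unfolding ip_cmult_right k by simp
        finally show "exp (\<i> * of_real (- (2 * t * \<mu> * r))) * (- (gg t r 0 * cnj (ch 0)) + ip (\<lambda>_. 0) ch + ip (gg t r) s)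
            + \<i> * of_real (- (2 * t * \<mu>)) * exp (\<i> * of_real (- (2 * t * \<mu> * r))) * ip (gg t r) ch = P' r"
          unfolding P'_def gam_def by (simp add: ip_def algebra_simps)
      qed
    qed
    have ch0: "cmod (ch 0) = b2 / (4 * t)" using t by (simp add: ch_def p00 norm_mult norm_divide b2_def)
    \<comment> \<open>\<open>|gam|\<close> is replaced by \<open>1 + |gam|^2\<close>: this needs no
      pointwise bound uniform in t, since the integral of \<open>|gam|^2\<close> never exceeds
      1/2.\<close>
    have P'b: "cmod (P' y) \<le> (b2 * (1 + (cmod (gam t y))\<^sup>2) + b3) / (4 * t)" if y: "y \<ge> 0" for y
    proof -
      have "cmod (P' y) \<le> cmod (gam t y) * cmod (ch 0) + cmod ?k * cmod (ip (gg t y) p3)"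
      proof -
        have "cmod (P' y) = cmod (- (gam t y * cnj (ch 0)) + ?k * ip (gg t y) p3)"
          unfolding P'_def norm_mult norm_exp_i_times by simp
        also have "\<dots> \<le> cmod (- (gam t y * cnj (ch 0))) + cmod (?k * ip (gg t y) p3)" by (rule norm_triangle_ineq)
        finally show ?thesis by (simp only: norm_minus_cancel norm_mult complex_mod_cnj)
      qed
      also have "\<dots> \<le> (1 + (cmod (gam t y))\<^sup>2) * (b2 / (4 * t)) + (1 / (4 * t)) * b3"
      proof (intro add_mono mult_mono)
        have "2 * 1 * cmod (gam t y) \<le> 1\<^sup>2 + (cmod (gam t y))\<^sup>2" by (rule sum_squares_bound)
        then show "cmod (gam t y) \<le> 1 + (cmod (gam t y))\<^sup>2"
          using norm_ge_zero[of "gam t y"] unfolding power_one by linarith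
        have "cmod (ip (gg t y) p3) \<le> sqrt (nsq (gg t y)) * sqrt (nsq p3)" by (intro ip_le gg_exp_decay e y)
        also have "\<dots> \<le> 1 * sqrt (nsq p3)" using N_le_half[OF y, of t] unfolding N_def
          by (intro mult_right_mono) (auto simp: real_sqrt_le_1_iff)
        finally show "cmod (ip (gg t y) p3) \<le> b3" by (simp add: b3_def)
      qed (use t bn ch0 in \<open>auto simp: norm_divide\<close>)
      also have "\<dots> = (b2 * (1 + (cmod (gam t y))\<^sup>2) + b3) / (4 * t)" using t by (simp add: field_simps)
      finally show ?thesis .
    qed
    have hi: "((\<lambda>y. (b2 * (1 + (cmod (gam t y))\<^sup>2) + b3) / (4 * t)) has_integral
        ((b2 * (r + (1 / 2 - N t r)) + r * b3) / (4 * t))) {0..r}"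
      using r has_integral_const_real[of "1::real" 0 r] has_integral_const_real[of b3 0 r]
      by (intro has_integral_divide has_integral_add has_integral_mult_right N_eq) auto
    have PI: "(P' has_integral (P r - P 0)) {0..r}" by (rule FTC_halfline_finite[OF P r]) simp
    have "cmod (integral {0..r} P') \<le> integral {0..r} (\<lambda>y. (b2 * (1 + (cmod (gam t y))\<^sup>2) + b3) / (4 * t))"
      by (rule Henstock_Kurzweil_Integration.integral_norm_bound_integral[OF has_integral_integrable[OF PI] has_integral_integrable[OF hi]])
         (use P'b in auto)
    then have "cmod (P r - P 0) \<le> (b2 * (r + (1 / 2 - N t r)) + r * b3) / (4 * t)"
      unfolding integral_unique[OF hi] integral_unique[OF PI] .
    also have "\<dots> \<le> (b2 * (r + 1) + r * b3) / (4 * t)"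
    proof (intro divide_right_mono add_mono mult_left_mono)
      show "1 / 2 - N t r \<le> 1" using N_nonneg[of t r] by linarith
    qed (use t bn r in auto)
    finally have 1: "cmod (P r - P 0) \<le> (b2 * (r + 1) + r * b3) / (4 * t)" .
    have "P 0 = cnj (ell p0) + cnj ?k * cnj (ell p2)"
    proof -
      have "P 0 = ip ee ch" unfolding P_def using ip_cong[of "gg t 0" ee ch ch] gg_0 by simp
      also have "\<dots> = ip ee p0 + cnj ?k * ip ee p2"
        unfolding ch_def ip_cmult_right[symmetric] by (intro ip_add_right e exp_decay_cmult exp_decay_ee)
      finally show ?thesis unfolding ell_ip ip_cnj .
    qed
    then have "cmod (P 0) \<ge> l - cmod (ell p2) / (4 * t)"
      using norm_diff_ineq[of "cnj (ell p0)" "cnj ?k * cnj (ell p2)"] t unfolding norm_mult complex_mod_cnj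
      by (simp add: l_def norm_divide)
    moreover have "cmod (P 0) \<le> cmod (P r) + cmod (P r - P 0)" using norm_triangle_sub[of "P 0" "P r"] by (simp add: norm_minus_commute)
    moreover have "cmod (P r) \<le> sqrt (N t r) * sqrt X"
    proof -
      have "cmod (P r) = cmod (ip (gg t r) ch)" by (simp add: P_def norm_mult)
      also have "\<dots> \<le> sqrt (N t r) * sqrt (nsq ch)" unfolding N_def by (intro ip_le gg_exp_decay ech r)
      also have "nsq ch \<le> X" unfolding X_def
      proof (rule nsq_le_of_cmod[OF ech(1) eX])
        fix x :: real
        have "cmod (ch x) \<le> cmod (p0 x) + cmod ?k * cmod (p2 x)" unfolding ch_def norm_mult[symmetric] by (rule norm_triangle_ineq)
        also have "cmod ?k * cmod (p2 x) \<le> 1 * cmod (p2 x)" using t by (intro mult_right_mono) (auto simp: norm_divide)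
        finally show "cmod (ch x) \<le> cmod (complex_of_real (cmod (p0 x) + cmod (p2 x)))" unfolding norm_of_real by simp
      qed
      finally show ?thesis by (simp add: mult_left_mono)
    qed
    moreover have "(b2 * (r + 1) + r * b3) / (4 * t) + cmod (ell p2) / (4 * t) \<le> B * (1 + r) / (4 * t)"
    proof -
      have "b2 * (r + 1) + r * b3 + cmod (ell p2) \<le> B * (1 + r)"
        unfolding B_def using r bn mult_nonneg_nonneg[OF r norm_ge_zero, of "ell p2"] by (simp add: algebra_simps)
      then show ?thesis using t unfolding add_divide_distrib[symmetric] by (intro divide_right_mono) auto
    qed
    ultimately show ?thesis using 1 by linarith
  qed
  \<comment> \<open>With these choices B <= l t and B c <= l, so the error
    \<open>B * (1 + c * t) / (4 * t)\<close> is at most half of the initial overlap l.\<close>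
  define c where "c = l / (B + 1)"
  define t0 where "t0 = max 1 (B / l)"
  define n0 where "n0 = (l / 2)\<^sup>2 / (X + 1)"
  show thesis
  proof (rule that[of c t0 n0])
    show "c > 0" "t0 \<ge> 1" "n0 > 0" using bn by (auto simp: c_def t0_def n0_def)
    fix t assume "t \<ge> t0"
    then have t: "t \<ge> 1" "t \<ge> B / l" by (auto simp: t0_def)
    have ct: "c * t \<ge> 0" using bn t by (simp add: c_def)
    have "B * (1 + c * t) = B + (B * c) * t" by (simp add: algebra_simps)
    also have "\<dots> \<le> l * t + l * t"
    proof (intro add_mono mult_right_mono)
      show "B \<le> l * t" using t(2) bn by (simp add: field_simps)
      have "B * c = l * (B / (B + 1))" by (simp add: c_def)
      also have "\<dots> \<le> l * 1" using bn by (intro mult_left_mono) auto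
      finally show "B * c \<le> l" by simp
    qed (use t in auto)
    finally have "B * (1 + c * t) / (4 * t) \<le> l / 2" using t by (simp add: field_simps)
    then have "l / 2 \<le> sqrt (N t (c * t)) * sqrt X" using main[OF t(1) ct] by linarith
    then have "(l / 2)\<^sup>2 \<le> (sqrt (N t (c * t)) * sqrt X)\<^sup>2" using bn by (intro power_mono) auto
    also have "\<dots> = N t (c * t) * X" using bn by (simp add: power_mult_distrib)
    also have "\<dots> \<le> N t (c * t) * (X + 1)" by (intro mult_left_mono) auto
    finally show "n0 \<le> N t (c * t)" unfolding n0_def using bn by (simp add: field_simps)
  qed
qed

end

section \<open>The negative eigenvalue\<close>

lemma integrable_powr_exp:
  assumes p: "p > -1" and c: "c > 0"
  shows "integrable hl (\<lambda>x. x powr p * exp (- c * x))"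
proof -
  let ?f = "\<lambda>t. complex_of_real t powr (of_real (p + 1) - 1) / of_real (exp (c * t))"
  have "?f absolutely_integrable_on {0<..}"
    by (rule absolutely_integrable_Gamma_integral) (use assms in auto)
  then have 1: "integrable lebesgue (\<lambda>t. indicator {0<..} t *\<^sub>R ?f t)" by (simp add: set_integrable_def)
  have "integrable lebesgue (\<lambda>t. norm (indicator {0<..} t *\<^sub>R ?f t))" by (rule integrable_norm[OF 1])
  also have "(\<lambda>t. norm (indicator {0<..} t *\<^sub>R ?f t)) = (\<lambda>t. indicator {0..} t *\<^sub>R (t powr p * exp (- c * t)))"
  proof
    fix t :: real
    consider "t > 0" | "t = 0" | "t < 0" by linarith
    then show "norm (indicator {0<..} t *\<^sub>R ?f t) = indicator {0..} t *\<^sub>R (t powr p * exp (- c * t))"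
    proof cases
      case 1
      then have "norm (complex_of_real t powr of_real p) = t powr p"
        by (simp add: norm_powr_real_powr)
      then show ?thesis using 1 by (simp add: norm_divide exp_minus field_simps)
    qed auto
  qed
  finally have "integrable lborel (\<lambda>t. indicator {0..} t *\<^sub>R (t powr p * exp (- c * t)))"
    by (subst (asm) integrable_completion) auto
  then show ?thesis by (simp add: integrable_hl_iff set_integrable_def)
qed

lemma integral_hl_exp: "c > 0 \<Longrightarrow> (\<integral>x. exp (- c * x) \<partial>hl) = 1 / (c::real)"
proof -
  assume c: "c > 0"
  have "(\<integral>x. exp (- c * x) \<partial>hl) = integral {0..} (\<lambda>x. exp (- c * x))"
    unfolding integral_hl_eq using integrable_hl_exp[OF c] by (intro set_borel_integral_eq_integral) (simp add: integrable_hl_iff)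
  then show ?thesis using integral_unique[OF has_integral_exp_minus_to_infinity[OF c, of 0]] by simp
qed

section \<open>The eigenfunction for masses above the threshold\<close>

locale ccm_super = ccm +
  fixes \<delta> :: real
  assumes delta: "0 < \<delta>" "\<delta> < 1" and kappa_delta: "\<kappa> = 1 + \<delta>"
begin

text \<open>
  In terms of \<open>w\<close> with \<open>w - w'' = 2\<kappa> \<phi>\<close> the eigenvalue equation is Whittaker's equation
  \<open>w'' = (1 - 2\<kappa>/s) w\<close>, \<open>s = x + \<mu>\<close>, with \<open>w = 0\<close> at \<open>x = 0\<close>. Its decaying solution is \<open>s exp (-s) y(s)\<close>, where
  the derivative of \<open>y\<close> (a confluent hypergeometric function) has the convergent Laplace representation \<open>Zf 0\<close>.
\<close>

definition om :: "real \<Rightarrow> real" where "om x = x powr (- \<delta>) * (1 + x) powr (1 + \<delta>)"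

definition Zf :: "nat \<Rightarrow> real \<Rightarrow> real" where "Zf k s = (\<integral>x. (- 2 * x) ^ k * om x * exp (- (2 * s) * x) \<partial>hl)"

lemma om_nonneg: "x \<ge> 0 \<Longrightarrow> om x \<ge> 0" by (simp add: om_def)

lemma om_measurable [measurable]: "om \<in> borel_measurable borel" unfolding om_def by measurable

lemma hl_measurable: "f \<in> borel_measurable borel \<Longrightarrow> f \<in> borel_measurable hl"
  by (simp add: measurable_restrict_space1)

text \<open>The weight has an integrable singularity at 0 since \<delta> < 1 and grows at most
  quadratically, so the integrand is dominated by three gamma integrands.\<close>

lemma Zf_majorant:
  assumes s: "s > 0"
  shows "integrable hl (\<lambda>x. (2 * x) ^ k * om x * exp (- (2 * s) * x))"
proof (rule Bochner_Integration.integrable_bound)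
  let ?g = "\<lambda>x. 2 ^ k * (x powr (real k - \<delta>) * exp (- (2 * s) * x) + 2 * (x powr (real k - \<delta> + 1) * exp (- (2 * s) * x))
      + x powr (real k - \<delta> + 2) * exp (- (2 * s) * x))"
  show "integrable hl ?g"
    by (intro integrable_mult_right Bochner_Integration.integrable_add integrable_powr_exp) (use s delta in auto)
  show "(\<lambda>x. (2 * x) ^ k * om x * exp (- (2 * s) * x)) \<in> borel_measurable hl"
    by (rule hl_measurable) measurable
  show "AE x in hl. norm ((2 * x) ^ k * om x * exp (- (2 * s) * x)) \<le> norm (?g x)"
  proof (rule AE_I2)
    fix x assume "x \<in> space hl"
    then have x: "x \<ge> 0" by simp
    show "norm ((2 * x) ^ k * om x * exp (- (2 * s) * x)) \<le> norm (?g x)"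
    proof (cases "x = 0")
      case False
      then have x: "x > 0" using x by simp
      have "(1 + x) powr (1 + \<delta>) \<le> (1 + x) powr 2" using x delta by (intro powr_mono) auto
      also have "\<dots> = 1 + 2 * x + x\<^sup>2" using x by (simp add: power2_eq_square algebra_simps)
      finally have o: "om x \<le> x powr (- \<delta>) * (1 + 2 * x + x\<^sup>2)" unfolding om_def by (intro mult_left_mono) auto
      have "norm ((2 * x) ^ k * om x * exp (- (2 * s) * x)) = 2 ^ k * x ^ k * om x * exp (- (2 * s) * x)"
        using x om_nonneg[of x] by (simp add: power_mult_distrib abs_mult)
      also have "\<dots> \<le> 2 ^ k * x ^ k * (x powr (- \<delta>) * (1 + 2 * x + x\<^sup>2)) * exp (- (2 * s) * x)"
        using x by (intro mult_right_mono mult_left_mono o) auto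
      also have "\<dots> = ?g x"
      proof -
        have e: "x powr (real k - \<delta>) = x ^ k * x powr (- \<delta>)"
          using x by (simp add: powr_diff powr_realpow powr_minus divide_inverse)
        have e1: "x powr (real k - \<delta> + 1) = x ^ k * x powr (- \<delta>) * x"
          and e2: "x powr (real k - \<delta> + 2) = x ^ k * x powr (- \<delta>) * x\<^sup>2"
          using x unfolding powr_add e by simp_all
        show ?thesis unfolding e e1 e2 by (simp add: algebra_simps)
      qed
      also have "\<dots> \<le> norm (?g x)" by simp
      finally show ?thesis .
    qed (simp add: om_def)
  qed
qed

lemma Zf_integrable:
  assumes s: "s > 0"
  shows "integrable hl (\<lambda>x. (- 2 * x) ^ k * om x * exp (- (2 * s) * x))"
  by (rule Bochner_Integration.integrable_bound[OF Zf_majorant[OF s, of k]])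
     (auto intro!: hl_measurable simp: abs_mult power_abs)

lemma Zf_bound:
  assumes s: "0 < s" "s \<le> s'"
  shows "\<bar>Zf k s'\<bar> \<le> (\<integral>x. (2 * x) ^ k * om x * exp (- (2 * s) * x) \<partial>hl)"
proof -
  have "\<bar>Zf k s'\<bar> \<le> (\<integral>x. \<bar>(- 2 * x) ^ k * om x * exp (- (2 * s') * x)\<bar> \<partial>hl)"
    unfolding Zf_def by (rule integral_abs_bound)
  also have "\<dots> \<le> (\<integral>x. (2 * x) ^ k * om x * exp (- (2 * s) * x) \<partial>hl)"
  proof (rule integral_mono)
    show "integrable hl (\<lambda>x. \<bar>(- 2 * x) ^ k * om x * exp (- (2 * s') * x)\<bar>)"
      using s by (intro integrable_abs Zf_integrable) auto
    show "integrable hl (\<lambda>x. (2 * x) ^ k * om x * exp (- (2 * s) * x))" by (rule Zf_majorant[OF s(1)])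
    fix x assume "x \<in> space hl"
    then have x: "x \<ge> 0" by simp
    have "\<bar>(- 2 * x) ^ k * om x * exp (- (2 * s') * x)\<bar> = (2 * x) ^ k * om x * exp (- (2 * s') * x)"
      using x om_nonneg[OF x] by (simp add: abs_mult power_abs)
    also have "\<dots> \<le> (2 * x) ^ k * om x * exp (- (2 * s) * x)"
      using x s om_nonneg[OF x] by (intro mult_left_mono) (auto intro!: mult_right_mono)
    finally show "\<bar>(- 2 * x) ^ k * om x * exp (- (2 * s') * x)\<bar> \<le> (2 * x) ^ k * om x * exp (- (2 * s) * x)" .
  qed
  finally show ?thesis .
qed

lemma Zf_derivative:
  assumes s: "s > 0" shows "(Zf k has_real_derivative Zf (Suc k) s) (at s)"
proof -
  let ?f = "\<lambda>s x. (- 2 * x) ^ k * om x * exp (- (2 * s) * x)"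
  let ?f' = "\<lambda>s x. (- 2 * x) ^ Suc k * om x * exp (- (2 * s) * x)"
  have "((\<lambda>s. \<integral>x. ?f s x \<partial>hl) has_vector_derivative (\<integral>x. ?f' s x \<partial>hl)) (at s within {s/2<..})"
  proof (rule has_vector_derivative_integral_dominated[where b = "\<lambda>x. (2 * x) ^ Suc k * om x * exp (- (2 * (s / 2)) * x)"])
    show "integrable hl (?f u)" if "u \<in> {s/2<..}" for u using that s by (intro Zf_integrable) auto
    show "((\<lambda>s. ?f s x) has_vector_derivative ?f' u x) (at u within {s/2<..})" for u x
      unfolding has_real_derivative_iff_has_vector_derivative[symmetric]
      by (auto intro!: derivative_eq_intros)
    show "integrable hl (\<lambda>x. (2 * x) ^ Suc k * om x * exp (- (2 * (s / 2)) * x))"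
      using s by (intro Zf_majorant) auto
    show "?f' s \<in> borel_measurable hl" by (rule hl_measurable) measurable
    fix u x assume u: "u \<in> {s/2<..}" and "x \<in> space hl"
    then have x: "x \<ge> 0" by simp
    have "norm (?f' u x) = (2 * x) ^ Suc k * om x * exp (- (2 * u) * x)"
      using x om_nonneg[OF x] by (simp add: abs_mult power_abs)
    also have "\<dots> \<le> (2 * x) ^ Suc k * om x * exp (- (2 * (s / 2)) * x)"
      using u x om_nonneg[OF x] by (intro mult_left_mono) (auto intro!: mult_right_mono)
    finally show "norm (?f' u x) \<le> (2 * x) ^ Suc k * om x * exp (- (2 * (s / 2)) * x)" .
  qed (use s in auto)
  moreover have "at s within {s/2<..} = at s" using s by (intro at_within_open) auto
  ultimately show ?thesis
    unfolding has_real_derivative_iff_has_vector_derivative Zf_def[abs_def] by simp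
qed

text \<open>\<open>om\<close> is at least 1 away from 0, so the integral of the plain exponential is
  a lower bound. Its 1/s behaviour makes the primitive \<open>yf\<close> diverge logarithmically at
  0.\<close>

lemma Zf_0_lower: assumes s: "s > 0" shows "Zf 0 s \<ge> 1 / (2 * s)"
proof -
  have "(\<integral>x. exp (- (2 * s) * x) \<partial>hl) \<le> Zf 0 s" unfolding Zf_def
  proof (rule integral_mono_AE)
    show "integrable hl (\<lambda>x. exp (- (2 * s) * x))" using s by (intro integrable_hl_exp) auto
    have "AE x in lborel. x \<noteq> (0::real)" by (rule AE_lborel_singleton)
    then have nz: "AE x in hl. x \<noteq> 0" by (subst AE_restrict_space_iff) auto
    show "AE x in hl. exp (- (2 * s) * x) \<le> (- 2 * x) ^ 0 * om x * exp (- (2 * s) * x)"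
      using nz AE_space
    proof eventually_elim
      case (elim x)
      then have x: "x > 0" by simp
      have "((1 + x) / x) powr \<delta> = (1 + x) powr \<delta> / x powr \<delta>" using x by (simp add: powr_divide)
      then have "om x = ((1 + x) / x) powr \<delta> * (1 + x)"
        using x by (simp add: om_def powr_add powr_minus field_simps)
      also have "\<dots> \<ge> 1 * 1" using x delta by (intro mult_mono ge_one_powr_ge_zero) auto
      finally have "om x \<ge> 1" by simp
      then show ?case by (simp add: mult_le_cancel_right1)
    qed
  qed (use Zf_integrable[OF s, of 0] in auto)
  then show ?thesis using integral_hl_exp[of "2 * s"] s by simp
qed

lemma Zf_1_nonpos: assumes s: "s > 0" shows "Zf 1 s \<le> 0"
proof -
  have "0 \<le> (\<integral>x. - ((- 2 * x) ^ 1 * om x * exp (- (2 * s) * x)) \<partial>hl)"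
    by (rule Bochner_Integration.integral_nonneg) (auto intro!: mult_nonneg_nonneg om_nonneg)
  then show ?thesis unfolding Zf_def by simp
qed

text \<open>Kummer's equation for U(1 - \<delta>, 3, 2s). The combination of integrands is the
  derivative of \<open>?F\<close>, which vanishes at infinity, and at 0 because the exponent 1 -
  \<delta> is positive.\<close>

lemma Zf_ode:
  assumes s: "s > 0"
  shows "s * Zf 2 s + (3 - 2 * s) * Zf 1 s = 2 * (1 - \<delta>) * Zf 0 s"
proof -
  let ?F = "\<lambda>x. exp (- (2 * s) * x) * (x powr (1 - \<delta>) * (1 + x) powr (2 + \<delta>))"
  let ?f = "\<lambda>x. om x * exp (- (2 * s) * x) * (- 2 * s * x\<^sup>2 - 2 * s * x + (1 - \<delta>) + 3 * x)"
  let ?I = "\<lambda>k x. (- 2 * x) ^ k * om x * exp (- (2 * s) * x)"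
  note I = Zf_integrable[OF s]
  have feq: "?f = (\<lambda>x. (- (s / 2)) * ?I 2 x + (s - 3 / 2) * ?I 1 x + (1 - \<delta>) * ?I 0 x)"
    by (auto simp: power2_eq_square algebra_simps)
  have fint: "integrable hl ?f" unfolding feq
    by (intro Bochner_Integration.integrable_add integrable_mult_right I)
  have hi: "(?f has_integral (?F R - ?F 0)) {0..R}" if R: "R \<ge> 0" for R
  proof (rule fundamental_theorem_of_calculus_interior[OF R])
    show "continuous_on {0..R} ?F"
      using delta by (intro continuous_intros continuous_on_powr') auto
    fix x assume "x \<in> {0<..<R}"
    then have x: "x > 0" by simp
    have d1: "((\<lambda>x. x powr (1 - \<delta>)) has_real_derivative (1 - \<delta>) * x powr (- \<delta>)) (at x)"
      using has_real_derivative_powr[OF x, of "1 - \<delta>"] by simp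
    have "((\<lambda>x. 1 + x) has_real_derivative 1) (at x)" by (auto intro!: derivative_eq_intros)
    from DERIV_fun_powr[OF this, of "2 + \<delta>"]
    have d2: "((\<lambda>x. (1 + x) powr (2 + \<delta>)) has_real_derivative (2 + \<delta>) * (1 + x) powr (1 + \<delta>)) (at x)"
      using x by (simp add: add.commute)
    have d0: "((\<lambda>x. exp (- (2 * s) * x)) has_real_derivative exp (- (2 * s) * x) * (- (2 * s))) (at x)"
      by (auto intro!: derivative_eq_intros)
    have p1: "x powr (1 - \<delta>) = x * x powr (- \<delta>)" using x powr_add[of x 1 "- \<delta>"] by simp
    have p2: "(1 + x) powr (2 + \<delta>) = (1 + x) * (1 + x) powr (1 + \<delta>)" using x powr_add[of "1 + x" 1 "1 + \<delta>"] by simp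
    have "(?F has_real_derivative (exp (- (2 * s) * x) * (x powr (1 - \<delta>) * ((2 + \<delta>) * (1 + x) powr (1 + \<delta>)) + (1 - \<delta>) * x powr (- \<delta>) * (1 + x) powr (2 + \<delta>))
       + exp (- (2 * s) * x) * (- (2 * s)) * (x powr (1 - \<delta>) * (1 + x) powr (2 + \<delta>)))) (at x)"
      using DERIV_mult[OF d0 DERIV_mult[OF d1 d2]] by (simp add: algebra_simps)
    also have "(exp (- (2 * s) * x) * (x powr (1 - \<delta>) * ((2 + \<delta>) * (1 + x) powr (1 + \<delta>)) + (1 - \<delta>) * x powr (- \<delta>) * (1 + x) powr (2 + \<delta>))
       + exp (- (2 * s) * x) * (- (2 * s)) * (x powr (1 - \<delta>) * (1 + x) powr (2 + \<delta>))) = ?f x"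
      unfolding p1 p2 om_def by (simp add: power2_eq_square algebra_simps)
    finally show "(?F has_vector_derivative ?f x) (at x)" by (simp add: has_real_derivative_iff_has_vector_derivative)
  qed
  have lim1: "((\<lambda>R. integral {0..R} ?f) \<longlongrightarrow> integral\<^sup>L hl ?f) at_top" by (rule integral_hl_tendsto[OF fint])
  have Flim: "(?F \<longlongrightarrow> 0) at_top"
  proof (rule Lim_null_comparison)
    let ?a = "s / 3"
    have "((\<lambda>x. exp (- s * x)) \<longlongrightarrow> 0) at_top"
      using exp_decay_tendsto_0[of "\<lambda>x. complex_of_real (exp (- s * x))"] s
      by (subst tendsto_of_real_iff[where 'a = complex, symmetric])
         (simp add: exp_decayI[of _ s 1] continuous_intros)
    from tendsto_mult_right_zero[OF this, of "exp s / ?a ^ 3"]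
    show "((\<lambda>x. exp s / ?a ^ 3 * exp (- s * x)) \<longlongrightarrow> 0) at_top" by simp
    show "\<forall>\<^sub>F x in at_top. norm (?F x) \<le> exp s / ?a ^ 3 * exp (- s * x)"
    proof (rule eventually_mono[OF eventually_ge_at_top[of 0]])
      fix x :: real assume x: "x \<ge> 0"
      have "x powr (1 - \<delta>) * (1 + x) powr (2 + \<delta>) \<le> (1 + x) powr (1 - \<delta>) * (1 + x) powr (2 + \<delta>)"
        using x delta by (intro mult_right_mono powr_mono2) auto
      also have "\<dots> = (1 + x) ^ 3" using x by (simp add: powr_add[symmetric])
      also have "\<dots> \<le> (exp (?a * (1 + x)) / ?a) ^ 3"
        using x s by (intro power_mono linear_le_exp) auto
      also have "\<dots> = exp (s * (1 + x)) / ?a ^ 3" by (simp add: power_divide exp_of_nat_mult[symmetric])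
      finally have "?F x \<le> exp (- (2 * s) * x) * (exp (s * (1 + x)) / ?a ^ 3)" by (intro mult_left_mono) auto
      also have "\<dots> = (exp (- (2 * s) * x) * exp (s * (1 + x))) / ?a ^ 3" by simp
      also have "exp (- (2 * s) * x) * exp (s * (1 + x)) = exp s * exp (- s * x)"
        unfolding mult_exp_exp by (simp add: algebra_simps)
      also have "exp s * exp (- s * x) / ?a ^ 3 = exp s / ?a ^ 3 * exp (- s * x)" by simp
      finally show "norm (?F x) \<le> exp s / ?a ^ 3 * exp (- s * x)" using x by simp
    qed
  qed
  have "((\<lambda>R. integral {0..R} ?f) \<longlongrightarrow> 0) at_top"
    by (rule Lim_transform_eventually[OF Flim])
       (use integral_unique[OF hi] delta in \<open>auto intro!: eventually_mono[OF eventually_ge_at_top[of 0]]\<close>)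
  then have "integral\<^sup>L hl ?f = 0" using lim1 tendsto_unique[OF trivial_limit_at_top_linorder] by blast
  also have "integral\<^sup>L hl ?f = (- (s / 2)) * Zf 2 s + (s - 3 / 2) * Zf 1 s + (1 - \<delta>) * Zf 0 s"
    unfolding feq Zf_def using I by (simp only: Bochner_Integration.integral_add Bochner_Integration.integrable_add integrable_mult_right integral_mult_right_zero)
  finally show ?thesis by (simp add: algebra_simps)
qed

text \<open>A positive multiple of Kummer's function U(-\<delta>, 2, 2s). Its first parameter is
  negative, so its own Laplace integral diverges; it is recovered from its derivative
  \<open>Zf 0\<close> by solving \<open>s y'' + 2 (1 - s) y' + 2 \<delta> y = 0\<close> for
  y.\<close>

definition yf :: "real \<Rightarrow> real" where "yf s = - (s * Zf 1 s + 2 * (1 - s) * Zf 0 s) / (2 * \<delta>)"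

lemma yf_derivative: assumes s: "s > 0" shows "(yf has_real_derivative Zf 0 s) (at s)"
proof -
  have z0: "(Zf 0 has_real_derivative Zf 1 s) (at s)" using Zf_derivative[OF s, of 0] by simp
  have z1: "(Zf 1 has_real_derivative Zf 2 s) (at s)" using Zf_derivative[OF s, of 1] by (simp add: numeral_2_eq_2)
  have "(yf has_real_derivative (- ((s * Zf 2 s + Zf 1 s) + (2 * (1 - s) * Zf 1 s - 2 * Zf 0 s)) / (2 * \<delta>))) (at s)"
  proof -
    have b: "((\<lambda>s. 2 * (1 - s)) has_real_derivative (- 2)) (at s)" by (auto intro!: derivative_eq_intros)
    show ?thesis unfolding yf_def[abs_def]
      using DERIV_cdivide[OF DERIV_minus[OF DERIV_add[OF DERIV_mult'[OF DERIV_ident z1] DERIV_mult'[OF b z0]]], of "2 * \<delta>"]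
      by simp
  qed
  also have "- ((s * Zf 2 s + Zf 1 s) + (2 * (1 - s) * Zf 1 s - 2 * Zf 0 s)) / (2 * \<delta>)
      = - ((s * Zf 2 s + (3 - 2 * s) * Zf 1 s) - 2 * Zf 0 s) / (2 * \<delta>)" by (simp add: algebra_simps)
  also have "\<dots> = Zf 0 s" unfolding Zf_ode[OF s] using delta by (simp add: field_simps)
  finally show ?thesis .
qed

text \<open>A change of sign: \<open>yf 2 >= 0\<close> from the signs of \<open>Zf 0\<close> and
  \<open>Zf 1\<close>, while \<open>yf - ln / 2\<close> is nondecreasing, so \<open>yf\<close> tends
  to minus infinity at 0. The zero is minus the eigenvalue.\<close>

lemma yf_zero: obtains \<mu> where "\<mu> > 0" "yf \<mu> = 0"
proof -
  have y2: "yf 2 \<ge> 0"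
    using Zf_1_nonpos[of 2] Zf_0_lower[of 2] delta unfolding yf_def by (intro divide_nonneg_pos) auto
  \<comment> \<open>So small that \<open>ln s / 2 <= - yf 2 - 1\<close>, which forces
    \<open>yf s\<close> to be negative.\<close>
  define s where "s = min 1 (exp (- 2 * yf 2 - 2))"
  have s: "s > 0" "s \<le> 1" by (auto simp: s_def)
  have "yf s - ln s / 2 \<le> yf 2 - ln 2 / 2"
  proof (rule DERIV_nonneg_imp_nondecreasing[where f = "\<lambda>x. yf x - ln x / 2"])
    show "s \<le> 2" using s by simp
    fix x assume x: "s \<le> x" "x \<le> 2"
    then have xp: "x > 0" using s by simp
    have "((\<lambda>x. yf x - ln x / 2) has_real_derivative (Zf 0 x - (1 / x) / 2)) (at x)"
      by (intro DERIV_diff DERIV_cdivide yf_derivative xp DERIV_ln_divide)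
    moreover have "Zf 0 x - (1 / x) / 2 \<ge> 0" using Zf_0_lower[OF xp] by simp
    ultimately show "\<exists>y. ((\<lambda>x. yf x - ln x / 2) has_real_derivative y) (at x) \<and> 0 \<le> y" by blast
  qed
  moreover have "ln s \<le> - 2 * yf 2 - 2"
    using s ln_le_cancel_iff[of s "exp (- 2 * yf 2 - 2)"] by (simp add: s_def)
  moreover have "ln 2 \<ge> (0::real)" by simp
  ultimately have ys: "yf s \<le> 0" by linarith
  have "\<exists>x\<ge>s. x \<le> 2 \<and> yf x = 0"
  proof (rule IVT')
    show "continuous_on {s..2} yf"
      using s by (intro continuous_at_imp_continuous_on ballI DERIV_isCont[OF yf_derivative]) auto
  qed (use ys y2 s in auto)
  then obtain x where x: "s \<le> x" "yf x = 0" by blast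
  show thesis by (rule that[of x]) (use x s in auto)
qed

lemma exp_decay_shifted:
  assumes m: "\<mu> > 0" and c: "continuous_on {\<mu>..} f" and b: "\<And>s. s \<ge> \<mu> \<Longrightarrow> \<bar>f s\<bar> \<le> B * (1 + s)"
  shows "exp_decay (\<lambda>x. complex_of_real (exp (- (x + \<mu>)) * f (x + \<mu>)))"
proof (rule exp_decayI[of _ "1/2" "2 * \<bar>B\<bar>"])
  show "continuous_on {0..} (\<lambda>x. complex_of_real (exp (- (x + \<mu>)) * f (x + \<mu>)))"
    by (intro continuous_intros continuous_on_compose2[OF c]) auto
  fix x :: real assume x: "x \<ge> 0"
  define s where "s = x + \<mu>"
  have s: "s > 0" "s \<ge> \<mu>" "x \<le> s" using x m by (auto simp: s_def)
  have "1 + s \<le> 2 * exp (s / 2)"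
    using exp_ge_add_one_self[of "s / 2"] by linarith
  then have "\<bar>f s\<bar> \<le> \<bar>B\<bar> * (2 * exp (s / 2))"
    using b[OF s(2)] s by (intro order_trans[OF b[OF s(2)]] mult_mono) auto
  then have "exp (- s) * \<bar>f s\<bar> \<le> exp (- s) * (\<bar>B\<bar> * (2 * exp (s / 2)))" by (intro mult_left_mono) auto
  also have "\<dots> = 2 * \<bar>B\<bar> * exp (- s + s / 2)" by (simp only: exp_add) simp
  also have "\<dots> \<le> 2 * \<bar>B\<bar> * exp (- (1/2) * x)" using s by (intro mult_left_mono) auto
  finally show "cmod (complex_of_real (exp (- (x + \<mu>)) * f (x + \<mu>))) \<le> 2 * \<bar>B\<bar> * exp (- (1/2) * x)"
    unfolding s_def[symmetric] norm_of_real by (simp add: abs_mult)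
qed simp

lemma shifted_derivative:
  assumes "\<mu> > 0" "x \<ge> 0" "(f has_real_derivative f') (at (x + \<mu>))"
  shows "((\<lambda>x. complex_of_real (exp (- (x + \<mu>)) * f (x + \<mu>))) has_vector_derivative
     complex_of_real (exp (- (x + \<mu>)) * (f' - f (x + \<mu>)))) (at x within S)"
proof -
  have "((\<lambda>x. f (x + \<mu>)) has_real_derivative f') (at x)" using assms(3) by (simp add: DERIV_shift)
  then have "((\<lambda>x. exp (- (x + \<mu>)) * f (x + \<mu>)) has_real_derivative (exp (- (x + \<mu>)) * (f' - f (x + \<mu>)))) (at x)"
  proof -
    assume f: "((\<lambda>x. f (x + \<mu>)) has_real_derivative f') (at x)"
    have "((\<lambda>x. exp (- (x + \<mu>))) has_real_derivative (- exp (- (x + \<mu>)))) (at x)"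
      by (auto intro!: derivative_eq_intros)
    from DERIV_mult[OF this f] show ?thesis by (simp add: right_diff_distrib mult.commute)
  qed
  from has_vector_derivative_of_real[OF DERIV_subset[OF this subset_UNIV]] show ?thesis .
qed

text \<open>The hypotheses of \<open>growth\<close> for the shifted function
  \<open>exp (- s) * yf s\<close>, s = x + \<mu>. Its images under \<open>Sst\<close> and
  \<open>Gop\<close> are guessed in closed form, as g and h, and confirmed by uniqueness; the zero
  of \<open>yf\<close> at \<mu> is the Dirichlet condition.\<close>

lemma super_growth:
  obtains c t0 n0 where "c > 0" "t0 \<ge> 1" "n0 > 0" "\<And>t. t \<ge> t0 \<Longrightarrow> N t (c * t) \<ge> n0"
proof -
  obtain \<mu> where m: "\<mu> > 0" "yf \<mu> = 0" by (rule yf_zero)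
  let ?c = "\<lambda>f x. complex_of_real (exp (- (x + \<mu>)) * f (x + \<mu>))"
  define W where "W k = (\<integral>x. (2 * x) ^ k * om x * exp (- (2 * \<mu>) * x) \<partial>hl)" for k
  have W: "\<bar>Zf k s\<bar> \<le> W k" if "s \<ge> \<mu>" for k s unfolding W_def by (rule Zf_bound[OF m(1) that])
  have W0: "W k \<ge> 0" for k using W[of \<mu> k] by (auto intro: order_trans[OF abs_ge_zero])
  define Y where "Y = (W 1 + 2 * W 0) / (2 * \<delta>)"
  have Y0: "Y \<ge> 0" unfolding Y_def using W0 delta by auto
  have yb: "\<bar>yf s\<bar> \<le> Y * (1 + s)" if s: "s \<ge> \<mu>" for s
  proof -
    have sp: "s > 0" using s m by simp
    have "\<bar>s * Zf 1 s + 2 * (1 - s) * Zf 0 s\<bar> \<le> s * \<bar>Zf 1 s\<bar> + 2 * \<bar>1 - s\<bar> * \<bar>Zf 0 s\<bar>"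
    proof -
      have "\<bar>s * Zf 1 s\<bar> = s * \<bar>Zf 1 s\<bar>" using sp by (simp add: abs_mult)
      moreover have "\<bar>2 * (1 - s) * Zf 0 s\<bar> = 2 * \<bar>1 - s\<bar> * \<bar>Zf 0 s\<bar>" unfolding abs_mult by simp
      ultimately show ?thesis using abs_triangle_ineq[of "s * Zf 1 s" "2 * (1 - s) * Zf 0 s"] by linarith
    qed
    also have "\<dots> \<le> (1 + s) * W 1 + 2 * (1 + s) * W 0"
      using sp by (intro add_mono mult_mono W s) auto
    finally show ?thesis using delta by (simp add: yf_def Y_def abs_mult field_simps)
  qed
  have lift: "\<bar>Zf k s\<bar> \<le> W k * (1 + s)" if s: "s \<ge> \<mu>" for k s
    using W[OF s, of k] mult_left_mono[OF _ W0[of k], of 1 "1 + s"] s m by simp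
  have cZ: "continuous_on {\<mu>..} (Zf k)" for k
    using m by (intro continuous_at_imp_continuous_on ballI DERIV_isCont[OF Zf_derivative]) auto
  have cy: "continuous_on {\<mu>..} yf"
    using m by (intro continuous_at_imp_continuous_on ballI DERIV_isCont[OF yf_derivative]) auto
  have dZ: "(Zf 0 has_real_derivative Zf 1 s) (at s)" "(Zf 1 has_real_derivative Zf 2 s) (at s)" if "s > 0" for s
    using Zf_derivative[OF that, of 0] Zf_derivative[OF that, of 1] by (simp_all add: numeral_2_eq_2)
  define f1 where "f1 s = Zf 0 s - yf s" for s
  define f2 where "f2 s = (Zf 1 s - Zf 0 s) - f1 s" for s
  define f3 where "f3 s = (Zf 2 s - Zf 1 s - (Zf 0 s * 0 + (Zf 1 s - Zf 0 s))) - f2 s" for s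
  define p0 where "p0 = ?c yf"
  define p1 where "p1 = ?c f1"
  define p2 where "p2 = ?c f2"
  define p3 where "p3 = ?c f3"
  have bd_add: "\<bar>a + b\<bar> \<le> (A + B) * u" if "\<bar>a\<bar> \<le> A * u" "\<bar>b\<bar> \<le> B * u" for a b A B u :: real
    using that by (simp add: distrib_right)
  have bd_diff: "\<bar>a - b\<bar> \<le> (A + B) * u" if "\<bar>a\<bar> \<le> A * u" "\<bar>b\<bar> \<le> B * u" for a b A B u :: real
    using that by (simp add: distrib_right)
  have b1: "\<bar>f1 s\<bar> \<le> (W 0 + Y) * (1 + s)" if "s \<ge> \<mu>" for s
    unfolding f1_def by (intro bd_diff lift yb that)
  have b2: "\<bar>f2 s\<bar> \<le> ((W 1 + W 0) + (W 0 + Y)) * (1 + s)" if "s \<ge> \<mu>" for s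
    unfolding f2_def by (intro bd_diff lift b1 that)
  have b3: "\<bar>f3 s\<bar> \<le> (((W 2 + W 1) + (0 + (W 1 + W 0))) + ((W 1 + W 0) + (W 0 + Y))) * (1 + s)" if "s \<ge> \<mu>" for s
    unfolding f3_def by (intro bd_diff bd_add lift b2 that) simp
  have e: "exp_decay p0" "exp_decay p1" "exp_decay p2" "exp_decay p3"
    unfolding p0_def p1_def p2_def p3_def
       apply (rule exp_decay_shifted[OF m(1) cy yb], assumption)
      apply (rule exp_decay_shifted[OF m(1) _ b1]; auto simp: f1_def intro!: continuous_intros cZ cy)
     apply (rule exp_decay_shifted[OF m(1) _ b2]; auto simp: f2_def f1_def intro!: continuous_intros cZ cy)
    apply (rule exp_decay_shifted[OF m(1) _ b3]; auto simp: f3_def f2_def f1_def intro!: continuous_intros cZ cy)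
    done
  have d0: "(p0 has_vector_derivative p1 x) (at x within {0..})" if x: "x \<ge> 0" for x
    unfolding p0_def p1_def f1_def using m x by (intro shifted_derivative yf_derivative) auto
  have df1: "(f1 has_real_derivative (Zf 1 s - Zf 0 s)) (at s)" if "s > 0" for s
    unfolding f1_def by (intro DERIV_diff dZ yf_derivative that)
  have d1: "(p1 has_vector_derivative p2 x) (at x within {0..})" if x: "x \<ge> 0" for x
    unfolding p1_def p2_def f2_def using m x by (intro shifted_derivative df1) auto
  have df2: "(f2 has_real_derivative (Zf 2 s - Zf 1 s - (Zf 0 s * 0 + (Zf 1 s - Zf 0 s)))) (at s)" if "s > 0" for s
  proof -
    have "(f2 has_real_derivative ((Zf 2 s - Zf 1 s) - (Zf 1 s - Zf 0 s))) (at s)"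
      unfolding f2_def by (intro DERIV_diff dZ df1 that)
    then show ?thesis by simp
  qed
  have d2: "(p2 has_vector_derivative p3 x) (at x within {0..})" if x: "x \<ge> 0" for x
    unfolding p2_def p3_def f3_def using m x by (intro shifted_derivative df2) auto
  \<comment> \<open>\<open>2 * \<kappa> * h\<close> is the Whittaker function
    \<open>s * yf s\<close> without its exponential; g is the derivative of h, so that
    \<open>exp (- s) * h\<close> has derivative \<open>exp (- s) * (g - h)\<close>, as required of
    \<open>Gop\<close>.\<close>
  define g where "g s = (yf s + s * Zf 0 s) / (2 * \<kappa>)" for s
  define h where "h s = s * yf s / (2 * \<kappa>)" for s
  have dg: "(g has_real_derivative ((2 * Zf 0 s + s * Zf 1 s) / (2 * \<kappa>))) (at s)" if "s > 0" for s
  proof -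
    have "(g has_real_derivative ((Zf 0 s + (s * Zf 1 s + 1 * Zf 0 s)) / (2 * \<kappa>))) (at s)"
      unfolding g_def by (intro DERIV_cdivide DERIV_add DERIV_mult' DERIV_ident yf_derivative dZ that)
    then show ?thesis by (simp add: algebra_simps)
  qed
  have dh: "(h has_real_derivative g s) (at s)" if "s > 0" for s
  proof -
    have "(h has_real_derivative ((s * Zf 0 s + 1 * yf s) / (2 * \<kappa>))) (at s)"
      unfolding h_def by (intro DERIV_cdivide DERIV_mult' DERIV_ident yf_derivative that)
    then show ?thesis by (simp add: g_def algebra_simps)
  qed
  have kp: "\<kappa> > 0" by (rule kappa_pos)
  have yeq: "s * Zf 1 s + 2 * (1 - s) * Zf 0 s = - (2 * \<delta>) * yf s" for s
    using delta by (simp add: yf_def)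
  have "?c g = (\<lambda>x. complex_of_real (1 / (2 * \<kappa>)) * (p0 x + (of_real x * ?c (Zf 0) x + of_real \<mu> * ?c (Zf 0) x)))"
    using kp by (auto simp: fun_eq_iff g_def p0_def field_simps simp flip: of_real_mult of_real_add of_real_divide)
  moreover have "exp_decay (?c (Zf 0))" by (rule exp_decay_shifted[OF m(1) cZ lift])
  ultimately have eg: "exp_decay (?c g)"
    by (simp only:) (intro exp_decay_cmult exp_decay_add exp_decay_times_id e(1))
  then obtain Bg where Bg: "\<And>x. x \<ge> 0 \<Longrightarrow> cmod (?c g x) \<le> Bg" using exp_decay_bounded by blast
  have Sst: "Sst p0 x = ?c g x" if x: "x \<ge> 0" for x
  proof (rule Sst_unique[OF _ e(1) Bg x])
    fix x :: real assume x: "x \<ge> 0"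
    define s where "s = x + \<mu>"
    have s: "s > 0" using x m by (simp add: s_def)
    \<comment> \<open>Kummer's equation in the form \<open>Sst' = Sst - p0\<close>; this is where
      \<kappa> = 1 + \<delta> is used.\<close>
    have *: "(2 * Zf 0 s + s * Zf 1 s) / (2 * \<kappa>) - g s = g s - yf s"
    proof -
      have "(2 * Zf 0 s + s * Zf 1 s) - 2 * (yf s + s * Zf 0 s) = - (2 * \<kappa>) * yf s"
        using yeq[of s] unfolding kappa_delta by (simp add: algebra_simps)
      then have A: "2 * Zf 0 s + s * Zf 1 s = 2 * (yf s + s * Zf 0 s) - (2 * \<kappa>) * yf s" by linarith
      show ?thesis unfolding g_def A using kp by (simp add: diff_divide_distrib)
    qed
    have "(?c g has_vector_derivative complex_of_real (exp (- (x + \<mu>)) * ((2 * Zf 0 (x + \<mu>) + (x + \<mu>) * Zf 1 (x + \<mu>)) / (2 * \<kappa>) - g (x + \<mu>)))) (at x within {0..})"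
      using m x by (intro shifted_derivative dg) auto
    then show "(?c g has_vector_derivative (?c g x - p0 x)) (at x within {0..})"
      unfolding *[unfolded s_def] p0_def by (simp add: right_diff_distrib)
  qed auto
  have Gop: "Gop p0 x = ?c h x" if x: "x \<ge> 0" for x
  proof -
    have "Gop p0 x = Sop (?c g) x" unfolding Gop_def by (simp add: Sop_cong[OF Sst])
    also have "\<dots> = ?c h x"
    proof (rule Sop_unique[OF _ exp_decay_continuous[OF eg] _ x])
      fix x :: real assume x: "x \<ge> 0"
      have "(?c h has_vector_derivative complex_of_real (exp (- (x + \<mu>)) * (g (x + \<mu>) - h (x + \<mu>)))) (at x within {0..})"
        using m x by (intro shifted_derivative dh) auto
      then show "(?c h has_vector_derivative (?c g x - ?c h x)) (at x within {0..})"
        by (simp add: right_diff_distrib)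
    qed (simp add: h_def m)
    finally show ?thesis .
  qed
  have L: "Lop p0 x = - of_real \<mu> * p0 x" if x: "x \<ge> 0" for x
  proof -
    have "Lop p0 x = of_real x * p0 x - of_real (2 * \<kappa>) * ?c h x" unfolding Lop_def Gop[OF x] ..
    also have "of_real (2 * \<kappa>) * ?c h x = of_real (x + \<mu>) * p0 x"
      unfolding p0_def h_def of_real_mult[symmetric] using kp by simp
    finally show ?thesis by (simp add: distrib_right)
  qed
  \<comment> \<open>At the zero of \<open>yf\<close> this equals
    \<open>exp (- \<mu>) * \<mu> * Zf 0 \<mu> / (2 * \<kappa>)\<close>, which is positive.\<close>
  have "ell p0 = ?c g 0" using Sst[of 0] by simp
  then have "ell p0 \<noteq> 0" using m Zf_0_lower[OF m(1)] kp by (auto simp: g_def divide_le_eq)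
  from growth[OF e d0 d1 d2 L m(1) this] that show thesis by blast
qed

end

section \<open>The Fourier transform of bounded integrable functions\<close>

definition invF :: "(real \<Rightarrow> complex) \<Rightarrow> real \<Rightarrow> complex" where
  "invF a x = complex_of_real (1 / sqrt (2 * pi)) * (LINT r|lborel. exp (\<i> * of_real x * of_real r) * a r)"

text \<open>Integrable and bounded functions: their correlations are again integrable and bounded,
  which suffices to prove square integrability of the inverse transform by Gaussian
  summation.\<close>

definition nice :: "(real \<Rightarrow> complex) \<Rightarrow> bool" where
  "nice a \<longleftrightarrow> integrable lborel a \<and> (\<exists>B. \<forall>x. cmod (a x) \<le> B)"

definition corr :: "(real \<Rightarrow> complex) \<Rightarrow> (real \<Rightarrow> complex) \<Rightarrow> real \<Rightarrow> complex" where
  "corr a b r = (LINT y|lborel. a (r + y) * cnj (b y))"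

lemma exp_i_norm [simp]: "cmod (exp (\<i> * of_real x * of_real r)) = 1"
proof -
  have "exp (\<i> * of_real x * of_real r) = exp (\<i> * complex_of_real (x * r))" by (simp add: mult.assoc)
  then show ?thesis by (simp only: norm_exp_i_times)
qed

lemma nice_integrable: "nice a \<Longrightarrow> integrable lborel a" by (simp add: nice_def)

lemma integrable_lborel_measurable [measurable_dest]: "integrable lborel a \<Longrightarrow> a \<in> borel_measurable borel"
  using borel_measurable_integrable[of lborel a] by simp

lemma integrable_bounded_mult:
  fixes f g :: "'a \<Rightarrow> complex"
  assumes "integrable M g" "f \<in> borel_measurable M" "\<And>x. cmod (f x) \<le> B"
  shows "integrable M (\<lambda>x. f x * g x)"
proof (rule Bochner_Integration.integrable_bound)
  show "integrable M (\<lambda>x. B * cmod (g x))" using assms(1) by simp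
  have "0 \<le> B" using assms(3)[of undefined] by (auto intro: order_trans[OF norm_ge_zero])
  then show "AE x in M. norm (f x * g x) \<le> norm (B * cmod (g x))"
    using assms(3) by (auto simp: norm_mult intro!: mult_right_mono)
qed (use assms in simp)

lemma exp_mult_integrable: "integrable lborel a \<Longrightarrow> integrable lborel (\<lambda>r. exp (\<i> * of_real x * of_real r) * a r)"
  by (rule integrable_bounded_mult[where B = 1]) auto

lemma invF_measurable [measurable]:
  assumes "integrable lborel a" shows "invF a \<in> borel_measurable borel"
proof -
  have [measurable]: "a \<in> borel_measurable borel" using assms by measurable
  show ?thesis unfolding invF_def by measurable
qed

lemma invF_bound: "cmod (invF a x) \<le> (LINT r|lborel. cmod (a r)) / sqrt (2 * pi)"
proof -
  have "cmod (invF a x) = cmod (LINT r|lborel. exp (\<i> * of_real x * of_real r) * a r) / sqrt (2 * pi)"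
    by (simp add: invF_def norm_mult norm_divide del: of_real_mult)
  also have "\<dots> \<le> (LINT r|lborel. cmod (exp (\<i> * of_real x * of_real r) * a r)) / sqrt (2 * pi)"
    by (intro divide_right_mono integral_norm_bound) simp
  finally show ?thesis by (simp add: norm_mult)
qed

section \<open>Gaussian summation of inverse Fourier integrals\<close>

lemma gauss_fourier:
  assumes n: "n > 0"
  shows "(LINT x|lborel. exp (\<i> * of_real x * of_real y) * of_real (exp (- (x / n)\<^sup>2 / 2)))
     = complex_of_real (n * sqrt (2 * pi) * exp (- (n * y)\<^sup>2 / 2))"
proof -
  let ?f = "\<lambda>x. std_normal_density x *\<^sub>R exp (\<i> * of_real (n * y * x))"
  have "complex_of_real (exp (- (n * y)\<^sup>2 / 2)) = char std_normal_distribution (n * y)"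
    by (simp add: char_std_normal_distribution)
  also have "\<dots> = (LINT x|lborel. ?f x)"
    unfolding char_def by (subst integral_density) (auto simp: mult.assoc)
  also have "\<dots> = \<bar>1 / n\<bar> *\<^sub>R (LINT x|lborel. ?f (0 + (1 / n) * x))"
    by (rule lborel_integral_real_affine) (use n in simp)
  also have "(\<lambda>x. ?f (0 + (1 / n) * x)) = (\<lambda>x. complex_of_real (1 / sqrt (2 * pi)) *
      (exp (\<i> * of_real x * of_real y) * of_real (exp (- (x / n)\<^sup>2 / 2))))"
    using n by (auto simp: fun_eq_iff std_normal_density_def scaleR_conv_of_real mult_ac)
  finally have "complex_of_real (exp (- (n * y)\<^sup>2 / 2)) = complex_of_real (1 / n) * (complex_of_real (1 / sqrt (2 * pi)) *
     (LINT x|lborel. exp (\<i> * of_real x * of_real y) * of_real (exp (- (x / n)\<^sup>2 / 2))))"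
    using n by (simp add: scaleR_conv_of_real)
  then show ?thesis using n by (simp add: field_simps)
qed

lemma gauss_integrable: assumes n: "n > 0" shows "integrable lborel (\<lambda>x. exp (- (x / n)\<^sup>2 / 2) :: real)"
proof -
  have "integrable lborel (\<lambda>x. std_normal_density (0 + (1 / n) * x))"
    using n by (intro lborel_integrable_real_affine integrable_normal_density) auto
  then have "integrable lborel (\<lambda>x. sqrt (2 * pi) * std_normal_density (0 + (1 / n) * x))" by (rule integrable_mult_right)
  then show ?thesis by (simp add: std_normal_density_def)
qed

lemma gauss_invF:
  assumes c: "integrable lborel c" and n: "n > 0"
  shows "(LINT x|lborel. of_real (exp (- (x / n)\<^sup>2 / 2)) * invF c x) = (LINT r|lborel. of_real (n * exp (- (n * r)\<^sup>2 / 2)) * c r)"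
proof -
  have [measurable]: "c \<in> borel_measurable borel" using c by measurable
  let ?W = "\<lambda>x. complex_of_real (exp (- (x / n)\<^sup>2 / 2))"
  let ?f = "\<lambda>x r. ?W x * (exp (\<i> * of_real x * of_real r) * c r)"
  have "integrable (lborel \<Otimes>\<^sub>M lborel) (case_prod ?f)"
  proof (rule lborel_pair.Fubini_integrable)
    have "(\<lambda>x. LINT r|lborel. norm (case_prod ?f (x, r))) = (\<lambda>x. (LINT r|lborel. cmod (c r)) * exp (- (x / n)\<^sup>2 / 2))"
      by (simp add: norm_mult mult.commute)
    then show "integrable lborel (\<lambda>x. LINT r|lborel. norm (case_prod ?f (x, r)))"
      using gauss_integrable[OF n] by simp
    show "AE x in lborel. integrable lborel (\<lambda>r. case_prod ?f (x, r))"
      by (auto intro!: AE_I2 integrable_mult_right exp_mult_integrable c)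
  qed measurable
  from lborel_pair.Fubini_integral[OF this]
  have "(LINT x|lborel. LINT r|lborel. ?f x r) = (LINT r|lborel. LINT x|lborel. ?f x r)" by simp
  also have "(\<lambda>r. LINT x|lborel. ?f x r) = (\<lambda>r. of_real (n * sqrt (2 * pi) * exp (- (n * r)\<^sup>2 / 2)) * c r)"
  proof
    fix r
    have "(LINT x|lborel. ?f x r) = (LINT x|lborel. (exp (\<i> * of_real x * of_real r) * ?W x) * c r)"
      by (rule Bochner_Integration.integral_cong) (auto simp: mult_ac)
    also have "\<dots> = (LINT x|lborel. exp (\<i> * of_real x * of_real r) * ?W x) * c r" by simp
    finally show "(LINT x|lborel. ?f x r) = of_real (n * sqrt (2 * pi) * exp (- (n * r)\<^sup>2 / 2)) * c r"
      unfolding gauss_fourier[OF n] .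
  qed
  finally have eq: "(LINT x|lborel. LINT r|lborel. ?f x r) = (LINT r|lborel. of_real (n * sqrt (2 * pi) * exp (- (n * r)\<^sup>2 / 2)) * c r)" .
  have "(LINT x|lborel. ?W x * invF c x) = (LINT x|lborel. complex_of_real (1 / sqrt (2 * pi)) * (LINT r|lborel. ?f x r))"
    unfolding invF_def by (rule Bochner_Integration.integral_cong) auto
  also have "\<dots> = complex_of_real (1 / sqrt (2 * pi)) * (LINT r|lborel. of_real (n * sqrt (2 * pi) * exp (- (n * r)\<^sup>2 / 2)) * c r)"
    using eq by simp
  also have "\<dots> = (LINT r|lborel. complex_of_real (1 / sqrt (2 * pi)) * (of_real (n * sqrt (2 * pi) * exp (- (n * r)\<^sup>2 / 2)) * c r))"
    by (rule integral_mult_right_zero[symmetric])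
  also have "\<dots> = (LINT r|lborel. of_real (n * exp (- (n * r)\<^sup>2 / 2)) * c r)"
    by (rule Bochner_Integration.integral_cong) (auto simp: field_simps)
  finally show ?thesis .
qed

lemma gauss_rescale:
  assumes n: "n > 0"
  shows "(LINT r|lborel. of_real (n * exp (- (n * r)\<^sup>2 / 2)) * c r) = (LINT v|lborel. complex_of_real (exp (- v\<^sup>2 / 2)) * c (v / n))"
proof -
  have "(LINT r|lborel. of_real (n * exp (- (n * r)\<^sup>2 / 2)) * c r) =
     \<bar>1 / n\<bar> *\<^sub>R (LINT v|lborel. of_real (n * exp (- (n * (0 + (1 / n) * v))\<^sup>2 / 2)) * c (0 + (1 / n) * v))"
    by (rule lborel_integral_real_affine) (use n in simp)
  also have "(\<lambda>v. of_real (n * exp (- (n * (0 + (1 / n) * v))\<^sup>2 / 2)) * c (0 + (1 / n) * v))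
      = (\<lambda>v. of_real n * (complex_of_real (exp (- v\<^sup>2 / 2)) * c (v / n)))"
    using n by (simp add: mult_ac)
  also have "\<bar>1 / n\<bar> *\<^sub>R (LINT v|lborel. of_real n * (complex_of_real (exp (- v\<^sup>2 / 2)) * c (v / n)))
     = (LINT v|lborel. complex_of_real (exp (- v\<^sup>2 / 2)) * c (v / n))"
    using n by (simp add: scaleR_conv_of_real)
  finally show ?thesis .
qed

lemma gauss_integral: "(LINT v|lborel. exp (- v\<^sup>2 / 2)) = sqrt (2 * pi)"
proof -
  have "(LINT v|lborel. exp (- v\<^sup>2 / 2)) = (LINT v|lborel. sqrt (2 * pi) * std_normal_density v)"
    by (simp add: std_normal_density_def)
  then show ?thesis by simp
qed

lemma gauss_invF_bound:
  assumes c: "integrable lborel c" "\<And>r. cmod (c r) \<le> B" and n: "n > 0"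
  shows "cmod (LINT x|lborel. of_real (exp (- (x / n)\<^sup>2 / 2)) * invF c x) \<le> B * sqrt (2 * pi)"
proof -
  have [measurable]: "c \<in> borel_measurable borel" using c by measurable
  have gi: "integrable lborel (\<lambda>v. exp (- v\<^sup>2 / 2) :: real)" using gauss_integrable[of 1] by simp
  have "cmod (LINT v|lborel. complex_of_real (exp (- v\<^sup>2 / 2)) * c (v / n)) \<le> (LINT v|lborel. B * exp (- v\<^sup>2 / 2))"
  proof (rule Bochner_Integration.integral_norm_bound_integral)
    have "integrable lborel (\<lambda>v. c (v / n) * complex_of_real (exp (- v\<^sup>2 / 2)))"
      by (rule integrable_bounded_mult[where B = B]) (use gi c(2) in auto)
    then show "integrable lborel (\<lambda>v. complex_of_real (exp (- v\<^sup>2 / 2)) * c (v / n))" by (simp add: mult.commute)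
    show "norm (complex_of_real (exp (- v\<^sup>2 / 2)) * c (v / n)) \<le> B * exp (- v\<^sup>2 / 2)" for v
      using c(2)[of "v / n"] by (simp add: norm_mult mult.commute)
  qed (use gi in simp)
  then show ?thesis unfolding gauss_invF[OF c(1) n] gauss_rescale[OF n] integral_mult_right_zero gauss_integral .
qed

lemma gauss_invF_tendsto:
  assumes c: "integrable lborel c" "\<And>r. cmod (c r) \<le> B" and cont: "isCont c 0"
  shows "(\<lambda>n. LINT x|lborel. of_real (exp (- (x / real (Suc n))\<^sup>2 / 2)) * invF c x) \<longlonglongrightarrow> of_real (sqrt (2 * pi)) * c 0"
proof -
  have [measurable]: "c \<in> borel_measurable borel" using c by measurable
  have gi: "integrable lborel (\<lambda>v. exp (- v\<^sup>2 / 2) :: real)" using gauss_integrable[of 1] by simp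
  have "(\<lambda>n. LINT v|lborel. complex_of_real (exp (- v\<^sup>2 / 2)) * c (v / real (Suc n))) \<longlonglongrightarrow>
     (LINT v|lborel. complex_of_real (exp (- v\<^sup>2 / 2)) * c 0)"
  proof (rule integral_dominated_convergence[where w = "\<lambda>v. B * exp (- v\<^sup>2 / 2)"])
    have "(\<lambda>n. c (v / real (Suc n))) \<longlonglongrightarrow> c 0" for v
      by (rule isCont_tendsto_compose[OF cont]) (rule LIMSEQ_Suc[OF lim_const_over_n])
    then show "AE v in lborel. (\<lambda>n. complex_of_real (exp (- v\<^sup>2 / 2)) * c (v / real (Suc n))) \<longlonglongrightarrow> complex_of_real (exp (- v\<^sup>2 / 2)) * c 0"
      by (auto intro!: AE_I2 tendsto_intros)
    show "AE v in lborel. norm (complex_of_real (exp (- v\<^sup>2 / 2)) * c (v / real (Suc n))) \<le> B * exp (- v\<^sup>2 / 2)" for n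
      using c(2) by (auto intro!: AE_I2 simp: norm_mult mult.commute)
  qed (use gi in auto)
  also have "(LINT v|lborel. complex_of_real (exp (- v\<^sup>2 / 2)) * c 0) = of_real (LINT v|lborel. exp (- v\<^sup>2 / 2)) * c 0"
    using gi by simp
  finally show ?thesis
    unfolding gauss_invF[OF c(1) of_nat_0_less_iff[THEN iffD2, OF zero_less_Suc]] gauss_rescale[OF of_nat_0_less_iff[THEN iffD2, OF zero_less_Suc]] gauss_integral .
qed

lemma integrable_shift: "integrable lborel a \<Longrightarrow> integrable lborel (\<lambda>r. a (r + y))" for a :: "real \<Rightarrow> complex"
  using lborel_integrable_real_affine[of a 1 y] by (simp add: add.commute)

lemma integral_shift: "(LINT r|lborel. a (r + y)) = (LINT r|lborel. a r)" for a :: "real \<Rightarrow> 'b::euclidean_space"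
  using lborel_integral_real_affine[of 1 a y] by (simp add: add.commute)

lemma cnj_measurable [measurable]: "cnj \<in> borel_measurable borel"
  by (intro borel_measurable_continuous_onI continuous_intros)

section \<open>Correlations, Plancherel's identity and the Fourier transform on bounded integrable
  functions\<close>

lemma corr_pair_integrable:
  fixes a b :: "real \<Rightarrow> complex"
  assumes a: "integrable lborel a" and b: "integrable lborel b"
  shows "integrable (lborel \<Otimes>\<^sub>M lborel) (\<lambda>(y, r). a (r + y) * cnj (b y))"
proof (rule lborel_pair.Fubini_integrable)
  have [measurable]: "a \<in> borel_measurable borel" "b \<in> borel_measurable borel" using a b by measurable
  show "(\<lambda>(y, r). a (r + y) * cnj (b y)) \<in> borel_measurable (lborel \<Otimes>\<^sub>M lborel)" by measurable
  have "(LINT r|lborel. norm (a (r + y) * cnj (b y))) = (LINT r|lborel. cmod (a r)) * cmod (b y)" for y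
    using integral_shift[of "\<lambda>r. cmod (a r)" y] by (simp add: norm_mult)
  then show "integrable lborel (\<lambda>y. LINT r|lborel. norm (case (y, r) of (y, r) \<Rightarrow> a (r + y) * cnj (b y)))"
    using b by simp
  show "AE y in lborel. integrable lborel (\<lambda>r. case (y, r) of (y, r) \<Rightarrow> a (r + y) * cnj (b y))"
    using integrable_shift[OF a] by (auto intro!: AE_I2 integrable_mult_left)
qed

lemma corr_integrable:
  assumes a: "integrable lborel a" and b: "integrable lborel b"
  shows "integrable lborel (corr a b)"
  using lborel_pair.integrable_snd[of "\<lambda>y r. a (r + y) * cnj (b y)"] corr_pair_integrable[OF assms]
  unfolding corr_def[abs_def] by simp

lemma corr_bounded:
  assumes a: "\<And>x. cmod (a x) \<le> B" "a \<in> borel_measurable borel" and b: "integrable lborel b"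
  shows "cmod (corr a b r) \<le> B * (LINT y|lborel. cmod (b y))"
proof -
  have [measurable]: "b \<in> borel_measurable borel" using b by measurable
  have "cmod (corr a b r) \<le> (LINT y|lborel. B * cmod (b y))"
    unfolding corr_def
  proof (rule Bochner_Integration.integral_norm_bound_integral)
    show "integrable lborel (\<lambda>y. a (r + y) * cnj (b y))"
      by (rule integrable_bounded_mult[where B = B]) (use a b in auto)
    show "norm (a (r + y) * cnj (b y)) \<le> B * cmod (b y)" for y
      using a by (simp add: norm_mult mult_right_mono)
  qed (use b in simp)
  then show ?thesis by simp
qed

lemma nice_corr: "nice a \<Longrightarrow> integrable lborel b \<Longrightarrow> nice (corr a b)"
  using corr_integrable corr_bounded[of a _ b] borel_measurable_integrable[of lborel a]
  unfolding nice_def by (metis measurable_lborel2)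

lemma invF_mult_cnj:
  assumes a: "integrable lborel a" and b: "integrable lborel b"
  shows "invF a x * cnj (invF b x) = complex_of_real (1 / sqrt (2 * pi)) * invF (corr a b) x"
proof -
  let ?e = "\<lambda>r. exp (\<i> * complex_of_real x * of_real r)"
  let ?f = "\<lambda>y r. ?e r * (a (r + y) * cnj (b y))"
  have [measurable]: "a \<in> borel_measurable borel" "b \<in> borel_measurable borel" using a b by measurable
  have fi: "integrable (lborel \<Otimes>\<^sub>M lborel) (case_prod ?f)"
  proof -
    have "integrable (lborel \<Otimes>\<^sub>M lborel) (\<lambda>z. ?e (snd z) * (case z of (y, r) \<Rightarrow> a (r + y) * cnj (b y)))"
      by (rule integrable_bounded_mult[OF corr_pair_integrable[OF a b], where B = 1]) auto
    then show ?thesis by (simp add: case_prod_unfold)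
  qed
  have "(LINT r|lborel. ?e r * corr a b r) = (LINT r|lborel. LINT y|lborel. ?f y r)"
    unfolding corr_def by simp
  also have "\<dots> = (LINT y|lborel. LINT r|lborel. ?f y r)" by (rule lborel_pair.Fubini_integral[OF fi])
  also have "(\<lambda>y. LINT r|lborel. ?f y r) = (\<lambda>y. (LINT r|lborel. ?e r * a r) * cnj (?e y * b y))"
  proof
    fix y
    have ec: "cnj (?e y) = ?e (- y)" by (simp add: exp_cnj)
    have "(LINT r|lborel. ?f y r) = (LINT r|lborel. (\<lambda>r. ?e (r - y) * a r * cnj (b y)) (r + y))"
      by (simp add: mult.assoc)
    also have "\<dots> = (LINT r|lborel. ?e (r - y) * a r * cnj (b y))" by (rule integral_shift)
    also have "\<dots> = (LINT r|lborel. (?e r * a r) * cnj (?e y * b y))"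
    proof (rule Bochner_Integration.integral_cong)
      fix r
      have "?e (r - y) = ?e r * ?e (- y)" by (simp add: exp_add[symmetric] algebra_simps)
      then show "?e (r - y) * a r * cnj (b y) = (?e r * a r) * cnj (?e y * b y)"
        unfolding complex_cnj_mult ec by simp
    qed simp
    also have "\<dots> = (LINT r|lborel. ?e r * a r) * cnj (?e y * b y)" by simp
    finally show "(LINT r|lborel. ?f y r) = (LINT r|lborel. ?e r * a r) * cnj (?e y * b y)" .
  qed
  also have "(LINT y|lborel. (LINT r|lborel. ?e r * a r) * cnj (?e y * b y)) = (LINT r|lborel. ?e r * a r) * (LINT y|lborel. cnj (?e y * b y))"
    by simp
  also have "(LINT y|lborel. cnj (?e y * b y)) = cnj (LINT y|lborel. ?e y * b y)" by (rule Bochner_Integration.integral_cnj)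
  finally have "(LINT r|lborel. ?e r * corr a b r) = (LINT r|lborel. ?e r * a r) * cnj (LINT y|lborel. ?e y * b y)" .
  then show ?thesis unfolding invF_def by simp
qed

text \<open>\<open>|invF a|^2\<close> is, up to a constant, the inverse transform of the bounded
  autocorrelation of a. Its integrals against wide Gaussians are thus bounded uniformly, and Fatou's
  lemma removes the Gaussians.\<close>

lemma invF_square_integrable:
  assumes a: "nice a" shows "square_integrable (invF a)"
  unfolding square_integrable_def
proof
  have ai: "integrable lborel a" by (rule nice_integrable[OF a])
  show m: "invF a \<in> borel_measurable lborel" using invF_measurable[OF ai] by simp
  obtain B where B: "\<And>r. cmod (corr a a r) \<le> B" using nice_corr[OF a ai] unfolding nice_def by blast
  obtain S where S: "\<And>x. cmod (invF a x) \<le> S" using invF_bound by blast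
  let ?W = "\<lambda>n x. exp (- (x / real (Suc n))\<^sup>2 / 2) :: real"
  have bd: "(\<integral>\<^sup>+x. ennreal (?W n x * (cmod (invF a x))\<^sup>2) \<partial>lborel) \<le> ennreal B" for n
  proof -
    have n: "real (Suc n) > 0" by simp
    have i: "integrable lborel (\<lambda>x. ?W n x * (cmod (invF a x))\<^sup>2)"
    proof (rule Bochner_Integration.integrable_bound[OF integrable_mult_left[OF gauss_integrable[OF n], of "S\<^sup>2"]])
      show "AE x in lborel. norm (?W n x * (cmod (invF a x))\<^sup>2) \<le> norm (?W n x * S\<^sup>2)"
        using S by (auto intro!: AE_I2 power_mono simp: abs_mult)
    qed (use m in simp)
    have "complex_of_real (LINT x|lborel. ?W n x * (cmod (invF a x))\<^sup>2) = (LINT x|lborel. complex_of_real (?W n x * (cmod (invF a x))\<^sup>2))"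
      by (rule integral_complex_of_real[symmetric])
    also have "\<dots> = (LINT x|lborel. complex_of_real (1 / sqrt (2 * pi)) * (of_real (?W n x) * invF (corr a a) x))"
    proof (rule Bochner_Integration.integral_cong)
      fix x
      have "complex_of_real ((cmod (invF a x))\<^sup>2) = complex_of_real (1 / sqrt (2 * pi)) * invF (corr a a) x"
        unfolding invF_mult_cnj[OF ai ai, symmetric] by (rule complex_norm_square)
      then show "complex_of_real (?W n x * (cmod (invF a x))\<^sup>2) = complex_of_real (1 / sqrt (2 * pi)) * (of_real (?W n x) * invF (corr a a) x)"
        unfolding of_real_mult by simp
    qed simp
    also have "\<dots> = complex_of_real (1 / sqrt (2 * pi)) * (LINT x|lborel. of_real (?W n x) * invF (corr a a) x)" by simp
    finally have eq: "complex_of_real (LINT x|lborel. ?W n x * (cmod (invF a x))\<^sup>2) =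
       complex_of_real (1 / sqrt (2 * pi)) * (LINT x|lborel. of_real (?W n x) * invF (corr a a) x)" .
    have "\<bar>LINT x|lborel. ?W n x * (cmod (invF a x))\<^sup>2\<bar> = \<bar>1 / sqrt (2 * pi)\<bar> * cmod (LINT x|lborel. of_real (?W n x) * invF (corr a a) x)"
      using arg_cong[OF eq, of cmod] unfolding norm_mult norm_of_real .
    also have "\<dots> \<le> \<bar>1 / sqrt (2 * pi)\<bar> * (B * sqrt (2 * pi))"
      by (intro mult_left_mono gauss_invF_bound[OF corr_integrable[OF ai ai] B n]) auto
    finally have "(LINT x|lborel. ?W n x * (cmod (invF a x))\<^sup>2) \<le> B" by simp
    then show ?thesis
      by (subst nn_integral_eq_integral[OF i]) (auto intro: ennreal_leI)
  qed
  have lim: "(\<lambda>n. ennreal (?W n x * (cmod (invF a x))\<^sup>2)) \<longlonglongrightarrow> ennreal ((cmod (invF a x))\<^sup>2)" for x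
  proof -
    have "(\<lambda>n. x / real (Suc n)) \<longlonglongrightarrow> 0"
      by (rule LIMSEQ_Suc[OF lim_const_over_n])
    then have "(\<lambda>n. ?W n x * (cmod (invF a x))\<^sup>2) \<longlonglongrightarrow> exp (- 0\<^sup>2 / 2) * (cmod (invF a x))\<^sup>2"
      by (intro tendsto_intros) auto
    then show ?thesis by (intro tendsto_ennrealI) simp
  qed
  have "(\<integral>\<^sup>+x. ennreal ((cmod (invF a x))\<^sup>2) \<partial>lborel) = (\<integral>\<^sup>+x. liminf (\<lambda>n. ennreal (?W n x * (cmod (invF a x))\<^sup>2)) \<partial>lborel)"
    by (intro nn_integral_cong lim_imp_Liminf[OF _ lim, symmetric]) simp
  also have "\<dots> \<le> liminf (\<lambda>n. \<integral>\<^sup>+x. ennreal (?W n x * (cmod (invF a x))\<^sup>2) \<partial>lborel)"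
    by (rule nn_integral_liminf) (use m in measurable)
  also have "\<dots> \<le> limsup (\<lambda>n. \<integral>\<^sup>+x. ennreal (?W n x * (cmod (invF a x))\<^sup>2) \<partial>lborel)"
    by (rule Liminf_le_Limsup) simp
  also have "\<dots> \<le> ennreal B" by (rule Limsup_bounded) (use bd in auto)
  finally have "(\<integral>\<^sup>+x. ennreal ((cmod (invF a x))\<^sup>2) \<partial>lborel) < \<infinity>" by (simp add: le_less_trans)
  then show "integrable lborel (\<lambda>x. (cmod (invF a x))\<^sup>2)"
    using m by (intro integrableI_bounded) (auto simp: real_norm_def)
qed

lemma nice_square_integrable:
  assumes a: "nice a" shows "square_integrable a"
  unfolding square_integrable_def
proof
  have ai: "integrable lborel a" by (rule nice_integrable[OF a])
  show m: "a \<in> borel_measurable lborel" using ai by auto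
  obtain B where B: "\<And>x. cmod (a x) \<le> B" using a unfolding nice_def by blast
  show "integrable lborel (\<lambda>x. (cmod (a x))\<^sup>2)"
  proof (rule Bochner_Integration.integrable_bound[OF integrable_mult_right[OF integrable_norm[OF ai], of B]])
    show "AE x in lborel. norm ((cmod (a x))\<^sup>2) \<le> norm (B * cmod (a x))"
    proof (rule AE_I2)
      fix x
      have "(cmod (a x))\<^sup>2 \<le> B * cmod (a x)" unfolding power2_eq_square by (intro mult_right_mono B) auto
      then show "norm ((cmod (a x))\<^sup>2) \<le> norm (B * cmod (a x))" by simp
    qed
  qed (use m in simp)
qed

lemma test_function_nice: assumes t: "test_function \<phi>" shows "nice \<phi>"
proof -
  have c: "continuous_on UNIV \<phi>" and b: "bounded {x. \<phi> x \<noteq> 0}" using t by (auto simp: test_function_def)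
  obtain R where R: "\<And>x. \<phi> x \<noteq> 0 \<Longrightarrow> \<bar>x\<bar> \<le> R" using b unfolding bounded_real by auto
  have "compact (\<phi> ` {- R..R})" by (intro compact_continuous_image continuous_on_subset[OF c]) auto
  then obtain B where B: "\<And>x. x \<in> {- R..R} \<Longrightarrow> cmod (\<phi> x) \<le> B" using compact_imp_bounded bounded_iff by (metis imageI)
  have z: "\<phi> x = 0" if "x \<notin> {- R..R}" for x using R[of x] that by (cases "\<phi> x = 0") (auto simp: abs_le_iff)
  have "set_integrable lborel {- R..R} \<phi>"
    by (intro borel_integrable_atLeastAtMost' continuous_on_subset[OF c]) auto
  moreover have "(\<lambda>x. indicator {- R..R} x *\<^sub>R \<phi> x) = \<phi>" using z by (auto simp: indicator_def)
  ultimately have "integrable lborel \<phi>" by (simp add: set_integrable_def)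
  moreover have "cmod (\<phi> x) \<le> max B 0" for x using B[of x] z[of x] by (cases "x \<in> {- R..R}") auto
  ultimately show ?thesis unfolding nice_def by blast
qed

lemma nice_cnj: "nice a \<Longrightarrow> nice (\<lambda>x. cnj (a x))"
  unfolding nice_def by auto

lemma fourier_L1_invF: "fourier_L1 \<phi> x = cnj (invF (\<lambda>y. cnj (\<phi> y)) x)"
proof -
  have "cnj (LINT r|lborel. exp (\<i> * of_real x * of_real r) * cnj (\<phi> r)) = (LINT r|lborel. cnj (exp (\<i> * of_real x * of_real r) * cnj (\<phi> r)))"
    by (rule Bochner_Integration.integral_cnj[symmetric])
  also have "\<dots> = (LINT r|lborel. exp (- \<i> * of_real x * of_real r) * \<phi> r)" by (simp add: exp_cnj)
  finally show ?thesis unfolding fourier_L1_def invF_def by simp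
qed

text \<open>With b the conjugate of the test function, the duality identity is Plancherel's identity
  for a and b. Gaussian summation evaluates the correlation at 0, where it is continuous because the
  test function is.\<close>

lemma is_fourier_invF:
  assumes a: "nice a" shows "is_fourier (invF a) a"
  unfolding is_fourier_def
proof (intro conjI allI impI invF_square_integrable[OF a] nice_square_integrable[OF a])
  fix \<phi> assume t: "test_function \<phi>"
  have ai: "integrable lborel a" by (rule nice_integrable[OF a])
  define b where "b y = cnj (\<phi> y)" for y
  have b: "nice b" unfolding b_def by (rule nice_cnj[OF test_function_nice[OF t]])
  have bi: "integrable lborel b" by (rule nice_integrable[OF b])
  obtain B where B: "\<And>x. cmod (\<phi> x) \<le> B" using test_function_nice[OF t] unfolding nice_def by blast
  have [measurable]: "a \<in> borel_measurable borel" "b \<in> borel_measurable borel" using ai bi by measurable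
  have [measurable]: "\<phi> \<in> borel_measurable borel" using nice_integrable[OF test_function_nice[OF t]] by measurable
  obtain C where C: "\<And>r. cmod (corr a b r) \<le> C" using nice_corr[OF a bi] unfolding nice_def by blast
  have corr_eq: "corr a b r = (LINT v|lborel. a v * \<phi> (v - r))" for r
    using integral_shift[of "\<lambda>v. a v * \<phi> (v - r)" r] unfolding corr_def b_def by (simp add: add.commute)
  have "continuous_on UNIV (\<lambda>r. LINT v|lborel. a v * \<phi> (v - r))"
  proof (rule continuous_on_integral_dominated[where b = "\<lambda>v. B * cmod (a v)"])
    show "continuous_on UNIV (\<lambda>r. a v * \<phi> (v - r))" for v
    proof -
      have "continuous_on UNIV \<phi>" using t by (simp add: test_function_def)
      then have "continuous_on UNIV (\<lambda>r. \<phi> (v - r))"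
        by (rule continuous_on_compose2) (auto intro: continuous_on_diff continuous_on_const continuous_on_id)
      then show ?thesis by (intro continuous_intros)
    qed
    show "norm (a v * \<phi> (v - r)) \<le> B * cmod (a v)" for r v
      using mult_right_mono[OF B[of "v - r"], of "cmod (a v)"] by (simp add: norm_mult mult.commute)
  qed (use ai in auto)
  then have cont: "isCont (corr a b) 0" unfolding corr_eq[abs_def] by (simp add: continuous_on_eq_continuous_at)
  let ?W = "\<lambda>n x. exp (- (x / real (Suc n))\<^sup>2 / 2) :: real"
  have pi: "integrable lborel (\<lambda>x. invF a x * cnj (invF b x))"
    using invF_square_integrable[OF a] invF_square_integrable[OF b] unfolding square_integrable_def
    by (intro integrable_mult_squares) auto
  have l1: "(\<lambda>n. LINT x|lborel. of_real (?W n x) * (invF a x * cnj (invF b x))) \<longlonglongrightarrow> (LINT x|lborel. invF a x * cnj (invF b x))"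
  proof (rule integral_dominated_convergence[where w = "\<lambda>x. cmod (invF a x * cnj (invF b x))"])
    show "AE x in lborel. (\<lambda>n. complex_of_real (?W n x) * (invF a x * cnj (invF b x))) \<longlonglongrightarrow> invF a x * cnj (invF b x)"
    proof (rule AE_I2)
      fix x :: real
      have "(\<lambda>n. x / real (Suc n)) \<longlonglongrightarrow> 0"
        by (rule LIMSEQ_Suc[OF lim_const_over_n])
      then have "(\<lambda>n. complex_of_real (?W n x) * (invF a x * cnj (invF b x))) \<longlonglongrightarrow> complex_of_real (exp (- 0\<^sup>2 / 2)) * (invF a x * cnj (invF b x))"
        by (intro tendsto_intros) auto
      then show "(\<lambda>n. complex_of_real (?W n x) * (invF a x * cnj (invF b x))) \<longlonglongrightarrow> invF a x * cnj (invF b x)" by simp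
    qed
    show "AE x in lborel. norm (complex_of_real (?W n x) * (invF a x * cnj (invF b x))) \<le> cmod (invF a x * cnj (invF b x))" for n
      by (auto intro!: AE_I2 mult_left_le_one_le simp: norm_mult)
  qed (use pi invF_measurable[OF ai] invF_measurable[OF bi] in auto)
  have "(\<lambda>n. complex_of_real (1 / sqrt (2 * pi)) * (LINT x|lborel. of_real (?W n x) * invF (corr a b) x)) \<longlonglongrightarrow>
      complex_of_real (1 / sqrt (2 * pi)) * (of_real (sqrt (2 * pi)) * corr a b 0)"
    by (intro tendsto_intros gauss_invF_tendsto[OF corr_integrable[OF ai bi] C cont])
  moreover have "complex_of_real (1 / sqrt (2 * pi)) * (LINT x|lborel. of_real (?W n x) * invF (corr a b) x)
      = (LINT x|lborel. of_real (?W n x) * (invF a x * cnj (invF b x)))" for n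
  proof -
    have "complex_of_real (1 / sqrt (2 * pi)) * (LINT x|lborel. of_real (?W n x) * invF (corr a b) x)
       = (LINT x|lborel. complex_of_real (1 / sqrt (2 * pi)) * (of_real (?W n x) * invF (corr a b) x))" by simp
    also have "\<dots> = (LINT x|lborel. of_real (?W n x) * (invF a x * cnj (invF b x)))"
      unfolding invF_mult_cnj[OF ai bi] by (rule Bochner_Integration.integral_cong) (auto simp: mult_ac)
    finally show ?thesis .
  qed
  moreover have "complex_of_real (1 / sqrt (2 * pi)) * (of_real (sqrt (2 * pi)) * corr a b 0) = corr a b 0"
    by (simp add: mult.assoc[symmetric] flip: of_real_mult)
  ultimately have "(LINT x|lborel. invF a x * cnj (invF b x)) = corr a b 0"
    using LIMSEQ_unique[OF l1] by simp
  then show "(LINT \<xi>|lborel. a \<xi> * \<phi> \<xi>) = (LINT x|lborel. invF a x * fourier_L1 \<phi> x)"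
    unfolding fourier_L1_invF b_def[symmetric] corr_eq by simp
qed

text \<open>The positive and the negative part of h are densities of finite measures that agree on
  all half-lines, hence everywhere.\<close>

lemma zero_AE_if_interval_integrals_zero:
  fixes h :: "real \<Rightarrow> real"
  assumes h: "integrable lborel h" and z: "\<And>c. (LINT x|lborel. indicator {c<..} x * h x) = 0"
  shows "AE x in lborel. h x = 0"
proof -
  have [measurable]: "h \<in> borel_measurable borel" using borel_measurable_integrable[OF h] by simp
  let ?p = "\<lambda>x. ennreal (max 0 (h x))" and ?m = "\<lambda>x. ennreal (max 0 (- h x))"
  have pi: "integrable lborel (\<lambda>x. indicator {c<..} x * max 0 (h x))"
    and mi: "integrable lborel (\<lambda>x. indicator {c<..} x * max 0 (- h x))" for c
    by (rule Bochner_Integration.integrable_bound[OF h]; auto simp: indicator_def)+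
  have pe: "emeasure (density lborel ?p) {c<..} = ennreal (LINT x|lborel. indicator {c<..} x * max 0 (h x))"
    and me: "emeasure (density lborel ?m) {c<..} = ennreal (LINT x|lborel. indicator {c<..} x * max 0 (- h x))" for c
  proof -
    have "emeasure (density lborel ?p) {c<..} = (\<integral>\<^sup>+x. ennreal (indicator {c<..} x * max 0 (h x)) \<partial>lborel)"
      by (subst emeasure_density) (auto intro!: nn_integral_cong simp: indicator_def)
    also have "\<dots> = ennreal (LINT x|lborel. indicator {c<..} x * max 0 (h x))"
      by (rule nn_integral_eq_integral[OF pi]) auto
    finally show "emeasure (density lborel ?p) {c<..} = ennreal (LINT x|lborel. indicator {c<..} x * max 0 (h x))" .
    have "emeasure (density lborel ?m) {c<..} = (\<integral>\<^sup>+x. ennreal (indicator {c<..} x * max 0 (- h x)) \<partial>lborel)"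
      by (subst emeasure_density) (auto intro!: nn_integral_cong simp: indicator_def)
    also have "\<dots> = ennreal (LINT x|lborel. indicator {c<..} x * max 0 (- h x))"
      by (rule nn_integral_eq_integral[OF mi]) auto
    finally show "emeasure (density lborel ?m) {c<..} = ennreal (LINT x|lborel. indicator {c<..} x * max 0 (- h x))" .
  qed
  have "(LINT x|lborel. indicator {c<..} x * max 0 (h x)) - (LINT x|lborel. indicator {c<..} x * max 0 (- h x))
     = (LINT x|lborel. indicator {c<..} x * h x)" for c
    by (subst Bochner_Integration.integral_diff[OF pi mi, symmetric])
      (auto intro!: Bochner_Integration.integral_cong simp: max_def algebra_simps)
  then have eq: "(LINT x|lborel. indicator {c<..} x * max 0 (h x)) = (LINT x|lborel. indicator {c<..} x * max 0 (- h x))" for c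
    using z[of c] by (metis eq_iff_diff_eq_0)
  have "density lborel ?p = density lborel ?m"
  proof (rule measure_eqI_lessThan)
    show "emeasure (density lborel ?p) {c<..} < \<infinity>" for c unfolding pe by (rule ennreal_less_top[folded infinity_ennreal_def])
    show "emeasure (density lborel ?p) {c<..} = emeasure (density lborel ?m) {c<..}" for c unfolding pe me eq ..
  qed simp_all
  then have "AE x in lborel. ?p x = ?m x"
    by (intro sigma_finite_measure.density_unique sigma_finite_lborel) auto
  then show ?thesis
    by (rule AE_mp) (auto intro!: AE_I2 simp: max_def split: if_splits)
qed

text \<open>The definition tests only against continuous functions of compact support; trapezoidal
  functions increasing to the indicator carry the equality over to intervals.\<close>

lemma is_fourier_interval:
  assumes f: "is_fourier f g" "is_fourier f g'"
  shows "(LINT x|lborel. indicator {a<..<b} x * (g x - g' x)) = 0"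
proof -
  have sg: "square_integrable g" "square_integrable g'" using f by (auto simp: is_fourier_def)
  then have [measurable]: "g \<in> borel_measurable borel" "g' \<in> borel_measurable borel" by (auto simp: square_integrable_def)
  define \<phi> where "\<phi> n x = complex_of_real (max 0 (min 1 (real n * min (x - a) (b - x))))" for n :: nat and x
  have \<phi>0: "\<phi> n x = 0" if "x \<notin> {a<..<b}" for n x
  proof -
    have "min (x - a) (b - x) \<le> 0" using that by auto
    then have "real n * min (x - a) (b - x) \<le> 0" by (simp add: mult_nonneg_nonpos)
    then show ?thesis unfolding \<phi>_def by (simp add: max_absorb1 min.coboundedI2)
  qed
  have "bounded {x. \<phi> n x \<noteq> 0}" for n
  proof (rule bounded_subset[OF bounded_closed_interval[of a b]], rule subsetI)
    fix x assume "x \<in> {x. \<phi> n x \<noteq> 0}"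
    then have "x \<in> {a<..<b}" using \<phi>0[of x n] by blast
    then show "x \<in> {a..b}" by simp
  qed
  moreover have "continuous_on UNIV (\<phi> n)" for n
    unfolding \<phi>_def by (intro continuous_intros)
  ultimately have test: "test_function (\<phi> n)" for n by (simp add: test_function_def)
  have pm [measurable]: "\<phi> n \<in> borel_measurable borel" for n unfolding \<phi>_def by measurable
  have sq: "square_integrable (\<phi> n)" for n by (rule nice_square_integrable[OF test_function_nice[OF test]])
  have i: "integrable lborel (\<lambda>x. g x * \<phi> n x)" "integrable lborel (\<lambda>x. g' x * \<phi> n x)" for n
    using sg sq[of n] by (auto intro!: integrable_mult_squares simp: square_integrable_def)
  have zero: "(LINT x|lborel. \<phi> n x * (g x - g' x)) = 0" for n
  proof -
    have "(LINT x|lborel. \<phi> n x * (g x - g' x)) = (LINT x|lborel. g x * \<phi> n x - g' x * \<phi> n x)"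
      by (rule Bochner_Integration.integral_cong) (auto simp: algebra_simps)
    also have "\<dots> = (LINT x|lborel. g x * \<phi> n x) - (LINT x|lborel. g' x * \<phi> n x)"
      by (rule Bochner_Integration.integral_diff[OF i])
    also have "\<dots> = 0" using f test[of n] by (simp add: is_fourier_def)
    finally show ?thesis .
  qed
  have ii: "integrable lborel (\<lambda>x. indicator {a..b} x * (cmod (g x) + cmod (g' x)))"
  proof -
    have sqi: "integrable lborel (\<lambda>x. (cmod (indicator {a..b} x :: complex))\<^sup>2)"
      by (rule Bochner_Integration.integrable_cong[THEN iffD2, OF refl _ integrable_real_indicator[of "{a..b}" lborel]])
        (auto simp: indicator_def emeasure_lborel_Icc_eq)
    have "integrable lborel (\<lambda>x. indicator {a..b} x * g x)" "integrable lborel (\<lambda>x. indicator {a..b} x * g' x)"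
      using sg by (auto intro!: integrable_mult_squares sqi simp: square_integrable_def)
    then have "integrable lborel (\<lambda>x. cmod (indicator {a..b} x * g x) + cmod (indicator {a..b} x * g' x))" by simp
    moreover have "(\<lambda>x. cmod (indicator {a..b} x * g x) + cmod (indicator {a..b} x * g' x))
       = (\<lambda>x. indicator {a..b} x * (cmod (g x) + cmod (g' x)))"
      by (auto simp: indicator_def norm_mult)
    ultimately show ?thesis by simp
  qed
  have "(\<lambda>n. LINT x|lborel. \<phi> n x * (g x - g' x)) \<longlonglongrightarrow> (LINT x|lborel. indicator {a<..<b} x * (g x - g' x))"
  proof (rule integral_dominated_convergence[OF _ _ ii])
    show "AE x in lborel. (\<lambda>n. \<phi> n x * (g x - g' x)) \<longlonglongrightarrow> indicator {a<..<b} x * (g x - g' x)"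
    proof (rule AE_I2)
      fix x :: real
      have "eventually (\<lambda>n. \<phi> n x = indicator {a<..<b} x) sequentially"
      proof (cases "x \<in> {a<..<b}")
        case True
        define e where "e = min (x - a) (b - x)"
        have e: "e > 0" using True by (simp add: e_def)
        have "eventually (\<lambda>n. 1 / e \<le> real n) sequentially" using eventually_ge_at_top[of "nat \<lceil>1 / e\<rceil>"]
          by eventually_elim linarith
        then show ?thesis
        proof eventually_elim
          case (elim n)
          then have "1 \<le> real n * e" using e by (simp add: field_simps)
          then show ?case using True unfolding \<phi>_def e_def[symmetric] by simp
        qed
      next
        case False
        then show ?thesis using \<phi>0 by simp
      qed
      then have "eventually (\<lambda>n. \<phi> n x * (g x - g' x) = indicator {a<..<b} x * (g x - g' x)) sequentially"
        by eventually_elim simp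
      then show "(\<lambda>n. \<phi> n x * (g x - g' x)) \<longlonglongrightarrow> indicator {a<..<b} x * (g x - g' x)"
        by (rule tendsto_eventually)
    qed
    show "AE x in lborel. norm (\<phi> n x * (g x - g' x)) \<le> indicator {a..b} x * (cmod (g x) + cmod (g' x))" for n
    proof (rule AE_I2)
      fix x :: real
      have "cmod (\<phi> n x) \<le> indicator {a..b} x"
      proof (cases "x \<in> {a..b}")
        case True then show ?thesis unfolding \<phi>_def by simp
      next
        case False
        then have "x \<notin> {a<..<b}" by auto
        then show ?thesis using \<phi>0 by simp
      qed
      then show "norm (\<phi> n x * (g x - g' x)) \<le> indicator {a..b} x * (cmod (g x) + cmod (g' x))"
        unfolding norm_mult by (intro mult_mono norm_triangle_ineq4) auto
    qed
  qed (auto simp: measurable)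
  then show ?thesis unfolding zero by (simp add: LIMSEQ_const_iff)
qed

text \<open>\<open>fourier\<close> is chosen among all functions satisfying the duality, so it can
  be computed only through uniqueness almost everywhere. Bounded windows make the square integrable
  difference integrable.\<close>

lemma is_fourier_unique:
  assumes f: "is_fourier f g" "is_fourier f g'"
  shows "AE x in lborel. g x = g' x"
proof -
  have sg: "square_integrable g" "square_integrable g'" using f by (auto simp: is_fourier_def)
  then have [measurable]: "g \<in> borel_measurable borel" "g' \<in> borel_measurable borel" by (auto simp: square_integrable_def)
  have "AE x in lborel. indicator {- real n<..<real n} x * (g x - g' x) = 0" for n
  proof -
    let ?I = "indicator {- real n<..<real n} :: real \<Rightarrow> complex"
    let ?d = "\<lambda>x. ?I x * (g x - g' x)"
    have sqi: "integrable lborel (\<lambda>x. (cmod (?I x))\<^sup>2)"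
      by (rule Bochner_Integration.integrable_cong[THEN iffD2, OF refl _ integrable_real_indicator[of "{- real n<..<real n}" lborel]])
        (auto simp: indicator_def)
    have di: "integrable lborel ?d"
      unfolding right_diff_distrib
      using sg by (auto intro!: Bochner_Integration.integrable_diff integrable_mult_squares sqi simp: square_integrable_def)
    have z: "(LINT x|lborel. indicator {c<..} x *\<^sub>R ?d x) = 0" for c
    proof -
      have "(\<lambda>x. indicator {c<..} x *\<^sub>R ?d x) = (\<lambda>x. indicator {max c (- real n)<..<real n} x * (g x - g' x))"
        by (auto simp: fun_eq_iff indicator_def)
      then show ?thesis using is_fourier_interval[OF f] by simp
    qed
    have dc: "integrable lborel (\<lambda>x. indicator {c<..} x *\<^sub>R ?d x)" for c
      by (rule integrable_mult_indicator[OF _ di]) simp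
    have re: "AE x in lborel. Re (?d x) = 0"
    proof (rule zero_AE_if_interval_integrals_zero)
      show "integrable lborel (\<lambda>x. Re (?d x))" using di by (rule integrable_Re)
      show "(LINT x|lborel. indicator {c<..} x * Re (?d x)) = 0" for c
        using integral_Re[OF dc[of c]] unfolding z by simp
    qed
    have im: "AE x in lborel. Im (?d x) = 0"
    proof (rule zero_AE_if_interval_integrals_zero)
      show "integrable lborel (\<lambda>x. Im (?d x))" using di by (rule integrable_Im)
      show "(LINT x|lborel. indicator {c<..} x * Im (?d x)) = 0" for c
        using integral_Im[OF dc[of c]] unfolding z by simp
    qed
    from re im show ?thesis by eventually_elim (rule complex_eqI, simp_all)
  qed
  then have "AE x in lborel. \<forall>n. indicator {- real n<..<real n} x * (g x - g' x) = 0" unfolding AE_all_countable by blast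
  then show ?thesis
  proof eventually_elim
    case (elim x)
    obtain n where "\<bar>x\<bar> < real n" using reals_Archimedean2 by blast
    then show ?case using elim[rule_format, of n] by (auto simp: indicator_def abs_less_iff split: if_splits)
  qed
qed

lemma fourier_invF: assumes "nice a" shows "AE x in lborel. fourier (invF a) x = a x"
proof -
  have "is_fourier (invF a) (fourier (invF a))"
    unfolding fourier_def by (rule someI[of "is_fourier (invF a)", OF is_fourier_invF[OF assms]])
  then show ?thesis by (rule is_fourier_unique[OF _ is_fourier_invF[OF assms]])
qed

lemma invF_has_vector_derivative:
  assumes a: "integrable lborel a" and ra: "integrable lborel (\<lambda>r. \<i> * of_real r * a r)"
  shows "(invF a has_vector_derivative invF (\<lambda>r. \<i> * of_real r * a r) x) (at x)"
proof -
  have [measurable]: "a \<in> borel_measurable borel" using a by measurable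
  have "((\<lambda>x. LINT r|lborel. exp (\<i> * of_real x * of_real r) * a r) has_vector_derivative
     (LINT r|lborel. exp (\<i> * of_real x * of_real r) * (\<i> * of_real r * a r))) (at x within UNIV)"
  proof (rule has_vector_derivative_integral_dominated[where b = "\<lambda>r. cmod (\<i> * of_real r * a r)"])
    fix y r :: real
    have "((\<lambda>x. exp (\<i> * of_real (x * r))) has_vector_derivative \<i> * of_real r * exp (\<i> * of_real (y * r))) (at y)"
      by (rule has_vector_derivative_cis) (auto intro!: derivative_eq_intros)
    from has_vector_derivative_mult_left[OF this, of "a r"]
    show "((\<lambda>x. exp (\<i> * of_real x * of_real r) * a r) has_vector_derivative
         exp (\<i> * of_real y * of_real r) * (\<i> * of_real r * a r)) (at y within UNIV)"
      by (simp add: mult_ac)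
    show "norm (exp (\<i> * of_real y * of_real r) * (\<i> * of_real r * a r)) \<le> cmod (\<i> * of_real r * a r)"
      unfolding norm_mult[of "exp _"] exp_i_norm by simp
  qed (use a ra exp_mult_integrable in auto)
  from has_vector_derivative_mult_right[OF this, of "complex_of_real (1 / sqrt (2 * pi))"]
  show ?thesis unfolding invF_def[abs_def] by simp
qed

lemma has_integral_inverse_quadratic:
  "integrable lborel (\<lambda>x. inverse (1 + x\<^sup>2) :: real)" "(LINT x|lborel. inverse (1 + x\<^sup>2)) = pi"
  using integrable_inverse_1_plus_square LBINT_inverse_1_plus_square
  by (simp_all add: set_integrable_def interval_lebesgue_integral_def set_lebesgue_integral_def)

lemma integrable_if_decay:
  fixes f :: "real \<Rightarrow> complex"
  assumes m: "f \<in> borel_measurable borel" and b: "\<And>x. cmod (f x) \<le> C * (1 + \<bar>x\<bar>) powr (- 2)"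
  shows "integrable lborel f"
proof (rule Bochner_Integration.integrable_bound[OF integrable_mult_right[OF has_integral_inverse_quadratic(1), of "\<bar>C\<bar>"]])
  show "AE x in lborel. norm (f x) \<le> norm (\<bar>C\<bar> * inverse (1 + x\<^sup>2))"
  proof (rule AE_I2)
    fix x :: real
    have "(1 + \<bar>x\<bar>) powr (- 2) = inverse ((1 + \<bar>x\<bar>)\<^sup>2)" by (simp add: powr_minus)
    also have "\<dots> \<le> inverse (1 + x\<^sup>2)"
      by (intro le_imp_inverse_le) (auto simp: power2_sum add_pos_nonneg)
    finally have "C * (1 + \<bar>x\<bar>) powr (- 2) \<le> \<bar>C\<bar> * inverse (1 + x\<^sup>2)" by (intro mult_mono) auto
    then show "norm (f x) \<le> norm (\<bar>C\<bar> * inverse (1 + x\<^sup>2))" using b[of x] by (simp add: abs_mult)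
  qed
qed (use m in simp)

section \<open>Rapidly decaying functions\<close>

text \<open>Decay without smoothness: the transforms of interest are cut off to nonnegative
  frequencies and may jump at 0. Decay on the Fourier side is what differentiability and Sobolev
  norms of u require.\<close>

definition rapid :: "(real \<Rightarrow> complex) \<Rightarrow> bool" where
  "rapid a \<longleftrightarrow> a \<in> borel_measurable borel \<and> (\<forall>k. \<exists>C. \<forall>x. (1 + \<bar>x\<bar>) ^ k * cmod (a x) \<le> C)"

lemma rapid_measurable [measurable_dest]: "rapid a \<Longrightarrow> a \<in> borel_measurable borel"
  by (simp add: rapid_def)

lemma rapidE:
  assumes "rapid a" obtains C where "\<And>x. (1 + \<bar>x\<bar>) ^ k * cmod (a x) \<le> C"
  using assms unfolding rapid_def by blast

lemma rapid_integrable: assumes "rapid a" shows "integrable lborel a"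
proof -
  obtain C where C: "\<And>x. (1 + \<bar>x\<bar>) ^ 2 * cmod (a x) \<le> C" using rapidE[OF assms] by blast
  show ?thesis
  proof (rule integrable_if_decay)
    show "cmod (a x) \<le> C * (1 + \<bar>x\<bar>) powr (- 2)" for x
      using C[of x] by (simp add: powr_minus powr_numeral field_simps)
  qed (use assms in measurable)
qed

lemma rapid_nice: assumes "rapid a" shows "nice a"
proof -
  obtain C where "\<And>x. (1 + \<bar>x\<bar>) ^ 0 * cmod (a x) \<le> C" using rapidE[OF assms] by blast
  then show ?thesis using rapid_integrable[OF assms] unfolding nice_def by auto
qed

lemma rapid_mult:
  assumes a: "rapid a" and [measurable]: "f \<in> borel_measurable borel" and f: "\<And>x. cmod (f x) \<le> B * (1 + \<bar>x\<bar>) ^ m"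
  shows "rapid (\<lambda>x. f x * a x)"
  unfolding rapid_def
proof (intro conjI allI)
  show "(\<lambda>x. f x * a x) \<in> borel_measurable borel" using a by measurable
  fix k
  obtain C where C: "\<And>x. (1 + \<bar>x\<bar>) ^ (k + m) * cmod (a x) \<le> C" using rapidE[OF a] by blast
  have B: "B \<ge> 0" using f[of 0] by (auto intro: order_trans[OF norm_ge_zero])
  have "(1 + \<bar>x\<bar>) ^ k * cmod (f x * a x) \<le> B * C" for x
  proof -
    have "(1 + \<bar>x\<bar>) ^ k * cmod (f x * a x) = (1 + \<bar>x\<bar>) ^ k * cmod (a x) * cmod (f x)" by (simp add: norm_mult)
    also have "\<dots> \<le> (1 + \<bar>x\<bar>) ^ k * cmod (a x) * (B * (1 + \<bar>x\<bar>) ^ m)" by (intro mult_left_mono f) auto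
    also have "\<dots> = B * ((1 + \<bar>x\<bar>) ^ (k + m) * cmod (a x))" by (simp add: power_add)
    also have "\<dots> \<le> B * C" by (intro mult_left_mono C B)
    finally show ?thesis .
  qed
  then show "\<exists>C. \<forall>x. (1 + \<bar>x\<bar>) ^ k * cmod (f x * a x) \<le> C" by blast
qed

lemma rapid_ir: "rapid a \<Longrightarrow> rapid (\<lambda>r. \<i> * of_real r * a r)"
  by (rule rapid_mult[where B = 1 and m = 1]) (auto simp: norm_mult)

lemma rapid_scale: "rapid a \<Longrightarrow> rapid (\<lambda>r. c * a r)"
  by (rule rapid_mult[where B = "cmod c" and m = 0]) auto

lemma rapid_cutoff: "rapid a \<Longrightarrow> rapid (\<lambda>r. indicator {0..} r * a r)"
  by (rule rapid_mult[where B = 1 and m = 0]) (auto simp: indicator_def)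

lemma rapid_diff:
  assumes a: "rapid a" and b: "rapid b" shows "rapid (\<lambda>r. a r - b r)"
  unfolding rapid_def
proof (intro conjI allI)
  show "(\<lambda>x. a x - b x) \<in> borel_measurable borel" using a b by measurable
  fix k
  obtain A B where A: "\<And>x. (1 + \<bar>x\<bar>) ^ k * cmod (a x) \<le> A" and B: "\<And>x. (1 + \<bar>x\<bar>) ^ k * cmod (b x) \<le> B"
    using rapidE[OF a] rapidE[OF b] by metis
  have "(1 + \<bar>x\<bar>) ^ k * cmod (a x - b x) \<le> A + B" for x
    using mult_left_mono[OF norm_triangle_ineq4[of "a x" "b x"], of "(1 + \<bar>x\<bar>) ^ k"] A[of x] B[of x]
    by (simp add: distrib_left)
  then show "\<exists>C. \<forall>x. (1 + \<bar>x\<bar>) ^ k * cmod (a x - b x) \<le> C" by blast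
qed

lemma rapid_reflect_cnj: assumes a: "rapid a" shows "rapid (\<lambda>r. cnj (a (- r)))"
  unfolding rapid_def
proof (intro conjI allI)
  have [measurable]: "a \<in> borel_measurable borel" using a by measurable
  show "(\<lambda>x. cnj (a (- x))) \<in> borel_measurable borel" by measurable
  fix k
  obtain A where A: "\<And>x. (1 + \<bar>x\<bar>) ^ k * cmod (a x) \<le> A" using rapidE[OF a] by metis
  show "\<exists>C. \<forall>x. (1 + \<bar>x\<bar>) ^ k * cmod (cnj (a (- x))) \<le> C" using A[of "- _"] by auto
qed

text \<open>The weight is distributed over the factors by
  \<open>1 + |r| <= (1 + |r + y|) * (1 + |y|)\<close>.\<close>

lemma rapid_corr:
  assumes a: "rapid a" and b: "rapid b" shows "rapid (corr a b)"
  unfolding rapid_def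
proof (intro conjI allI)
  note i = rapid_integrable[OF a] rapid_integrable[OF b]
  show "corr a b \<in> borel_measurable borel" using corr_integrable[OF i] by measurable
  fix k
  obtain A where A: "\<And>x. (1 + \<bar>x\<bar>) ^ k * cmod (a x) \<le> A" using rapidE[OF a] by metis
  define w where "w y = complex_of_real ((1 + \<bar>y\<bar>) ^ k) * b y" for y
  have "rapid w" unfolding w_def by (rule rapid_mult[OF b, where B = 1 and m = k]) (auto simp del: of_real_power)
  then have wi: "integrable lborel w" by (rule rapid_integrable)
  have [measurable]: "a \<in> borel_measurable borel" "b \<in> borel_measurable borel" using i by auto
  have "(1 + \<bar>r\<bar>) ^ k * cmod (corr a b r) \<le> (LINT y|lborel. A * cmod (w y))" for r
  proof -
    let ?f = "\<lambda>y. complex_of_real ((1 + \<bar>r\<bar>) ^ k) * (a (r + y) * cnj (b y))"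
    have "(1 + \<bar>r\<bar>) ^ k * cmod (corr a b r) = cmod (LINT y|lborel. ?f y)"
      unfolding corr_def integral_mult_right_zero norm_mult norm_of_real by simp
    also have "\<dots> \<le> (LINT y|lborel. A * cmod (w y))"
    proof (rule Bochner_Integration.integral_norm_bound_integral)
      show bd: "cmod (?f y) \<le> A * cmod (w y)" for y
      proof -
        have "\<bar>r\<bar> \<le> \<bar>r + y\<bar> + \<bar>y\<bar>" by linarith
        moreover have "(1 + \<bar>r + y\<bar>) * (1 + \<bar>y\<bar>) = 1 + \<bar>r + y\<bar> + \<bar>y\<bar> + \<bar>r + y\<bar> * \<bar>y\<bar>" by (simp add: algebra_simps)
        ultimately have "1 + \<bar>r\<bar> \<le> (1 + \<bar>r + y\<bar>) * (1 + \<bar>y\<bar>)" using mult_nonneg_nonneg[OF abs_ge_zero[of "r + y"] abs_ge_zero[of y]] by linarith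
        then have p: "(1 + \<bar>r\<bar>) ^ k \<le> (1 + \<bar>r + y\<bar>) ^ k * (1 + \<bar>y\<bar>) ^ k" unfolding power_mult_distrib[symmetric] by (intro power_mono) auto
        have "cmod (?f y) = (1 + \<bar>r\<bar>) ^ k * (cmod (a (r + y)) * cmod (b y))" by (simp add: norm_mult del: of_real_power)
        also have "\<dots> \<le> (1 + \<bar>r + y\<bar>) ^ k * (1 + \<bar>y\<bar>) ^ k * (cmod (a (r + y)) * cmod (b y))" by (intro mult_right_mono p) auto
        also have "\<dots> = ((1 + \<bar>r + y\<bar>) ^ k * cmod (a (r + y))) * cmod (w y)" by (simp add: w_def norm_mult del: of_real_power)
        also have "\<dots> \<le> A * cmod (w y)" by (intro mult_right_mono A) auto
        finally show ?thesis .
      qed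
      show "integrable lborel (\<lambda>y. A * cmod (w y))" using wi by simp
      then show "integrable lborel ?f"
        by (rule Bochner_Integration.integrable_bound) (use bd order_trans[OF bd abs_ge_self] in \<open>auto simp: real_norm_def\<close>)
    qed
    finally show ?thesis .
  qed
  then show "\<exists>C. \<forall>x. (1 + \<bar>x\<bar>) ^ k * cmod (corr a b x) \<le> C" by blast
qed

lemma rapid_derivative: "rapid a \<Longrightarrow> (invF a has_vector_derivative invF (\<lambda>r. \<i> * of_real r * a r) x) (at x)"
  by (intro invF_has_vector_derivative rapid_integrable rapid_ir)

lemma powr_weight_le:
  fixes x s :: real
  shows "(1 + x\<^sup>2) powr s \<le> (1 + \<bar>x\<bar>) ^ (2 * nat \<lceil>s\<rceil>)"
proof -
  have "s \<le> real (nat \<lceil>s\<rceil>)" by linarith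
  then have "(1 + x\<^sup>2) powr s \<le> (1 + x\<^sup>2) powr real (nat \<lceil>s\<rceil>)" by (rule powr_mono) simp
  also have "\<dots> = (1 + x\<^sup>2) ^ nat \<lceil>s\<rceil>" by (rule powr_realpow) (simp add: add_pos_nonneg)
  also have "\<dots> \<le> ((1 + \<bar>x\<bar>)\<^sup>2) ^ nat \<lceil>s\<rceil>"
    by (intro power_mono) (auto simp: power2_sum)
  finally show ?thesis by (simp add: power_mult)
qed

lemma rapid_weight_integrable:
  assumes a: "rapid a" shows "integrable lborel (\<lambda>x. (1 + x\<^sup>2) powr s * (cmod (a x))\<^sup>2)"
proof -
  obtain C where C: "\<And>x. (1 + \<bar>x\<bar>) ^ 0 * cmod (a x) \<le> C" using rapidE[OF a] by metis
  have [measurable]: "a \<in> borel_measurable borel" using a by measurable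
  have "rapid (\<lambda>x. (complex_of_real ((1 + x\<^sup>2) powr s) * a x) * a x)"
  proof (rule rapid_mult[OF a, where B = C and m = "2 * nat \<lceil>s\<rceil>"])
    show "cmod (complex_of_real ((1 + x\<^sup>2) powr s) * a x) \<le> C * (1 + \<bar>x\<bar>) ^ (2 * nat \<lceil>s\<rceil>)" for x
      using mult_mono[OF C[of x] powr_weight_le[of x s]] order_trans[OF norm_ge_zero, of "a x" C] C[of x]
      by (simp add: norm_mult mult.commute)
  qed measurable
  from integrable_norm[OF rapid_integrable[OF this]]
  show ?thesis by (simp add: norm_mult power2_eq_square mult.assoc)
qed

lemma fourier_measurable: assumes "nice a" shows "fourier (invF a) \<in> borel_measurable borel"
proof -
  have "is_fourier (invF a) (fourier (invF a))"
    unfolding fourier_def by (rule someI[of "is_fourier (invF a)", OF is_fourier_invF[OF assms]])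
  then show ?thesis by (simp add: is_fourier_def square_integrable_def)
qed

lemma rapid_in_Hs:
  assumes a: "rapid a"
  shows "in_Hs s (invF a)" "Hs_norm s (invF a) = sqrt (LINT x|lborel. (1 + x\<^sup>2) powr s * (cmod (a x))\<^sup>2)"
proof -
  have [measurable]: "a \<in> borel_measurable borel" "fourier (invF a) \<in> borel_measurable borel"
    using rapid_measurable[OF a] fourier_measurable[OF rapid_nice[OF a]] by auto
  have ae: "AE x in lborel. (1 + x\<^sup>2) powr s * (cmod (fourier (invF a) x))\<^sup>2 = (1 + x\<^sup>2) powr s * (cmod (a x))\<^sup>2"
    using fourier_invF[OF rapid_nice[OF a]] by eventually_elim simp
  have "integrable lborel (\<lambda>x. (1 + x\<^sup>2) powr s * (cmod (fourier (invF a) x))\<^sup>2)"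
    by (subst integrable_cong_AE[OF _ _ ae]) (use rapid_weight_integrable[OF a] in auto)
  then show "in_Hs s (invF a)" using invF_square_integrable[OF rapid_nice[OF a]] by (simp add: in_Hs_def)
  show "Hs_norm s (invF a) = sqrt (LINT x|lborel. (1 + x\<^sup>2) powr s * (cmod (a x))\<^sup>2)"
    unfolding Hs_norm_def by (subst integral_cong_AE[OF _ _ ae]) auto
qed

lemma rapid_in_Hs_plus:
  assumes a: "rapid a" and neg: "\<And>r. r < 0 \<Longrightarrow> a r = 0"
  shows "in_Hs_plus s (invF a)"
  unfolding in_Hs_plus_def
proof
  show "AE x in lborel. x < 0 \<longrightarrow> fourier (invF a) x = 0"
    using fourier_invF[OF rapid_nice[OF a]] by eventually_elim (simp add: neg)
qed (rule rapid_in_Hs[OF a])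

lemma Pi_plus_invF:
  assumes a: "rapid a" shows "Pi_plus (invF a) x = invF (\<lambda>r. indicator {0..} r * a r) x"
proof -
  have [measurable]: "a \<in> borel_measurable borel" "fourier (invF a) \<in> borel_measurable borel"
    using rapid_measurable[OF a] fourier_measurable[OF rapid_nice[OF a]] by auto
  have "(LINT r|lborel. indicator {0..} r *\<^sub>R (exp (\<i> * complex_of_real x * complex_of_real r) * fourier (invF a) r))
    = (LINT r|lborel. exp (\<i> * complex_of_real x * complex_of_real r) * (indicator {0..} r * a r))"
  proof (rule integral_cong_AE)
    show "AE r in lborel. indicator {0..} r *\<^sub>R (exp (\<i> * complex_of_real x * complex_of_real r) * fourier (invF a) r)
        = exp (\<i> * complex_of_real x * complex_of_real r) * (indicator {0..} r * a r)"
      using fourier_invF[OF rapid_nice[OF a]] by eventually_elim (simp add: indicator_def)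
  qed auto
  then show ?thesis unfolding Pi_plus_def invF_def set_lebesgue_integral_def by simp
qed

lemma conv_eq_corr: "(LINT y|lborel. a (r - y) * b y) = corr a (\<lambda>y. cnj (b (- y))) r"
  using lborel_integral_real_affine[of "- 1" "\<lambda>y. a (r - y) * b y" 0] unfolding corr_def by simp

lemma invF_mult:
  assumes a: "rapid a" and b: "rapid b"
  shows "invF a x * invF b x = complex_of_real (1 / sqrt (2 * pi)) * invF (\<lambda>r. LINT y|lborel. a (r - y) * b y) x"
proof -
  let ?b = "\<lambda>y. cnj (b (- y))"
  have "cnj (invF ?b x) = invF b x"
  proof -
    have "cnj (LINT r|lborel. exp (\<i> * of_real x * of_real r) * ?b r) = (LINT r|lborel. cnj (exp (\<i> * of_real x * of_real r) * ?b r))"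
      by (rule Bochner_Integration.integral_cnj[symmetric])
    also have "\<dots> = (LINT r|lborel. (\<lambda>r. exp (\<i> * of_real x * of_real r) * b r) (0 + (- 1) * r))" by (simp add: exp_cnj)
    also have "\<dots> = (LINT r|lborel. exp (\<i> * of_real x * of_real r) * b r)"
      using lborel_integral_real_affine[of "- 1" "\<lambda>r. exp (\<i> * of_real x * of_real r) * b r" 0] by simp
    finally show ?thesis unfolding invF_def by simp
  qed
  then show ?thesis
    using invF_mult_cnj[OF rapid_integrable[OF a] rapid_integrable[OF rapid_reflect_cnj[OF b]], of x]
    unfolding conv_eq_corr by simp
qed

lemma rapid_conv: "rapid a \<Longrightarrow> rapid b \<Longrightarrow> rapid (\<lambda>r. LINT y|lborel. a (r - y) * b y)"
  unfolding conv_eq_corr by (intro rapid_corr rapid_reflect_cnj)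

lemma integrable_quadratic_decay: "integrable lborel (\<lambda>r. C * (1 + \<bar>r\<bar>) powr (- 2) :: real)"
proof -
  have "integrable lborel (\<lambda>r. complex_of_real (C * (1 + \<bar>r\<bar>) powr (- 2)))"
  proof (rule integrable_if_decay)
    show "cmod (complex_of_real (C * (1 + \<bar>r\<bar>) powr (- 2))) \<le> \<bar>C\<bar> * (1 + \<bar>r\<bar>) powr (- 2)" for r
      unfolding norm_of_real by (simp add: abs_mult)
  qed measurable
  from integrable_Re[OF this] show ?thesis by (simp only: Re_complex_of_real)
qed

context ccm
begin

section \<open>The solution\<close>

text \<open>Chosen so that the inverse transform at time 0 is
  \<open>sqrt (2 * \<kappa>) / (1 - \<i> * x)\<close>, of mass \<open>2 * pi * \<kappa>\<close>. It
  also makes the convolution coefficient in the time derivative agree with the equation, see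
  \<open>uh'_eq\<close>.\<close>

definition amp :: real where "amp = sqrt (4 * pi * \<kappa>)"

definition uh :: "real \<Rightarrow> real \<Rightarrow> complex" where "uh t r = (if 0 \<le> r then of_real amp * gam t r else 0)"

definition uu :: "real \<Rightarrow> real \<Rightarrow> complex" where "uu t = invF (uh t)"

lemma amp_pos: "amp > 0" and amp_square: "amp\<^sup>2 = 4 * pi * \<kappa>"
  using kappa_pos by (auto simp: amp_def)

lemma halfline_measurable:
  fixes f :: "real \<Rightarrow> complex"
  assumes "continuous_on {0..} f" shows "(\<lambda>r. if 0 \<le> r then f r else 0) \<in> borel_measurable borel"
proof -
  have "(\<lambda>r. indicator {0..} r *\<^sub>R f r) \<in> borel_measurable borel"
    by (rule borel_measurable_continuous_on_indicator[OF _ assms]) simp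
  moreover have "(\<lambda>r. indicator {0..} r *\<^sub>R f r) = (\<lambda>r. if 0 \<le> r then f r else 0)" by (auto simp: indicator_def)
  ultimately show ?thesis by simp
qed

lemma uh_measurable [measurable]: "uh t \<in> borel_measurable borel"
  unfolding uh_def[abs_def] by (intro halfline_measurable continuous_intros gam_continuous)

lemma gam_power_decay:
  assumes K: "K \<ge> 0"
  obtains C where "C \<ge> 0" "\<And>t r. good R K t \<Longrightarrow> r \<ge> 0 \<Longrightarrow> (1 + r) ^ k * cmod (gam t r) \<le> C"
proof -
  obtain C where C: "C \<ge> 0" "\<And>t r. good R K t \<Longrightarrow> r \<ge> 0 \<Longrightarrow> cmod (gam t r) \<le> C * (1 + r) powr (- real k)"
    using gam_decay[OF K, of R "real k"] by metis
  have "(1 + r) ^ k * cmod (gam t r) \<le> C" if "good R K t" "r \<ge> 0" for t r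
    using C(2)[OF that] that(2) by (simp add: powr_minus powr_realpow field_simps)
  then show thesis using that C(1) by blast
qed

lemma mt_power_decay:
  assumes K: "K \<ge> 0"
  obtains C where "C \<ge> 0" "\<And>t r. good R K t \<Longrightarrow> r \<ge> 0 \<Longrightarrow> (1 + r) ^ k * cmod (mt t r) \<le> C"
proof -
  obtain G where G: "G \<ge> 0" "\<And>t r. 4 * \<kappa> * N t K \<le> 1 / 2 \<Longrightarrow> r \<ge> 0 \<Longrightarrow> integral {0..r} (\<lambda>y. cmod (gam t y)) \<le> G"
    using regularity_bound[OF K] by metis
  obtain C where C: "C \<ge> 0" "\<And>t r. good R K t \<Longrightarrow> r \<ge> 0 \<Longrightarrow> (1 + r) ^ k * cmod (gam t r) \<le> C"
    using gam_power_decay[OF K] by metis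
  have "(1 + r) ^ k * cmod (mt t r) \<le> C * G" if g: "good R K t" and r: "r \<ge> 0" for t r
  proof -
    have "cmod (mj t 0 r) \<le> (C / (1 + r) ^ k) * G"
    proof (rule mj_tail_bound[OF _ r])
      show "stable t" "\<And>a. a \<ge> 0 \<Longrightarrow> integral {0..a} (\<lambda>y. cmod (gam t y)) \<le> G" using g G(2) by (auto simp: good_def)
      fix y assume y: "y \<ge> r"
      have "(1 + r) ^ k * cmod (gam t y) \<le> (1 + y) ^ k * cmod (gam t y)" using r y by (intro mult_right_mono power_mono) auto
      also have "\<dots> \<le> C" using C(2)[OF g] r y by simp
      finally show "cmod (eta t 0 y) \<le> C / (1 + r) ^ k" using r by (simp add: eta_zero field_simps)
    qed
    then show ?thesis using r by (simp add: mj_def mt_def field_simps)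
  qed
  then show thesis using that C(1) G(1) by (metis mult_nonneg_nonneg)
qed

definition Jt :: "real \<Rightarrow> real \<Rightarrow> complex" where
  "Jt t r = integral {0..r} (\<lambda>y. of_real y * mt t y * gam t (r - y))"

definition uh' :: "real \<Rightarrow> real \<Rightarrow> complex" where
  "uh' t r = (if 0 \<le> r then of_real amp * (- \<i> * of_real (r\<^sup>2) * gam t r + 4 * \<i> * of_real \<kappa> * Jt t r) else 0)"

lemma uh_t_derivative: "((\<lambda>t. uh t r) has_vector_derivative uh' t r) (at t)"
proof (cases "r \<ge> 0")
  case True
  then show ?thesis unfolding uh_def uh'_def Jt_def using has_vector_derivative_mult_right[OF gam_t_derivative[OF True]] by simp
qed (simp add: uh_def uh'_def)

text \<open>The constants are uniform for times near t because a whole neighbourhood is good for one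
  K. Quadratic decay of the time derivative is what dominated differentiation of the inverse
  transform needs.\<close>

lemma uh_decay:
  assumes t: "stable t"
  obtains d where "d > 0" "\<And>t'. \<bar>t' - t\<bar> < d \<Longrightarrow> stable t'"
    "\<And>k. \<exists>C. \<forall>t' x. \<bar>t' - t\<bar> < d \<longrightarrow> (1 + \<bar>x\<bar>) ^ k * cmod (uh t' x) \<le> C"
    "\<exists>C. \<forall>t' x. \<bar>t' - t\<bar> < d \<longrightarrow> (1 + \<bar>x\<bar>) ^ 2 * cmod (uh' t' x) \<le> C"
proof -
  obtain K d where Kd: "K \<ge> 0" "d > 0" "\<And>t'. \<bar>t' - t\<bar> < d \<Longrightarrow> good (\<bar>t\<bar> + 1) K t'" using good_nhd[OF t] by metis
  show thesis
  proof (rule that[OF Kd(2)])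
    show "stable t'" if "\<bar>t' - t\<bar> < d" for t' using Kd(3)[OF that] by (simp add: good_def)
    show "\<exists>C. \<forall>t' x. \<bar>t' - t\<bar> < d \<longrightarrow> (1 + \<bar>x\<bar>) ^ k * cmod (uh t' x) \<le> C" for k
    proof -
      obtain C where C: "C \<ge> 0" "\<And>t' r. good (\<bar>t\<bar> + 1) K t' \<Longrightarrow> r \<ge> 0 \<Longrightarrow> (1 + r) ^ k * cmod (gam t' r) \<le> C"
        using gam_power_decay[OF Kd(1)] by metis
      have "(1 + \<bar>x\<bar>) ^ k * cmod (uh t' x) \<le> amp * C" if "\<bar>t' - t\<bar> < d" for t' x
        using mult_left_mono[OF C(2)[OF Kd(3)[OF that], of x], of amp] amp_pos C(1)
        by (auto simp: uh_def norm_mult mult_ac)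
      then show ?thesis by blast
    qed
    obtain C3 where C3: "C3 \<ge> 0" "\<And>t' r. good (\<bar>t\<bar> + 1) K t' \<Longrightarrow> r \<ge> 0 \<Longrightarrow> (1 + r) ^ 3 * cmod (gam t' r) \<le> C3"
      using gam_power_decay[OF Kd(1)] by metis
    obtain C4 where C4: "C4 \<ge> 0" "\<And>t' r. good (\<bar>t\<bar> + 1) K t' \<Longrightarrow> r \<ge> 0 \<Longrightarrow> (1 + r) ^ 4 * cmod (gam t' r) \<le> C4"
      using gam_power_decay[OF Kd(1)] by metis
    obtain M where M: "M \<ge> 0" "\<And>t' r. good (\<bar>t\<bar> + 1) K t' \<Longrightarrow> r \<ge> 0 \<Longrightarrow> (1 + r) ^ 4 * cmod (mt t' r) \<le> M"
      using mt_power_decay[OF Kd(1)] by metis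
    have "(1 + \<bar>x\<bar>) ^ 2 * cmod (uh' t' x) \<le> amp * (C4 + 4 * \<kappa> * (M * C3))" if t': "\<bar>t' - t\<bar> < d" for t' x
    proof (cases "x \<ge> 0")
      case True
      note g = Kd(3)[OF t']
      have J: "(1 + x) ^ 2 * cmod (Jt t' x) \<le> M * C3"
      proof -
        have bd: "cmod (of_real y * mt t' y * gam t' (x - y)) \<le> M * C3 / (1 + x) ^ 3" if y: "y \<in> {0..x}" for y
        proof -
          \<comment> \<open>Distributes three powers of the weight over the factors of the
            convolution; the factor y takes a fourth power from \<open>mt\<close>, and integrating
            over {0..x} gives one power back, so two remain.\<close>
          have "1 + x \<le> (1 + y) * (1 + (x - y))" using mult_nonneg_nonneg[of y "x - y"] y by (simp add: algebra_simps)
          then have "(1 + x) ^ 3 \<le> ((1 + y) * (1 + (x - y))) ^ 3" using True by (intro power_mono) auto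
          then have "(1 + x) ^ 3 * cmod (of_real y * mt t' y * gam t' (x - y)) \<le> ((1 + y) * (1 + (x - y))) ^ 3 * (y * cmod (mt t' y) * cmod (gam t' (x - y)))"
            using y by (auto simp: norm_mult intro!: mult_mono)
          also have "\<dots> = ((1 + y) ^ 3 * y * cmod (mt t' y)) * ((1 + (x - y)) ^ 3 * cmod (gam t' (x - y)))"
            by (simp only: power_mult_distrib mult_ac)
          also have "\<dots> \<le> M * C3"
          proof (rule mult_mono)
            have "(1 + y) ^ 3 * y * cmod (mt t' y) \<le> (1 + y) ^ 3 * (1 + y) * cmod (mt t' y)" using y by (intro mult_right_mono mult_left_mono) auto
            also have "\<dots> = (1 + y) ^ 4 * cmod (mt t' y)" by (simp add: eval_nat_numeral mult_ac)
            also have "\<dots> \<le> M" using M(2)[OF g] y by simp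
            finally show "(1 + y) ^ 3 * y * cmod (mt t' y) \<le> M" .
            show "(1 + (x - y)) ^ 3 * cmod (gam t' (x - y)) \<le> C3" using C3(2)[OF g] y by simp
          qed (use y M(1) in auto)
          finally show ?thesis using True by (simp add: field_simps)
        qed
        have "cmod (Jt t' x) \<le> M * C3 / (1 + x) ^ 3 * (x - 0)"
          unfolding Jt_def
        proof (rule integral_bound[OF True])
          show "continuous_on {0..x} (\<lambda>y. of_real y * mt t' y * gam t' (x - y))"
            by (intro continuous_intros continuous_on_subset[OF mt_continuous] gam_reflect_continuous) auto
        qed (rule bd)
        also have "\<dots> \<le> M * C3 / (1 + x) ^ 3 * (1 + x)" using True M(1) C3(1) by (intro mult_left_mono) auto
        also have "\<dots> = M * C3 / (1 + x) ^ 2" using True by (simp add: power2_eq_square power3_eq_cube)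
        finally show ?thesis using True by (simp add: field_simps)
      qed
      have "cmod (- \<i> * of_real (x\<^sup>2) * gam t' x + 4 * \<i> * of_real \<kappa> * Jt t' x) \<le> x\<^sup>2 * cmod (gam t' x) + 4 * \<kappa> * cmod (Jt t' x)"
        using norm_triangle_ineq[of "- \<i> * of_real (x\<^sup>2) * gam t' x" "4 * \<i> * of_real \<kappa> * Jt t' x"] kappa_pos
        by (simp add: norm_mult norm_power)
      then have "(1 + x) ^ 2 * cmod (- \<i> * of_real (x\<^sup>2) * gam t' x + 4 * \<i> * of_real \<kappa> * Jt t' x)
          \<le> (1 + x) ^ 2 * (x\<^sup>2 * cmod (gam t' x) + 4 * \<kappa> * cmod (Jt t' x))" by (intro mult_left_mono) auto
      also have "\<dots> = (1 + x) ^ 2 * x\<^sup>2 * cmod (gam t' x) + 4 * \<kappa> * ((1 + x) ^ 2 * cmod (Jt t' x))" by (simp add: algebra_simps)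
      also have "\<dots> \<le> C4 + 4 * \<kappa> * (M * C3)"
      proof (rule add_mono)
        have "(1 + x) ^ 2 * x\<^sup>2 * cmod (gam t' x) \<le> (1 + x) ^ 2 * (1 + x)\<^sup>2 * cmod (gam t' x)"
          using True by (intro mult_right_mono mult_left_mono power_mono) auto
        also have "\<dots> = (1 + x) ^ 4 * cmod (gam t' x)" by (simp flip: power_add)
        also have "\<dots> \<le> C4" by (rule C4(2)[OF g True])
        finally show "(1 + x) ^ 2 * x\<^sup>2 * cmod (gam t' x) \<le> C4" .
        show "4 * \<kappa> * ((1 + x) ^ 2 * cmod (Jt t' x)) \<le> 4 * \<kappa> * (M * C3)" using J kappa_pos by (intro mult_left_mono) auto
      qed
      finally have "amp * ((1 + x) ^ 2 * cmod (- \<i> * of_real (x\<^sup>2) * gam t' x + 4 * \<i> * of_real \<kappa> * Jt t' x)) \<le> amp * (C4 + 4 * \<kappa> * (M * C3))"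
        using amp_pos by (intro mult_left_mono) auto
      moreover have "cmod (uh' t' x) = amp * cmod (- \<i> * of_real (x\<^sup>2) * gam t' x + 4 * \<i> * of_real \<kappa> * Jt t' x)"
        unfolding uh'_def if_P[OF True] norm_mult[of "of_real amp"] norm_of_real using amp_pos by simp
      ultimately show ?thesis using True by (simp only: abs_of_nonneg mult_ac)
    next
      case False
      then show ?thesis using amp_pos kappa_pos C3(1) C4(1) M(1) by (simp add: uh'_def)
    qed
    then show "\<exists>C. \<forall>t' x. \<bar>t' - t\<bar> < d \<longrightarrow> (1 + \<bar>x\<bar>) ^ 2 * cmod (uh' t' x) \<le> C" by blast
  qed
qed

lemma rapid_uh: assumes t: "stable t" shows "rapid (uh t)"
proof -
  obtain d where "d > 0" "\<And>k. \<exists>C. \<forall>t' x. \<bar>t' - t\<bar> < d \<longrightarrow> (1 + \<bar>x\<bar>) ^ k * cmod (uh t' x) \<le> C"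
    using uh_decay[OF t] by metis
  then show ?thesis unfolding rapid_def by (metis uh_measurable diff_self abs_zero)
qed

lemma uu_t_derivative: assumes t: "stable t" shows "((\<lambda>t. uu t x) has_vector_derivative invF (uh' t) x) (at t)"
proof -
  obtain d where d: "d > 0" "\<And>t'. \<bar>t' - t\<bar> < d \<Longrightarrow> stable t'"
    "\<exists>C. \<forall>t' x. \<bar>t' - t\<bar> < d \<longrightarrow> (1 + \<bar>x\<bar>) ^ 2 * cmod (uh' t' x) \<le> C"
    using uh_decay[OF t] by metis
  obtain C where C: "\<And>t' x. \<bar>t' - t\<bar> < d \<Longrightarrow> (1 + \<bar>x\<bar>) ^ 2 * cmod (uh' t' x) \<le> C" using d(3) by blast
  define S where "S = {t - d<..<t + d}"
  have S: "\<bar>t' - t\<bar> < d" if "t' \<in> S" for t' using that by (auto simp: S_def)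
  have Cb: "cmod (uh' t' x) \<le> C * (1 + \<bar>x\<bar>) powr (- 2)" if "\<bar>t' - t\<bar> < d" for t' x
    using C[OF that, of x] by (simp add: powr_minus powr_numeral field_simps)
  \<comment> \<open>Measurability in r of the time derivative, as a limit of measurable difference
    quotients.\<close>
  have m [measurable]: "uh' t \<in> borel_measurable borel"
  proof (rule borel_measurable_LIMSEQ_metric)
    fix x
    have h: "(\<lambda>n. 1 / real (Suc n)) \<longlonglongrightarrow> 0" by (rule LIMSEQ_Suc[OF lim_const_over_n])
    have "((\<lambda>s. (uh s x - uh t x) /\<^sub>R (s - t)) \<longlongrightarrow> uh' t x) (at t)"
      using uh_t_derivative[of x t] unfolding has_vector_derivative_iff_difference_quotient .
    moreover have "filterlim (\<lambda>n. t + 1 / real (Suc n)) (at t) sequentially"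
      unfolding filterlim_at using tendsto_add[OF tendsto_const[of t] h] by auto
    ultimately show "(\<lambda>n. (uh (t + 1 / real (Suc n)) x - uh t x) /\<^sub>R (t + 1 / real (Suc n) - t)) \<longlonglongrightarrow> uh' t x"
      by (rule filterlim_compose)
  qed measurable
  let ?e = "\<lambda>r. exp (\<i> * complex_of_real x * of_real r)"
  have "((\<lambda>t. LINT r|lborel. ?e r * uh t r) has_vector_derivative (LINT r|lborel. ?e r * uh' t r)) (at t within S)"
  proof (rule has_vector_derivative_integral_dominated[where b = "\<lambda>r. C * (1 + \<bar>r\<bar>) powr (- 2)"])
    show "convex S" "t \<in> S" using d(1) by (auto simp: S_def)
    show "integrable lborel (\<lambda>r. ?e r * uh t' r)" if "t' \<in> S" for t'
      by (intro exp_mult_integrable rapid_integrable rapid_uh d(2) S that)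
    show "((\<lambda>t. ?e r * uh t r) has_vector_derivative ?e r * uh' t' r) (at t' within S)" for t' r
      by (rule has_vector_derivative_at_within[OF has_vector_derivative_mult_right[OF uh_t_derivative]])
    show "norm (?e r * uh' t' r) \<le> C * (1 + \<bar>r\<bar>) powr (- 2)" if "t' \<in> S" for t' r
      unfolding norm_mult[of "?e r"] exp_i_norm using Cb[OF S[OF that]] by simp
    show "integrable lborel (\<lambda>r. C * (1 + \<bar>r\<bar>) powr (- 2))" by (rule integrable_quadratic_decay)
  qed measurable
  then have "((\<lambda>t. LINT r|lborel. ?e r * uh t r) has_vector_derivative (LINT r|lborel. ?e r * uh' t r)) (at t)"
    using d(1) by (subst (asm) at_within_open) (auto simp: S_def)
  from has_vector_derivative_mult_right[OF this, of "complex_of_real (1 / sqrt (2 * pi))"]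
  show ?thesis unfolding uu_def invF_def by simp
qed

end

lemma invF_scale: "invF (\<lambda>r. c * a r) x = c * invF a x"
proof -
  have "(LINT r|lborel. exp (\<i> * of_real x * of_real r) * (c * a r)) = (LINT r|lborel. c * (exp (\<i> * of_real x * of_real r) * a r))"
    by (rule Bochner_Integration.integral_cong) (auto simp: mult_ac)
  then show ?thesis unfolding invF_def by simp
qed

lemma invF_diff:
  assumes "integrable lborel a" "integrable lborel b"
  shows "invF (\<lambda>r. a r - b r) x = invF a x - invF b x"
  unfolding invF_def right_diff_distrib
  by (subst Bochner_Integration.integral_diff) (auto intro!: exp_mult_integrable assms simp: right_diff_distrib)

lemma at_within_interval_neq_bot:
  fixes I :: "real set"
  assumes "is_interval I" "x \<in> I" "y \<in> I" "x \<noteq> y" "t \<in> I"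
  shows "at t within I \<noteq> bot"
proof -
  have "t islimpt I" using assms by (intro connected_imp_perfect) (auto intro: is_interval_connected)
  then show ?thesis using trivial_limit_within by blast
qed

section \<open>Verification of the equation\<close>

context ccm
begin

text \<open>Letting K tend to infinity in \<open>ell_split\<close>: stability makes the remaining
  inner product vanish, so \<open>mt\<close> is the autocorrelation of \<open>gam\<close>. Thereby
  \<open>mt\<close>, a quantity of the trajectory, becomes the Fourier transform of
  \<open>|u|^2\<close>, and the formula for the time derivative becomes an equation for u.\<close>

lemma corr_uh:
  assumes st: "stable t" and r: "r \<ge> 0"
  shows "corr (uh t) (uh t) r = of_real (amp\<^sup>2) * mt t r"
proof -
  let ?f = "\<lambda>y. of_real (amp\<^sup>2) * (gam t (r + y) * cnj (gam t y))"
  note i = rapid_integrable[OF rapid_uh[OF st]]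
  obtain B where B: "\<And>x. cmod (uh t x) \<le> B" using rapid_nice[OF rapid_uh[OF st]] unfolding nice_def by blast
  have "integrable lborel (\<lambda>y. cnj (uh t y) * uh t (y + r))"
    by (rule integrable_bounded_mult[OF integrable_shift[OF i], where B = B]) (use B in auto)
  moreover have e: "(\<lambda>y. cnj (uh t y) * uh t (y + r)) = (\<lambda>y. indicator {0..} y *\<^sub>R ?f y)"
    using r by (auto simp: uh_def fun_eq_iff indicator_def power2_eq_square add.commute)
  ultimately have fi: "integrable hl ?f" unfolding integrable_hl_iff set_integrable_def by (simp only:)
  have "corr (uh t) (uh t) r = (LINT y|lborel. cnj (uh t y) * uh t (y + r))"
    unfolding corr_def by (simp add: mult.commute add.commute)
  also have "\<dots> = integral\<^sup>L hl ?f" unfolding e integral_hl_eq set_lebesgue_integral_def ..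
  finally have c: "corr (uh t) (uh t) r = integral\<^sup>L hl ?f" .
  have l1: "((\<lambda>K. integral {0..K} ?f) \<longlongrightarrow> corr (uh t) (uh t) r) at_top"
    unfolding c by (rule integral_hl_tendsto[OF fi])
  have ip0: "((\<lambda>K. ip (gg t (r + K)) (gg t K)) \<longlongrightarrow> 0) at_top"
  proof (rule Lim_null_comparison)
    show "\<forall>\<^sub>F K in at_top. norm (ip (gg t (r + K)) (gg t K)) \<le> sqrt (1 / 2) * sqrt (N t K)"
      using eventually_ge_at_top[of 0]
    proof eventually_elim
      case (elim K)
      have "norm (ip (gg t (r + K)) (gg t K)) \<le> sqrt (nsq (gg t (r + K))) * sqrt (nsq (gg t K))"
        by (intro ip_le gg_exp_decay) (use elim r in auto)
      also have "\<dots> \<le> sqrt (1 / 2) * sqrt (N t K)"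
        unfolding N_def[symmetric] using elim r by (intro mult_right_mono real_sqrt_le_mono N_le_half) auto
      finally show ?case .
    qed
    have "((\<lambda>K. sqrt (1 / 2) * sqrt (N t K)) \<longlongrightarrow> sqrt (1 / 2) * sqrt 0) at_top"
      using st unfolding stable_def by (intro tendsto_intros)
    then show "((\<lambda>K. sqrt (1 / 2) * sqrt (N t K)) \<longlongrightarrow> 0) at_top" by simp
  qed
  have "((\<lambda>K. of_real (amp\<^sup>2) * (mt t r - ip (gg t (r + K)) (gg t K))) \<longlongrightarrow> of_real (amp\<^sup>2) * (mt t r - 0)) at_top"
    by (intro tendsto_intros ip0)
  moreover have "\<forall>\<^sub>F K in at_top. of_real (amp\<^sup>2) * (mt t r - ip (gg t (r + K)) (gg t K)) = integral {0..K} ?f"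
    using eventually_ge_at_top[of 0]
  proof eventually_elim
    case (elim K)
    have "mt t r - ip (gg t (r + K)) (gg t K) = integral {0..K} (\<lambda>y. gam t (r + y) * cnj (gam t y))"
      unfolding mt_def ell_split[OF gg_sol r elim] by (simp add: gam_def)
    then show ?case by (simp only: integral_mult_right)
  qed
  ultimately have "((\<lambda>K. integral {0..K} ?f) \<longlongrightarrow> of_real (amp\<^sup>2) * (mt t r - 0)) at_top"
    by (rule Lim_transform_eventually)
  from tendsto_unique[OF _ l1 this] show ?thesis by simp
qed

definition Ph :: "real \<Rightarrow> real \<Rightarrow> complex" where
  "Ph t r = of_real (1 / sqrt (2 * pi)) * corr (uh t) (uh t) r"

lemma rapid_Ph: "stable t \<Longrightarrow> rapid (Ph t)"
  unfolding Ph_def[abs_def] by (intro rapid_scale rapid_corr rapid_uh)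

lemma uu_square: assumes "stable t" shows "complex_of_real ((cmod (uu t x))\<^sup>2) = invF (Ph t) x"
  unfolding Ph_def[abs_def] invF_scale uu_def
  using invF_mult_cnj[OF rapid_integrable[OF rapid_uh[OF assms]] rapid_integrable[OF rapid_uh[OF assms]], of x]
  by (simp only: complex_norm_square)

definition Fh :: "real \<Rightarrow> real \<Rightarrow> complex" where
  "Fh t r = indicator {0..} r * (\<i> * of_real r * Ph t r)"

lemma rapid_Fh: "stable t \<Longrightarrow> rapid (Fh t)"
  unfolding Fh_def[abs_def] by (intro rapid_cutoff rapid_ir rapid_Ph)

lemma uh_conv_Fh:
  assumes st: "stable t"
  shows "(LINT y|lborel. uh t (r - y) * Fh t y) =
     (if r \<ge> 0 then \<i> * of_real (amp ^ 3 / sqrt (2 * pi)) * Jt t r else 0)"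
proof (cases "r \<ge> 0")
  case False
  then have "(\<lambda>y. uh t (r - y) * Fh t y) = (\<lambda>y. 0)" by (auto simp: uh_def Fh_def indicator_def)
  then show ?thesis using False by simp
next
  case True
  let ?g = "\<lambda>y. of_real y * mt t y * gam t (r - y)"
  let ?c = "\<i> * complex_of_real (amp ^ 3 / sqrt (2 * pi))"
  have "(\<lambda>y. uh t (r - y) * Fh t y) = (\<lambda>y. indicator {0..r} y *\<^sub>R (?c * ?g y))"
    by (auto simp: fun_eq_iff uh_def Fh_def Ph_def corr_uh[OF st] indicator_def power2_eq_square power3_eq_cube)
  then have "(LINT y|lborel. uh t (r - y) * Fh t y) = (LINT y:{0..r}|lborel. ?c * ?g y)"
    unfolding set_lebesgue_integral_def by (simp only:)
  also have "\<dots> = integral {0..r} (\<lambda>y. ?c * ?g y)"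
    by (intro set_borel_integral_eq_integral borel_integrable_atLeastAtMost' continuous_intros
        continuous_on_subset[OF mt_continuous] gam_reflect_continuous) auto
  also have "\<dots> = ?c * Jt t r" unfolding Jt_def by (rule integral_mult_right)
  finally show ?thesis using True by simp
qed

lemma uh'_eq:
  assumes st: "stable t"
  shows "uh' t r = \<i> * (\<i> * of_real r * (\<i> * of_real r * uh t r)) -
     (- 2 / complex_of_real (sqrt (2 * pi))) * (LINT y|lborel. uh t (r - y) * Fh t y)"
proof (cases "r \<ge> 0")
  case True
  \<comment> \<open>From \<open>amp^2 = 4 * pi * \<kappa>\<close>: this matches the coefficient
    \<open>4 * \<i> * \<kappa>\<close> of the convolution with the factor 2 of the
    nonlinearity.\<close>
  have "amp ^ 3 / (sqrt (2 * pi) * sqrt (2 * pi)) = 2 * \<kappa> * amp"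
    using amp_square by (simp add: power3_eq_cube power2_eq_square)
  then have "complex_of_real (amp ^ 3 / sqrt (2 * pi)) / complex_of_real (sqrt (2 * pi)) = of_real (2 * \<kappa> * amp)"
    by (metis divide_divide_eq_left of_real_divide)
  then have k: "2 / complex_of_real (sqrt (2 * pi)) * (\<i> * complex_of_real (amp ^ 3 / sqrt (2 * pi)) * Jt t r)
     = of_real amp * (4 * \<i> * of_real \<kappa> * Jt t r)"
    by (simp add: field_simps)
  show ?thesis unfolding uh_conv_Fh[OF st] unfolding uh'_def uh_def using True k
    by (simp add: algebra_simps power2_eq_square)
next
  case False
  then show ?thesis unfolding uh_conv_Fh[OF st] by (simp add: uh'_def uh_def)
qed

lemma uu_equation:
  assumes st: "stable t"
  shows "\<i> * invF (uh' t) x + invF (\<lambda>r. \<i> * of_real r * (\<i> * of_real r * uh t r)) x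
     - 2 * \<i> * uu t x * invF (Fh t) x = 0"
proof -
  let ?a = "\<lambda>r. \<i> * of_real r * (\<i> * of_real r * uh t r)"
  let ?w = "\<lambda>r. LINT y|lborel. uh t (r - y) * Fh t y"
  have a: "rapid ?a" by (intro rapid_ir rapid_uh st)
  have w: "rapid ?w" by (intro rapid_conv rapid_uh rapid_Fh st)
  have "invF (uh' t) x = invF (\<lambda>r. \<i> * ?a r - (- 2 / complex_of_real (sqrt (2 * pi))) * ?w r) x"
    unfolding uh'_eq[OF st, abs_def] ..
  also have "\<dots> = \<i> * invF ?a x - (- 2 / complex_of_real (sqrt (2 * pi))) * invF ?w x"
    unfolding invF_scale[symmetric] by (rule invF_diff) (intro rapid_integrable rapid_scale a w)+
  finally have d: "invF (uh' t) x = \<i> * invF ?a x - (- 2 / complex_of_real (sqrt (2 * pi))) * invF ?w x" .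
  have m: "uu t x * invF (Fh t) x = complex_of_real (1 / sqrt (2 * pi)) * invF ?w x"
    unfolding uu_def by (rule invF_mult[OF rapid_uh[OF st] rapid_Fh[OF st]])
  show ?thesis unfolding d mult.assoc m by (simp add: algebra_simps)
qed

text \<open>The time derivative is taken within I, and \<open>vector_derivative\<close> is
  determined only at points that I accumulates at; hence the second assumption.\<close>

lemma uu_CCM_solution:
  assumes st: "\<And>t. t \<in> I \<Longrightarrow> stable t" and I: "\<And>t. t \<in> I \<Longrightarrow> at t within I \<noteq> bot"
  shows "CCM_solution uu I"
  unfolding CCM_solution_def
proof (intro conjI ballI allI impI)
  fix t x s assume t: "t \<in> I"
  note st = st[OF t]
  show "in_Hs_plus s (uu t)" unfolding uu_def by (rule rapid_in_Hs_plus[OF rapid_uh[OF st]]) (simp add: uh_def)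
  have dt: "((\<lambda>t. uu t x) has_vector_derivative invF (uh' t) x) (at t within I)"
    by (rule has_vector_derivative_at_within[OF uu_t_derivative[OF st]])
  show "(\<lambda>\<tau>. uu \<tau> x) differentiable at t within I" using dt by (rule differentiableI_vector)
  have dx: "(uu t has_vector_derivative invF (\<lambda>r. \<i> * of_real r * uh t r) y) (at y)" for y
    unfolding uu_def by (rule rapid_derivative[OF rapid_uh[OF st]])
  then show "uu t differentiable at y" for y by (rule differentiableI_vector)
  have dx': "(\<lambda>y. vector_derivative (uu t) (at y)) = invF (\<lambda>r. \<i> * of_real r * uh t r)"
    using vector_derivative_at[OF dx] by auto
  have dxx: "((\<lambda>y. vector_derivative (uu t) (at y)) has_vector_derivative
      invF (\<lambda>r. \<i> * of_real r * (\<i> * of_real r * uh t r)) x) (at x)"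
    unfolding dx' by (rule rapid_derivative[OF rapid_ir[OF rapid_uh[OF st]]])
  then show "(\<lambda>y. vector_derivative (uu t) (at y)) differentiable at x" by (rule differentiableI_vector)
  have sq: "(\<lambda>z. complex_of_real ((cmod (uu t z))\<^sup>2)) = invF (Ph t)" using uu_square[OF st] by auto
  have dp: "(invF (Ph t) has_vector_derivative invF (\<lambda>r. \<i> * of_real r * Ph t r) y) (at y)" for y
    by (rule rapid_derivative[OF rapid_Ph[OF st]])
  then show "(\<lambda>z. complex_of_real ((cmod (uu t z))\<^sup>2)) differentiable at y" for y
    unfolding sq by (rule differentiableI_vector)
  have dp': "(\<lambda>y. vector_derivative (\<lambda>z. complex_of_real ((cmod (uu t z))\<^sup>2)) (at y)) = invF (\<lambda>r. \<i> * of_real r * Ph t r)"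
    unfolding sq using vector_derivative_at[OF dp] by auto
  have pi: "Pi_plus (invF (\<lambda>r. \<i> * of_real r * Ph t r)) x = invF (Fh t) x"
    unfolding Fh_def[abs_def] by (rule Pi_plus_invF[OF rapid_ir[OF rapid_Ph[OF st]]])
  show "\<i> * vector_derivative (\<lambda>\<tau>. uu \<tau> x) (at t within I)
        + vector_derivative (\<lambda>y. vector_derivative (uu t) (at y)) (at x)
        - 2 * \<i> * uu t x * Pi_plus (\<lambda>y. vector_derivative (\<lambda>z. complex_of_real ((cmod (uu t z))\<^sup>2)) (at y)) x = 0"
    unfolding dp' pi vector_derivative_at[OF dxx] vector_derivative_within[OF I[OF t] dt] by (rule uu_equation[OF st])
qed

lemma uu_Hs_continuous:
  assumes st: "\<And>t. t \<in> I \<Longrightarrow> stable t"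
  shows "Hs_continuous s uu I"
  unfolding Hs_continuous_def
proof (intro conjI ballI allI impI)
  show "in_Hs s (uu t)" if "t \<in> I" for t unfolding uu_def by (rule rapid_in_Hs[OF rapid_uh[OF st[OF that]]])
  fix t and e :: real assume t: "t \<in> I" and e: "e > 0"
  note st' = st[OF t]
  \<comment> \<open>The weight is at most \<open>(1 + |x|) ^ (2 * m)\<close>. Decay of order m + 1
    of the difference, squared, leaves the integrable factor
    \<open>(1 + |x|) powr (- 2)\<close>.\<close>
  define m where "m = nat \<lceil>s\<rceil>"
  obtain d where d: "d > 0" "\<And>t'. \<bar>t' - t\<bar> < d \<Longrightarrow> stable t'"
    "\<And>k. \<exists>C. \<forall>t' x. \<bar>t' - t\<bar> < d \<longrightarrow> (1 + \<bar>x\<bar>) ^ k * cmod (uh t' x) \<le> C"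
    using uh_decay[OF st'] by metis
  obtain C where C: "\<And>t' x. \<bar>t' - t\<bar> < d \<Longrightarrow> (1 + \<bar>x\<bar>) ^ (m + 1) * cmod (uh t' x) \<le> C" using d(3)[of "m + 1"] by blast
  define S where "S = {t - d<..<t + d}"
  have S: "\<bar>t' - t\<bar> < d" if "t' \<in> S" for t' using that by (auto simp: S_def)
  have tS: "t \<in> S" using d(1) by (simp add: S_def)
  define F where "F t' = (LINT x|lborel. (1 + x\<^sup>2) powr s * (cmod (uh t' x - uh t x))\<^sup>2)" for t'
  have "continuous_on S F"
    unfolding F_def
  proof (rule continuous_on_integral_dominated[where b = "\<lambda>x. (2 * C)\<^sup>2 * (1 + \<bar>x\<bar>) powr (- 2)"])
    show "continuous_on S (\<lambda>t'. (1 + x\<^sup>2) powr s * (cmod (uh t' x - uh t x))\<^sup>2)" for x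
    proof -
      have "continuous_on S (\<lambda>t'. uh t' x)"
        using has_vector_derivative_continuous[OF uh_t_derivative] by (intro continuous_at_imp_continuous_on) auto
      then show ?thesis by (intro continuous_intros)
    qed
    show "norm ((1 + x\<^sup>2) powr s * (cmod (uh t' x - uh t x))\<^sup>2) \<le> (2 * C)\<^sup>2 * (1 + \<bar>x\<bar>) powr (- 2)" if "t' \<in> S" for t' x
    proof -
      let ?p = "1 + \<bar>x\<bar>"
      have "?p ^ (m + 1) * cmod (uh t' x - uh t x) \<le> ?p ^ (m + 1) * (cmod (uh t' x) + cmod (uh t x))"
        by (intro mult_left_mono norm_triangle_ineq4) auto
      also have "\<dots> \<le> 2 * C" using C[OF S[OF that], of x] C[OF S[OF tS], of x] by (simp add: distrib_left)
      finally have "(?p ^ (m + 1) * cmod (uh t' x - uh t x))\<^sup>2 \<le> (2 * C)\<^sup>2" by (intro power_mono) auto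
      then have b: "?p ^ (2 * m) * (cmod (uh t' x - uh t x))\<^sup>2 * ?p\<^sup>2 \<le> (2 * C)\<^sup>2"
        by (simp add: power_mult_distrib power_mult power_add mult_ac power2_eq_square)
      have "(1 + x\<^sup>2) powr s * (cmod (uh t' x - uh t x))\<^sup>2 \<le> ?p ^ (2 * m) * (cmod (uh t' x - uh t x))\<^sup>2"
        unfolding m_def by (intro mult_right_mono powr_weight_le) auto
      also have "\<dots> \<le> (2 * C)\<^sup>2 * ?p powr (- 2)" using b by (simp add: powr_minus powr_numeral field_simps)
      finally show ?thesis by simp
    qed
  qed (measurable, rule integrable_quadratic_decay)
  then have "isCont F t" using tS by (subst (asm) continuous_on_eq_continuous_at) (auto simp: S_def)
  moreover have "F t = 0" by (simp add: F_def)
  ultimately obtain d' where d': "d' > 0" "\<And>t'. \<bar>t' - t\<bar> < d' \<Longrightarrow> \<bar>F t'\<bar> < e\<^sup>2"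
    unfolding continuous_at_eps_delta using e by (metis diff_zero dist_real_def real_norm_def zero_less_power)
  have "Hs_norm s (\<lambda>x. uu t' x - uu t x) < e" if t': "t' \<in> I" "\<bar>t' - t\<bar> < d'" for t'
  proof -
    have r: "rapid (\<lambda>r. uh t' r - uh t r)" by (intro rapid_diff rapid_uh st t t')
    have "(\<lambda>x. uu t' x - uu t x) = invF (\<lambda>r. uh t' r - uh t r)"
      using invF_diff[OF rapid_integrable[OF rapid_uh[OF st[OF t'(1)]]] rapid_integrable[OF rapid_uh[OF st']]] by (auto simp: uu_def)
    then have "Hs_norm s (\<lambda>x. uu t' x - uu t x) = sqrt (F t')" unfolding F_def by (simp only: rapid_in_Hs(2)[OF r])
    also have "\<dots> < sqrt (e\<^sup>2)" using d'(2)[OF t'(2)] by (intro real_sqrt_less_mono) auto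
    finally show ?thesis using e by simp
  qed
  then show "\<exists>d>0. \<forall>t'\<in>I. \<bar>t' - t\<bar> < d \<longrightarrow> Hs_norm s (\<lambda>x. uu t' x - uu t x) < e" using d'(1) by blast
qed

text \<open>Above frequency r0 the Sobolev weight is at least \<open>(1 + r0^2) powr s\<close>. The
  mass there is \<open>amp^2 * N t r0\<close> because, by stability, nothing is left in the
  trajectory as the upper cutoff tends to infinity.\<close>

lemma uu_Hs_lower:
  assumes st: "stable t" and r0: "r0 \<ge> 0" and s: "s \<ge> 0"
  shows "amp * (1 + r0\<^sup>2) powr (s / 2) * sqrt (N t r0) \<le> Hs_norm s (uu t)"
proof -
  let ?g = "\<lambda>y. (cmod (gam t y))\<^sup>2"
  let ?H = "LINT x|lborel. (1 + x\<^sup>2) powr s * (cmod (uh t x))\<^sup>2"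
  let ?c = "(1 + r0\<^sup>2) powr s * amp\<^sup>2"
  have bd: "?c * (N t r0 - N t r) \<le> ?H" if r: "r \<ge> r0" for r
  proof -
    have c: "continuous_on {0..} ?g" by (intro continuous_intros gam_continuous)
    have "integral {0..r0} ?g + integral {r0..r} ?g = integral {0..r} ?g"
      by (rule Henstock_Kurzweil_Integration.integral_combine)
        (use r r0 in \<open>auto intro!: integrable_continuous_interval continuous_on_subset[OF c]\<close>)
    then have "integral {r0..r} ?g = N t r0 - N t r"
      using integral_unique[OF N_eq, of r0 t] integral_unique[OF N_eq, of r t] r r0 by simp
    moreover have si: "set_integrable lborel {r0..r} ?g"
      by (intro borel_integrable_atLeastAtMost' continuous_on_subset[OF c]) (use r0 in auto)
    ultimately have "?c * (N t r0 - N t r) = ?c * (LINT y:{r0..r}|lborel. ?g y)"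
      using set_borel_integral_eq_integral(2)[OF si] by simp
    also have "\<dots> = (LINT y|lborel. ?c * (indicator {r0..r} y * ?g y))" by (simp add: set_lebesgue_integral_def)
    also have "\<dots> \<le> ?H"
    proof (rule integral_mono)
      show "integrable lborel (\<lambda>y. ?c * (indicator {r0..r} y * ?g y))" using si by (simp add: set_integrable_def)
      show "integrable lborel (\<lambda>x. (1 + x\<^sup>2) powr s * (cmod (uh t x))\<^sup>2)" by (rule rapid_weight_integrable[OF rapid_uh[OF st]])
      fix y
      show "?c * (indicator {r0..r} y * ?g y) \<le> (1 + y\<^sup>2) powr s * (cmod (uh t y))\<^sup>2"
      proof (cases "y \<in> {r0..r}")
        case True
        then have "(cmod (uh t y))\<^sup>2 = amp\<^sup>2 * ?g y" using r0 by (simp add: uh_def norm_mult power_mult_distrib)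
        moreover have "(1 + r0\<^sup>2) powr s \<le> (1 + y\<^sup>2) powr s"
          using True r0 s by (intro powr_mono2 add_left_mono power_mono) (auto simp: add_nonneg_nonneg)
        ultimately show ?thesis using True by (simp add: mult.assoc mult_right_mono)
      qed simp
    qed
    finally show ?thesis .
  qed
  have "((\<lambda>r. ?c * (N t r0 - N t r)) \<longlongrightarrow> ?c * (N t r0 - 0)) at_top"
    using st unfolding stable_def by (intro tendsto_intros)
  then have "?c * (N t r0 - 0) \<le> ?H"
    by (rule tendsto_upperbound) (auto intro!: eventually_mono[OF eventually_ge_at_top[of r0]] bd)
  then have "sqrt (?c * N t r0) \<le> sqrt ?H" by simp
  moreover have "sqrt (?c * N t r0) = amp * (1 + r0\<^sup>2) powr (s / 2) * sqrt (N t r0)"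
    using amp_pos by (simp add: real_sqrt_mult powr_half_sqrt_powr)
  ultimately show ?thesis unfolding uu_def rapid_in_Hs(2)[OF rapid_uh[OF st]] by simp
qed

section \<open>The initial datum, its stability and its mass\<close>

lemma gam_initial: assumes r: "r \<ge> 0" shows "gam 0 r = ee r"
proof -
  have e0: "sol 0 (\<lambda>_. ee) (\<lambda>_ x. - ee x) (\<lambda>_. ee)"
  proof -
    have tm: "tame (\<lambda>_. ee)"
    proof (rule tameI)
      show "continuous_on ({0..} \<times> {0..}) (\<lambda>(r::real, x). ee x)"
        unfolding ee_def case_prod_unfold by (intro continuous_intros)
      show "\<exists>a>0. \<exists>C. \<forall>r\<in>{0..R}. \<forall>x\<ge>0. cmod (ee x) \<le> C * exp (- a * x)" for R :: real
        by (intro exI[of _ 1] conjI exI[of _ 1]) (auto simp: ee_def)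
    qed
    have tn: "tame (\<lambda>_ x. - ee x)" using tame_scale[OF tm, of "- 1"] by simp
    have t0: "tame (\<lambda>_ _. 0)" using tame_scale[OF tm, of 0] by simp
    show ?thesis unfolding sol_def xder_def tder_def using tm tn t0 ee_derivative by auto
  qed
  have de: "((\<lambda>a. ee a) has_vector_derivative - ee a) (at a within {0..})" if "a \<ge> 0" for a using ee_derivative that by auto
  have "sol 0 (\<lambda>a x. ee a * ee x) (\<lambda>a x. ee a * (- ee x)) (\<lambda>a x. ee a * ee x + (- ee a) * ee x)"
    by (rule sol_cmult[OF e0 de]) (auto intro!: continuous_intros simp: ee_def)
  then have E: "sol 0 (\<lambda>a x. ee a * ee x) (\<lambda>a x. ee a * (- ee x)) (\<lambda>_ _. 0)" by simp
  have "ee r * ee 0 = gam 0 r" by (rule sol_trace_eq_gam[OF E _ r]) (simp add: ee_def)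
  then show ?thesis by (simp add: ee_def)
qed

lemma N_initial: assumes r: "r \<ge> 0" shows "N 0 r = exp (- 2 * r) / 2"
proof -
  have "((\<lambda>y. exp (- 2 * y)) has_integral (- exp (- 2 * r) / 2 - - exp (- 2 * 0) / 2)) {0..r}"
    by (rule fundamental_theorem_of_calculus[OF r])
      (auto intro!: derivative_eq_intros simp flip: has_real_derivative_iff_has_vector_derivative)
  moreover have "((\<lambda>y. exp (- 2 * y)) has_integral (1 / 2 - N 0 r)) {0..r}"
    by (rule has_integral_eq[OF _ N_eq[OF r]]) (auto simp: gam_initial ee_def power2_eq_square simp flip: exp_add)
  ultimately have "1 / 2 - N 0 r = - exp (- 2 * r) / 2 - - exp (- 2 * 0) / 2" by (rule has_integral_unique[rotated])
  then show ?thesis by simp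
qed

lemma stable_0: "stable 0"
proof -
  have "((\<lambda>r::real. exp (- 2 * r) / 2) \<longlongrightarrow> 0) at_top" by real_asymp
  then show ?thesis unfolding stable_def
    by (rule Lim_transform_eventually) (auto intro!: eventually_mono[OF eventually_ge_at_top[of 0]] simp: N_initial)
qed

lemma uu_0: "uu 0 x = of_real (amp / sqrt (2 * pi)) / (1 - \<i> * of_real x)"
proof -
  let ?z = "\<i> * complex_of_real x - 1"
  have z: "?z \<noteq> 0" by (simp add: complex_eq_iff)
  have ex: "cmod (exp (?z * of_real r)) = exp (- r)" for r by simp
  have ed: "exp_decay (\<lambda>r. exp (?z * of_real r))" "exp_decay (\<lambda>r. exp (?z * of_real r) / ?z)"
    by (rule exp_decayI[of _ 1 1] exp_decayI[of _ 1 "1 / cmod ?z"];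
        use z in \<open>auto intro!: continuous_intros simp: ex norm_divide\<close>)+
  have "(\<integral>r. exp (?z * of_real r) \<partial>hl) = - (exp (?z * of_real 0) / ?z)"
  proof (rule integral_hl_derivative[OF ed(2,1)])
    fix r :: real
    have "((\<lambda>w. exp (?z * w) / ?z) has_field_derivative exp (?z * of_real r)) (at (of_real r))"
      using z by (auto intro!: derivative_eq_intros)
    from has_vector_derivative_real_field[OF this]
    show "((\<lambda>r. exp (?z * of_real r) / ?z) has_vector_derivative exp (?z * of_real r)) (at r within {0..})"
      by (rule has_vector_derivative_at_within)
  qed
  then have h: "(LINT r:{0..}|lborel. exp (?z * of_real r)) = 1 / (1 - \<i> * of_real x)"
    unfolding integral_hl_eq using z by (simp add: field_simps)
  have "(\<lambda>r. exp (\<i> * complex_of_real x * of_real r) * uh 0 r) = (\<lambda>r. of_real amp * (indicator {0..} r *\<^sub>R exp (?z * of_real r)))"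
    by (auto simp: fun_eq_iff uh_def gam_initial ee_def indicator_def exp_of_real[symmetric] simp flip: exp_add simp: algebra_simps)
  then have "(LINT r|lborel. exp (\<i> * complex_of_real x * of_real r) * uh 0 r) = of_real amp * (LINT r:{0..}|lborel. exp (?z * of_real r))"
    unfolding set_lebesgue_integral_def by (simp only: integral_mult_right_zero)
  then have l: "(LINT r|lborel. exp (\<i> * complex_of_real x * of_real r) * uh 0 r) = of_real amp * (1 / (1 - \<i> * of_real x))"
    unfolding h .
  show ?thesis unfolding uu_def invF_def l by simp
qed

lemma mass_uu_0: "(LINT x|lborel. (cmod (uu 0 x))\<^sup>2) = 2 * pi * \<kappa>"
proof -
  have "(cmod (uu 0 x))\<^sup>2 = 2 * \<kappa> * inverse (1 + x\<^sup>2)" for x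
  proof -
    have "(cmod (1 - \<i> * of_real x))\<^sup>2 = 1 + x\<^sup>2" by (simp add: cmod_power2)
    moreover have "(amp / sqrt (2 * pi))\<^sup>2 = 2 * \<kappa>" using amp_square by (simp add: power_divide)
    ultimately show ?thesis unfolding uu_0 norm_divide norm_of_real power_divide[of _ "cmod (1 - _)"]
      by (simp add: field_simps del: of_real_divide)
  qed
  then show ?thesis using has_integral_inverse_quadratic(2) by simp
qed

section \<open>Blow-up at a first unstable time, growth if there is none\<close>

lemma first_instability:
  obtains "\<And>t. t \<ge> 0 \<Longrightarrow> stable t"
  | T where "T > 0" "\<not> stable T" "\<And>t. 0 \<le> t \<Longrightarrow> t < T \<Longrightarrow> stable t"
proof (cases "\<forall>t\<ge>0. stable t")
  case False
  define B where "B = {0..} \<inter> - {t. stable t}"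
  have "open {t. stable t}"
    unfolding open_dist dist_real_def by (metis good_def good_nhd mem_Collect_eq)
  then have cl: "closed B" unfolding B_def by (intro closed_Int) (auto simp: closed_Compl)
  have ne: "B \<noteq> {}" using False by (auto simp: B_def)
  have bb: "bdd_below B" by (rule bdd_belowI[of _ 0]) (simp add: B_def)
  have IB: "Inf B \<in> B" by (rule closed_contains_Inf[OF ne bb cl])
  show ?thesis
  proof (rule that(2)[of "Inf B"])
    show "\<not> stable (Inf B)" using IB by (simp add: B_def)
    then have "Inf B \<noteq> 0" using stable_0 by metis
    then show "Inf B > 0" using IB by (simp add: B_def)
    show "stable t" if "0 \<le> t" "t < Inf B" for t
      using cInf_lower[OF _ bb, of t] that by (force simp: B_def)
  qed
qed (use that(1) in blast)

text \<open>At the unstable time T at least \<open>1 / (2 * \<kappa>)\<close> of the norm remains at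
  every r. For fixed r, continuity in time keeps half of it shortly before T; since r is arbitrary,
  the lower bound of the Sobolev norm exceeds every Z.\<close>

lemma blowup_finite_time:
  assumes T: "T > 0" "\<not> stable T" and H: "\<And>t r. 0 \<le> t \<Longrightarrow> t < T \<Longrightarrow> r \<ge> 0 \<Longrightarrow> amp * (1 + r\<^sup>2) powr (s / 2) * sqrt (N t r) \<le> H t"
    and s: "s > 0"
  shows "filterlim H at_top (at_left T)"
  unfolding filterlim_at_top
proof
  fix Z :: real
  define n where "n = 1 / (4 * \<kappa>)"
  have n: "n > 0" using kappa_pos by (simp add: n_def)
  have "filterlim (\<lambda>r::real. amp * (1 + r\<^sup>2) powr (s / 2) * sqrt n) at_top at_top"
    using amp_pos n s by real_asymp
  then have "\<forall>\<^sub>F r in at_top. Z \<le> amp * (1 + r\<^sup>2) powr (s / 2) * sqrt n" by (simp add: filterlim_at_top)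
  then obtain r where r: "r \<ge> 0" "Z \<le> amp * (1 + r\<^sup>2) powr (s / 2) * sqrt n"
    unfolding eventually_at_top_linorder by (metis linear max.cobounded1 max.cobounded2)
  obtain C where C: "\<And>t'. \<bar>t' - T\<bar> \<le> 1 \<Longrightarrow> \<bar>N t' r - N T r\<bar> \<le> C * \<bar>t' - T\<bar>" using N_t_lipschitz[OF r(1)] by metis
  define d where "d = min (min 1 T) (n / (\<bar>C\<bar> + 1))"
  have d: "d > 0" using n T by (simp add: d_def)
  have NT: "N T r \<ge> 2 * n" using not_stable_N_ge[OF T(2) r(1)] by (simp add: n_def)
  show "\<forall>\<^sub>F t in at_left T. Z \<le> H t"
    unfolding eventually_at_left_field
  proof (intro exI[of _ "T - d"] conjI allI impI)
    fix t assume t: "T - d < t" "t < T"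
    have "\<bar>N t r - N T r\<bar> \<le> C * \<bar>t - T\<bar>" using t by (intro C) (auto simp: d_def)
    also have "\<dots> \<le> (\<bar>C\<bar> + 1) * (n / (\<bar>C\<bar> + 1))" using t by (intro mult_mono) (auto simp: d_def)
    also have "\<dots> = n" by simp
    finally have "n \<le> N t r" using NT by linarith
    then have "amp * (1 + r\<^sup>2) powr (s / 2) * sqrt n \<le> amp * (1 + r\<^sup>2) powr (s / 2) * sqrt (N t r)"
      using amp_pos by (intro mult_left_mono) auto
    also have "\<dots> \<le> H t" using t by (intro H r) (auto simp: d_def)
    finally show "Z \<le> H t" using r(2) by linarith
  qed (use d in simp)
qed

end

context ccm_super
begin

text \<open>A fixed amount of mass sits above frequency c t by \<open>super_growth\<close>. Times
  between 1 and t0 are covered by the total mass, r = 0 with N = 1/2; hence the two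
  constants.\<close>

lemma growth_infinite_time:
  assumes H: "\<And>t r. 0 \<le> t \<Longrightarrow> r \<ge> 0 \<Longrightarrow> amp * (1 + r\<^sup>2) powr (s / 2) * sqrt (N t r) \<le> H t" and s: "s > 0"
  shows "\<exists>C>0. \<forall>t\<ge>1. C * t powr s \<le> H t"
proof -
  obtain c t0 n0 where c: "c > 0" "t0 \<ge> 1" "n0 > 0" "\<And>t. t \<ge> t0 \<Longrightarrow> N t (c * t) \<ge> n0" using super_growth by metis
  define C1 where "C1 = amp * sqrt n0 * c powr s"
  define C2 where "C2 = amp * sqrt (1 / 2) / t0 powr s"
  have C: "C1 > 0" "C2 > 0" using amp_pos c by (auto simp: C1_def C2_def)
  have "min C1 C2 * t powr s \<le> H t" if t: "t \<ge> 1" for t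
  proof (cases "t \<ge> t0")
    case True
    have "min C1 C2 * t powr s \<le> C1 * t powr s" by (intro mult_right_mono) auto
    also have "\<dots> = amp * ((c * t)\<^sup>2) powr (s / 2) * sqrt n0"
      using t c(1) by (simp add: C1_def powr_mult powr_powr flip: powr_numeral)
    also have "\<dots> \<le> amp * (1 + (c * t)\<^sup>2) powr (s / 2) * sqrt (N t (c * t))"
      using amp_pos s c(3) c(4)[OF True] by (intro mult_mono powr_mono2) auto
    also have "\<dots> \<le> H t" using t c(1) by (intro H) auto
    finally show ?thesis .
  next
    case False
    have "min C1 C2 * t powr s \<le> C2 * t0 powr s" using False t s C by (intro mult_mono powr_mono2) auto
    also have "\<dots> = amp * (1 + 0\<^sup>2) powr (s / 2) * sqrt (N t 0)" using c(2) by (simp add: C2_def)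
    also have "\<dots> \<le> H t" using t by (intro H) auto
    finally show ?thesis .
  qed
  then show ?thesis using C by (intro exI[of _ "min C1 C2"]) auto
qed

text \<open>The norm enters only through a lower bound that holds at all stable times. Keeping H
  abstract lets one T serve for the forward norm and for the reflected backward norm.\<close>

lemma lifespan:
  obtains T :: ereal where "0 < T" "\<And>t. 0 \<le> t \<Longrightarrow> ereal t < T \<Longrightarrow> stable t"
    "\<And>s H. s > 0 \<Longrightarrow> (\<And>t r. stable t \<Longrightarrow> r \<ge> 0 \<Longrightarrow> amp * (1 + r\<^sup>2) powr (s / 2) * sqrt (N t r) \<le> H t) \<Longrightarrow>
       tends_to_infinity_at_left T H \<and> (T = \<infinity> \<longrightarrow> (\<exists>C>0. \<forall>t\<ge>1. C * t powr s \<le> H t))"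
proof (cases rule: first_instability)
  case 1
  show ?thesis
  proof (rule that[of \<infinity>])
    fix s :: real and H assume s: "s > 0" and H: "\<And>t r. stable t \<Longrightarrow> r \<ge> 0 \<Longrightarrow> amp * (1 + r\<^sup>2) powr (s / 2) * sqrt (N t r) \<le> H t"
    have "\<exists>C>0. \<forall>t\<ge>1. C * t powr s \<le> H t" by (rule growth_infinite_time[OF H s]) (use 1 in auto)
    moreover from this obtain C where C: "C > 0" "\<And>t. t \<ge> 1 \<Longrightarrow> C * t powr s \<le> H t" by blast
    have "filterlim (\<lambda>t. C * t powr s) at_top at_top" using C(1) s by real_asymp
    then have "filterlim H at_top at_top"
      by (rule filterlim_at_top_mono) (auto intro!: eventually_mono[OF eventually_ge_at_top[of 1]] C)
    ultimately show "tends_to_infinity_at_left \<infinity> H \<and> (\<infinity> = (\<infinity>::ereal) \<longrightarrow> (\<exists>C>0. \<forall>t\<ge>1. C * t powr s \<le> H t))"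
      unfolding tends_to_infinity_at_left_def infinity_ereal_def ereal.case by blast
  qed (use 1 in auto)
next
  case (2 T)
  show ?thesis
  proof (rule that[of "ereal T"])
    fix s :: real and H assume s: "s > 0" and H: "\<And>t r. stable t \<Longrightarrow> r \<ge> 0 \<Longrightarrow> amp * (1 + r\<^sup>2) powr (s / 2) * sqrt (N t r) \<le> H t"
    have "filterlim H at_top (at_left T)" by (rule blowup_finite_time[OF 2(1,2) H s]) (use 2 in auto)
    then show "tends_to_infinity_at_left (ereal T) H \<and> (ereal T = \<infinity> \<longrightarrow> (\<exists>C>0. \<forall>t\<ge>1. C * t powr s \<le> H t))"
      by (simp add: tends_to_infinity_at_left_def)
  qed (use 2 in auto)
qed

end

theorem theorem1p1:
  shows "\<exists>\<epsilon>\<^sub>0>0. \<forall>\<epsilon>. 0 < \<epsilon> \<and> \<epsilon> < \<epsilon>\<^sub>0 \<longrightarrow>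
    (\<exists>u\<^sub>0 (T::ereal) u.
        in_Hinf_plus u\<^sub>0 \<and>
        (LINT x|lborel. (cmod (u\<^sub>0 x))\<^sup>2) = 2 * pi + \<epsilon> \<and>
        0 < T \<and>
        CCM_solution u {t. 0 \<le> t \<and> ereal t < T} \<and> u 0 = u\<^sub>0 \<and>
        (\<forall>s>0. Hs_continuous s u {t. 0 \<le> t \<and> ereal t < T} \<and>
               tends_to_infinity_at_left T (\<lambda>t. Hs_norm s (u t))) \<and>
        (T = \<infinity> \<longrightarrow> (\<forall>s>0. \<exists>C>0. \<forall>t\<ge>1. Hs_norm s (u t) \<ge> C * t powr s))) \<and>
    (\<exists>u\<^sub>0 (T::ereal) u.
        in_Hinf_plus u\<^sub>0 \<and>
        (LINT x|lborel. (cmod (u\<^sub>0 x))\<^sup>2) = 2 * pi + \<epsilon> \<and>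
        0 < T \<and>
        CCM_solution u {t. - T < ereal t \<and> t \<le> 0} \<and> u 0 = u\<^sub>0 \<and>
        (\<forall>s>0. Hs_continuous s u {t. - T < ereal t \<and> t \<le> 0} \<and>
               tends_to_infinity_at_left T (\<lambda>t. Hs_norm s (u (- t)))) \<and>
        (T = \<infinity> \<longrightarrow> (\<forall>s>0. \<exists>C>0. \<forall>t\<ge>1. Hs_norm s (u (- t)) \<ge> C * t powr s)))"
proof (rule exI[of _ "2 * pi"], rule conjI, simp, intro allI impI, goal_cases)
  case (1 \<epsilon>)
  \<comment> \<open>\<epsilon> is the excess over the threshold mass 2 pi, so \<delta> = \<epsilon>
    / (2 pi); the bound 2 pi on \<epsilon> is the condition \<delta> < 1 that makes the weight
    \<open>om\<close> integrable at 0.\<close>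
  interpret ccm_super "1 + \<epsilon> / (2 * pi)" "\<epsilon> / (2 * pi)"
    by unfold_locales (use 1 pi_gt_zero in \<open>auto simp: add_pos_pos\<close>)
  obtain T :: ereal where T: "0 < T" "\<And>t. 0 \<le> t \<Longrightarrow> ereal t < T \<Longrightarrow> stable t"
    "\<And>s H. s > 0 \<Longrightarrow> (\<And>t r. stable t \<Longrightarrow> r \<ge> 0 \<Longrightarrow> amp * (1 + r\<^sup>2) powr (s / 2) * sqrt (N t r) \<le> H t) \<Longrightarrow>
       tends_to_infinity_at_left T H \<and> (T = \<infinity> \<longrightarrow> (\<exists>C>0. \<forall>t\<ge>1. C * t powr s \<le> H t))"
    using lifespan by metis
  let ?I = "{t. 0 \<le> t \<and> ereal t < T}" and ?J = "{t. - T < ereal t \<and> t \<le> 0}"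
  have IJ: "t \<in> ?J \<longleftrightarrow> - t \<in> ?I" for t by (cases T) auto
  obtain e where e: "0 < e" "e \<in> ?I" using T(1) ereal_dense2[of 0 T] by (auto simp: zero_ereal_def)
  have zero: "0 \<in> ?I" "0 \<in> ?J" using T(1) by (auto simp: zero_ereal_def[symmetric] ereal_uminus_less_reorder)
  have I: "stable t" "at t within ?I \<noteq> bot" if "t \<in> ?I" for t
  proof -
    show "stable t" using T(2) that by simp
    have "is_interval ?I" unfolding is_interval_1 by (cases T) auto
    then show "at t within ?I \<noteq> bot" by (rule at_within_interval_neq_bot[OF _ zero(1) e(2) _ that]) (use e in simp)
  qed
  have J: "stable t" "at t within ?J \<noteq> bot" if "t \<in> ?J" for t
  proof -
    show "stable t" using I(1)[of "- t"] that unfolding IJ stable_uminus by blast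
    have "is_interval ?J" unfolding is_interval_1 by (cases T) auto
    then show "at t within ?J \<noteq> bot"
      by (rule at_within_interval_neq_bot[OF _ zero(2) _ _ that]) (use e IJ[of "- e"] in auto)
  qed
  have u0: "in_Hinf_plus (uu 0)" unfolding in_Hinf_plus_def uu_def
    by (auto intro!: rapid_in_Hs_plus rapid_uh stable_0 simp: uh_def)
  have mass: "(LINT x|lborel. (cmod (uu 0 x))\<^sup>2) = 2 * pi + \<epsilon>" unfolding mass_uu_0 by (simp add: field_simps)
  \<comment> \<open>Both stability and N are even in time, so the bound for the reflected solution
    has the same left side, and one T works in both directions.\<close>
  have lower: "amp * (1 + r\<^sup>2) powr (s / 2) * sqrt (N t r) \<le> Hs_norm s (uu t)"
    "amp * (1 + r\<^sup>2) powr (s / 2) * sqrt (N t r) \<le> Hs_norm s (uu (- t))" if "s > 0" "stable t" "r \<ge> 0" for s t r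
    using uu_Hs_lower[of t r s] uu_Hs_lower[of "- t" r s] that by (auto simp: stable_uminus N_uminus)
  have fw: "tends_to_infinity_at_left T (\<lambda>t. Hs_norm s (uu t)) \<and> (T = \<infinity> \<longrightarrow> (\<exists>C>0. \<forall>t\<ge>1. C * t powr s \<le> Hs_norm s (uu t)))"
    and bw: "tends_to_infinity_at_left T (\<lambda>t. Hs_norm s (uu (- t))) \<and> (T = \<infinity> \<longrightarrow> (\<exists>C>0. \<forall>t\<ge>1. C * t powr s \<le> Hs_norm s (uu (- t))))"
    if "s > 0" for s
    by (rule T(3)[OF that], rule lower; use that in simp)+
  have "CCM_solution uu ?I" "CCM_solution uu ?J" by (rule uu_CCM_solution; use I J in blast)+
  moreover have "Hs_continuous s uu ?I" "Hs_continuous s uu ?J" for s by (rule uu_Hs_continuous; use I J in blast)+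
  ultimately show ?case
    using u0 mass T(1) fw bw
    by - (rule conjI; rule exI[of _ "uu 0"], rule exI[of _ T], rule exI[of _ uu], simp)
qed

end
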